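(* Let $1/2<s<1$, let $f\in C^2(\mathbb{R})$ be a bistable nonlinearity with associated speed $k>0$ and one-dimensional profile $\Phi$, let $c>k$, and let $h$, $\varphi$, $S$ be as in the context. For $\varepsilon,\alpha\in(0,1)$ put $$V(x,y,z)=\Phi\left(\frac{z-\alpha^{-1}\varphi(\alpha x,\alpha y)}{\sqrt{1+|\nabla\varphi(\alpha x,\alpha y)|^2}}\right)+\varepsilon S(\alpha x,\alpha y),\qquad v(x,y,z)=\Phi\left(\frac{k}{c}\,(z-h(x,y))\right),$$ and $\mathcal{L}[u]=(-\Delta)^su-cu_z-f(u)$. Then there exist small parameters $\varepsilon,\alpha\in(0,1)$ such that $V$ is a super-solution of $\mathcal{L}[u]=0$ in $\mathbb{R}^3$. In fact, $V\in C_s^2(\mathbb{R}^3)$ and $$\mathcal{L}[V]>0\quad\text{and}\quad v<V\quad\text{in }\mathbb{R}^3.$$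
   Context: Fractional Laplacian: $C_s^2(\mathbb{R}^n)=\{w\in C^2(\mathbb{R}^n):\int_{\mathbb{R}^n}\frac{|w(x)|}{(1+|x|)^{n+2s}}dx<\infty\}$, and for $w\in C_s^2(\mathbb{R}^n)$, $(-\Delta)^sw(x)=C_{n,s}\,\mathrm{P.V.}\int_{\mathbb{R}^n}\frac{w(x)-w(x+\xi)}{|\xi|^{n+2s}}d\xi$ with $C_{n,s}=\frac{2^{2s}s\Gamma(\frac n2+s)}{\Gamma(1-s)\pi^{n/2}}$. For $n=1$ it is written $(-\partial^2)^s$. Super-solution: a function in $C(\mathbb{R}^3)\cap L^\infty(\mathbb{R}^3)$ which is the minimum of finitely many $V_j\in C^2(\mathbb{R}^3)\cap L^\infty(\mathbb{R}^3)$ satisfying $\mathcal{L}[V_j]\ge0$ in $\mathbb{R}^3$ for each $j$. Bistable nonlinearity: $f\in C^2(\mathbb{R})$ and there is $t_0\in(-1,1)$ with $f(\pm1)=f(t_0)=0$, $f<0$ on $(-1,t_0)$, $f>0$ on $(t_0,1)$, $f'(\pm1)<0$. One-dimensional profile: $(k,\Phi)$ is the unique pair (known to exist by a result of Gui and Zhao), normalized by $\Phi(0)=0$, with $(-\partial^2)^s\Phi(\mu)-k\Phi'(\mu)-f(\Phi(\mu))=0$ and $\Phi'(\mu)<0$ for all $\mu\in\mathbb{R}$, and $\lim_{\mu\to\pm\infty}\Phi(\mu)=\mp1$. It is assumed that $k>0$. It is known that $1-|\Phi(\mu)|=O(|\mu|^{-2s})$ and $0<-\Phi'(\mu)=O(|\mu|^{-1-2s})$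 as $|\mu|\to\infty$. Pyramid: $m_*=\sqrt{c^2-k^2}/k>0$, $N\ge3$ is an integer, and $(a_j,b_j)\in\mathbb{R}^2$, $1\le j\le N$, are pairwise distinct pairs with $a_j^2+b_j^2=m_*^2$ and $a_jb_{j+1}-a_{j+1}b_j>0$ for $1\le j\le N$, where $a_{N+1}=a_1$, $b_{N+1}=b_1$. Put $h_j(x,y)=a_jx+b_jy$, $h=\max_{1\le j\le N}h_j$, $\Omega_j=\{(x,y)\in\mathbb{R}^2:h(x,y)=h_j(x,y)\}$ (the sectors $\Omega_1,\dots,\Omega_N$ are arranged counter-clockwise around the origin). Mollified pyramid: $\rho\in C^\infty(\mathbb{R}^2)$ is a fixed function of the form $\rho(x,y)=\tilde\rho(\sqrt{x^2+y^2})$, where $\tilde\rho\in C^\infty([0,\infty))$ satisfies: $0<\tilde\rho(r)\le1$ and $\tilde\rho'(r)\le0$ for $r>0$; $2\pi\int_0^\infty r\tilde\rho(r)\,dr=1$; $\tilde\rho(r)=1$ for $0\le r\le\tilde r_0$ for some small $\tilde r_0>0$; $\tilde\rho(r)=\tilde\rho_0r^{-2s-2}$ for $r\ge r_0$, where $r_0$ is large ($r_0>2$), $\tilde\rho_0>0$ is determined by $\frac{\tilde\rho_0}{2s}\mathrm{B}(\frac12,\frac12+s)=1$ ($\mathrm{B}$ the Beta function), and $2s(m_*^2+2)(2r_0)^{-2s}<1$. Then $\varphi=\rho*h$ on $\mathbb{R}^2$, and $S(x,y)=\frac{c}{\sqrt{1+|\nabla\varphi(x,y)|^2}}-k$. 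*)

theory Defs
  imports "HOL-Analysis.Analysis" "HOL-Library.Landau_Symbols"
begin

text \<open>
  \<open>C\<^sup>k\<close> functions on \<open>S\<close>. Derivatives are taken within \<open>S\<close>, so this is meaningful only where they
  are unique: for open \<open>S\<close>, and for intervals such as \<open>[0, \<infinity>)\<close>, where the derivative at an
  end point is one-sided.
\<close>

primrec Ck_on :: "nat \<Rightarrow> 'a::euclidean_space set \<Rightarrow> ('a \<Rightarrow> real) \<Rightarrow> bool" where
  "Ck_on 0 S w \<longleftrightarrow> continuous_on S w"
| "Ck_on (Suc k) S w \<longleftrightarrow>
     (\<forall>x\<in>S. w differentiable (at x within S)) \<and>
     (\<forall>e. Ck_on k S (\<lambda>x. frechet_derivative w (at x within S) e))"

definition smooth_on :: "'a::euclidean_space set \<Rightarrow> ('a \<Rightarrow> real) \<Rightarrow> bool" where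
  "smooth_on S w \<longleftrightarrow> (\<forall>k. Ck_on k S w)"

definition grad :: "('a::euclidean_space \<Rightarrow> real) \<Rightarrow> 'a \<Rightarrow> 'a" where
  "grad w x = (THE D. GDERIV w x :> D)"

definition convolve :: "('a::euclidean_space \<Rightarrow> real) \<Rightarrow> ('a \<Rightarrow> real) \<Rightarrow> 'a \<Rightarrow> real" where
  "convolve u w x = (LINT y|lborel. u (x - y) * w y)"

definition Cs2 :: "real \<Rightarrow> ('a::euclidean_space \<Rightarrow> real) set" where
  "Cs2 s = {w. Ck_on 2 UNIV w \<and>
     integrable lborel (\<lambda>x. \<bar>w x\<bar> / (1 + norm x) powr (real DIM('a) + 2 * s))}"

definition frac_const :: "nat \<Rightarrow> real \<Rightarrow> real" where
  "frac_const n s = 2 powr (2 * s) * s * Gamma (real n / 2 + s)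
                      / (Gamma (1 - s) * pi powr (real n / 2))"

text \<open>
  The principal value is the limit of the integrals over the complements of balls around \<open>0\<close>.
  It exists for every \<open>w \<in> Cs2 s\<close> with \<open>0 < s < 1\<close>; only such \<open>w\<close> are intended.
\<close>

definition frac_laplacian :: "real \<Rightarrow> ('a::euclidean_space \<Rightarrow> real) \<Rightarrow> 'a \<Rightarrow> real" where
  "frac_laplacian s w x = frac_const DIM('a) s *
     Lim (at_right 0) (\<lambda>\<delta>.
       LINT \<xi>:- cball 0 \<delta>|lborel. (w x - w (x + \<xi>)) / norm \<xi> powr (real DIM('a) + 2 * s))"

definition travel_op ::
    "real \<Rightarrow> real \<Rightarrow> (real \<Rightarrow> real) \<Rightarrow> (real^3 \<Rightarrow> real) \<Rightarrow> real^3 \<Rightarrow> real" where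
  "travel_op s c f u p =
     frac_laplacian s u p - c * deriv (\<lambda>t. u (p + t *\<^sub>R axis 3 1)) 0 - f (u p)"

text \<open>For continuous functions, membership in \<open>L\<^sup>\<infinity>\<close> is boundedness of the range.\<close>

definition super_solution ::
    "real \<Rightarrow> real \<Rightarrow> (real \<Rightarrow> real) \<Rightarrow> (real^3 \<Rightarrow> real) \<Rightarrow> bool" where
  "super_solution s c f u \<longleftrightarrow>
     continuous_on UNIV u \<and> bounded (range u) \<and>
     (\<exists>W. finite W \<and> W \<noteq> {} \<and>
        (\<forall>w\<in>W. Ck_on 2 UNIV w \<and> bounded (range w) \<and> (\<forall>p. travel_op s c f w p \<ge> 0)) \<and>
        (\<forall>p. u p = Min ((\<lambda>w. w p) ` W)))"

definition bistable :: "(real \<Rightarrow> real) \<Rightarrow> bool" where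
  "bistable f \<longleftrightarrow> Ck_on 2 UNIV f \<and>
     (\<exists>t0\<in>{-1<..<1}. f (-1) = 0 \<and> f 1 = 0 \<and> f t0 = 0 \<and>
        (\<forall>t\<in>{-1<..<t0}. f t < 0) \<and> (\<forall>t\<in>{t0<..<1}. f t > 0)) \<and>
     deriv f (-1) < 0 \<and> deriv f 1 < 0"

definition profile :: "real \<Rightarrow> (real \<Rightarrow> real) \<Rightarrow> real \<Rightarrow> (real \<Rightarrow> real) \<Rightarrow> bool" where
  "profile s f k \<Phi> \<longleftrightarrow> \<Phi> \<in> Cs2 s \<and> \<Phi> 0 = 0 \<and>
     (\<forall>\<mu>. frac_laplacian s \<Phi> \<mu> - k * deriv \<Phi> \<mu> - f (\<Phi> \<mu>) = 0) \<and>
     (\<forall>\<mu>. deriv \<Phi> \<mu> < 0) \<and>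
     (\<Phi> \<longlongrightarrow> -1) at_top \<and> (\<Phi> \<longlongrightarrow> 1) at_bot"

definition m_star :: "real \<Rightarrow> real \<Rightarrow> real" where
  "m_star c k = sqrt (c\<^sup>2 - k\<^sup>2) / k"

text \<open>The values at \<open>N + 1\<close> encode the cyclic convention for the indices.\<close>

definition pyramid_data :: "real \<Rightarrow> nat \<Rightarrow> (nat \<Rightarrow> real) \<Rightarrow> (nat \<Rightarrow> real) \<Rightarrow> bool" where
  "pyramid_data m N a b \<longleftrightarrow> 3 \<le> N \<and>
     a (N + 1) = a 1 \<and> b (N + 1) = b 1 \<and>
     inj_on (\<lambda>j. (a j, b j)) {1..N} \<and>
     (\<forall>j\<in>{1..N}. (a j)\<^sup>2 + (b j)\<^sup>2 = m\<^sup>2) \<and>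
     (\<forall>j\<in>{1..N}. a j * b (j + 1) - a (j + 1) * b j > 0)"

definition pyramid :: "nat \<Rightarrow> (nat \<Rightarrow> real) \<Rightarrow> (nat \<Rightarrow> real) \<Rightarrow> real^2 \<Rightarrow> real" where
  "pyramid N a b q = Max ((\<lambda>j. a j * q$1 + b j * q$2) ` {1..N})"

definition mollifier_profile :: "real \<Rightarrow> real \<Rightarrow> (real \<Rightarrow> real) \<Rightarrow> bool" where
  "mollifier_profile s m g \<longleftrightarrow>
     smooth_on {0..} g \<and> smooth_on UNIV (\<lambda>q::real^2. g (norm q)) \<and>
     (\<forall>r>0. 0 < g r \<and> g r \<le> 1 \<and> deriv g r \<le> 0) \<and>
     2 * pi * (LINT r:{0..}|lborel. r * g r) = 1 \<and>
     (\<exists>d>0. \<forall>r\<in>{0..d}. g r = 1) \<and>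
     (\<exists>r0>2. \<exists>g0>0.
        g0 / (2 * s) * Beta (1/2) (1/2 + s) = 1 \<and>
        (\<forall>r\<ge>r0. g r = g0 * r powr (- 2 * s - 2)) \<and>
        2 * s * (m\<^sup>2 + 2) * (2 * r0) powr (- 2 * s) < 1)"

definition mollified :: "(real \<Rightarrow> real) \<Rightarrow> (real^2 \<Rightarrow> real) \<Rightarrow> real^2 \<Rightarrow> real" where
  "mollified g h = convolve (\<lambda>q. g (norm q)) h"

definition S_fun :: "real \<Rightarrow> real \<Rightarrow> (real^2 \<Rightarrow> real) \<Rightarrow> real^2 \<Rightarrow> real" where
  "S_fun c k \<phi> q = c / sqrt (1 + (norm (grad \<phi> q))\<^sup>2) - k"

definition xy :: "real^3 \<Rightarrow> real^2" where
  "xy p = vector [p$1, p$2]"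

definition V_fun ::
    "real \<Rightarrow> real \<Rightarrow> (real \<Rightarrow> real) \<Rightarrow> (real^2 \<Rightarrow> real) \<Rightarrow> real \<Rightarrow> real \<Rightarrow> real^3 \<Rightarrow> real" where
  "V_fun c k \<Phi> \<phi> \<epsilon> \<alpha> p =
     \<Phi> ((p$3 - \<phi> (\<alpha> *\<^sub>R xy p) / \<alpha>) / sqrt (1 + (norm (grad \<phi> (\<alpha> *\<^sub>R xy p)))\<^sup>2))
     + \<epsilon> * S_fun c k \<phi> (\<alpha> *\<^sub>R xy p)"

definition v_fun ::
    "real \<Rightarrow> real \<Rightarrow> (real \<Rightarrow> real) \<Rightarrow> (real^2 \<Rightarrow> real) \<Rightarrow> real^3 \<Rightarrow> real" where
  "v_fun c k \<Phi> h p = \<Phi> (k / c * (p$3 - h (xy p)))"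

end

(*
  With q = alpha (x, y), the function V - eps S is the one-dimensional profile evaluated at the
  scaled distance mu to the graph of the rescaled mollified pyramid. To first order mu is affine,
  so V is close to a plane wave, and the three-dimensional fractional Laplacian of a plane wave
  with unit slope is the one-dimensional one; the profile equation then leaves
     L[V] = - S Phi'(mu) - (f (Phi (mu) + eps S) - f (Phi (mu))) + error.
  The first two terms are at least b S with b > 0: away from the ends of the profile because
  Phi' < 0, near the ends because f' (1), f' (-1) < 0. Every error carries a factor measuring how
  far q is from the edges of the pyramid: the kernel decays like |.|^(-2s-2), so the deviation of
  phi from a linear function and its derivatives are O(d^(-2s)) at depth d inside a facet. S and
  phi - h are bounded below by the same quantity, hence the error is at most
  C alpha^(s - 1/2) S and is absorbed for small alpha; the same bounds give v < V.
*)
theory Submission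
  imports Defs
begin

section \<open>Integrating the kernel over planes\<close>

text \<open>Two mismatches shape the estimates. First, \<mu> is not affine with unit slope: away
  from the graph its gradient gains a term proportional to the height, so the slope deviates from 1
  by up to a small multiple of 1 + |\<mu>|. This is affordable because the derivative and the
  fractional Laplacian of \<Phi> decay in |\<mu>|; both rates are carried through the comparison
  lemmas. Second, the operator is nonlocal: beyond the distance depth/\<alpha> at which other facets
  become visible, V is only known to be bounded, and the kernel leaves an error of order
  (depth/\<alpha>)^(-2s). S can dominate it because the tail of the mollifier has the exponent 2s +
  2, so that its mass beyond the depth is again of order depth^(-2s); with a compactly supported
  mollifier S would vanish deep inside the facets. The power s - 1/2 of \<alpha> is a compromise: a
  remainder known to be both O(|x|) and O(|x|^2) is bounded by |x|^(1 + theta), where 1 + theta < 2s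
  makes it integrable against the kernel at infinity; theta = s - 1/2 is the midpoint of the
  admissible range.\<close>

lemma ball_vol_nonneg: "0 \<le> unit_ball_vol (real n)"
  by (simp add: unit_ball_vol_def)

text \<open>Polar coordinates for radial integrands: a ball of radius r has volume
  \<open>unit_ball_vol n * r ^ n\<close>, and differentiating in r gives the density. Comparing both
  measures on the half-lines \<open>{..r}\<close> suffices, since these are stable under
  intersection and generate the Borel sets.\<close>

lemma distr_norm_lborel:
  "distr (lborel :: 'a::euclidean_space measure) borel norm =
   density lborel (\<lambda>r. ennreal (real DIM('a) * unit_ball_vol (real DIM('a)) * r ^ (DIM('a) - 1)) * indicator {0..} r)"
  (is "?M = ?N")
proof (rule measure_eqI_generator_eq[where E = "range atMost" and \<Omega> = UNIV and A = "\<lambda>n. {..real n}"])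
  let ?n = "DIM('a)" let ?v = "unit_ball_vol (real ?n)"
  show "Int_stable (range (atMost :: real \<Rightarrow> real set))"
    by (auto simp: Int_stable_def)
  have M: "emeasure ?M {..r} = (if r < 0 then 0 else ennreal (?v * r ^ ?n))" for r
  proof -
    have "norm -` {..r} = (cball 0 r :: 'a set)" by (auto simp: dist_norm)
    then show ?thesis
      by (subst emeasure_distr) (auto simp: emeasure_cball)
  qed
  have N: "emeasure ?N {..r} = (if r < 0 then 0 else ennreal (?v * r ^ ?n))" for r
  proof (cases "r < 0")
    case True
    have "emeasure ?N {..r} = (\<integral>\<^sup>+x. ennreal (real ?n * ?v * x ^ (?n - 1)) * indicator {0..} x * indicator {..r} x \<partial>lborel)"
      by (subst emeasure_density) auto
    also have "\<dots> = (\<integral>\<^sup>+x. 0 \<partial>(lborel :: real measure))"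
      by (rule nn_integral_cong) (use True in \<open>auto simp: indicator_def\<close>)
    finally show ?thesis using True by simp
  next
    case False
    then have "emeasure ?N {..r} = (\<integral>\<^sup>+x. ennreal (real ?n * ?v * x ^ (?n - 1)) * indicator {0..r} x \<partial>lborel)"
      by (subst emeasure_density) (auto intro!: nn_integral_cong simp: indicator_def)
    also have "\<dots> = ennreal (?v * r ^ ?n - ?v * 0 ^ ?n)"
      using False
      by (intro nn_integral_FTC_Icc) (auto intro!: derivative_eq_intros simp: ball_vol_nonneg)
    finally show ?thesis using False by simp
  qed
  show "emeasure ?M X = emeasure ?N X" if "X \<in> range atMost" for X
    using that M N by auto
  show "emeasure ?M {..real i} \<noteq> \<infinity>" for i
    by (simp add: M)
  show "(\<Union>i. {..real i}) = UNIV"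
    by (auto intro: real_arch_simple)
qed (auto simp: borel_eq_atMost sets_measure_of)

lemma nn_integral_radial:
  assumes [measurable]: "F \<in> borel_measurable borel"
  shows "(\<integral>\<^sup>+x. F (norm x) \<partial>(lborel :: 'a::euclidean_space measure)) =
    (\<integral>\<^sup>+r. ennreal (real DIM('a) * unit_ball_vol (real DIM('a)) * r ^ (DIM('a) - 1)) * indicator {0..} r * F r \<partial>lborel)"
proof -
  have "(\<integral>\<^sup>+x. F (norm x) \<partial>(lborel :: 'a measure)) = (\<integral>\<^sup>+r. F r \<partial>distr (lborel :: 'a measure) borel norm)"
    by (simp add: nn_integral_distr)
  then show ?thesis
    by (simp add: distr_norm_lborel nn_integral_density)
qed

text \<open>The exact power of \<rho> is the point: it yields the factor
  \<open>R powr (- 2 * s)\<close> of far-field errors and the order \<open>decay\<close> of the tail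
  mass of the mollifier.\<close>

lemma nn_integral_norm_powr_ge:
  assumes a: "a > real DIM('a)" and \<rho>: "\<rho> > 0"
  shows "(\<integral>\<^sup>+x. ennreal (norm x powr (-a)) * indicator {x. norm x > \<rho>} x \<partial>(lborel :: 'a::euclidean_space measure)) =
     ennreal (real DIM('a) * unit_ball_vol (real DIM('a)) / (a - real DIM('a)) * \<rho> powr (real DIM('a) - a))"
proof -
  let ?n = "DIM('a)" let ?v = "unit_ball_vol (real ?n)"
  let ?F = "\<lambda>r. - (real ?n * ?v / (a - real ?n)) * r powr (real ?n - a)"
  have "(\<integral>\<^sup>+x. ennreal (norm x powr (-a)) * indicator {x. norm x > \<rho>} x \<partial>(lborel :: 'a measure))
      = (\<integral>\<^sup>+x. (\<lambda>r. ennreal (r powr (-a)) * indicator {\<rho><..} r) (norm x) \<partial>(lborel :: 'a measure))"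
    by (intro nn_integral_cong) (auto simp: indicator_def)
  also have "\<dots> = (\<integral>\<^sup>+r. ennreal (real ?n * ?v * r ^ (?n - 1)) * indicator {0..} r * (ennreal (r powr (-a)) * indicator {\<rho><..} r) \<partial>lborel)"
    by (rule nn_integral_radial) auto
  \<comment> \<open>The sphere of radius \<rho> is a null set, so the half-line may be closed as the
    fundamental theorem requires.\<close>
  also have "\<dots> = (\<integral>\<^sup>+r. ennreal (real ?n * ?v * r powr (real ?n - a - 1)) * indicator {\<rho>..} r \<partial>lborel)"
  proof (intro nn_integral_cong_AE, use AE_lborel_singleton[of \<rho>] in eventually_elim)
    fix r :: real assume "r \<noteq> \<rho>"
    show "ennreal (real ?n * ?v * r ^ (?n - 1)) * indicator {0..} r * (ennreal (r powr (-a)) * indicator {\<rho><..} r)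
      = ennreal (real ?n * ?v * r powr (real ?n - a - 1)) * indicator {\<rho>..} r"
    proof (cases "r > \<rho>")
      case True
      then have r: "r > 0" using \<rho> by simp
      have "r ^ (?n - 1) * r powr (-a) = r powr (real ?n - a - 1)"
        using r DIM_positive[where 'a='a]
        by (simp add: powr_realpow[symmetric] powr_add[symmetric] of_nat_diff Suc_le_eq algebra_simps)
      then show ?thesis
        using True r \<open>r \<noteq> \<rho>\<close> by (simp add: ennreal_mult'[symmetric] ball_vol_nonneg mult.assoc ennreal_mult''[symmetric])
    qed (use \<open>r \<noteq> \<rho>\<close> in auto)
  qed
  also have "\<dots> = ennreal (0 - ?F \<rho>)"
  proof (rule nn_integral_FTC_atLeast)
    have "((\<lambda>r. r powr (real ?n - a)) \<longlongrightarrow> 0) at_top"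
      using a by (intro tendsto_neg_powr filterlim_ident) auto
    from tendsto_mult_right_zero[OF this] show "(?F \<longlongrightarrow> 0) at_top"
      by blast
    show "DERIV ?F r :> real ?n * ?v * r powr (real ?n - a - 1)" if "\<rho> \<le> r" for r
    proof -
      have "DERIV (\<lambda>r. r powr (real ?n - a)) r :> (real ?n - a) * r powr (real ?n - a - 1)"
        using that \<rho> by (auto intro!: derivative_eq_intros)
      from DERIV_cmult[OF this, of "- (real ?n * ?v / (a - real ?n))"]
      have "DERIV ?F r :> - (real ?n * ?v / (a - real ?n)) * ((real ?n - a) * r powr (real ?n - a - 1))" .
      moreover have "- (real ?n * ?v / (a - real ?n)) * (real ?n - a) = real ?n * ?v"
        using a by (simp add: divide_simps algebra_simps)
      ultimately show ?thesis by (metis mult.assoc)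
    qed
  qed (auto simp: ball_vol_nonneg)
  finally show ?thesis by simp
qed

lemma nn_integral_norm_powr_le:
  assumes a: "a < real DIM('a)"
  shows "(\<integral>\<^sup>+x. ennreal (norm x powr (-a)) * indicator (cball 0 1) x \<partial>(lborel :: 'a::euclidean_space measure)) < \<infinity>"
proof -
  let ?n = "DIM('a)" let ?v = "unit_ball_vol (real ?n)"
  have "(\<integral>\<^sup>+x. ennreal (norm x powr (-a)) * indicator (cball 0 1) x \<partial>(lborel :: 'a measure))
      = (\<integral>\<^sup>+x. (\<lambda>r. ennreal (r powr (-a)) * indicator {..1} r) (norm x) \<partial>(lborel :: 'a measure))"
    by (intro nn_integral_cong) (auto simp: indicator_def)
  also have "\<dots> = (\<integral>\<^sup>+r. ennreal (real ?n * ?v * r ^ (?n - 1)) * indicator {0..} r * (ennreal (r powr (-a)) * indicator {..1} r) \<partial>lborel)"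
    by (rule nn_integral_radial) auto
  also have "\<dots> = (\<integral>\<^sup>+r. ennreal (real ?n * ?v * (r powr (real ?n - a - 1))) * indicator {0..1} r \<partial>lborel)"
  proof (intro nn_integral_cong_AE, use AE_lborel_singleton[of "0::real"] in eventually_elim)
    fix r :: real assume "r \<noteq> 0"
    show "ennreal (real ?n * ?v * r ^ (?n - 1)) * indicator {0..} r * (ennreal (r powr (-a)) * indicator {..1} r)
      = ennreal (real ?n * ?v * r powr (real ?n - a - 1)) * indicator {0..1} r"
    proof (cases "r > 0")
      case r: True
      have "r ^ (?n - 1) * r powr (-a) = r powr (real ?n - a - 1)"
        using r DIM_positive[where 'a='a]
        by (simp add: powr_realpow[symmetric] powr_add[symmetric] of_nat_diff Suc_le_eq algebra_simps)
      then show ?thesis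
        using r by (auto simp: indicator_def ennreal_mult'[symmetric] ball_vol_nonneg mult.assoc ennreal_mult''[symmetric])
    qed (use \<open>r \<noteq> 0\<close> in auto)
  qed
  also have "\<dots> < \<infinity>"
  proof -
    have "((\<lambda>r. r powr (real ?n - a - 1)) has_integral (1 powr (real ?n - a - 1 + 1) / (real ?n - a - 1 + 1))) {0..1}"
      using has_integral_powr_from_0[of "real ?n - a - 1" 1] a by simp
    from has_integral_mult_right[OF this, of "real ?n * ?v"]
    have *: "((\<lambda>r. real ?n * ?v * r powr (real ?n - a - 1)) has_integral (real ?n * ?v * (1 / (real ?n - a)))) {0..1}"
      by simp
    have "(\<integral>\<^sup>+r. ennreal (real ?n * ?v * (r powr (real ?n - a - 1))) * indicator {0..1} r \<partial>lborel) = ennreal (real ?n * ?v * (1 / (real ?n - a)))"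
      using nn_integral_has_integral_lebesgue[OF _ *] 
      by (simp add: ball_vol_nonneg nn_integral_completion ennreal_mult'' mult.commute ennreal_indicator indicator_mult_ennreal)
    then show ?thesis by simp
  qed
  finally show ?thesis .
qed

section \<open>Change of variables: rotations and splitting off one coordinate\<close>

lemma distr_orthogonal_lborel:
  fixes L :: "real^'n::{finite,wellorder} \<Rightarrow> real^'n::_"
  assumes L: "orthogonal_transformation L"
  shows "distr lborel borel L = (lborel :: (real^'n::{finite,wellorder}) measure)"
proof (rule lborel_eqI[symmetric])
  have lin: "linear L" using L by (simp add: orthogonal_transformation_linear)
  have [measurable]: "L \<in> borel_measurable borel"
    using lin by (intro borel_measurable_continuous_onI linear_continuous_on) (simp add: linear_conv_bounded_linear)
  fix l u :: "real^'n::{finite,wellorder}" assume le: "\<And>b. b \<in> Basis \<Longrightarrow> l \<bullet> b \<le> u \<bullet> b"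
  have inv: "orthogonal_transformation (inv L)" using L by (rule orthogonal_transformation_inv)
  have eq: "L -` box l u = inv L ` box l u"
    using orthogonal_transformation_bij[OF L] by (simp add: bij_vimage_eq_inv_image)
  have m: "inv L ` box l u \<in> lmeasurable" "measure lebesgue (inv L ` box l u) = measure lebesgue (box l u)"
    using measurable_orthogonal_image[OF inv] measure_orthogonal_image[OF inv] by auto
  have b: "L -` box l u \<in> sets borel"
    using measurable_sets[of L borel borel "box l u"] by simp
  have "emeasure (distr lborel borel L) (box l u) = emeasure lborel (L -` box l u)"
    by (subst emeasure_distr) auto
  also have "\<dots> = emeasure lebesgue (L -` box l u)"
    using b by simp
  also have "\<dots> = ennreal (measure lebesgue (inv L ` box l u))"
    unfolding eq by (rule emeasure_eq_measure2[OF m(1)])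
  also have "\<dots> = emeasure lebesgue (box l u)"
    unfolding m(2) by (rule emeasure_eq_measure2[symmetric]) simp
  also have "\<dots> = emeasure lborel (box l u)" by simp
  also have "\<dots> = (\<Prod>b\<in>Basis. (u - l) \<bullet> b)"
    using le by (simp add: emeasure_lborel_box_eq)
  finally show "emeasure (distr lborel borel L) (box l u) = (\<Prod>b\<in>Basis. (u - l) \<bullet> b)" .
qed simp

text \<open>The coordinate along which a plane wave varies comes first, so that in Fubini's theorem
  the inner integral runs over the planes orthogonal to it.\<close>

definition join3 :: "real \<times> (real^2) \<Rightarrow> real^3" where
  "join3 p = vector [snd p $ 1, snd p $ 2, fst p]"

lemma join3_nth [simp]: "join3 p $ 1 = snd p $ 1" "join3 p $ 2 = snd p $ 2" "join3 p $ 3 = fst p"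
  by (simp_all add: join3_def)

lemma prod_UNIV_2: "(\<Prod>i\<in>(UNIV::2 set). f i) = f 1 * (f 2 :: real)"
  unfolding UNIV_2 by simp

lemma prod_UNIV_3: "(\<Prod>i\<in>(UNIV::3 set). f i) = f 1 * f 2 * (f 3 :: real)"
  unfolding UNIV_3 by (simp add: mult.assoc)

lemma prod_Basis_vec: "(\<Prod>b\<in>Basis. (x::real^'n) \<bullet> b) = (\<Prod>i\<in>UNIV. x $ i)"
proof -
  have B: "(Basis :: (real^'n) set) = (\<lambda>i. axis i 1) ` UNIV"
    by (auto simp: Basis_vec_def)
  have "inj (\<lambda>i. axis i (1::real) :: real^'n)"
    by (auto simp: inj_on_def axis_eq_axis)
  then show ?thesis
    unfolding B by (subst prod.reindex) (auto simp: inner_axis)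
qed

lemma join3_measurable [measurable]: "join3 \<in> borel_measurable borel"
proof -
  have "linear join3"
    by (intro linearI) (simp_all add: vec_eq_iff forall_3)
  then show ?thesis
    by (intro borel_measurable_continuous_onI linear_continuous_on) (simp add: linear_conv_bounded_linear)
qed

lemma distr_join3: "distr lborel borel join3 = lborel"
proof (rule lborel_eqI[symmetric])
  fix l u :: "real^3" assume le: "\<And>b. b \<in> Basis \<Longrightarrow> l \<bullet> b \<le> u \<bullet> b"
  have le': "l $ i \<le> u $ i" for i
    using le[of "axis i 1"] by (simp add: inner_axis)
  let ?l = "(l$3, vector [l$1, l$2]) :: real \<times> (real^2)"
  let ?u = "(u$3, vector [u$1, u$2]) :: real \<times> (real^2)"
  have eq: "join3 -` box l u = box ?l ?u"
    by (auto simp: box_def Basis_prod_def Basis_vec_def inner_axis forall_2 forall_3 ball_Un inner_prod_def)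
  have le2: "?l \<bullet> b \<le> ?u \<bullet> b" if "b \<in> Basis" for b
  proof -
    have "b = (1, 0) \<or> (\<exists>i. b = (0, axis i 1))"
      using that by (auto simp: Basis_prod_def Basis_vec_def)
    then consider "b = (1, 0)" | "b = (0, axis 1 1)" | "b = (0, axis 2 1)"
      by (metis exhaust_2)
    then show ?thesis
      using le' by cases (simp_all add: inner_prod_def inner_axis)
  qed
  have "emeasure (distr lborel borel join3) (box l u) = emeasure lborel (box ?l ?u)"
    by (subst emeasure_distr) (auto simp: eq)
  also have "\<dots> = (\<Prod>b\<in>Basis. (?u - ?l) \<bullet> b)"
    using le2 by (simp add: emeasure_lborel_box_eq)
  also have "(\<Prod>b\<in>Basis. (?u - ?l) \<bullet> b) = (u$3 - l$3) * (\<Prod>b\<in>Basis. (vector [u$1, u$2] - vector [l$1, l$2] :: real^2) \<bullet> b)"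
    unfolding Basis_prod_def
    by (subst prod.union_disjoint) (auto simp: prod.reindex inj_on_def inner_prod_def)
  also have "\<dots> = (\<Prod>b\<in>Basis. (u - l) \<bullet> b)"
    unfolding prod_Basis_vec prod_UNIV_2 prod_UNIV_3 by simp
  finally show "emeasure (distr lborel borel join3) (box l u) = (\<Prod>b\<in>Basis. (u - l) \<bullet> b)" .
qed simp

lemma norm_join3: "norm (join3 p) = sqrt ((fst p)\<^sup>2 + (norm (snd p))\<^sup>2)"
  by (simp add: norm_eq_sqrt_inner inner_vec_def sum_3 sum_2 power2_eq_square)

text \<open>By Pythagoras the slice of the kernel at height \<tau> is radial in the plane. The ball
  of radius \<rho> cuts a disc out of the plane when \<open>\<bar>\<tau>\<bar> < \<rho>\<close> and
  misses it otherwise, which is why the truncation reappears as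
  \<open>max \<bar>\<tau>\<bar> \<rho>\<close>: the one-dimensional kernel is flattened near 0
  rather than cut off.\<close>

lemma nn_integral_slice:
  fixes \<tau> \<rho> s :: real
  assumes s: "s > -1/2" and \<rho>: "\<rho> > 0"
  shows "(\<integral>\<^sup>+w. ennreal (sqrt (\<tau>\<^sup>2 + (norm w)\<^sup>2) powr (-(3+2 * s))) * indicator {w. sqrt (\<tau>\<^sup>2 + (norm w)\<^sup>2) > \<rho>} w \<partial>(lborel :: (real^2) measure))
     = ennreal (2*pi/(1+2 * s) * max \<bar>\<tau>\<bar> \<rho> powr (-(1+2 * s)))"
proof -
  \<comment> \<open>The radius of the disc removed from the plane, 0 if the plane misses the
    ball.\<close>
  define a where "a = sqrt (max 0 (\<rho>\<^sup>2 - \<tau>\<^sup>2))"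
  have a0: "a \<ge> 0" by (simp add: a_def)
  have a2: "\<tau>\<^sup>2 + a\<^sup>2 = (max \<bar>\<tau>\<bar> \<rho>)\<^sup>2"
  proof (cases "\<bar>\<tau>\<bar> \<le> \<rho>")
    case True
    then have "\<tau>\<^sup>2 \<le> \<rho>\<^sup>2" using \<rho> by (simp add: abs_le_square_iff[symmetric])
    then show ?thesis using True by (simp add: a_def max_def)
  next
    case False
    then have "\<tau>\<^sup>2 \<ge> \<rho>\<^sup>2" using \<rho> by (simp add: abs_le_square_iff[symmetric])
    then show ?thesis using False by (simp add: a_def max_def)
  qed
  have pos: "\<tau>\<^sup>2 + r\<^sup>2 > 0" if "a \<le> r" for r
  proof -
    have "r\<^sup>2 \<ge> a\<^sup>2" using that a0 by (simp add: power_mono)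
    moreover have "(max \<bar>\<tau>\<bar> \<rho>)\<^sup>2 > 0" using \<rho> by simp
    ultimately show ?thesis using a2 by linarith
  qed
  have iff: "sqrt (\<tau>\<^sup>2 + r\<^sup>2) > \<rho> \<longleftrightarrow> r > a" if "r \<ge> 0" "r \<noteq> a" for r
  proof -
    have "sqrt (\<tau>\<^sup>2 + r\<^sup>2) > \<rho> \<longleftrightarrow> \<tau>\<^sup>2 + r\<^sup>2 > \<rho>\<^sup>2"
      using \<rho> real_less_rsqrt real_sqrt_less_iff[of "\<rho>\<^sup>2"] by (metis abs_of_pos real_sqrt_abs)
    also have "\<dots> \<longleftrightarrow> r > a"
    proof
      assume "r > a"
      then have "r\<^sup>2 > a\<^sup>2" using a0 by (simp add: power_strict_mono)
      then show "\<tau>\<^sup>2 + r\<^sup>2 > \<rho>\<^sup>2"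
        using a2 \<rho> power_mono[of \<rho> "max \<bar>\<tau>\<bar> \<rho>" 2] by (simp del: max.absorb1 max.absorb2 power_mono_iff)
    next
      assume "\<tau>\<^sup>2 + r\<^sup>2 > \<rho>\<^sup>2"
      then have "max 0 (\<rho>\<^sup>2 - \<tau>\<^sup>2) \<le> r\<^sup>2" by simp
      then have "a \<le> r" unfolding a_def using that real_le_lsqrt by blast
      then show "r > a" using that by simp
    qed
    finally show ?thesis .
  qed
  let ?f = "\<lambda>r. 2*pi * (r * (\<tau>\<^sup>2 + r\<^sup>2) powr (-(3+2 * s)/2))"
  let ?F = "\<lambda>r. -(2*pi/(1+2 * s)) * (\<tau>\<^sup>2 + r\<^sup>2) powr (-(1+2 * s)/2)"
  have "(\<integral>\<^sup>+w. ennreal (sqrt (\<tau>\<^sup>2 + (norm w)\<^sup>2) powr (-(3+2 * s))) * indicator {w. sqrt (\<tau>\<^sup>2 + (norm w)\<^sup>2) > \<rho>} w \<partial>(lborel :: (real^2) measure))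
     = (\<integral>\<^sup>+w. (\<lambda>r. ennreal (sqrt (\<tau>\<^sup>2 + r\<^sup>2) powr (-(3+2 * s))) * indicator {r. sqrt (\<tau>\<^sup>2 + r\<^sup>2) > \<rho>} r) (norm w) \<partial>(lborel :: (real^2) measure))"
    by (intro nn_integral_cong) (auto simp: indicator_def)
  also have "\<dots> = (\<integral>\<^sup>+r. ennreal (real DIM(real^2) * unit_ball_vol (real DIM(real^2)) * r ^ (DIM(real^2) - 1)) * indicator {0..} r
      * (ennreal (sqrt (\<tau>\<^sup>2 + r\<^sup>2) powr (-(3+2 * s))) * indicator {r. sqrt (\<tau>\<^sup>2 + r\<^sup>2) > \<rho>} r) \<partial>lborel)"
    by (rule nn_integral_radial) measurable
  also have "\<dots> = (\<integral>\<^sup>+r. ennreal (?f r) * indicator {a..} r \<partial>lborel)"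
  proof (intro nn_integral_cong_AE, use AE_lborel_singleton[of a] in eventually_elim)
    fix r assume ra: "r \<noteq> a"
    show "ennreal (real DIM(real^2) * unit_ball_vol (real DIM(real^2)) * r ^ (DIM(real^2) - 1)) * indicator {0..} r
      * (ennreal (sqrt (\<tau>\<^sup>2 + r\<^sup>2) powr (-(3+2 * s))) * indicator {r. sqrt (\<tau>\<^sup>2 + r\<^sup>2) > \<rho>} r) = ennreal (?f r) * indicator {a..} r"
    proof (cases "r > a")
      case True
      have "sqrt (\<tau>\<^sup>2 + r\<^sup>2) powr (-(3+2 * s)) = (\<tau>\<^sup>2 + r\<^sup>2) powr (-(3+2 * s)/2)"
        using pos[of r] True by (simp add: powr_half_sqrt[symmetric] powr_powr)
      then show ?thesis
        using True iff[of r] a0 by (simp add: ennreal_mult[symmetric] unit_ball_vol_2 mult.assoc)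
    next
      case False
      then show ?thesis using ra iff[of r] a0 by (auto simp: indicator_def)
    qed
  qed
  also have "\<dots> = ennreal (0 - ?F a)"
  proof (rule nn_integral_FTC_atLeast)
    have "LIM r at_top. \<tau>\<^sup>2 + r\<^sup>2 :> at_top"
      by (intro filterlim_tendsto_add_at_top[OF tendsto_const] filterlim_pow_at_top filterlim_ident) auto
    then have "((\<lambda>r. (\<tau>\<^sup>2 + r\<^sup>2) powr (-(1+2 * s)/2)) \<longlongrightarrow> 0) at_top"
      using s by (intro tendsto_neg_powr) auto
    from tendsto_mult_right_zero[OF this] show "(?F \<longlongrightarrow> 0) at_top" by blast
    show "0 \<le> ?f r" if "a \<le> r" for r using that a0 by simp
    show "DERIV ?F r :> ?f r" if "a \<le> r" for r
    proof -
      have "DERIV (\<lambda>r. (\<tau>\<^sup>2 + r\<^sup>2) powr (-(1+2 * s)/2)) r :> (-(1+2 * s)/2) * (\<tau>\<^sup>2 + r\<^sup>2) powr (-(3+2 * s)/2) * (2*r)"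
        using pos[OF that] by (auto intro!: derivative_eq_intros simp: field_simps)
      from DERIV_cmult[OF this, of "-(2*pi/(1+2 * s))"]
      have "DERIV ?F r :> -(2*pi/(1+2 * s)) * ((-(1+2 * s)/2) * (\<tau>\<^sup>2 + r\<^sup>2) powr (-(3+2 * s)/2) * (2*r))" .
      moreover have "-(2*pi/(1+2 * s)) * ((-(1+2 * s)/2) * (\<tau>\<^sup>2 + r\<^sup>2) powr (-(3+2 * s)/2) * (2*r)) = ?f r"
        using s by (simp add: field_simps)
      ultimately show ?thesis by metis
    qed
  qed measurable
  also have "0 - ?F a = 2*pi/(1+2 * s) * max \<bar>\<tau>\<bar> \<rho> powr (-(1+2 * s))"
  proof -
    have m: "max \<bar>\<tau>\<bar> \<rho> > 0" using \<rho> by simp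
    have "((max \<bar>\<tau>\<bar> \<rho>)\<^sup>2) powr (-(1+2 * s)/2) = max \<bar>\<tau>\<bar> \<rho> powr (-(1+2 * s))"
    proof -
      have "(max \<bar>\<tau>\<bar> \<rho>)\<^sup>2 = max \<bar>\<tau>\<bar> \<rho> powr 2" using m by simp
      moreover have "2 * (-(1+2 * s)/2) = -(1+2 * s)" by simp
      ultimately show ?thesis by (simp only: powr_powr)
    qed
    then show ?thesis by (simp add: a2)
  qed
  finally show ?thesis .
qed

text \<open>A rotation takes n to the third axis; slicing orthogonally to it then gives the density.
  The result does not depend on n, and up to a constant it is the one-dimensional kernel of the same
  order s.\<close>

lemma distr_plane_kernel:
  fixes n :: "real^3"
  assumes n: "norm n = 1" and s: "s > -1/2" and \<rho>: "\<rho> > 0"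
  shows "distr (density lborel (\<lambda>\<xi>. ennreal (norm \<xi> powr (-(3+2 * s))) * indicator {\<xi>. norm \<xi> > \<rho>} \<xi>)) borel (\<lambda>\<xi>. n \<bullet> \<xi>)
     = density lborel (\<lambda>\<tau>. ennreal (2*pi/(1+2 * s) * max \<bar>\<tau>\<bar> \<rho> powr (-(1+2 * s))))"
    (is "?M = ?N")
proof (rule measure_eqI)
  fix A assume "A \<in> sets ?M"
  then have [measurable]: "A \<in> sets borel" by simp
  define k where "k = (\<lambda>\<xi>::real^3. ennreal (norm \<xi> powr (-(3+2 * s))) * indicator {\<xi>. norm \<xi> > \<rho>} \<xi>)"
  have km [measurable]: "k \<in> borel_measurable borel" unfolding k_def by measurable
  have "norm (axis 3 1 :: real^3) = norm n" using n by simp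
  then obtain L where L: "orthogonal_transformation L" "L (axis 3 1 :: real^3) = n"
    by (rule orthogonal_transformation_exists) blast
  have [measurable]: "L \<in> borel_measurable borel"
    using orthogonal_transformation_linear[OF L(1)]
    by (intro borel_measurable_continuous_onI linear_continuous_on) (simp add: linear_conv_bounded_linear)
  have nL: "n \<bullet> L \<xi> = \<xi> $ 3" for \<xi>
    using L by (simp add: orthogonal_transformation_def inner_axis' flip: L(2))
  have [measurable]: "fst \<in> borel_measurable (borel :: (real \<times> (real^2)) measure)"
      "(\<lambda>w::real^2. (\<tau>::real, w)) \<in> borel_measurable borel" for \<tau>
    by (intro borel_measurable_continuous_onI continuous_intros)+
  have jm: "(\<lambda>p. k (join3 p) * indicator A (fst p)) \<in> borel_measurable (lborel \<Otimes>\<^sub>M lborel)"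
    unfolding lborel_prod by measurable
  have kL: "k (L \<xi>) = k \<xi>" for \<xi>
    by (simp add: k_def orthogonal_transformation_norm[OF L(1)] indicator_def)
  have "emeasure ?M A = (\<integral>\<^sup>+\<xi>. k \<xi> * indicator A (n \<bullet> \<xi>) \<partial>lborel)"
    unfolding k_def[symmetric]
    by (subst nn_integral_indicator[symmetric]) (simp_all add: nn_integral_distr nn_integral_density del: nn_integral_indicator)
  also have "\<dots> = (\<integral>\<^sup>+\<xi>. k \<xi> * indicator A (n \<bullet> \<xi>) \<partial>distr lborel borel L)"
    by (simp only: distr_orthogonal_lborel[OF L(1)])
  also have "\<dots> = (\<integral>\<^sup>+\<xi>. k \<xi> * indicator A (\<xi> $ 3) \<partial>lborel)"
    by (subst nn_integral_distr) (simp_all add: nL kL)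
  also have "\<dots> = (\<integral>\<^sup>+\<xi>. k \<xi> * indicator A (\<xi> $ 3) \<partial>distr lborel borel join3)"
    by (simp only: distr_join3)
  also have "\<dots> = (\<integral>\<^sup>+p. k (join3 p) * indicator A (fst p) \<partial>(lborel \<Otimes>\<^sub>M lborel))"
    by (subst nn_integral_distr) (simp_all add: lborel_prod)
  also have "\<dots> = (\<integral>\<^sup>+\<tau>. \<integral>\<^sup>+w. k (join3 (\<tau>, w)) * indicator A \<tau> \<partial>lborel \<partial>lborel)"
    by (subst lborel.nn_integral_fst[symmetric, OF jm]) simp
  also have "\<dots> = (\<integral>\<^sup>+\<tau>. ennreal (2*pi/(1+2 * s) * max \<bar>\<tau>\<bar> \<rho> powr (-(1+2 * s))) * indicator A \<tau> \<partial>lborel)"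
  proof (rule nn_integral_cong)
    fix \<tau> :: real
    have "(\<integral>\<^sup>+w. k (join3 (\<tau>, w)) * indicator A \<tau> \<partial>lborel) = (\<integral>\<^sup>+w. k (join3 (\<tau>, w)) \<partial>lborel) * indicator A \<tau>"
      by (rule nn_integral_multc) measurable
    also have "(\<integral>\<^sup>+w. k (join3 (\<tau>, w)) \<partial>lborel) = ennreal (2*pi/(1+2 * s) * max \<bar>\<tau>\<bar> \<rho> powr (-(1+2 * s)))"
      unfolding nn_integral_slice[OF s \<rho>, symmetric]
      by (intro nn_integral_cong) (simp add: k_def norm_join3 indicator_def)
    finally show "(\<integral>\<^sup>+w. k (join3 (\<tau>, w)) * indicator A \<tau> \<partial>lborel) = ennreal (2*pi/(1+2 * s) * max \<bar>\<tau>\<bar> \<rho> powr (-(1+2 * s))) * indicator A \<tau>" .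
  qed
  also have "\<dots> = emeasure ?N A"
    by (subst emeasure_density) simp_all
  finally show "emeasure ?M A = emeasure ?N A" .
qed simp

section \<open>Integrability and scaling of the kernels\<close>

lemma integrable_norm_powr_near:
  assumes "b < real DIM('a)"
  shows "integrable (lborel :: 'a::euclidean_space measure) (\<lambda>x. indicator (cball 0 1) x * norm x powr (-b))"
proof (rule integrableI_nonneg)
  have "(\<integral>\<^sup>+ x. ennreal (indicator (cball 0 1) x * norm x powr (-b)) \<partial>(lborel :: 'a measure))
     = (\<integral>\<^sup>+x. ennreal (norm x powr (-b)) * indicator (cball 0 1) x \<partial>(lborel :: 'a measure))"
    by (intro nn_integral_cong) (auto simp: indicator_def)
  then show "(\<integral>\<^sup>+ x. ennreal (indicator (cball 0 1) x * norm x powr (-b)) \<partial>(lborel :: 'a measure)) < \<infinity>"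
    using nn_integral_norm_powr_le[OF assms] by simp
qed (auto simp: indicator_def)

lemma
  assumes "a > real DIM('a)" "\<rho> > 0"
  shows integrable_norm_powr_far:
      "integrable (lborel :: 'a::euclidean_space measure) (\<lambda>x. indicator {x. norm x > \<rho>} x * norm x powr (-a))"
    and integral_norm_powr_far:
      "(LINT x|(lborel :: 'a measure). indicator {x. norm x > \<rho>} x * norm x powr (-a)) =
       real DIM('a) * unit_ball_vol (real DIM('a)) / (a - real DIM('a)) * \<rho> powr (real DIM('a) - a)"
proof -
  have "(\<integral>\<^sup>+ x. ennreal (indicator {x. norm x > \<rho>} x * norm x powr (-a)) \<partial>(lborel :: 'a measure))
     = (\<integral>\<^sup>+x. ennreal (norm x powr (-a)) * indicator {x. norm x > \<rho>} x \<partial>(lborel :: 'a measure))"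
    by (intro nn_integral_cong) (auto simp: indicator_def)
  also note nn_integral_norm_powr_ge[OF assms]
  finally have *: "(\<integral>\<^sup>+ x. ennreal (indicator {x. norm x > \<rho>} x * norm x powr (-a)) \<partial>(lborel :: 'a measure))
     = ennreal (real DIM('a) * unit_ball_vol (real DIM('a)) / (a - real DIM('a)) * \<rho> powr (real DIM('a) - a))" .
  show "integrable (lborel :: 'a measure) (\<lambda>x. indicator {x. norm x > \<rho>} x * norm x powr (-a))"
    by (rule integrableI_nonneg) (use * in \<open>auto simp: indicator_def\<close>)
  show "(LINT x|(lborel :: 'a measure). indicator {x. norm x > \<rho>} x * norm x powr (-a)) =
       real DIM('a) * unit_ball_vol (real DIM('a)) / (a - real DIM('a)) * \<rho> powr (real DIM('a) - a)"
    by (subst integral_eq_nn_integral) (use assms in \<open>auto simp: * ball_vol_nonneg intro!: divide_nonneg_pos mult_nonneg_nonneg\<close>)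
qed

lemma integrable_powr_near_far:
  fixes f :: "'a::euclidean_space \<Rightarrow> real"
  assumes [measurable]: "f \<in> borel_measurable borel"
    and b: "b < real DIM('a)" and a: "a > real DIM('a)"
    and near: "\<And>x. 0 < norm x \<Longrightarrow> norm x \<le> 1 \<Longrightarrow> \<bar>f x\<bar> \<le> B * norm x powr (-b)"
    and far: "\<And>x. norm x > 1 \<Longrightarrow> \<bar>f x\<bar> \<le> B * norm x powr (-a)"
  shows "integrable lborel f"
proof (rule Bochner_Integration.integrable_bound)
  show "integrable lborel (\<lambda>x::'a. B * (indicator (cball 0 1) x * norm x powr (-b))
      + B * (indicator {x. norm x > 1} x * norm x powr (-a)))"
    using integrable_norm_powr_near[OF b] integrable_norm_powr_far[OF a, of 1] by simp
  show "AE x in lborel. norm (f x) \<le> norm (B * (indicator (cball 0 1) x * norm x powr (-b))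
      + B * (indicator {x. norm x > 1} x * norm x powr (-a)))"
    using AE_lborel_singleton[of "0::'a"]
  proof eventually_elim
    case (elim x)
    then show ?case
      using near[of x] far[of x] by (cases "norm x \<le> 1") (auto simp: indicator_def)
  qed
qed simp

text \<open>A function of \<open>n \<bullet> \<xi>\<close> alone is integrated by pushing the kernel
  forward. No integrability of \<open>F\<close> is assumed: push-forwards and densities preserve
  integrability in both directions, so otherwise both sides are 0.\<close>

lemma integral_plane_wave:
  fixes n :: "real^3" and F :: "real \<Rightarrow> real"
  assumes n: "norm n = 1" and s: "s > -1/2" and \<rho>: "\<rho> > 0" and [measurable]: "F \<in> borel_measurable borel"
  shows "(LINT \<xi>|lborel. F (n \<bullet> \<xi>) * (indicator {\<xi>. norm \<xi> > \<rho>} \<xi> * norm \<xi> powr (-(3+2 * s))))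
      = 2*pi/(1+2 * s) * (LINT \<tau>|lborel. F \<tau> * max \<bar>\<tau>\<bar> \<rho> powr (-(1+2 * s)))"
proof -
  let ?k = "\<lambda>\<xi>::real^3. indicator {\<xi>. norm \<xi> > \<rho>} \<xi> * norm \<xi> powr (-(3+2 * s))"
  define c where "c = 2*pi/(1+2 * s)"
  let ?\<kappa> = "\<lambda>\<tau>. max \<bar>\<tau>\<bar> \<rho> powr (-(1+2 * s))"
  have c: "c > 0" using s unfolding c_def by (intro divide_pos_pos) auto
  have "density lborel (\<lambda>\<xi>::real^3. ennreal (norm \<xi> powr (-(3+2 * s))) * indicator {\<xi>. norm \<xi> > \<rho>} \<xi>) = density lborel (\<lambda>\<xi>. ennreal (?k \<xi>))"
    by (intro arg_cong2[where f=density] refl ext) (auto simp: indicator_def)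
  then have D: "distr (density lborel (\<lambda>\<xi>::real^3. ennreal (?k \<xi>))) borel (\<lambda>\<xi>. n \<bullet> \<xi>) = density lborel (\<lambda>\<tau>. ennreal (c * ?\<kappa> \<tau>))"
    using distr_plane_kernel[OF n s \<rho>] by (simp add: c_def)
  have "(LINT \<xi>|lborel. F (n \<bullet> \<xi>) * ?k \<xi>) = (LINT \<xi>|density lborel (\<lambda>\<xi>::real^3. ennreal (?k \<xi>)). F (n \<bullet> \<xi>))"
    by (subst integral_real_density) (auto simp: mult.commute)
  also have "\<dots> = (LINT \<tau>|distr (density lborel (\<lambda>\<xi>::real^3. ennreal (?k \<xi>))) borel (\<lambda>\<xi>. n \<bullet> \<xi>). F \<tau>)"
    by (subst integral_distr) auto
  also have "\<dots> = (LINT \<tau>|lborel. c * (F \<tau> * ?\<kappa> \<tau>))"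
    unfolding D using c by (subst integral_real_density) (auto simp: mult_ac)
  also have "\<dots> = c * (LINT \<tau>|lborel. F \<tau> * ?\<kappa> \<tau>)"
    by (subst integral_mult_right_zero) auto
  finally show ?thesis unfolding c_def .
qed

text \<open>The flattened kernel is homogeneous only jointly with its cut-off. A plane wave of slope
  \<open>lam\<close> therefore sees the cut-off \<open>lam * \<rho>\<close>, and this is how the
  length of a gradient enters the comparison below.\<close>

lemma integral_max_kernel_scale:
  fixes F :: "real \<Rightarrow> real"
  assumes "lam > 0" "\<rho> > 0"
  shows "(LINT \<tau>|lborel. F (lam * \<tau>) * max \<bar>\<tau>\<bar> \<rho> powr (-(1+2 * s)))
       = lam powr (2 * s) * (LINT \<tau>|lborel. F \<tau> * max \<bar>\<tau>\<bar> (lam * \<rho>) powr (-(1+2 * s)))"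
proof -
  have "(LINT \<tau>|lborel. F \<tau> * max \<bar>\<tau>\<bar> (lam * \<rho>) powr (-(1+2 * s)))
     = lam * (LINT \<tau>|lborel. F (lam * \<tau>) * max \<bar>lam * \<tau>\<bar> (lam * \<rho>) powr (-(1+2 * s)))"
    using lborel_integral_real_affine[of lam "\<lambda>\<tau>. F \<tau> * max \<bar>\<tau>\<bar> (lam * \<rho>) powr (-(1+2 * s))" 0] assms by simp
  also have "(\<lambda>\<tau>. F (lam * \<tau>) * max \<bar>lam * \<tau>\<bar> (lam * \<rho>) powr (-(1+2 * s)))
      = (\<lambda>\<tau>. lam powr (-(1+2 * s)) * (F (lam * \<tau>) * max \<bar>\<tau>\<bar> \<rho> powr (-(1+2 * s))))"
  proof
    fix \<tau>
    have "max \<bar>lam * \<tau>\<bar> (lam * \<rho>) = lam * max \<bar>\<tau>\<bar> \<rho>"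
      using assms by (simp add: abs_mult max_mult_distrib_left)
    then show "F (lam * \<tau>) * max \<bar>lam * \<tau>\<bar> (lam * \<rho>) powr (-(1+2 * s))
      = lam powr (-(1+2 * s)) * (F (lam * \<tau>) * max \<bar>\<tau>\<bar> \<rho> powr (-(1+2 * s)))"
      using assms by (simp add: powr_mult)
  qed
  also have "lam * (LINT \<tau>|lborel. lam powr (-(1+2 * s)) * (F (lam * \<tau>) * max \<bar>\<tau>\<bar> \<rho> powr (-(1+2 * s))))
     = (lam * lam powr (-(1+2 * s))) * (LINT \<tau>|lborel. F (lam * \<tau>) * max \<bar>\<tau>\<bar> \<rho> powr (-(1+2 * s)))"
    by simp
  also have "lam * lam powr (-(1+2 * s)) = lam powr (-2 * s)"
    using assms powr_add[of lam 1 "-(1+2 * s)"] by simp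
  finally show ?thesis
    using assms by (simp add: mult.assoc[symmetric] powr_add[symmetric])
qed

lemma integrable_max_kernel:
  fixes F :: "real \<Rightarrow> real" and s :: real
  assumes s: "s > 0" and \<rho>: "\<rho> > 0"
    and [measurable]: "F \<in> borel_measurable borel" and F: "\<And>\<tau>. \<bar>F \<tau>\<bar> \<le> B"
  shows "integrable lborel (\<lambda>\<tau>. F \<tau> * max \<bar>\<tau>\<bar> \<rho> powr (-(1+2 * s)))"
proof (rule integrable_powr_near_far[where a = "1 + 2 * s" and b = 0 and B = "B * (1 + \<rho> powr (-(1+2 * s)))"])
  have B: "B \<ge> 0" using F[of 0] by linarith
  show "\<bar>F \<tau> * max \<bar>\<tau>\<bar> \<rho> powr (-(1+2 * s))\<bar> \<le> B * (1 + \<rho> powr (-(1+2 * s))) * norm \<tau> powr (-0)" if "0 < norm \<tau>" for \<tau>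
  proof -
    have "max \<bar>\<tau>\<bar> \<rho> powr (-(1+2 * s)) \<le> \<rho> powr (-(1+2 * s))"
      using \<rho> s by (intro powr_mono2') auto
    also have "\<dots> \<le> 1 + \<rho> powr (-(1+2 * s))" by simp
    finally show ?thesis
      using that F[of \<tau>] B by (auto simp: abs_mult intro!: mult_mono)
  qed
  show "\<bar>F \<tau> * max \<bar>\<tau>\<bar> \<rho> powr (-(1+2 * s))\<bar> \<le> B * (1 + \<rho> powr (-(1+2 * s))) * norm \<tau> powr (-(1+2 * s))" if "norm \<tau> > 1" for \<tau>
  proof -
    have "max \<bar>\<tau>\<bar> \<rho> powr (-(1+2 * s)) \<le> \<bar>\<tau>\<bar> powr (-(1+2 * s))"
      using that s by (intro powr_mono2') auto
    then have "\<bar>F \<tau> * max \<bar>\<tau>\<bar> \<rho> powr (-(1+2 * s))\<bar> \<le> B * \<bar>\<tau>\<bar> powr (-(1+2 * s))"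
      using F[of \<tau>] B by (auto simp: abs_mult intro!: mult_mono)
    also have "\<dots> \<le> B * (1 + \<rho> powr (-(1+2 * s))) * \<bar>\<tau>\<bar> powr (-(1+2 * s))"
      using B by (intro mult_right_mono) (auto simp: algebra_simps)
    finally show ?thesis by simp
  qed
qed (use s in auto)

text \<open>At infinity the integrand is \<open>\<bar>\<tau>\<bar> powr (- 2 * s)\<close>, which is
  integrable precisely because \<open>s > 1/2\<close>.\<close>

lemma integrable_abs_max_kernel:
  fixes s \<rho> :: real
  assumes s: "s > 1/2" and \<rho>: "\<rho> > 0"
  shows "integrable lborel (\<lambda>\<tau>::real. \<bar>\<tau>\<bar> * max \<bar>\<tau>\<bar> \<rho> powr (-(1+2 * s)))"
proof (rule integrable_powr_near_far[where a = "2 * s" and b = 0 and B = "1 + \<rho> powr (-(1+2 * s))"])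
  show "\<bar>\<bar>\<tau>\<bar> * max \<bar>\<tau>\<bar> \<rho> powr (-(1+2 * s))\<bar> \<le> (1 + \<rho> powr (-(1+2 * s))) * norm \<tau> powr (-0)"
    if "0 < norm \<tau>" "norm \<tau> \<le> 1" for \<tau> :: real
  proof -
    have "max \<bar>\<tau>\<bar> \<rho> powr (-(1+2 * s)) \<le> \<rho> powr (-(1+2 * s))"
      using \<rho> s by (intro powr_mono2') auto
    then have "\<bar>\<tau>\<bar> * max \<bar>\<tau>\<bar> \<rho> powr (-(1+2 * s)) \<le> 1 * \<rho> powr (-(1+2 * s))"
      using that by (intro mult_mono) auto
    then show ?thesis using that by simp
  qed
  show "\<bar>\<bar>\<tau>\<bar> * max \<bar>\<tau>\<bar> \<rho> powr (-(1+2 * s))\<bar> \<le> (1 + \<rho> powr (-(1+2 * s))) * norm \<tau> powr (-(2 * s))" if "norm \<tau> > 1" for \<tau> :: real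
  proof -
    have "max \<bar>\<tau>\<bar> \<rho> powr (-(1+2 * s)) \<le> \<bar>\<tau>\<bar> powr (-(1+2 * s))"
      using that s by (intro powr_mono2') auto
    then have "\<bar>\<bar>\<tau>\<bar> * max \<bar>\<tau>\<bar> \<rho> powr (-(1+2 * s))\<bar> \<le> \<bar>\<tau>\<bar> * \<bar>\<tau>\<bar> powr (-(1+2 * s))"
      by (simp add: mult_left_mono)
    also have "\<bar>\<tau>\<bar> * \<bar>\<tau>\<bar> powr (-(1+2 * s)) = \<bar>\<tau>\<bar> powr (-(2 * s))"
      using that powr_add[of "\<bar>\<tau>\<bar>" 1 "-(1+2 * s)"] by simp
    also have "\<dots> \<le> (1 + \<rho> powr (-(1+2 * s))) * \<bar>\<tau>\<bar> powr (-(2 * s))"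
      by (simp add: algebra_simps)
    finally show ?thesis by simp
  qed
qed (use s in auto)

text \<open>First absolute moment for the cut-off 1; other cut-offs reduce to it by scaling, see
  \<open>integral_abs_max_kernel\<close>.\<close>

definition kernel_moment :: "real \<Rightarrow> real" where
  "kernel_moment s = (LINT \<tau>|lborel. \<bar>\<tau>\<bar> * max \<bar>\<tau>\<bar> 1 powr (-(1+2 * s)))"

lemma kernel_moment_nonneg: "kernel_moment s \<ge> 0"
  unfolding kernel_moment_def by (rule integral_nonneg_AE) auto

lemma integral_abs_max_kernel:
  assumes \<rho>: "\<rho> > 0"
  shows "(LINT \<tau>|lborel. \<bar>\<tau>\<bar> * max \<bar>\<tau>\<bar> \<rho> powr (-(1+2 * s))) = \<rho> powr (1 - 2 * s) * kernel_moment s"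
proof -
  have "(LINT \<tau>|lborel. \<bar>\<rho> * \<tau>\<bar> * max \<bar>\<tau>\<bar> 1 powr (-(1+2 * s)))
    = \<rho> powr (2 * s) * (LINT \<tau>|lborel. \<bar>\<tau>\<bar> * max \<bar>\<tau>\<bar> (\<rho> * 1) powr (-(1+2 * s)))"
    using assms by (intro integral_max_kernel_scale) auto
  moreover have "(LINT \<tau>|lborel. \<bar>\<rho> * \<tau>\<bar> * max \<bar>\<tau>\<bar> 1 powr (-(1+2 * s))) = \<rho> * kernel_moment s"
    using \<rho> by (simp add: kernel_moment_def abs_mult mult.assoc)
  ultimately have "\<rho> powr (-2 * s) * (\<rho> * kernel_moment s) = \<rho> powr (-2 * s) * (\<rho> powr (2 * s) * (LINT \<tau>|lborel. \<bar>\<tau>\<bar> * max \<bar>\<tau>\<bar> \<rho> powr (-(1+2 * s))))"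
    by simp
  moreover have "\<rho> powr (-2 * s) * (\<rho> * kernel_moment s) = \<rho> powr (1 - 2 * s) * kernel_moment s"
    using \<rho> powr_add[of \<rho> 1 "-2 * s"] by simp
  ultimately show ?thesis
    using \<rho> by (simp add: mult.assoc[symmetric] powr_add[symmetric])
qed

lemma tendsto_integral_at_right_0:
  fixes f :: "real \<Rightarrow> 'a::euclidean_space \<Rightarrow> real"
  assumes [measurable]: "\<And>\<delta>. f \<delta> \<in> borel_measurable borel" "g \<in> borel_measurable borel"
    and w: "integrable lborel w"
    and bound: "\<And>\<delta> x. 0 < \<delta> \<Longrightarrow> \<delta> < 1 \<Longrightarrow> \<bar>f \<delta> x\<bar> \<le> w x"
    and lim: "\<And>x. x \<noteq> 0 \<Longrightarrow> ((\<lambda>\<delta>. f \<delta> x) \<longlongrightarrow> g x) (at_right 0)"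
  shows "((\<lambda>\<delta>. LINT x|lborel. f \<delta> x) \<longlongrightarrow> (LINT x|lborel. g x)) (at_right 0)"
proof (rule tendsto_at_right_sequentially[of 0 1])
  fix S :: "nat \<Rightarrow> real" assume S: "\<And>n. 0 < S n" "\<And>n. S n < 1" "decseq S" "S \<longlonglongrightarrow> 0"
  show "(\<lambda>n. LINT x|lborel. f (S n) x) \<longlonglongrightarrow> (LINT x|lborel. g x)"
  proof (rule integral_dominated_convergence[where w = w])
    have "filterlim S (at_right 0) sequentially"
      using S by (intro tendsto_imp_filterlim_at_right) auto
    then have "(\<lambda>n. f (S n) x) \<longlonglongrightarrow> g x" if "x \<noteq> 0" for x
      using lim[OF that] filterlim_compose by blast
    then show "AE x in lborel. (\<lambda>n. f (S n) x) \<longlonglongrightarrow> g x"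
      by (intro eventually_mono[OF AE_lborel_singleton[of "0::'a"]])
  qed (use w S bound in auto)
qed simp

text \<open>Reflection shows that the integral equals its own negative, whether or not
  \<open>f\<close> is integrable. It removes linear terms from principal values.\<close>

lemma integral_odd:
  fixes f :: "'a::euclidean_space \<Rightarrow> real"
  assumes [measurable]: "f \<in> borel_measurable borel" and odd: "\<And>x. f (- x) = - f x"
  shows "(LINT x|lborel. f x) = 0"
proof -
  have "lborel = distr lborel borel (\<lambda>x::'a. - x)"
    using lborel_affine[of "-1" "0::'a"] by (simp add: density_1)
  then have "(LINT x|lborel. f x) = (LINT x|distr lborel borel (\<lambda>x::'a. - x). f x)"
    by simp
  also have "\<dots> = (LINT x|lborel. f (- x))"
    by (subst integral_distr) auto
  also have "\<dots> = - (LINT x|lborel. f x)"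
    by (simp add: odd)
  finally show ?thesis by simp
qed

lemma divide_powr: "x / y powr c = x * y powr (-c)" for x y c :: real
  by (simp add: powr_minus divide_inverse)

section \<open>Fractional Laplacians close to plane waves\<close>

text \<open>What remains of a three-dimensional integral outside a ball once a plane wave has been
  integrated over planes; \<rho> is the cut-off of the flattened kernel.\<close>

definition trunc_int :: "real \<Rightarrow> (real \<Rightarrow> real) \<Rightarrow> real \<Rightarrow> real \<Rightarrow> real" where
  "trunc_int s \<Phi> m \<rho> = (LINT \<tau>|lborel. (\<Phi> m - \<Phi> (m + \<tau>)) * max \<bar>\<tau>\<bar> \<rho> powr (-(1+2 * s)))"

text \<open>The principal value as an absolutely convergent integral. The odd term
  \<open>d * \<tau>\<close>, with d in the role of the derivative of \<Phi> at m, compensates the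
  increment on \<open>{-1..1}\<close> and contributes nothing to a symmetric truncation.\<close>

definition pv_int :: "real \<Rightarrow> (real \<Rightarrow> real) \<Rightarrow> real \<Rightarrow> real \<Rightarrow> real" where
  "pv_int s \<Phi> m d = (LINT \<tau>|lborel. (\<Phi> m - \<Phi> (m + \<tau>) + d * \<tau> * indicator {-1..1} \<tau>) * \<bar>\<tau>\<bar> powr (-(1+2 * s)))"

text \<open>Cutting the kernel off on \<open>{-\<delta>..\<delta>}\<close> and flattening it there
  are two symmetric truncations. Both lose the linear term by oddness, and the rest is dominated by
  one integrable function, so the limits agree. The first truncation defines the one-dimensional
  operator, the second is the one that plane waves produce.\<close>

lemma
  fixes \<Phi> :: "real \<Rightarrow> real"
  assumes s: "0 < s" "s < 1" and [measurable]: "\<Phi> \<in> borel_measurable borel" and B: "\<And>t. \<bar>\<Phi> t\<bar> \<le> B"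
    and C: "\<And>\<tau>. \<bar>\<tau>\<bar> \<le> 1 \<Longrightarrow> \<bar>\<Phi> (m + \<tau>) - \<Phi> m - d * \<tau>\<bar> \<le> C * \<tau>\<^sup>2"
  shows frac_laplacian_pv_int: "frac_laplacian s \<Phi> m = frac_const 1 s * pv_int s \<Phi> m d" (is ?A)
    and trunc_int_tendsto: "(trunc_int s \<Phi> m \<longlongrightarrow> pv_int s \<Phi> m d) (at_right 0)" (is ?B)
proof -
  define H where "H = (\<lambda>\<tau>. \<Phi> m - \<Phi> (m + \<tau>) + d * \<tau> * indicator {-1..1} \<tau>)"
  have [measurable]: "H \<in> borel_measurable borel" unfolding H_def by measurable
  have B0: "B \<ge> 0" using B[of 0] by linarith
  have C0: "C \<ge> 0" using C[of 1] by simp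
  have near: "\<bar>H \<tau>\<bar> \<le> C * \<tau>\<^sup>2" if "\<bar>\<tau>\<bar> \<le> 1" for \<tau>
  proof -
    have "H \<tau> = - (\<Phi> (m + \<tau>) - \<Phi> m - d * \<tau>)" using that by (auto simp: H_def indicator_def)
    then show ?thesis using C[OF that] by (metis abs_minus_cancel)
  qed
  have far: "\<bar>H \<tau>\<bar> \<le> 2 * B" if "\<bar>\<tau>\<bar> > 1" for \<tau>
    using that B[of m] B[of "m + \<tau>"] by (auto simp: H_def indicator_def)
  \<comment> \<open>Quadratic smallness at 0 leaves
    \<open>\<bar>\<tau>\<bar> powr (1 - 2 * s)\<close>, integrable as \<open>s < 1\<close>;
    boundedness at infinity leaves \<open>\<bar>\<tau>\<bar> powr (- 1 - 2 * s)\<close>, integrable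
    as \<open>s > 0\<close>.\<close>
  have int: "integrable lborel (\<lambda>\<tau>. \<bar>H \<tau>\<bar> * \<bar>\<tau>\<bar> powr (-(1+2 * s)))"
  proof (rule integrable_powr_near_far[where a = "1 + 2 * s" and b = "2 * s - 1" and B = "2 * B + C"])
    fix \<tau> :: real assume t: "0 < norm \<tau>" "norm \<tau> \<le> 1"
    have "\<tau>\<^sup>2 * \<bar>\<tau>\<bar> powr (-(1+2 * s)) = \<bar>\<tau>\<bar> powr (-(2 * s - 1))"
    proof -
      have "\<tau>\<^sup>2 = \<bar>\<tau>\<bar> powr 2" using t by simp
      then show ?thesis by (simp only: powr_add[symmetric]) simp
    qed
    moreover have "\<bar>\<bar>H \<tau>\<bar> * \<bar>\<tau>\<bar> powr (-(1+2 * s))\<bar> \<le> C * \<tau>\<^sup>2 * \<bar>\<tau>\<bar> powr (-(1+2 * s))"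
      using near[of \<tau>] t by (simp add: mult_right_mono)
    moreover have "C * \<bar>\<tau>\<bar> powr (-(2 * s - 1)) \<le> (2 * B + C) * \<bar>\<tau>\<bar> powr (-(2 * s - 1))"
      using B0 by (intro mult_right_mono) auto
    ultimately show "\<bar>\<bar>H \<tau>\<bar> * \<bar>\<tau>\<bar> powr (-(1+2 * s))\<bar> \<le> (2 * B + C) * norm \<tau> powr (-(2 * s - 1))"
      by (simp add: mult.assoc)
  next
    fix \<tau> :: real assume t: "norm \<tau> > 1"
    have "\<bar>H \<tau>\<bar> \<le> 2 * B + C" using far[of \<tau>] t C0 by simp
    then show "\<bar>\<bar>H \<tau>\<bar> * \<bar>\<tau>\<bar> powr (-(1+2 * s))\<bar> \<le> (2 * B + C) * norm \<tau> powr (-(1+2 * s))"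
      by (simp add: mult_right_mono)
  qed (use s in auto)
  have kle: "max \<bar>\<tau>\<bar> \<delta> powr (-(1+2 * s)) \<le> \<bar>\<tau>\<bar> powr (-(1+2 * s))" if "\<delta> > 0" "\<tau> \<noteq> 0" for \<tau> \<delta> :: real
    using that s by (intro powr_mono2') auto
  have H0: "H 0 = 0" by (simp add: H_def)
  have *: "((\<lambda>\<delta>. LINT \<tau>|lborel. H \<tau> * max \<bar>\<tau>\<bar> \<delta> powr (-(1+2 * s))) \<longlongrightarrow> (LINT \<tau>|lborel. H \<tau> * \<bar>\<tau>\<bar> powr (-(1+2 * s)))) (at_right 0)"
  proof (rule tendsto_integral_at_right_0[OF _ _ int])
    fix \<delta> \<tau> :: real assume "0 < \<delta>" "\<delta> < 1"
    then show "\<bar>H \<tau> * max \<bar>\<tau>\<bar> \<delta> powr (-(1+2 * s))\<bar> \<le> \<bar>H \<tau>\<bar> * \<bar>\<tau>\<bar> powr (-(1+2 * s))"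
      using kle[of \<delta> \<tau>] H0 by (cases "\<tau> = 0") (auto simp: abs_mult intro!: mult_left_mono)
  next
    fix \<tau> :: real assume "\<tau> \<noteq> 0"
    then have "eventually (\<lambda>\<delta>. \<delta> < \<bar>\<tau>\<bar>) (at_right 0)"
      by (intro eventually_at_rightI[of 0 "\<bar>\<tau>\<bar>"]) auto
    then have "eventually (\<lambda>\<delta>. H \<tau> * max \<bar>\<tau>\<bar> \<delta> powr (-(1+2 * s)) = H \<tau> * \<bar>\<tau>\<bar> powr (-(1+2 * s))) (at_right 0)"
      by eventually_elim (auto simp: max_def)
    then show "((\<lambda>\<delta>. H \<tau> * max \<bar>\<tau>\<bar> \<delta> powr (-(1+2 * s))) \<longlongrightarrow> H \<tau> * \<bar>\<tau>\<bar> powr (-(1+2 * s))) (at_right 0)"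
      by (rule tendsto_eventually)
  qed auto
  have **: "((\<lambda>\<delta>. LINT \<tau>|lborel. H \<tau> * (indicator (- cball 0 \<delta>) \<tau> * \<bar>\<tau>\<bar> powr (-(1+2 * s)))) \<longlongrightarrow> (LINT \<tau>|lborel. H \<tau> * \<bar>\<tau>\<bar> powr (-(1+2 * s)))) (at_right 0)"
  proof (rule tendsto_integral_at_right_0[OF _ _ int])
    fix \<delta> \<tau> :: real
    show "\<bar>H \<tau> * (indicator (- cball 0 \<delta>) \<tau> * \<bar>\<tau>\<bar> powr (-(1+2 * s)))\<bar> \<le> \<bar>H \<tau>\<bar> * \<bar>\<tau>\<bar> powr (-(1+2 * s))"
      by (auto simp: abs_mult indicator_def)
  next
    fix \<tau> :: real assume "\<tau> \<noteq> 0"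
    then have "eventually (\<lambda>\<delta>. \<delta> < \<bar>\<tau>\<bar>) (at_right 0)"
      by (intro eventually_at_rightI[of 0 "\<bar>\<tau>\<bar>"]) auto
    then have "eventually (\<lambda>\<delta>. H \<tau> * (indicator (- cball 0 \<delta>) \<tau> * \<bar>\<tau>\<bar> powr (-(1+2 * s))) = H \<tau> * \<bar>\<tau>\<bar> powr (-(1+2 * s))) (at_right 0)"
      by eventually_elim (auto simp: indicator_def)
    then show "((\<lambda>\<delta>. H \<tau> * (indicator (- cball 0 \<delta>) \<tau> * \<bar>\<tau>\<bar> powr (-(1+2 * s)))) \<longlongrightarrow> H \<tau> * \<bar>\<tau>\<bar> powr (-(1+2 * s))) (at_right 0)"
      by (rule tendsto_eventually)
  qed auto
  have pv: "pv_int s \<Phi> m d = (LINT \<tau>|lborel. H \<tau> * \<bar>\<tau>\<bar> powr (-(1+2 * s)))"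
    by (simp add: pv_int_def H_def)
  have Wint: "integrable lborel (\<lambda>\<tau>. (\<Phi> m - \<Phi> (m + \<tau>)) * max \<bar>\<tau>\<bar> \<delta> powr (-(1+2 * s)))" if "\<delta> > 0" for \<delta>
  proof (rule integrable_max_kernel[where B = "2 * B"])
    show "\<bar>\<Phi> m - \<Phi> (m + \<tau>)\<bar> \<le> 2 * B" for \<tau>
      using B[of m] B[of "m + \<tau>"] by linarith
  qed (use that s in auto)
  have lin_int: "integrable lborel (\<lambda>\<tau>. d * \<tau> * indicator {-1..1} \<tau> * max \<bar>\<tau>\<bar> \<delta> powr (-(1+2 * s)))" if "\<delta> > 0" for \<delta> :: real
  proof (rule integrable_max_kernel[where B = "\<bar>d\<bar>"])
    show "\<bar>d * \<tau> * indicator {-1..1} \<tau>\<bar> \<le> \<bar>d\<bar>" for \<tau> :: real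
      by (auto simp: indicator_def abs_mult intro!: mult_left_le)
  qed (use that s in auto)
  have trunc: "trunc_int s \<Phi> m \<delta> = (LINT \<tau>|lborel. H \<tau> * max \<bar>\<tau>\<bar> \<delta> powr (-(1+2 * s)))" if "\<delta> > 0" for \<delta>
  proof -
    have "(LINT \<tau>|lborel. H \<tau> * max \<bar>\<tau>\<bar> \<delta> powr (-(1+2 * s))) = trunc_int s \<Phi> m \<delta> + (LINT \<tau>|lborel. d * \<tau> * indicator {-1..1} \<tau> * max \<bar>\<tau>\<bar> \<delta> powr (-(1+2 * s)))"
      unfolding trunc_int_def H_def distrib_right[of "_ - _"]
      by (rule Bochner_Integration.integral_add[OF Wint[OF that] lin_int[OF that]])
    also have "(LINT \<tau>|lborel. d * \<tau> * indicator {-1..1} \<tau> * max \<bar>\<tau>\<bar> \<delta> powr (-(1+2 * s))) = 0"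
      by (rule integral_odd) (auto simp: indicator_def)
    finally show ?thesis by simp
  qed
  have "eventually (\<lambda>\<delta>. (LINT \<tau>|lborel. H \<tau> * max \<bar>\<tau>\<bar> \<delta> powr (-(1+2 * s))) = trunc_int s \<Phi> m \<delta>) (at_right 0)"
    by (intro eventually_at_rightI[of 0 1]) (auto simp: trunc)
  from tendsto_cong[OF this] show ?B using * by (simp add: pv)
  have mk: "indicator (- cball 0 \<delta>) \<tau> * \<bar>\<tau>\<bar> powr (-(1+2 * s)) = indicator (- cball 0 \<delta>) \<tau> * max \<bar>\<tau>\<bar> \<delta> powr (-(1+2 * s))" for \<tau> \<delta> :: real
    by (auto simp: indicator_def)
  have I: "(LINT \<xi>:- cball 0 \<delta>|lborel. (\<Phi> m - \<Phi> (m + \<xi>)) / norm \<xi> powr (real DIM(real) + 2 * s))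
     = (LINT \<tau>|lborel. H \<tau> * (indicator (- cball 0 \<delta>) \<tau> * \<bar>\<tau>\<bar> powr (-(1+2 * s))))" if "\<delta> > 0" for \<delta>
  proof -
    have i1: "integrable lborel (\<lambda>\<tau>. (\<Phi> m - \<Phi> (m + \<tau>)) * (indicator (- cball 0 \<delta>) \<tau> * \<bar>\<tau>\<bar> powr (-(1+2 * s))))"
      unfolding mk by (rule Bochner_Integration.integrable_bound[OF Wint[OF that]]) (auto simp: indicator_def)
    have i2: "integrable lborel (\<lambda>\<tau>. d * \<tau> * indicator {-1..1} \<tau> * (indicator (- cball 0 \<delta>) \<tau> * \<bar>\<tau>\<bar> powr (-(1+2 * s))))"
      unfolding mk by (rule Bochner_Integration.integrable_bound[OF lin_int[OF that]]) (auto simp: indicator_def)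
    have "(LINT \<xi>:- cball 0 \<delta>|lborel. (\<Phi> m - \<Phi> (m + \<xi>)) / norm \<xi> powr (real DIM(real) + 2 * s))
       = (LINT \<tau>|lborel. (\<Phi> m - \<Phi> (m + \<tau>)) * (indicator (- cball 0 \<delta>) \<tau> * \<bar>\<tau>\<bar> powr (-(1+2 * s))))"
      unfolding set_lebesgue_integral_def
      by (simp add: divide_powr mult_ac)
    moreover have "(LINT \<tau>|lborel. H \<tau> * (indicator (- cball 0 \<delta>) \<tau> * \<bar>\<tau>\<bar> powr (-(1+2 * s))))
       = (LINT \<tau>|lborel. (\<Phi> m - \<Phi> (m + \<tau>)) * (indicator (- cball 0 \<delta>) \<tau> * \<bar>\<tau>\<bar> powr (-(1+2 * s))))
        + (LINT \<tau>|lborel. d * \<tau> * indicator {-1..1} \<tau> * (indicator (- cball 0 \<delta>) \<tau> * \<bar>\<tau>\<bar> powr (-(1+2 * s))))"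
      unfolding H_def distrib_right[of "_ - _"]
      by (rule Bochner_Integration.integral_add[OF i1 i2])
    moreover have "(LINT \<tau>|lborel. d * \<tau> * indicator {-1..1} \<tau> * (indicator (- cball 0 \<delta>) \<tau> * \<bar>\<tau>\<bar> powr (-(1+2 * s)))) = 0"
      by (rule integral_odd) (auto simp: indicator_def)
    ultimately show ?thesis by simp
  qed
  have "eventually (\<lambda>\<delta>. (LINT \<tau>|lborel. H \<tau> * (indicator (- cball 0 \<delta>) \<tau> * \<bar>\<tau>\<bar> powr (-(1+2 * s))))
     = (LINT \<xi>:- cball 0 \<delta>|lborel. (\<Phi> m - \<Phi> (m + \<xi>)) / norm \<xi> powr (real DIM(real) + 2 * s))) (at_right 0)"
    by (rule eventually_at_rightI[of 0 1], rule I[symmetric]) auto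
  from tendsto_cong[OF this, THEN iffD1, OF **] have
    "((\<lambda>\<delta>. LINT \<xi>:- cball 0 \<delta>|lborel. (\<Phi> m - \<Phi> (m + \<xi>)) / norm \<xi> powr (real DIM(real) + 2 * s)) \<longlongrightarrow> pv_int s \<Phi> m d) (at_right 0)"
    unfolding pv .
  from tendsto_Lim[OF _ this] show ?A
    unfolding frac_laplacian_def by simp
qed

text \<open>
  The factor \<open>2 \<pi> / (1 + 2 s)\<close> is what integrating the three-dimensional kernel over planes yields.
\<close>

lemma frac_const_3_1:
  assumes "0 < s" "s < 1"
  shows "frac_const 3 s * (2*pi/(1+2 * s)) = frac_const 1 s"
proof -
  have G: "Gamma (3/2 + s) = (1/2 + s) * Gamma (1/2 + s)"
  proof -
    have "1/2 + s \<notin> \<int>\<^sub>\<le>\<^sub>0" using nonpos_Ints_nonpos[of "1/2 + s"] assms by auto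
    from Gamma_plus1[OF this] show ?thesis by (simp add: add_ac)
  qed
  have p: "pi powr (3/2) = pi * pi powr (1/2)"
    using powr_add[of pi 1 "1/2"] by simp
  have "frac_const 3 s = 2 powr (2 * s) * s * ((1/2 + s) * Gamma (1/2 + s)) / (Gamma (1 - s) * (pi * pi powr (1/2)))"
    by (simp only: frac_const_def of_nat_numeral G p)
  moreover have "frac_const 1 s = 2 powr (2 * s) * s * Gamma (1/2 + s) / (Gamma (1 - s) * pi powr (1/2))"
    by (simp only: frac_const_def of_nat_1)
  moreover have "X * ((1/2 + s) * g) / (q * (pi * p)) * (2*pi/(1+2 * s)) = X * g / (q * p)" for X g q p :: real
  proof -
    have "(1/2 + s) * (2*pi/(1+2 * s)) = pi" using assms by (simp add: field_simps)
    moreover have "X * (a * g) / Q * Y = X * g / Q * (a * Y)" for a Q Y by simp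
    ultimately have "X * ((1/2 + s) * g) / (q * (pi * p)) * (2*pi/(1+2 * s)) = X * g / (q * (pi * p)) * pi"
      by metis
    then show ?thesis by simp
  qed
  ultimately show ?thesis by metis
qed

lemma integral_abs_max_kernel_mult:
  fixes L s \<rho> :: real
  assumes \<rho>: "\<rho> > 0"
  shows "(LINT \<tau>|lborel. L * (\<bar>\<tau>\<bar> * max \<bar>\<tau>\<bar> \<rho> powr (-(1+2 * s)))) = L * (\<rho> powr (1 - 2 * s) * kernel_moment s)"
  using integral_abs_max_kernel[OF assms, of s] by simp

text \<open>Both estimates integrate the Lipschitz bound against the kernel. For the second, the
  kernels decrease in the cut-off, so their difference has one sign and its first moment is exactly
  a difference of two moments.\<close>

lemma trunc_int_bound:
  fixes s lam m L :: real
  assumes s: "s > 1/2" and lam: "lam > 0"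
    and L: "\<And>\<tau>. \<bar>\<Phi> m - \<Phi> (m + \<tau>)\<bar> \<le> L * \<bar>\<tau>\<bar>" and [measurable]: "\<Phi> \<in> borel_measurable borel"
  shows "\<bar>trunc_int s \<Phi> m lam\<bar> \<le> L * (lam powr (1 - 2 * s) * kernel_moment s)"
    and "\<bar>trunc_int s \<Phi> m lam - trunc_int s \<Phi> m 1\<bar> \<le> L * (\<bar>lam powr (1 - 2 * s) - 1\<bar> * kernel_moment s)"
proof -
  let ?k = "\<lambda>\<rho> \<tau>. max \<bar>\<tau>\<bar> \<rho> powr (-(1+2 * s))"
  have int: "integrable lborel (\<lambda>\<tau>. L * (\<bar>\<tau>\<bar> * ?k \<rho> \<tau>))" if "\<rho> > 0" for \<rho> :: real
    using integrable_abs_max_kernel[OF s that] by simp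
  have intF: "integrable lborel (\<lambda>\<tau>. (\<Phi> m - \<Phi> (m + \<tau>)) * ?k \<rho> \<tau>)" if "\<rho> > 0" for \<rho> :: real
  proof (rule Bochner_Integration.integrable_bound[OF int[OF that]])
    show "AE \<tau> in lborel. norm ((\<Phi> m - \<Phi> (m + \<tau>)) * ?k \<rho> \<tau>) \<le> norm (L * (\<bar>\<tau>\<bar> * ?k \<rho> \<tau>))"
    proof (rule AE_I2)
      fix \<tau>
      have "norm ((\<Phi> m - \<Phi> (m + \<tau>)) * ?k \<rho> \<tau>) \<le> L * \<bar>\<tau>\<bar> * ?k \<rho> \<tau>"
        using L[of \<tau>] by (simp add: abs_mult mult_right_mono)
      then show "norm ((\<Phi> m - \<Phi> (m + \<tau>)) * ?k \<rho> \<tau>) \<le> norm (L * (\<bar>\<tau>\<bar> * ?k \<rho> \<tau>))"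
        by (simp add: mult.assoc)
    qed
  qed simp
  have "\<bar>trunc_int s \<Phi> m lam\<bar> \<le> (LINT \<tau>|lborel. L * (\<bar>\<tau>\<bar> * ?k lam \<tau>))"
    unfolding trunc_int_def
  proof (rule integral_abs_bound_integral[OF intF[OF lam] int[OF lam]])
    show "\<bar>(\<Phi> m - \<Phi> (m + \<tau>)) * ?k lam \<tau>\<bar> \<le> L * (\<bar>\<tau>\<bar> * ?k lam \<tau>)" for \<tau>
      using L[of \<tau>] by (simp add: abs_mult mult_right_mono mult.assoc[symmetric])
  qed
  then show "\<bar>trunc_int s \<Phi> m lam\<bar> \<le> L * (lam powr (1 - 2 * s) * kernel_moment s)"
    using integral_abs_max_kernel[OF lam, of s] by simp
  have scale_diff: "L * (x * k) - L * (y * k) = L * ((x - y) * k)" for x y k by (simp add: algebra_simps)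
  have L0: "L \<ge> 0" using L[of 1] by simp
  have M: "?k \<rho>' \<tau> \<le> ?k \<rho> \<tau>" if "0 < \<rho>" "\<rho> \<le> \<rho>'" for \<rho> \<rho>' \<tau> :: real
    using that s by (intro powr_mono2') auto
  have key: "\<bar>trunc_int s \<Phi> m \<rho> - trunc_int s \<Phi> m \<rho>'\<bar> \<le> L * ((\<rho> powr (1 - 2 * s) - \<rho>' powr (1 - 2 * s)) * kernel_moment s)"
    if r: "0 < \<rho>" "\<rho> \<le> \<rho>'" for \<rho> \<rho>'
  proof -
    have r': "0 < \<rho>'" using r by simp
    have eq: "trunc_int s \<Phi> m \<rho> - trunc_int s \<Phi> m \<rho>' = (LINT \<tau>|lborel. (\<Phi> m - \<Phi> (m + \<tau>)) * ?k \<rho> \<tau> - (\<Phi> m - \<Phi> (m + \<tau>)) * ?k \<rho>' \<tau>)"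
      unfolding trunc_int_def using intF[OF r(1)] intF[OF r'] by simp
    have le: "\<bar>trunc_int s \<Phi> m \<rho> - trunc_int s \<Phi> m \<rho>'\<bar> \<le> (LINT \<tau>|lborel. L * (\<bar>\<tau>\<bar> * ?k \<rho> \<tau>) - L * (\<bar>\<tau>\<bar> * ?k \<rho>' \<tau>))"
    unfolding eq proof (rule integral_abs_bound_integral[OF Bochner_Integration.integrable_diff[OF intF[OF r(1)] intF[OF r']]
          Bochner_Integration.integrable_diff[OF int[OF r(1)] int[OF r']]])
      fix \<tau>
      have "\<bar>(\<Phi> m - \<Phi> (m + \<tau>)) * (?k \<rho> \<tau> - ?k \<rho>' \<tau>)\<bar> \<le> L * \<bar>\<tau>\<bar> * (?k \<rho> \<tau> - ?k \<rho>' \<tau>)"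
        using L[of \<tau>] M[OF r, of \<tau>] by (simp add: abs_mult mult_right_mono)
      then show "\<bar>(\<Phi> m - \<Phi> (m + \<tau>)) * ?k \<rho> \<tau> - (\<Phi> m - \<Phi> (m + \<tau>)) * ?k \<rho>' \<tau>\<bar> \<le> L * (\<bar>\<tau>\<bar> * ?k \<rho> \<tau>) - L * (\<bar>\<tau>\<bar> * ?k \<rho>' \<tau>)"
        by (simp only: right_diff_distrib mult.assoc)
    qed
    also have "(LINT \<tau>|lborel. L * (\<bar>\<tau>\<bar> * ?k \<rho> \<tau>) - L * (\<bar>\<tau>\<bar> * ?k \<rho>' \<tau>)) = L * ((\<rho> powr (1 - 2 * s) - \<rho>' powr (1 - 2 * s)) * kernel_moment s)"
      unfolding Bochner_Integration.integral_diff[OF int[OF r(1)] int[OF r']]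
        integral_abs_max_kernel_mult[OF r(1)] integral_abs_max_kernel_mult[OF r']
      by (rule scale_diff)
    finally show ?thesis .
  qed
  show "\<bar>trunc_int s \<Phi> m lam - trunc_int s \<Phi> m 1\<bar> \<le> L * (\<bar>lam powr (1 - 2 * s) - 1\<bar> * kernel_moment s)"
  proof (cases "lam \<le> 1")
    case True
    have "L * ((lam powr (1 - 2 * s) - 1) * kernel_moment s) \<le> L * (\<bar>lam powr (1 - 2 * s) - 1\<bar> * kernel_moment s)"
      using L0 kernel_moment_nonneg by (intro mult_left_mono mult_right_mono) auto
    then show ?thesis using key[OF lam True] by simp
  next
    case False
    have "L * ((1 - lam powr (1 - 2 * s)) * kernel_moment s) \<le> L * (\<bar>lam powr (1 - 2 * s) - 1\<bar> * kernel_moment s)"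
      using L0 kernel_moment_nonneg by (intro mult_left_mono mult_right_mono) auto
    then show ?thesis using key[of 1 lam] False by (simp add: abs_minus_commute)
  qed
qed

text \<open>The masses of the two admissible errors, \<open>(norm \<xi>)\<^sup>2\<close> in the unit
  ball and \<open>norm \<xi> powr p\<close> outside, against the kernel
  \<open>norm \<xi> powr (- (3 + 2 * s))\<close>.\<close>

definition error_const :: "real \<Rightarrow> real \<Rightarrow> real" where
  "error_const s p = (LINT \<xi>|lborel. indicator (cball 0 1) \<xi> * norm (\<xi>::real^3) powr (-(1+2 * s)))
     + (LINT \<xi>|lborel. indicator {\<xi>. norm \<xi> > 1} \<xi> * norm (\<xi>::real^3) powr (-(3+2 * s-p)))"

text \<open>
  \<open>A\<close> is the gradient of the argument of the profile, which is needed for the quadratic bound near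
  the origin, while far away the unit normal \<open>n\<close> is the better approximation. The vector \<open>b\<close> is
  invisible to the principal value.
\<close>

lemma frac_laplacian_comparison:
  fixes V :: "real^3 \<Rightarrow> real" and \<Phi> :: "real \<Rightarrow> real" and x A b n :: "real^3" and s p m d B BV C M D R :: real
  assumes s: "0 < s" "s < 1" and \<Phi>m [measurable]: "\<Phi> \<in> borel_measurable borel" and B: "\<And>t. \<bar>\<Phi> t\<bar> \<le> B"
    and C: "\<And>\<tau>. \<bar>\<tau>\<bar> \<le> 1 \<Longrightarrow> \<bar>\<Phi> (m + \<tau>) - \<Phi> m - d * \<tau>\<bar> \<le> C * \<tau>\<^sup>2"
    and n: "norm n = 1" and A: "A \<noteq> 0"
    and Vm [measurable]: "V \<in> borel_measurable borel" and p: "p < 2 * s" and R: "R > 0" and D: "D \<ge> 0"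
    and near: "\<And>\<xi>. norm \<xi> \<le> 1 \<Longrightarrow> \<bar>V (x + \<xi>) - V x - (\<Phi> (m + A \<bullet> \<xi>) - \<Phi> m) - b \<bullet> \<xi>\<bar> \<le> M * (norm \<xi>)\<^sup>2"
    and far: "\<And>\<xi>. norm \<xi> > 1 \<Longrightarrow> \<bar>V (x + \<xi>) - V x - (\<Phi> (m + n \<bullet> \<xi>) - \<Phi> m)\<bar> \<le> M * norm \<xi> powr p + (if norm \<xi> > R then D else 0)"
  shows "\<bar>frac_laplacian s V x - frac_const 1 s * (norm A powr (2 * s) * (pv_int s \<Phi> m d - trunc_int s \<Phi> m (norm A)) + trunc_int s \<Phi> m 1)\<bar>
     \<le> \<bar>frac_const 3 s\<bar> * (M * error_const s p + D * (2 * pi / s * R powr (- 2 * s)))"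
proof -
  define k where "k = (\<lambda>\<delta> (\<xi>::real^3). indicator {\<xi>. norm \<xi> > \<delta>} \<xi> * norm \<xi> powr (-(3+2 * s)) :: real)"
  define c where "c = 2*pi/(1+2 * s)"
  define L where "L = norm A"
  have L: "L > 0" using A by (simp add: L_def)
  define FA where "FA = (\<lambda>\<xi>. \<Phi> m - \<Phi> (m + A \<bullet> \<xi>))"
  define Fn where "Fn = (\<lambda>\<xi>. \<Phi> m - \<Phi> (m + n \<bullet> \<xi>))"
  \<comment> \<open>The error left by comparing with slope A (corrected by b) inside the unit ball
    and with the unit slope n outside.\<close>
  define e where "e = (\<lambda>\<xi>. V x - V (x + \<xi>) - (if norm \<xi> \<le> 1 then FA \<xi> - b \<bullet> \<xi> else Fn \<xi>))"
  define w where "w = (\<lambda>\<xi>::real^3. M * (indicator (cball 0 1) \<xi> * norm \<xi> powr (-(1+2 * s)))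
     + M * (indicator {\<xi>. norm \<xi> > 1} \<xi> * norm \<xi> powr (-(3+2 * s-p)))
     + D * (indicator {\<xi>. norm \<xi> > R} \<xi> * norm \<xi> powr (-(3+2 * s))))"
  have km [measurable]: "k \<delta> \<in> borel_measurable borel" for \<delta> unfolding k_def by measurable
  have FAm [measurable]: "FA \<in> borel_measurable borel" unfolding FA_def by measurable
  have Fnm [measurable]: "Fn \<in> borel_measurable borel" unfolding Fn_def by measurable
  have em [measurable]: "e \<in> borel_measurable borel" unfolding e_def by measurable
  have FAb: "\<bar>FA \<xi>\<bar> \<le> 2 * B" for \<xi> unfolding FA_def using B[of m] B[of "m + A \<bullet> \<xi>"] by linarith
  have Fnb: "\<bar>Fn \<xi>\<bar> \<le> 2 * B" for \<xi> unfolding Fn_def using B[of m] B[of "m + n \<bullet> \<xi>"] by linarith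
  have kint: "integrable lborel (k \<delta>)" if "\<delta> > 0" for \<delta>
    unfolding k_def using s that by (intro integrable_norm_powr_far) auto
  have bk: "integrable lborel (\<lambda>\<xi>. f \<xi> * k \<delta> \<xi>)" if "\<delta> > 0" and [measurable]: "f \<in> borel_measurable borel" and f: "\<And>\<xi>. \<bar>f \<xi>\<bar> \<le> Q" for f Q \<delta>
  proof (rule Bochner_Integration.integrable_bound)
    show "integrable lborel (\<lambda>\<xi>. Q * k \<delta> \<xi>)" using kint[OF that(1)] by simp
    show "AE \<xi> in lborel. norm (f \<xi> * k \<delta> \<xi>) \<le> norm (Q * k \<delta> \<xi>)"
    proof (rule AE_I2)
      fix \<xi>
      have "\<bar>f \<xi>\<bar> \<le> \<bar>Q\<bar>" using f[of \<xi>] by linarith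
      then show "norm (f \<xi> * k \<delta> \<xi>) \<le> norm (Q * k \<delta> \<xi>)" by (simp add: abs_mult mult_right_mono)
    qed
  qed simp
  have wint: "integrable lborel w"
    unfolding w_def using s p R
    by (intro Bochner_Integration.integrable_add Bochner_Integration.integrable_mult_right integrable_norm_powr_near integrable_norm_powr_far) auto
  have ew: "\<bar>e \<xi> * norm \<xi> powr (-(3+2 * s))\<bar> \<le> w \<xi>" if "\<xi> \<noteq> 0" for \<xi>
  proof (cases "norm \<xi> \<le> 1")
    case True
    have "e \<xi> = - (V (x + \<xi>) - V x - (\<Phi> (m + A \<bullet> \<xi>) - \<Phi> m) - b \<bullet> \<xi>)"
      using True by (simp add: e_def FA_def)
    then have "\<bar>e \<xi>\<bar> \<le> M * (norm \<xi>)\<^sup>2" using near[OF True] by (metis abs_minus_cancel)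
    then have "\<bar>e \<xi> * norm \<xi> powr (-(3+2 * s))\<bar> \<le> M * ((norm \<xi>)\<^sup>2 * norm \<xi> powr (-(3+2 * s)))"
      by (simp add: abs_mult mult_right_mono flip: mult.assoc)
    also have "(norm \<xi>)\<^sup>2 * norm \<xi> powr (-(3+2 * s)) = norm \<xi> powr (-(1+2 * s))"
    proof -
      have "(norm \<xi>)\<^sup>2 = norm \<xi> powr 2" using that by simp
      then show ?thesis by (simp only: powr_add[symmetric]) simp
    qed
    finally have *: "\<bar>e \<xi> * norm \<xi> powr (-(3+2 * s))\<bar> \<le> M * norm \<xi> powr (-(1+2 * s))" .
    moreover have "D * norm \<xi> powr (-(3+2 * s)) \<ge> 0" using D by simp
    ultimately show ?thesis
      using True by (simp add: w_def indicator_def)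
  next
    case False
    have "e \<xi> = - (V (x + \<xi>) - V x - (\<Phi> (m + n \<bullet> \<xi>) - \<Phi> m))"
      using False by (simp add: e_def Fn_def)
    then have "\<bar>e \<xi>\<bar> \<le> M * norm \<xi> powr p + (if norm \<xi> > R then D else 0)" using far[of \<xi>] False by simp
    then have "\<bar>e \<xi> * norm \<xi> powr (-(3+2 * s))\<bar> \<le> (M * norm \<xi> powr p + (if norm \<xi> > R then D else 0)) * norm \<xi> powr (-(3+2 * s))"
      by (simp only: abs_mult abs_of_nonneg[OF powr_ge_zero] mult_right_mono powr_ge_zero)
    also have "\<dots> = M * norm \<xi> powr (-(3+2 * s-p)) + (if norm \<xi> > R then D else 0) * norm \<xi> powr (-(3+2 * s))"
    proof -
      have "norm \<xi> powr p * norm \<xi> powr (-(3+2 * s)) = norm \<xi> powr (-(3+2 * s-p))"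
        by (simp add: powr_add[symmetric] algebra_simps)
      then show ?thesis by (simp only: distrib_right mult.assoc)
    qed
    also have "\<dots> = w \<xi>" using False by (simp add: w_def)
    finally show ?thesis .
  qed
  have ewk: "\<bar>e \<xi> * k \<delta> \<xi>\<bar> \<le> \<bar>w \<xi>\<bar>" for \<xi> \<delta>
  proof (cases "\<xi> \<noteq> 0 \<and> norm \<xi> > \<delta>")
    case True
    then have "k \<delta> \<xi> = norm \<xi> powr (-(3+2 * s))" by (simp add: k_def)
    then show ?thesis using ew[of \<xi>] True by (metis abs_ge_self order_trans)
  next
    case False
    then have "k \<delta> \<xi> = 0" by (auto simp: k_def)
    then show ?thesis by simp
  qed
  have ekint: "integrable lborel (\<lambda>\<xi>. e \<xi> * k \<delta> \<xi>)" for \<delta>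
    by (rule Bochner_Integration.integrable_bound[OF wint]) (use ewk in auto)
  \<comment> \<open>The slope A has length L: normalising it and rescaling the profile variable
    costs the factor \<open>L powr (2 * s)\<close> and turns the cut-off \<delta> into
    \<open>L * \<delta>\<close>.\<close>
  have plane: "(LINT \<xi>|lborel. FA \<xi> * k \<delta> \<xi>) = c * (L powr (2 * s) * trunc_int s \<Phi> m (L * \<delta>))" if "\<delta> > 0" for \<delta>
  proof -
    let ?n = "A /\<^sub>R L"
    have nn: "norm ?n = 1" using L by (simp add: L_def)
    have e: "A \<bullet> \<xi> = L * (?n \<bullet> \<xi>)" for \<xi> using L by (simp add: inner_scaleR_left)
    have s': "- 1/2 < s" using s by simp
    have Fm: "(\<lambda>t. \<Phi> m - \<Phi> (m + L * t)) \<in> borel_measurable borel" by measurable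
    have 1: "(LINT \<xi>|lborel. FA \<xi> * k \<delta> \<xi>) = c * (LINT \<tau>|lborel. (\<Phi> m - \<Phi> (m + L * \<tau>)) * max \<bar>\<tau>\<bar> \<delta> powr (-(1+2 * s)))"
      unfolding c_def FA_def k_def e by (rule integral_plane_wave[OF nn s' that Fm])
    show ?thesis
      unfolding 1 trunc_int_def integral_max_kernel_scale[OF L that, where F = "\<lambda>t. \<Phi> m - \<Phi> (m + t)"] ..
  qed
  have plane_n: "(LINT \<xi>|lborel. Fn \<xi> * k 1 \<xi>) = c * trunc_int s \<Phi> m 1"
  proof -
    have s': "- 1/2 < s" using s by simp
    have Fm: "(\<lambda>t. \<Phi> m - \<Phi> (m + t)) \<in> borel_measurable borel" by measurable
    show ?thesis
      unfolding c_def Fn_def k_def trunc_int_def by (rule integral_plane_wave[OF n s' zero_less_one Fm])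
  qed
  define bl where "bl = (\<lambda>\<xi>. b \<bullet> \<xi> * indicator {\<xi>. norm \<xi> \<le> 1} \<xi>)"
  have blm [measurable]: "bl \<in> borel_measurable borel" unfolding bl_def by measurable
  have blb: "\<bar>bl \<xi>\<bar> \<le> norm b" for \<xi>
  proof -
    have "\<bar>b \<bullet> \<xi>\<bar> \<le> norm b" if "norm \<xi> \<le> 1"
      using Cauchy_Schwarz_ineq2[of b \<xi>] mult_left_le[OF that, of "norm b"] by simp
    then show ?thesis by (auto simp: bl_def indicator_def)
  qed
  have blk: "(LINT \<xi>|lborel. bl \<xi> * k \<delta> \<xi>) = 0" for \<delta>
  proof (rule integral_odd)
    show "(\<lambda>\<xi>. bl \<xi> * k \<delta> \<xi>) \<in> borel_measurable borel" by measurable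
    show "bl (-\<xi>) * k \<delta> (-\<xi>) = - (bl \<xi> * k \<delta> \<xi>)" for \<xi>
      by (simp add: bl_def k_def indicator_def)
  qed
  \<comment> \<open>The wave of slope A is needed only in the annulus between \<delta> and 1. It is
    written as a difference of integrals outside the balls of radius \<delta> and 1, since only such
    integrals reduce to dimension one.\<close>
  have decomp: "(V x - V (x + \<xi>)) * k \<delta> \<xi> = FA \<xi> * k \<delta> \<xi> - FA \<xi> * k 1 \<xi> + Fn \<xi> * k 1 \<xi> - bl \<xi> * k \<delta> \<xi> + e \<xi> * k \<delta> \<xi>"
    if "\<delta> < 1" for \<xi> \<delta>
  proof (cases "norm \<xi> \<le> 1")
    case True
    then have eqs: "k 1 \<xi> = 0" "bl \<xi> = b \<bullet> \<xi>" "V x - V (x + \<xi>) = FA \<xi> - b \<bullet> \<xi> + e \<xi>" by (auto simp: k_def bl_def e_def)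
    show ?thesis unfolding eqs by (simp add: left_diff_distrib distrib_right)
  next
    case False
    then have eqs: "k 1 \<xi> = k \<delta> \<xi>" "bl \<xi> = 0" "V x - V (x + \<xi>) = Fn \<xi> + e \<xi>" using that by (auto simp: k_def bl_def e_def)
    show ?thesis unfolding eqs by (simp add: left_diff_distrib distrib_right)
  qed
  have I: "(LINT \<xi>:- cball 0 \<delta>|lborel. (V x - V (x + \<xi>)) / norm \<xi> powr (real DIM(real^3) + 2 * s))
     = c * (L powr (2 * s) * trunc_int s \<Phi> m (L * \<delta>)) - c * (L powr (2 * s) * trunc_int s \<Phi> m L) + c * trunc_int s \<Phi> m 1 + (LINT \<xi>|lborel. e \<xi> * k \<delta> \<xi>)"
    if \<delta>: "0 < \<delta>" "\<delta> < 1" for \<delta>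
  proof -
    have ind: "indicator (- cball 0 \<delta>) \<xi> = (indicator {\<xi>. norm \<xi> > \<delta>} \<xi> :: real)" for \<xi> :: "real^3"
      by (auto simp: indicator_def)
    have "(LINT \<xi>:- cball 0 \<delta>|lborel. (V x - V (x + \<xi>)) / norm \<xi> powr (real DIM(real^3) + 2 * s)) = (LINT \<xi>|lborel. (V x - V (x + \<xi>)) * k \<delta> \<xi>)"
      unfolding set_lebesgue_integral_def by (simp add: divide_powr k_def ind mult_ac)
    also have "\<dots> = (LINT \<xi>|lborel. FA \<xi> * k \<delta> \<xi> - FA \<xi> * k 1 \<xi> + Fn \<xi> * k 1 \<xi> - bl \<xi> * k \<delta> \<xi> + e \<xi> * k \<delta> \<xi>)"
      using decomp[OF \<delta>(2)] by simp
    also have "\<dots> = (LINT \<xi>|lborel. FA \<xi> * k \<delta> \<xi>) - (LINT \<xi>|lborel. FA \<xi> * k 1 \<xi>) + (LINT \<xi>|lborel. Fn \<xi> * k 1 \<xi>) - (LINT \<xi>|lborel. bl \<xi> * k \<delta> \<xi>) + (LINT \<xi>|lborel. e \<xi> * k \<delta> \<xi>)"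
      using bk[OF \<delta>(1) FAm FAb] bk[OF zero_less_one FAm FAb] bk[OF zero_less_one Fnm Fnb] bk[OF \<delta>(1) blm blb] ekint[of \<delta>]
      by simp
    also have "\<dots> = c * (L powr (2 * s) * trunc_int s \<Phi> m (L * \<delta>)) - c * (L powr (2 * s) * trunc_int s \<Phi> m L) + c * trunc_int s \<Phi> m 1 + (LINT \<xi>|lborel. e \<xi> * k \<delta> \<xi>)"
      using plane[OF \<delta>(1)] plane[of 1] plane_n blk by simp
    finally show ?thesis .
  qed
  define E where "E = (LINT \<xi>|lborel. e \<xi> * norm \<xi> powr (-(3+2 * s)))"
  have limE: "((\<lambda>\<delta>. LINT \<xi>|lborel. e \<xi> * k \<delta> \<xi>) \<longlongrightarrow> E) (at_right 0)"
    unfolding E_def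
  proof (rule tendsto_integral_at_right_0)
    show "integrable lborel (\<lambda>\<xi>. \<bar>w \<xi>\<bar>)" using wint by simp
    show "\<bar>e \<xi> * k \<delta> \<xi>\<bar> \<le> \<bar>w \<xi>\<bar>" for \<xi> \<delta> by (rule ewk)
    fix \<xi> :: "real^3" assume "\<xi> \<noteq> 0"
    then have "eventually (\<lambda>\<delta>. \<delta> < norm \<xi>) (at_right 0)"
      by (intro eventually_at_rightI[of 0 "norm \<xi>"]) auto
    then have "eventually (\<lambda>\<delta>. e \<xi> * k \<delta> \<xi> = e \<xi> * norm \<xi> powr (-(3+2 * s))) (at_right 0)"
      by eventually_elim (auto simp: k_def)
    then show "((\<lambda>\<delta>. e \<xi> * k \<delta> \<xi>) \<longlongrightarrow> e \<xi> * norm \<xi> powr (-(3+2 * s))) (at_right 0)"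
      by (rule tendsto_eventually)
  qed auto
  have limT: "((\<lambda>\<delta>. trunc_int s \<Phi> m (L * \<delta>)) \<longlongrightarrow> pv_int s \<Phi> m d) (at_right 0)"
  proof (rule filterlim_compose[OF trunc_int_tendsto[OF s \<Phi>m B C]])
    have "((\<lambda>\<delta>. L * \<delta>) \<longlongrightarrow> L * 0) (at_right 0)" by (intro tendsto_intros)
    then show "filterlim (\<lambda>\<delta>. L * \<delta>) (at_right 0) (at_right 0)"
      using L by (intro tendsto_imp_filterlim_at_right) (auto simp: eventually_at_right_less intro: eventually_at_rightI[of 0 1])
  qed auto
  have "((\<lambda>\<delta>. c * (L powr (2 * s) * trunc_int s \<Phi> m (L * \<delta>)) - c * (L powr (2 * s) * trunc_int s \<Phi> m L) + c * trunc_int s \<Phi> m 1 + (LINT \<xi>|lborel. e \<xi> * k \<delta> \<xi>))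
      \<longlongrightarrow> c * (L powr (2 * s) * pv_int s \<Phi> m d) - c * (L powr (2 * s) * trunc_int s \<Phi> m L) + c * trunc_int s \<Phi> m 1 + E) (at_right 0)"
    by (intro tendsto_intros limE limT)
  moreover have "eventually (\<lambda>\<delta>. c * (L powr (2 * s) * trunc_int s \<Phi> m (L * \<delta>)) - c * (L powr (2 * s) * trunc_int s \<Phi> m L) + c * trunc_int s \<Phi> m 1 + (LINT \<xi>|lborel. e \<xi> * k \<delta> \<xi>)
     = (LINT \<xi>:- cball 0 \<delta>|lborel. (V x - V (x + \<xi>)) / norm \<xi> powr (real DIM(real^3) + 2 * s))) (at_right 0)"
    by (rule eventually_at_rightI[of 0 1], rule I[symmetric]) auto
  ultimately have "((\<lambda>\<delta>. LINT \<xi>:- cball 0 \<delta>|lborel. (V x - V (x + \<xi>)) / norm \<xi> powr (real DIM(real^3) + 2 * s))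
      \<longlongrightarrow> c * (L powr (2 * s) * pv_int s \<Phi> m d) - c * (L powr (2 * s) * trunc_int s \<Phi> m L) + c * trunc_int s \<Phi> m 1 + E) (at_right 0)"
    by (rule Lim_transform_eventually)
  from tendsto_Lim[OF _ this] have "frac_laplacian s V x = frac_const 3 s * (c * (L powr (2 * s) * pv_int s \<Phi> m d) - c * (L powr (2 * s) * trunc_int s \<Phi> m L) + c * trunc_int s \<Phi> m 1 + E)"
    unfolding frac_laplacian_def by simp
  also have "\<dots> = (frac_const 3 s * c) * (L powr (2 * s) * (pv_int s \<Phi> m d - trunc_int s \<Phi> m L) + trunc_int s \<Phi> m 1) + frac_const 3 s * E"
    by (simp add: algebra_simps)
  also have "frac_const 3 s * c = frac_const 1 s" unfolding c_def by (rule frac_const_3_1[OF s])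
  finally have eq: "frac_laplacian s V x - frac_const 1 s * (L powr (2 * s) * (pv_int s \<Phi> m d - trunc_int s \<Phi> m L) + trunc_int s \<Phi> m 1) = frac_const 3 s * E"
    by simp
  have far3: "(LINT \<xi>|lborel. indicator {\<xi>. norm \<xi> > R} \<xi> * norm (\<xi>::real^3) powr (-(3+2 * s))) = 2 * pi / s * R powr (- 2 * s)"
    using integral_norm_powr_far[where 'a = "real^3", of "3 + 2 * s" R] s R by (simp add: unit_ball_vol_3)
  have "\<bar>E\<bar> \<le> (LINT \<xi>|lborel. w \<xi>)"
    unfolding E_def
  proof (rule order_trans[OF integral_abs_bound integral_mono_AE'[OF wint]])
    show "AE \<xi> in lborel. \<bar>e \<xi> * norm \<xi> powr (-(3+2 * s))\<bar> \<le> w \<xi>"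
      by (rule eventually_mono[OF AE_lborel_singleton[of "0::real^3"] ew])
    then show "AE \<xi> in lborel. 0 \<le> w \<xi>" by eventually_elim linarith
  qed
  also have "(LINT \<xi>|lborel. w \<xi>) = M * error_const s p + D * (2 * pi / s * R powr (- 2 * s))"
  proof -
    have i: "integrable lborel (\<lambda>\<xi>::real^3. indicator (cball 0 1) \<xi> * norm \<xi> powr (-(1+2 * s)))"
      "integrable lborel (\<lambda>\<xi>::real^3. indicator {\<xi>. norm \<xi> > 1} \<xi> * norm \<xi> powr (-(3+2 * s-p)))"
      "integrable lborel (\<lambda>\<xi>::real^3. indicator {\<xi>. norm \<xi> > R} \<xi> * norm \<xi> powr (-(3+2 * s)))"
      using s p R by (intro integrable_norm_powr_near integrable_norm_powr_far; simp)+
    show ?thesis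
      unfolding w_def error_const_def far3[symmetric] using i by (simp add: distrib_left)
  qed
  finally have "\<bar>E\<bar> \<le> M * error_const s p + D * (2 * pi / s * R powr (- 2 * s))" .
  then show ?thesis
    unfolding eq[unfolded L_def] by (simp add: abs_mult mult_left_mono)
qed


text \<open>Here L is the slope and a the modulus of the profile variable. Since L may deviate from
  1 by a multiple of \<open>1 + a\<close>, \<open>L powr (2 * s)\<close> may grow like
  \<open>(1 + a) powr (2 * s)\<close>; the weight in the first bound, the decay rate of the
  fractional Laplacian of the profile, compensates this. The second bound uses that slopes stay
  above \<open>lam0\<close>, the third that
  \<open>L powr (2 * s) * L powr (1 - 2 * s) = L\<close>.\<close>

lemma powr_rescale_bounds:
  fixes s lam0 L P P0 a :: real
  assumes s: "1/2 < s" "s < 1" and lam0: "0 < lam0" "lam0 \<le> 1" "lam0 \<le> L" and a: "a \<ge> 0" and P: "P \<le> P0" and P0: "P0 \<ge> 0"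
    and L1: "\<bar>L - 1\<bar> \<le> P * (1 + a)"
  shows "\<bar>L powr (2 * s) - 1\<bar> * (1 + a) powr (- 2 * s) \<le> 2 * (1 + P0) * P" (is ?A)
    and "\<bar>L powr (1 - 2 * s) - 1\<bar> \<le> lam0 powr (- 2 * s) * \<bar>L - 1\<bar>" (is ?B)
    and "\<bar>L powr (2 * s) - 1\<bar> * L powr (1 - 2 * s) \<le> \<bar>L - 1\<bar> + \<bar>L powr (1 - 2 * s) - 1\<bar>" (is ?C)
proof -
  have L: "L > 0" using lam0 by linarith
  have P': "P \<ge> 0" using L1 a mult_neg_pos[of P "1 + a"] by linarith
  show ?B
  proof -
    have "norm (L powr (1 - 2 * s) - 1 powr (1 - 2 * s)) \<le> lam0 powr (- 2 * s) * norm (L - 1)"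
    proof (rule field_differentiable_bound[of "{lam0..}"])
      show "((\<lambda>x. x powr (1 - 2 * s)) has_field_derivative (1 - 2 * s) * z powr (- 2 * s)) (at z within {lam0..})"
        if "z \<in> {lam0..}" for z
        using that lam0 by (auto intro!: derivative_eq_intros)
      show "norm ((1 - 2 * s) * z powr (- 2 * s)) \<le> lam0 powr (- 2 * s)" if "z \<in> {lam0..}" for z
      proof -
        have "z powr (- 2 * s) \<le> lam0 powr (- 2 * s)"
          using that lam0 s by (intro powr_mono2') auto
        moreover have "\<bar>1 - 2 * s\<bar> * z powr (- 2 * s) \<le> 1 * z powr (- 2 * s)"
          using s by (intro mult_right_mono) auto
        ultimately show ?thesis by (simp add: abs_mult)
      qed
    qed (use lam0 in auto)
    then show ?thesis by simp
  qed
  show ?C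
  proof -
    have "L powr (2 * s) * L powr (1 - 2 * s) = L"
      using L by (simp add: powr_add[symmetric])
    then have "(L powr (2 * s) - 1) * L powr (1 - 2 * s) = (L - 1) - (L powr (1 - 2 * s) - 1)"
      by (simp add: left_diff_distrib)
    then have "\<bar>L powr (2 * s) - 1\<bar> * L powr (1 - 2 * s) = \<bar>(L - 1) - (L powr (1 - 2 * s) - 1)\<bar>"
      by (metis abs_mult abs_of_nonneg powr_ge_zero)
    then show ?thesis by linarith
  qed
  show ?A
  proof -
    \<comment> \<open>An upper bound for L in product form, so that its power separates into a
      constant and a power of \<open>1 + a\<close>.\<close>
    define U where "U = (1 + P0) * (1 + a)"
    have PU: "1 + P * (1 + a) \<le> U"
      using a P mult_right_mono[OF P, of "1 + a"] by (simp add: U_def algebra_simps)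
    have U1: "1 \<le> U" using PU mult_nonneg_nonneg[OF P', of "1 + a"] a by linarith
    have LU: "L \<le> U" using PU L1 by linarith
    have "norm (L powr (2 * s) - 1 powr (2 * s)) \<le> 2 * U powr (2 * s - 1) * norm (L - 1)"
    proof (rule field_differentiable_bound[of "{lam0..U}"])
      show "((\<lambda>x. x powr (2 * s)) has_field_derivative (2 * s) * z powr (2 * s - 1)) (at z within {lam0..U})"
        if "z \<in> {lam0..U}" for z
        using that lam0 by (auto intro!: derivative_eq_intros)
      show "norm ((2 * s) * z powr (2 * s - 1)) \<le> 2 * U powr (2 * s - 1)" if "z \<in> {lam0..U}" for z
      proof -
        have "z powr (2 * s - 1) \<le> U powr (2 * s - 1)"
          using that lam0 s by (intro powr_mono2) auto
        then have "(2 * s) * z powr (2 * s - 1) \<le> 2 * U powr (2 * s - 1)"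
          using s by (intro mult_mono) auto
        then show ?thesis using s by (simp add: abs_mult)
      qed
    qed (use lam0 LU U1 in auto)
    also have "\<dots> \<le> 2 * ((1 + P0) * (1 + a) powr (2 * s - 1)) * (P * (1 + a))"
    proof -
      have "U powr (2 * s - 1) = (1 + P0) powr (2 * s - 1) * (1 + a) powr (2 * s - 1)"
        using a P0 by (simp add: U_def powr_mult)
      also have "\<dots> \<le> (1 + P0) powr 1 * (1 + a) powr (2 * s - 1)"
        using P0 s by (intro mult_right_mono powr_mono) auto
      finally have "U powr (2 * s - 1) \<le> (1 + P0) * (1 + a) powr (2 * s - 1)" using P0 by simp
      then show ?thesis using L1 P0 by (intro mult_mono) auto
    qed
    finally have "\<bar>L powr (2 * s) - 1\<bar> \<le> 2 * ((1 + P0) * (1 + a) powr (2 * s - 1)) * (P * (1 + a))" by simp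
    then have "\<bar>L powr (2 * s) - 1\<bar> * (1 + a) powr (- 2 * s) \<le> 2 * ((1 + P0) * (1 + a) powr (2 * s - 1)) * (P * (1 + a)) * (1 + a) powr (- 2 * s)"
      by (rule mult_right_mono) simp
    also have "\<dots> = 2 * (1 + P0) * P * (((1 + a) powr (2 * s - 1) * (1 + a)) * (1 + a) powr (- 2 * s))"
      by simp
    also have "(1 + a) powr (2 * s - 1) * (1 + a) = (1 + a) powr (2 * s)"
      using a powr_add[of "1 + a" "2 * s - 1" 1] by simp
    also have "(1 + a) powr (2 * s) * (1 + a) powr (- 2 * s) = 1"
      using a by (simp add: powr_add[symmetric])
    finally show ?thesis by simp
  qed
qed

text \<open>The comparison made uniform: \<open>CC\<close> does not depend on V, on the point or on
  the profile variable m. The weights in \<open>K1\<close> and \<open>K2\<close> pay for slopes that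
  deviate from 1 proportionally to \<open>1 + \<bar>m\<bar>\<close>.\<close>

lemma frac_laplacian_close:
  fixes \<Phi> :: "real \<Rightarrow> real" and s p B K1 K2 lam0 P0 :: real
  assumes s: "1/2 < s" "s < 1" and \<Phi>m: "\<Phi> \<in> borel_measurable borel" and B: "\<And>t. \<bar>\<Phi> t\<bar> \<le> B"
    and C2: "\<And>m. \<exists>d C. \<forall>\<tau>. \<bar>\<tau>\<bar> \<le> 1 \<longrightarrow> \<bar>\<Phi> (m + \<tau>) - \<Phi> m - d * \<tau>\<bar> \<le> C * \<tau>\<^sup>2"
    and K1: "\<And>m \<tau>. \<bar>\<Phi> m - \<Phi> (m + \<tau>)\<bar> \<le> K1 / (1 + \<bar>m\<bar>) * \<bar>\<tau>\<bar>"
    and K2: "\<And>m. \<bar>frac_laplacian s \<Phi> m\<bar> \<le> K2 * (1 + \<bar>m\<bar>) powr (- 2 * s)"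
    and lam0: "0 < lam0" "lam0 \<le> 1" and P0: "P0 \<ge> 0" and p: "p < 2 * s"
  obtains CC where "CC > 0"
    "\<And>V x A b n m M D R P. \<lbrakk>V \<in> borel_measurable borel; norm n = 1; lam0 \<le> norm A; \<bar>norm A - 1\<bar> \<le> P * (1 + \<bar>m\<bar>); P \<le> P0; R > 0; D \<ge> 0; M \<ge> 0;
      \<And>\<xi>. norm \<xi> \<le> 1 \<Longrightarrow> \<bar>V (x + \<xi>) - V x - (\<Phi> (m + A \<bullet> \<xi>) - \<Phi> m) - b \<bullet> \<xi>\<bar> \<le> M * (norm \<xi>)\<^sup>2;
      \<And>\<xi>. norm \<xi> > 1 \<Longrightarrow> \<bar>V (x + \<xi>) - V x - (\<Phi> (m + n \<bullet> \<xi>) - \<Phi> m)\<bar> \<le> M * norm \<xi> powr p + (if norm \<xi> > R then D else 0)\<rbrakk>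
     \<Longrightarrow> \<bar>frac_laplacian s V (x::real^3) - frac_laplacian s \<Phi> m\<bar> \<le> CC * (M + D * R powr (- 2 * s) + P)"
proof -
  define c1 where "c1 = \<bar>frac_const 3 s\<bar> * \<bar>error_const s p\<bar>"
  define c2 where "c2 = \<bar>frac_const 3 s\<bar> * (2 * pi / s)"
  define c3 where "c3 = K2 * (2 * (1 + P0)) + \<bar>frac_const 1 s\<bar> * (K1 * (kernel_moment s * (1 + 2 * lam0 powr (- 2 * s))))"
  define CC where "CC = 1 + c1 + c2 + \<bar>c3\<bar>"
  have c: "c1 \<ge> 0" "c2 \<ge> 0" using s by (auto simp: c1_def c2_def)
  have K1p: "K1 \<ge> 0" 
  proof -
    have "\<bar>\<Phi> 0 - \<Phi> (0 + 1)\<bar> \<le> K1" using K1[of 0 1] by simp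
    then show ?thesis using abs_ge_zero order_trans by blast
  qed
  have K2p: "K2 \<ge> 0" 
  proof -
    have "\<bar>frac_laplacian s \<Phi> 0\<bar> \<le> K2" using K2[of 0] by simp
    then show ?thesis using abs_ge_zero order_trans by blast
  qed
  show thesis
  proof (rule that)
    show "CC > 0" using c by (simp add: CC_def)
    fix V :: "real^3 \<Rightarrow> real" and x A b n :: "real^3" and m M D R P
    assume V: "V \<in> borel_measurable borel" and n: "norm n = 1" and A: "lam0 \<le> norm A" and A1: "\<bar>norm A - 1\<bar> \<le> P * (1 + \<bar>m\<bar>)"
      and P: "P \<le> P0" and R: "R > 0" and D: "D \<ge> 0" and M: "M \<ge> 0"
      and near: "\<And>\<xi>. norm \<xi> \<le> 1 \<Longrightarrow> \<bar>V (x + \<xi>) - V x - (\<Phi> (m + A \<bullet> \<xi>) - \<Phi> m) - b \<bullet> \<xi>\<bar> \<le> M * (norm \<xi>)\<^sup>2"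
      and far: "\<And>\<xi>. norm \<xi> > 1 \<Longrightarrow> \<bar>V (x + \<xi>) - V x - (\<Phi> (m + n \<bullet> \<xi>) - \<Phi> m)\<bar> \<le> M * norm \<xi> powr p + (if norm \<xi> > R then D else 0)"
    have s0: "0 < s" using s by simp
    have "norm A > 0" using A lam0 by linarith
    then have A0: "A \<noteq> 0" by simp
    obtain d C where dC: "\<And>\<tau>. \<bar>\<tau>\<bar> \<le> 1 \<Longrightarrow> \<bar>\<Phi> (m + \<tau>) - \<Phi> m - d * \<tau>\<bar> \<le> C * \<tau>\<^sup>2" using C2[of m] by blast
    define L where "L = norm A"
    have L: "L > 0" using A0 by (simp add: L_def)
    define Lap where "Lap = frac_laplacian s \<Phi> m"
    have Lap: "Lap = frac_const 1 s * pv_int s \<Phi> m d" unfolding Lap_def by (rule frac_laplacian_pv_int[OF s0 s(2) \<Phi>m B dC])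
    have cmp: "\<bar>frac_laplacian s V x - frac_const 1 s * (L powr (2 * s) * (pv_int s \<Phi> m d - trunc_int s \<Phi> m L) + trunc_int s \<Phi> m 1)\<bar>
       \<le> \<bar>frac_const 3 s\<bar> * (M * error_const s p + D * (2 * pi / s * R powr (- 2 * s)))"
      unfolding L_def by (rule frac_laplacian_comparison[OF s0 s(2) \<Phi>m B dC n A0 V p R D near far])
    \<comment> \<open>With slope 1 the comparison value is exactly \<open>Lap\<close>. The deviation
      splits into a multiple of \<open>Lap\<close>, small by the decay \<open>K2\<close>, and
      truncated integrals, small by the Lipschitz bound \<open>K1\<close>.\<close>
    have eq: "frac_const 1 s * (L powr (2 * s) * (pv_int s \<Phi> m d - trunc_int s \<Phi> m L) + trunc_int s \<Phi> m 1) - Lap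
       = (L powr (2 * s) - 1) * Lap - frac_const 1 s * ((L powr (2 * s) - 1) * trunc_int s \<Phi> m L + (trunc_int s \<Phi> m L - trunc_int s \<Phi> m 1))"
      unfolding Lap by (simp add: algebra_simps)
    have P': "P \<ge> 0" using A1 mult_neg_pos[of P "1 + \<bar>m\<bar>"] by linarith
    note pr = powr_rescale_bounds[OF s lam0 A[folded L_def] abs_ge_zero[of m] P P0 A1[folded L_def]]
    have t1: "\<bar>(L powr (2 * s) - 1) * Lap\<bar> \<le> K2 * (2 * (1 + P0)) * P"
    proof -
      have "\<bar>(L powr (2 * s) - 1) * Lap\<bar> \<le> \<bar>L powr (2 * s) - 1\<bar> * (K2 * (1 + \<bar>m\<bar>) powr (- 2 * s))"
        unfolding abs_mult Lap_def by (intro mult_left_mono K2) simp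
      also have "\<dots> = K2 * (\<bar>L powr (2 * s) - 1\<bar> * (1 + \<bar>m\<bar>) powr (- 2 * s))" by simp
      also have "\<dots> \<le> K2 * (2 * (1 + P0) * P)" using pr(1) K2p by (rule mult_left_mono)
      finally show ?thesis by simp
    qed
    note tb = trunc_int_bound[OF s(1) L K1 \<Phi>m]
    have t2: "\<bar>(L powr (2 * s) - 1) * trunc_int s \<Phi> m L + (trunc_int s \<Phi> m L - trunc_int s \<Phi> m 1)\<bar> \<le> K1 * (kernel_moment s * (1 + 2 * lam0 powr (- 2 * s))) * P"
    proof -
      define Q where "Q = K1 / (1 + \<bar>m\<bar>)"
      define k where "k = kernel_moment s"
      have k: "k \<ge> 0" by (simp add: k_def kernel_moment_nonneg)
      have Q: "Q \<ge> 0" using K1p by (simp add: Q_def)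
      have "\<bar>(L powr (2 * s) - 1) * trunc_int s \<Phi> m L\<bar> \<le> \<bar>L powr (2 * s) - 1\<bar> * (Q * (L powr (1 - 2 * s) * k))"
        unfolding abs_mult using tb(1) by (intro mult_left_mono) (auto simp: Q_def k_def)
      also have "\<dots> = Q * k * (\<bar>L powr (2 * s) - 1\<bar> * L powr (1 - 2 * s))" by simp
      also have "\<dots> \<le> Q * k * (\<bar>L - 1\<bar> + \<bar>L powr (1 - 2 * s) - 1\<bar>)"
        using pr(3) Q k by (intro mult_left_mono) auto
      finally have 1: "\<bar>(L powr (2 * s) - 1) * trunc_int s \<Phi> m L\<bar> \<le> Q * k * (\<bar>L - 1\<bar> + \<bar>L powr (1 - 2 * s) - 1\<bar>)" .
      have 2: "\<bar>trunc_int s \<Phi> m L - trunc_int s \<Phi> m 1\<bar> \<le> Q * k * \<bar>L powr (1 - 2 * s) - 1\<bar>"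
        using tb(2) by (simp add: Q_def k_def mult_ac)
      have "\<bar>(L powr (2 * s) - 1) * trunc_int s \<Phi> m L + (trunc_int s \<Phi> m L - trunc_int s \<Phi> m 1)\<bar>
         \<le> Q * k * (\<bar>L - 1\<bar> + \<bar>L powr (1 - 2 * s) - 1\<bar>) + Q * k * \<bar>L powr (1 - 2 * s) - 1\<bar>"
        using 1 2 by linarith
      also have "\<dots> = Q * k * (\<bar>L - 1\<bar> + 2 * \<bar>L powr (1 - 2 * s) - 1\<bar>)" by (simp add: algebra_simps)
      also have "\<dots> \<le> Q * k * ((1 + 2 * lam0 powr (- 2 * s)) * \<bar>L - 1\<bar>)"
        using pr(2) Q k by (intro mult_left_mono) (auto simp: algebra_simps)
      also have "\<dots> \<le> Q * k * ((1 + 2 * lam0 powr (- 2 * s)) * (P * (1 + \<bar>m\<bar>)))"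
        using A1 Q k by (intro mult_left_mono) (auto simp: L_def)
      also have "\<dots> = (Q * (1 + \<bar>m\<bar>)) * (k * (1 + 2 * lam0 powr (- 2 * s))) * P" by simp
      also have "Q * (1 + \<bar>m\<bar>) = K1" by (simp add: Q_def)
      finally show ?thesis by (simp add: k_def)
    qed
    have t3: "\<bar>frac_const 1 s * ((L powr (2 * s) - 1) * trunc_int s \<Phi> m L + (trunc_int s \<Phi> m L - trunc_int s \<Phi> m 1))\<bar>
       \<le> \<bar>frac_const 1 s\<bar> * (K1 * (kernel_moment s * (1 + 2 * lam0 powr (- 2 * s))) * P)"
      unfolding abs_mult[of "frac_const 1 s"] using t2 by (rule mult_left_mono) simp
    have "\<bar>frac_const 1 s * (L powr (2 * s) * (pv_int s \<Phi> m d - trunc_int s \<Phi> m L) + trunc_int s \<Phi> m 1) - Lap\<bar> \<le> c3 * P"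
      unfolding eq using t1 t3 by (simp add: c3_def distrib_right mult.assoc)
    moreover have "c3 * P \<le> \<bar>c3\<bar> * P" using P' by (intro mult_right_mono) auto
    moreover have "\<bar>frac_const 3 s\<bar> * (M * error_const s p + D * (2 * pi / s * R powr (- 2 * s))) \<le> c1 * M + c2 * (D * R powr (- 2 * s))"
    proof -
      have "M * error_const s p \<le> M * \<bar>error_const s p\<bar>" using M by (intro mult_left_mono) auto
      then have "\<bar>frac_const 3 s\<bar> * (M * error_const s p + D * (2 * pi / s * R powr (- 2 * s))) \<le> \<bar>frac_const 3 s\<bar> * (M * \<bar>error_const s p\<bar> + D * (2 * pi / s * R powr (- 2 * s)))"
        by (intro mult_left_mono) auto
      then show ?thesis by (simp add: c1_def c2_def distrib_left mult_ac)
    qed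
    ultimately have "\<bar>frac_laplacian s V x - Lap\<bar> \<le> c1 * M + c2 * (D * R powr (- 2 * s)) + \<bar>c3\<bar> * P"
      using cmp by linarith
    also have "\<dots> \<le> CC * M + CC * (D * R powr (- 2 * s)) + CC * P"
      using M D P' c by (intro add_mono mult_right_mono) (auto simp: CC_def)
    finally show "\<bar>frac_laplacian s V x - frac_laplacian s \<Phi> m\<bar> \<le> CC * (M + D * R powr (- 2 * s) + P)"
      by (simp add: distrib_left Lap_def)
  qed
qed

section \<open>Convolutions and functions of class \<open>C\<^sup>k\<close>\<close>

text \<open>Differentiability is required only for almost every y, at the price of a Lipschitz bound
  with integrable constant. This is the form suited to the pyramid, whose kinks form a null
  set.\<close>

lemma has_derivative_integral_Lipschitz:
  fixes F :: "'a::euclidean_space \<Rightarrow> 'b::euclidean_space \<Rightarrow> real" and F' :: "'b \<Rightarrow> 'a \<Rightarrow> real"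
  assumes int: "\<And>q. integrable lborel (F q)"
    and lin: "\<And>y. linear (F' y)" and meas: "\<And>e. (\<lambda>y. F' y e) \<in> borel_measurable borel"
    and deriv: "AE y in lborel. ((\<lambda>q. F q y) has_derivative F' y) (at q)"
    and Lip: "\<And>q' y. dist q' q < 1 \<Longrightarrow> \<bar>F q' y - F q y\<bar> \<le> B y * norm (q' - q)"
    and B: "integrable lborel B"
  shows "((\<lambda>q. LINT y|lborel. F q y) has_derivative (\<lambda>e. LINT y|lborel. F' y e)) (at q)"
proof -
  have Fm: "F q \<in> borel_measurable borel" for q using borel_measurable_integrable[OF int] by simp
  have Bm [measurable]: "B \<in> borel_measurable borel" using borel_measurable_integrable[OF B] by simp
  have B0: "B y \<ge> 0" for y
  proof -
    obtain b :: 'a where b: "b \<in> Basis" using nonempty_Basis by blast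
    have "\<bar>F (q + (1/2) *\<^sub>R b) y - F q y\<bar> \<le> B y * norm (q + (1/2) *\<^sub>R b - q)"
      using b by (intro Lip) (simp add: dist_norm)
    then have "0 \<le> B y * norm (q + (1/2) *\<^sub>R b - q)" using abs_ge_zero order_trans by blast
    then show ?thesis using b by simp
  qed
  \<comment> \<open>The derivative inherits the Lipschitz constant as a limit of difference
    quotients in the direction e.\<close>
  have bound: "AE y in lborel. \<forall>e. \<bar>F' y e\<bar> \<le> B y * norm e"
    using deriv
  proof eventually_elim
    case (elim y)
    show ?case
    proof
      fix e :: 'a
      show "\<bar>F' y e\<bar> \<le> B y * norm e"
      proof (cases "e = 0")
        case True
        then show ?thesis using linear_0[OF lin[of y]] by simp
      next
        case False
        have "((\<lambda>t::real. F (q + t *\<^sub>R e) y) has_derivative (\<lambda>t. F' y (t *\<^sub>R e))) (at 0)"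
        proof (rule has_derivative_compose[of "\<lambda>t. q + t *\<^sub>R e" "\<lambda>t. t *\<^sub>R e" 0 UNIV "\<lambda>q. F q y" "F' y", simplified])
          show "((\<lambda>t. q + t *\<^sub>R e) has_derivative (\<lambda>t. t *\<^sub>R e)) (at 0)"
            by (auto intro!: derivative_eq_intros)
          show "((\<lambda>q. F q y) has_derivative F' y) (at q)" by (rule elim)
        qed
        then have "((\<lambda>t::real. F (q + t *\<^sub>R e) y) has_real_derivative F' y e) (at 0)"
          by (rule has_derivative_imp_has_field_derivative) (simp add: linear_cmul[OF lin])
        then have lim: "(\<lambda>t. (F (q + t *\<^sub>R e) y - F q y) / t) \<midarrow>0\<rightarrow> F' y e"
          by (simp add: has_field_derivative_iff)
        have ev: "eventually (\<lambda>t::real. \<bar>(F (q + t *\<^sub>R e) y - F q y) / t\<bar> \<le> B y * norm e) (at 0)"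
          unfolding eventually_at
        proof (intro exI conjI ballI impI)
          show "1 / norm e > 0" using False by simp
          fix t :: real assume t: "t \<noteq> 0 \<and> dist t 0 < 1 / norm e"
          then have "\<bar>t\<bar> * norm e < 1" using False by (simp add: field_simps)
          then have "\<bar>F (q + t *\<^sub>R e) y - F q y\<bar> \<le> B y * norm (q + t *\<^sub>R e - q)"
            by (intro Lip) (simp add: dist_norm)
          then show "\<bar>(F (q + t *\<^sub>R e) y - F q y) / t\<bar> \<le> B y * norm e"
            using t by (simp add: abs_divide divide_le_eq mult_ac)
        qed
        show ?thesis
          by (rule tendsto_upperbound[OF tendsto_rabs[OF lim] ev]) simp
      qed
    qed
  qed
  have F'int: "integrable lborel (\<lambda>y. F' y e)" for e
  proof (rule Bochner_Integration.integrable_bound)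
    show "integrable lborel (\<lambda>y. B y * norm e)" using B by simp
    show "AE y in lborel. norm (F' y e) \<le> norm (B y * norm e)"
      using bound by eventually_elim (use B0 in \<open>auto simp: abs_mult\<close>)
  qed (use meas in simp)
  have blin: "bounded_linear (\<lambda>e. LINT y|lborel. F' y e)"
    unfolding linear_conv_bounded_linear[symmetric]
  proof (rule linearI)
    show "(LINT y|lborel. F' y (a + b)) = (LINT y|lborel. F' y a) + (LINT y|lborel. F' y b)" for a b
      by (simp add: linear_add[OF lin] F'int)
    show "(LINT y|lborel. F' y (c *\<^sub>R a)) = c *\<^sub>R (LINT y|lborel. F' y a)" for c a
      by (simp add: linear_cmul[OF lin])
  qed
  define Q where "Q = (\<lambda>h y. (F (q + h) y - F q y - F' y h) / norm h)"
  have Qm: "Q h \<in> borel_measurable borel" for h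
    unfolding Q_def using Fm meas by simp
  \<comment> \<open>Dominated convergence with \<open>2 * B y\<close>: one Lipschitz constant for
    the increment, one for the derivative.\<close>
  have "((\<lambda>h. LINT y|lborel. Q h y) \<longlongrightarrow> 0) (at 0 within ball 0 1)"
    unfolding tendsto_at_iff_sequentially comp_def
  proof (intro allI impI)
    fix X :: "nat \<Rightarrow> 'a" assume X: "\<forall>i. X i \<in> ball 0 1 - {0}" "X \<longlonglongrightarrow> 0"
    have "(\<lambda>i. LINT y|lborel. Q (X i) y) \<longlonglongrightarrow> (LINT y|(lborel :: 'b measure). 0)"
    proof (rule integral_dominated_convergence[where w = "\<lambda>y. 2 * B y"])
      show "AE y in lborel. (\<lambda>i. Q (X i) y) \<longlonglongrightarrow> 0"
        using deriv
      proof eventually_elim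
        case (elim y)
        then have "((\<lambda>h. norm (F (q + h) y - F q y - F' y h) / norm h) \<longlongrightarrow> 0) (at 0)"
          by (simp add: has_derivative_at)
        then have "(\<lambda>i. norm (F (q + X i) y - F q y - F' y (X i)) / norm (X i)) \<longlonglongrightarrow> 0"
          using X unfolding tendsto_at_iff_sequentially comp_def by auto
        then show ?case
          by (intro tendsto_norm_zero_cancel[of "\<lambda>i. Q (X i) y"]) (simp add: Q_def)
      qed
      show "AE y in lborel. norm (Q (X i) y) \<le> 2 * B y" for i
        using bound
      proof eventually_elim
        case (elim y)
        have X0: "norm (X i) > 0" "norm (X i) < 1" using X(1) by (auto simp: dist_norm)
        have "\<bar>F (q + X i) y - F q y\<bar> \<le> B y * norm (q + X i - q)"
          using X0 by (intro Lip) (simp add: dist_norm)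
        then have "\<bar>F (q + X i) y - F q y - F' y (X i)\<bar> \<le> 2 * B y * norm (X i)"
          using elim[rule_format, of "X i"] by simp
        then show ?case
          using X0 by (simp add: Q_def abs_divide divide_le_eq)
      qed
    qed (use B Qm in auto)
    then show "(\<lambda>i. LINT y|lborel. Q (X i) y) \<longlonglongrightarrow> 0" by simp
  qed
  then have "((\<lambda>h. LINT y|lborel. Q h y) \<longlongrightarrow> 0) (at 0)"
    by (simp add: at_within_open[of 0 "ball 0 1"])
  then have "((\<lambda>h. norm (LINT y|lborel. Q h y)) \<longlongrightarrow> 0) (at 0)"
    by (rule tendsto_norm_zero)
  moreover have "norm (LINT y|lborel. Q h y) = norm ((LINT y|lborel. F (q + h) y) - (LINT y|lborel. F q y) - (LINT y|lborel. F' y h)) / norm h" for h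
  proof -
    have "(LINT y|lborel. Q h y) = ((LINT y|lborel. F (q + h) y) - (LINT y|lborel. F q y) - (LINT y|lborel. F' y h)) / norm h"
      unfolding Q_def using int F'int by simp
    then show ?thesis by simp
  qed
  ultimately show ?thesis
    unfolding has_derivative_at using blin by simp
qed

section \<open>Convolution with kernels of algebraic decay\<close>

definition weight :: "real \<Rightarrow> 'a::euclidean_space \<Rightarrow> real" where
  "weight \<beta> x = (1 + norm x) powr (- \<beta>)"

lemma weight_pos: "weight \<beta> x > 0"
proof -
  have "1 + norm x > 0" using norm_ge_zero[of x] by linarith
  then show ?thesis by (simp add: weight_def)
qed

lemma continuous_weight: "continuous_on UNIV (weight \<beta> :: 'a::euclidean_space \<Rightarrow> real)"
  unfolding weight_def
  by (intro continuous_intros ballI) (metis add_pos_nonneg less_irrefl norm_ge_zero zero_less_one)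

lemma weight_measurable [measurable]: "weight \<beta> \<in> borel_measurable borel"
  by (intro borel_measurable_continuous_onI continuous_weight)

text \<open>A pointwise bound by the weight is thereby uniform over unit balls, as dominated
  convergence and the mean value theorem require.\<close>

lemma weight_shift:
  assumes "\<beta> \<ge> 0" "norm \<eta> \<le> 1"
  shows "weight \<beta> (x + \<eta>) \<le> 2 powr \<beta> * weight \<beta> x"
proof -
  have "1 + norm x \<le> 2 * (1 + norm (x + \<eta>))"
  proof -
    have "norm x \<le> norm (x + \<eta>) + norm \<eta>" using norm_triangle_ineq4[of "x + \<eta>" \<eta>] by simp
    then show ?thesis using assms(2) norm_ge_zero[of "x + \<eta>"] unfolding distrib_left by linarith
  qed
  then have "(2 * (1 + norm (x + \<eta>))) powr (- \<beta>) \<le> (1 + norm x) powr (- \<beta>)"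
    using assms by (intro powr_mono2') (auto intro: add_pos_nonneg)
  then have "2 powr (- \<beta>) * weight \<beta> (x + \<eta>) \<le> weight \<beta> x"
    unfolding weight_def by (subst powr_mult[symmetric]) auto
  then have "2 powr \<beta> * (2 powr (- \<beta>) * weight \<beta> (x + \<eta>)) \<le> 2 powr \<beta> * weight \<beta> x"
    by (intro mult_left_mono) auto
  then show ?thesis by (simp add: mult.assoc[symmetric] powr_add[symmetric])
qed

lemma integrable_weight:
  assumes "\<beta> > real DIM('a)"
  shows "integrable lborel (weight \<beta> :: 'a::euclidean_space \<Rightarrow> real)"
proof (rule integrable_powr_near_far[where a = \<beta> and b = 0 and B = 1])
  have \<beta>: "\<beta> > 0" using assms by (metis of_nat_0_le_iff order_le_less_trans)
  show "\<bar>weight \<beta> x\<bar> \<le> 1 * norm x powr (- 0)" if "0 < norm x" for x :: 'a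
  proof -
    have "(1 + norm x) powr (- \<beta>) \<le> 1 powr (- \<beta>)" using \<beta> by (intro powr_mono2') auto
    then show ?thesis using that by (simp add: weight_def)
  qed
  show "\<bar>weight \<beta> x\<bar> \<le> 1 * norm x powr (- \<beta>)" if "norm x > 1" for x :: 'a
  proof -
    have "(1 + norm x) powr (- \<beta>) \<le> norm x powr (- \<beta>)" using \<beta> that by (intro powr_mono2') auto
    then show ?thesis by (simp add: weight_def)
  qed
qed (use assms in auto)

lemma lborel_reflect: "distr lborel borel (\<lambda>y. q - y) = (lborel :: 'a::euclidean_space measure)"
  using lborel_affine[of "-1" q] by (simp add: density_1)

lemma
  fixes f :: "'a::euclidean_space \<Rightarrow> real"
  assumes [measurable]: "f \<in> borel_measurable borel"
  shows integrable_reflect: "integrable lborel (\<lambda>y. f (q - y)) \<longleftrightarrow> integrable lborel f"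
    and integral_reflect: "(LINT y|lborel. f (q - y)) = (LINT y|lborel. f y)"
proof -
  have "integrable lborel (\<lambda>y. f (q - y)) \<longleftrightarrow> integrable (distr lborel borel (\<lambda>y. q - y)) f"
    by (subst integrable_distr_eq) auto
  then show "integrable lborel (\<lambda>y. f (q - y)) \<longleftrightarrow> integrable lborel f" by (simp add: lborel_reflect)
  have "(LINT y|lborel. f (q - y)) = (LINT y|distr lborel borel (\<lambda>y. q - y). f y)"
    by (subst integral_distr) auto
  then show "(LINT y|lborel. f (q - y)) = (LINT y|lborel. f y)" by (simp add: lborel_reflect)
qed

lemma integrable_convolve:
  fixes \<kappa> w :: "'a::euclidean_space \<Rightarrow> real"
  assumes \<beta>: "\<beta> > real DIM('a)" and [measurable]: "\<kappa> \<in> borel_measurable borel" "w \<in> borel_measurable borel"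
    and C: "\<And>x. \<bar>\<kappa> x\<bar> \<le> C * weight \<beta> x" and w: "\<And>y. \<bar>w y\<bar> \<le> 1"
  shows "integrable lborel (\<lambda>y. \<kappa> (q - y) * w y)"
proof (rule Bochner_Integration.integrable_bound)
  show "integrable lborel (\<lambda>y. C * weight \<beta> (q - y))"
    using integrable_weight[OF \<beta>] by (simp add: integrable_reflect)
  show "AE y in lborel. norm (\<kappa> (q - y) * w y) \<le> norm (C * weight \<beta> (q - y))"
  proof (rule AE_I2)
    fix y
    have "\<bar>\<kappa> (q - y)\<bar> * \<bar>w y\<bar> \<le> C * weight \<beta> (q - y) * 1"
      using C[of "q - y"] w[of y] by (intro mult_mono) (auto intro: order_trans[OF abs_ge_zero])
    then show "norm (\<kappa> (q - y) * w y) \<le> norm (C * weight \<beta> (q - y))"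
      unfolding real_norm_def abs_mult[of "\<kappa> (q - y)"] by linarith
  qed
qed simp

text \<open>The derivative falls on the kernel, so w may be merely measurable and bounded; it will
  be the indicator of a sector.\<close>

lemma convolve_has_derivative:
  fixes \<kappa> w :: "'a::euclidean_space \<Rightarrow> real" and \<kappa>' :: "'a \<Rightarrow> 'a \<Rightarrow> real"
  assumes \<beta>: "\<beta> > real DIM('a)" and wm: "w \<in> borel_measurable borel" and w: "\<And>y. \<bar>w y\<bar> \<le> 1"
    and C: "\<And>x. \<bar>\<kappa> x\<bar> \<le> C * weight \<beta> x"
    and d: "\<And>x. (\<kappa> has_derivative \<kappa>' x) (at x)"
    and cont: "\<And>e::'a. continuous_on UNIV (\<lambda>x. \<kappa>' x e)"
    and C': "\<And>e::'a. \<exists>C. \<forall>x. \<bar>\<kappa>' x e\<bar> \<le> C * weight \<beta> x"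
  shows "(convolve \<kappa> w has_derivative (\<lambda>e. convolve (\<lambda>x. \<kappa>' x e) w q)) (at q)"
proof -
  have b0: "\<beta> \<ge> 0" using \<beta> by (metis of_nat_0_le_iff order_trans less_imp_le)
  have lin: "linear (\<kappa>' x)" for x using d[of x] by (simp add: has_derivative_linear)
  have \<kappa>m [measurable]: "\<kappa> \<in> borel_measurable borel"
    using d by (intro borel_measurable_continuous_onI continuous_at_imp_continuous_on) (auto intro: has_derivative_continuous)
  have \<kappa>'m: "(\<lambda>x. \<kappa>' x e) \<in> borel_measurable borel" for e
    by (intro borel_measurable_continuous_onI cont)
  obtain Ce where Ce: "\<And>e x. \<bar>\<kappa>' x e\<bar> \<le> Ce e * weight \<beta> x" using C' by metis
  \<comment> \<open>The bounds \<open>Ce\<close> depend on the direction in an unspecified way;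
    expanding in the basis gives one constant, with a bound linear in \<open>norm e\<close>.\<close>
  define K where "K = (\<Sum>b\<in>Basis. Ce b)"
  have Cb: "Ce e \<ge> 0" for e
    using Ce[of 0 e] weight_pos[of \<beta> "0::'a"] by (metis abs_ge_zero order_trans zero_le_mult_iff not_less)
  have K: "\<bar>\<kappa>' x e\<bar> \<le> K * weight \<beta> x * norm e" for x e
  proof -
    have "\<kappa>' x e = \<kappa>' x (\<Sum>b\<in>Basis. (e \<bullet> b) *\<^sub>R b)" by (simp add: euclidean_representation)
    also have "\<dots> = (\<Sum>b\<in>Basis. (e \<bullet> b) * \<kappa>' x b)" by (simp add: linear_sum[OF lin] linear_cmul[OF lin])
    finally have "\<bar>\<kappa>' x e\<bar> \<le> (\<Sum>b\<in>Basis. \<bar>e \<bullet> b\<bar> * \<bar>\<kappa>' x b\<bar>)"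
      by (simp add: abs_mult[symmetric])
    also have "\<dots> \<le> (\<Sum>b\<in>Basis. norm e * (Ce b * weight \<beta> x))"
      by (intro sum_mono mult_mono Ce) (auto simp: Basis_le_norm)
    finally show ?thesis by (simp add: K_def sum_distrib_left sum_distrib_right mult_ac)
  qed
  have K0: "K \<ge> 0" unfolding K_def by (intro sum_nonneg Cb)
  show ?thesis
    unfolding convolve_def
  proof (rule has_derivative_integral_Lipschitz[where B = "\<lambda>y. K * 2 powr \<beta> * weight \<beta> (q - y)"])
    show "integrable lborel (\<lambda>y. \<kappa> (q - y) * w y)" for q
      by (rule integrable_convolve[OF \<beta> \<kappa>m wm C w])
    show "linear (\<lambda>e. \<kappa>' (q - y) e * w y)" for y
      by (rule linearI) (simp_all add: linear_add[OF lin] linear_cmul[OF lin] distrib_right)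
    show "(\<lambda>y. \<kappa>' (q - y) e * w y) \<in> borel_measurable borel" for e
      using measurable_compose[OF _ \<kappa>'m, of "\<lambda>y. q - y" borel] wm by simp
    show "AE y in lborel. ((\<lambda>q. \<kappa> (q - y) * w y) has_derivative (\<lambda>e. \<kappa>' (q - y) e * w y)) (at q)"
    proof (rule AE_I2)
      fix y
      have "((\<lambda>q. \<kappa> (q - y)) has_derivative (\<lambda>e. \<kappa>' (q - y) e)) (at q)"
        by (rule has_derivative_compose[of "\<lambda>q. q - y" "\<lambda>e. e" q UNIV \<kappa> "\<kappa>' (q - y)", simplified])
           (auto intro!: derivative_eq_intros d)
      then show "((\<lambda>q. \<kappa> (q - y) * w y) has_derivative (\<lambda>e. \<kappa>' (q - y) e * w y)) (at q)"
        by (rule has_derivative_mult_left)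
    qed
    show "integrable lborel (\<lambda>y. K * 2 powr \<beta> * weight \<beta> (q - y))"
      using integrable_weight[OF \<beta>] by (simp add: integrable_reflect)
    fix q' y assume q': "dist q' q < 1"
    have "norm (\<kappa> (q' - y) - \<kappa> (q - y)) \<le> (K * 2 powr \<beta> * weight \<beta> (q - y)) * norm (q' - y - (q - y))"
    proof (rule differentiable_bound[where f' = \<kappa>' and S = "ball (q - y) 1"])
      show "(\<kappa> has_derivative \<kappa>' x) (at x within ball (q - y) 1)" for x
        using d by (rule has_derivative_at_withinI)
      show "onorm (\<kappa>' x) \<le> K * 2 powr \<beta> * weight \<beta> (q - y)" if "x \<in> ball (q - y) 1" for x
      proof (rule onorm_le)
        fix e :: 'a
        have "weight \<beta> x \<le> 2 powr \<beta> * weight \<beta> (q - y)"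
          using weight_shift[OF b0, of "x - (q - y)" "q - y"] that by (simp add: dist_norm norm_minus_commute)
        then have "K * weight \<beta> x * norm e \<le> K * (2 powr \<beta> * weight \<beta> (q - y)) * norm e"
          using K0 by (intro mult_right_mono mult_left_mono) auto
        then show "norm (\<kappa>' x e) \<le> K * 2 powr \<beta> * weight \<beta> (q - y) * norm e"
          using K[of x e] by (simp add: mult.assoc)
      qed
    qed (use q' in \<open>auto simp: dist_norm norm_minus_commute\<close>)
    then have *: "\<bar>\<kappa> (q' - y) - \<kappa> (q - y)\<bar> \<le> K * 2 powr \<beta> * weight \<beta> (q - y) * norm (q' - q)" by simp
    have "\<bar>\<kappa> (q' - y) * w y - \<kappa> (q - y) * w y\<bar> = \<bar>\<kappa> (q' - y) - \<kappa> (q - y)\<bar> * \<bar>w y\<bar>"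
      by (simp add: abs_mult[symmetric] left_diff_distrib)
    also have "\<dots> \<le> \<bar>\<kappa> (q' - y) - \<kappa> (q - y)\<bar>" using w[of y] by (simp add: mult_left_le)
    finally show "\<bar>\<kappa> (q' - y) * w y - \<kappa> (q - y) * w y\<bar> \<le> K * 2 powr \<beta> * weight \<beta> (q - y) * norm (q' - q)"
      using * by linarith
  qed
qed

lemma continuous_on_convolve:
  fixes \<kappa> w :: "'a::euclidean_space \<Rightarrow> real"
  assumes \<beta>: "\<beta> > real DIM('a)" and wm: "w \<in> borel_measurable borel" and w: "\<And>y. \<bar>w y\<bar> \<le> 1"
    and C: "\<And>x. \<bar>\<kappa> x\<bar> \<le> C * weight \<beta> x" and cont: "continuous_on UNIV \<kappa>"
  shows "continuous_on UNIV (convolve \<kappa> w)"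
proof -
  have b0: "\<beta> \<ge> 0" using \<beta> by (metis of_nat_0_le_iff order_trans less_imp_le)
  have C0: "C \<ge> 0" using C[of 0] weight_pos[of \<beta> "0::'a"] by (metis abs_ge_zero order_trans zero_le_mult_iff not_less)
  have \<kappa>m: "\<kappa> \<in> borel_measurable borel" using cont by (rule borel_measurable_continuous_onI)
  have km: "(\<lambda>y. \<kappa> (q - y) * w y) \<in> borel_measurable borel" for q
    using measurable_compose[OF _ \<kappa>m, of "\<lambda>y. q - y" borel] wm by simp
  have "(convolve \<kappa> w \<longlongrightarrow> convolve \<kappa> w q) (at q within ball q 1)" for q
    unfolding tendsto_at_iff_sequentially comp_def
  proof (intro allI impI)
    fix X :: "nat \<Rightarrow> 'a" assume X: "\<forall>i. X i \<in> ball q 1 - {q}" "X \<longlonglongrightarrow> q"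
    show "(\<lambda>i. convolve \<kappa> w (X i)) \<longlonglongrightarrow> convolve \<kappa> w q"
      unfolding convolve_def
    proof (rule integral_dominated_convergence[where w = "\<lambda>y. C * (2 powr \<beta> * weight \<beta> (q - y))"])
      show "integrable lborel (\<lambda>y. C * (2 powr \<beta> * weight \<beta> (q - y)))"
        using integrable_weight[OF \<beta>] by (simp add: integrable_reflect)
      show "AE y in lborel. (\<lambda>i. \<kappa> (X i - y) * w y) \<longlonglongrightarrow> \<kappa> (q - y) * w y"
      proof (rule AE_I2)
        fix y
        have "isCont \<kappa> (q - y)" using cont by (simp add: continuous_on_eq_continuous_at)
        moreover have "(\<lambda>i. X i - y) \<longlonglongrightarrow> q - y" using X(2) by (intro tendsto_intros)
        ultimately have "(\<lambda>i. \<kappa> (X i - y)) \<longlonglongrightarrow> \<kappa> (q - y)" by (rule isCont_tendsto_compose)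
        then show "(\<lambda>i. \<kappa> (X i - y) * w y) \<longlonglongrightarrow> \<kappa> (q - y) * w y" by (intro tendsto_intros)
      qed
      show "AE y in lborel. norm (\<kappa> (X i - y) * w y) \<le> C * (2 powr \<beta> * weight \<beta> (q - y))" for i
      proof (rule AE_I2)
        fix y
        have "norm (X i - q) \<le> 1" using X(1) by (simp add: dist_norm norm_minus_commute less_imp_le)
        from weight_shift[OF b0 this, of "q - y"] have "weight \<beta> (X i - y) \<le> 2 powr \<beta> * weight \<beta> (q - y)" by simp
        then have "C * weight \<beta> (X i - y) \<le> C * (2 powr \<beta> * weight \<beta> (q - y))" using C0 by (rule mult_left_mono)
        moreover have "\<bar>\<kappa> (X i - y)\<bar> * \<bar>w y\<bar> \<le> C * weight \<beta> (X i - y) * 1"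
          using C[of "X i - y"] w[of y] by (intro mult_mono) (auto intro: order_trans[OF abs_ge_zero])
        ultimately show "norm (\<kappa> (X i - y) * w y) \<le> C * (2 powr \<beta> * weight \<beta> (q - y))" by (simp add: abs_mult)
      qed
    qed (use km in auto)
  qed
  then have "(convolve \<kappa> w \<longlongrightarrow> convolve \<kappa> w q) (at q)" for q
    using at_within_open[of q "ball q 1"] by (metis centre_in_ball open_ball zero_less_one)
  then show ?thesis
    by (simp add: continuous_on_def)
qed

text \<open>Compactness takes care of the ball of radius R; outside it \<open>norm x\<close> and
  \<open>1 + norm x\<close> differ by at most the factor 2.\<close>

lemma bounded_by_weight:
  fixes f :: "'a::euclidean_space \<Rightarrow> real"
  assumes cont: "continuous_on UNIV f" and R: "R \<ge> 1" and \<beta>: "\<beta> \<ge> 0"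
    and C: "\<And>x. norm x > R \<Longrightarrow> \<bar>f x\<bar> \<le> C * norm x powr (- \<beta>)"
  obtains C' where "\<And>x. \<bar>f x\<bar> \<le> C' * weight \<beta> x" "C' \<ge> 0"
proof -
  have "compact (f ` cball 0 R)"
    by (intro compact_continuous_image continuous_on_subset[OF cont]) auto
  then have "bounded (f ` cball 0 R)" by (rule compact_imp_bounded)
  then obtain K where "\<forall>x\<in>f ` cball 0 R. norm x \<le> K" unfolding bounded_iff by blast
  then have K: "\<bar>f x\<bar> \<le> K" if "norm x \<le> R" for x using that by simp
  have K0: "K \<ge> 0" using K[of 0] R by simp
  define C' where "C' = K * (1 + R) powr \<beta> + \<bar>C\<bar> * 2 powr \<beta>"
  show thesis
  proof (rule that)
    show "C' \<ge> 0" using K0 by (simp add: C'_def)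
    fix x :: 'a
    show "\<bar>f x\<bar> \<le> C' * weight \<beta> x"
    proof (cases "norm x \<le> R")
      case True
      have "(1 + R) powr (- \<beta>) \<le> weight \<beta> x" unfolding weight_def
        using True \<beta> by (intro powr_mono2') (auto intro: add_pos_nonneg)
      then have "K * (1 + R) powr \<beta> * (1 + R) powr (- \<beta>) \<le> K * (1 + R) powr \<beta> * weight \<beta> x"
        using K0 by (intro mult_left_mono) auto
      moreover have "K * (1 + R) powr \<beta> * (1 + R) powr (- \<beta>) = K"
        using R by (simp add: mult.assoc powr_add[symmetric])
      moreover have "0 \<le> \<bar>C\<bar> * 2 powr \<beta> * weight \<beta> x" using weight_pos[of \<beta> x] by simp
      ultimately show ?thesis using K[OF True] by (simp add: C'_def distrib_right)
    next
      case False
      then have "norm x > 1" using R by simp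
      then have "(2 * norm x) powr (- \<beta>) \<le> weight \<beta> x" unfolding weight_def
        using \<beta> by (intro powr_mono2') (auto intro: add_pos_nonneg)
      then have "2 powr \<beta> * (2 powr (- \<beta>) * norm x powr (- \<beta>)) \<le> 2 powr \<beta> * weight \<beta> x"
        by (intro mult_left_mono) (auto simp: powr_mult)
      then have "norm x powr (- \<beta>) \<le> 2 powr \<beta> * weight \<beta> x"
        by (simp add: mult.assoc[symmetric] powr_add[symmetric])
      then have "\<bar>C\<bar> * norm x powr (- \<beta>) \<le> \<bar>C\<bar> * (2 powr \<beta> * weight \<beta> x)" by (intro mult_left_mono) auto
      moreover have "C * norm x powr (- \<beta>) \<le> \<bar>C\<bar> * norm x powr (- \<beta>)" by (intro mult_right_mono) auto
      moreover have "0 \<le> K * (1 + R) powr \<beta> * weight \<beta> x" using weight_pos[of \<beta> x] K0 by simp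
      ultimately show ?thesis using C[of x] False by (simp add: C'_def distrib_right)
    qed
  qed
qed

section \<open>Calculus of functions of class \<open>C\<^sup>k\<close>\<close>

lemma Ck_on_cong:
  assumes "\<And>x. x \<in> S \<Longrightarrow> f x = g x"
  shows "Ck_on k S f \<longleftrightarrow> Ck_on k S g"
  using assms
proof (induction k arbitrary: f g)
  case 0
  then show ?case by (simp cong: continuous_on_cong)
next
  case (Suc k)
  have D: "(f has_derivative D) (at x within S) \<longleftrightarrow> (g has_derivative D) (at x within S)" if "x \<in> S" for x D
    using Suc.prems that by (metis has_derivative_transform)
  have "frechet_derivative f (at x within S) = frechet_derivative g (at x within S)" if "x \<in> S" for x
    unfolding frechet_derivative_def using D[OF that] by simp
  then have "Ck_on k S (\<lambda>x. frechet_derivative f (at x within S) e) \<longleftrightarrow> Ck_on k S (\<lambda>x. frechet_derivative g (at x within S) e)" for e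
    by (intro Suc.IH) simp
  moreover have "f differentiable (at x within S) \<longleftrightarrow> g differentiable (at x within S)" if "x \<in> S" for x
    unfolding differentiable_def using D[OF that] by simp
  ultimately show ?case by simp
qed

lemma Ck_on_SucI:
  assumes S: "open S" and d: "\<And>x. x \<in> S \<Longrightarrow> (w has_derivative w' x) (at x)"
    and w': "\<And>e. Ck_on k S (\<lambda>x. w' x e)"
  shows "Ck_on (Suc k) S w"
proof -
  have "frechet_derivative w (at x within S) e = w' x e" if "x \<in> S" for x e
    using frechet_derivative_at[OF d[OF that]] at_within_open[OF that S] by simp
  then have "Ck_on k S (\<lambda>x. frechet_derivative w (at x within S) e)" for e
    using w'[of e] Ck_on_cong[of S "\<lambda>x. frechet_derivative w (at x within S) e" "\<lambda>x. w' x e" k] by simp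
  moreover have "w differentiable (at x within S)" if "x \<in> S" for x
    using d[OF that] at_within_open[OF that S] by (auto simp: differentiable_def)
  ultimately show ?thesis by simp
qed

lemma Ck_on_SucD:
  assumes S: "open S" and w: "Ck_on (Suc k) S w"
  shows "x \<in> S \<Longrightarrow> (w has_derivative frechet_derivative w (at x)) (at x)"
    and "Ck_on k S (\<lambda>x. frechet_derivative w (at x) e)"
proof -
  show "(w has_derivative frechet_derivative w (at x)) (at x)" if "x \<in> S"
    using w that at_within_open[OF that S] by (auto simp: frechet_derivative_works)
  have "Ck_on k S (\<lambda>x. frechet_derivative w (at x within S) e)" using w by simp
  moreover have "frechet_derivative w (at x within S) e = frechet_derivative w (at x) e" if "x \<in> S" for x
    using at_within_open[OF that S] by simp
  ultimately show "Ck_on k S (\<lambda>x. frechet_derivative w (at x) e)"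
    using Ck_on_cong[of S "\<lambda>x. frechet_derivative w (at x within S) e" "\<lambda>x. frechet_derivative w (at x) e" k] by blast
qed

lemma Ck_on_imp_continuous_on: "Ck_on k S w \<Longrightarrow> continuous_on S w"
  by (cases k) (auto simp: continuous_on_eq_continuous_within intro: differentiable_imp_continuous_within)

lemma Ck_on_Suc: "Ck_on (Suc k) S w \<Longrightarrow> Ck_on k S w"
proof (induction k arbitrary: w)
  case 0
  then show ?case using Ck_on_imp_continuous_on[OF 0] by simp
next
  case (Suc k)
  then show ?case by simp
qed

lemma Ck_on_const: "open S \<Longrightarrow> Ck_on k S (\<lambda>x. c)"
proof (induction k arbitrary: c)
  case (Suc k)
  show ?case by (rule Ck_on_SucI[OF Suc.prems, where w' = "\<lambda>_ _. 0"]) (auto intro: Suc)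
qed simp

lemma Ck_on_bounded_linear:
  assumes "open S" "bounded_linear L"
  shows "Ck_on k S L"
proof (cases k)
  case 0
  then show ?thesis using assms by (simp add: linear_continuous_on)
next
  case (Suc n)
  show ?thesis unfolding Suc
    by (rule Ck_on_SucI[OF assms(1), where w' = "\<lambda>_. L"])
       (auto intro: bounded_linear_imp_has_derivative assms Ck_on_const)
qed

lemma Ck_on_add:
  assumes S: "open S"
  shows "Ck_on k S u \<Longrightarrow> Ck_on k S v \<Longrightarrow> Ck_on k S (\<lambda>x. u x + v x)"
proof (induction k arbitrary: u v)
  case 0
  then show ?case by (auto intro: continuous_on_add)
next
  case (Suc k)
  show ?case
    by (rule Ck_on_SucI[OF S, where w' = "\<lambda>x e. frechet_derivative u (at x) e + frechet_derivative v (at x) e"])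
       (auto intro!: has_derivative_add Ck_on_SucD(1)[OF S] Ck_on_SucD(2)[OF S] Suc)
qed

lemma Ck_on_mult:
  assumes S: "open S"
  shows "Ck_on k S u \<Longrightarrow> Ck_on k S v \<Longrightarrow> Ck_on k S (\<lambda>x. u x * v x)"
proof (induction k arbitrary: u v)
  case 0
  then show ?case by (auto intro: continuous_on_mult)
next
  case (Suc k)
  show ?case
    by (rule Ck_on_SucI[OF S, where w' = "\<lambda>x e. u x * frechet_derivative v (at x) e + frechet_derivative u (at x) e * v x"])
       (auto intro!: has_derivative_mult Ck_on_SucD(1)[OF S] Ck_on_SucD(2)[OF S] Suc Ck_on_add[OF S] Ck_on_Suc[OF Suc.prems(1)] Ck_on_Suc[OF Suc.prems(2)])
qed

lemma Ck_on_cmult: "open S \<Longrightarrow> Ck_on k S u \<Longrightarrow> Ck_on k S (\<lambda>x. c * u x)"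
  by (intro Ck_on_mult Ck_on_const)

lemma Ck_on_sum:
  assumes "open S"
  shows "(\<And>i. i \<in> I \<Longrightarrow> Ck_on k S (u i)) \<Longrightarrow> Ck_on k S (\<lambda>x. \<Sum>i\<in>I. u i x)"
  by (induction I rule: infinite_finite_induct) (auto intro: Ck_on_const Ck_on_add assms)

lemma Ck_on_compose_real:
  fixes F :: "real \<Rightarrow> real"
  assumes S: "open S" and T: "open T"
  shows "Ck_on k T F \<Longrightarrow> Ck_on k S u \<Longrightarrow> (\<And>x. x \<in> S \<Longrightarrow> u x \<in> T) \<Longrightarrow> Ck_on k S (\<lambda>x. F (u x))"
proof (induction k arbitrary: F u)
  case 0
  then show ?case by (auto intro: continuous_on_compose2)
next
  case (Suc k)
  have F: "(F has_derivative frechet_derivative F (at t)) (at t)" if "t \<in> T" for t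
    by (rule Ck_on_SucD(1)[OF T Suc.prems(1) that])
  show ?case
  proof (rule Ck_on_SucI[OF S, where w' = "\<lambda>x e. frechet_derivative F (at (u x)) 1 * frechet_derivative u (at x) e"])
    fix x assume x: "x \<in> S"
    have l: "frechet_derivative F (at (u x)) h = frechet_derivative F (at (u x)) 1 * h" for h
      using linear_cmul[OF has_derivative_linear[OF F[OF Suc.prems(3)[OF x]]], of h 1] by simp
    have "((\<lambda>x. F (u x)) has_derivative (\<lambda>e. frechet_derivative F (at (u x)) (frechet_derivative u (at x) e))) (at x)"
      by (rule has_derivative_compose[OF Ck_on_SucD(1)[OF S Suc.prems(2) x] F[OF Suc.prems(3)[OF x]]])
    then show "((\<lambda>x. F (u x)) has_derivative (\<lambda>e. frechet_derivative F (at (u x)) 1 * frechet_derivative u (at x) e)) (at x)"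
      by (subst (asm) l)
  next
    fix e
    have "Ck_on k S (\<lambda>x. frechet_derivative F (at (u x)) 1)"
      by (rule Suc.IH[OF Ck_on_SucD(2)[OF T Suc.prems(1)] Ck_on_Suc[OF Suc.prems(2)] Suc.prems(3)])
    then show "Ck_on k S (\<lambda>x. frechet_derivative F (at (u x)) 1 * frechet_derivative u (at x) e)"
      by (intro Ck_on_mult[OF S] Ck_on_SucD(2)[OF S Suc.prems(2)])
  qed
qed

lemma Ck_on_compose_linear:
  fixes L :: "'a::euclidean_space \<Rightarrow> 'b::euclidean_space"
  assumes L: "bounded_linear L"
  shows "Ck_on k UNIV u \<Longrightarrow> Ck_on k UNIV (\<lambda>x. u (L x))"
proof (induction k arbitrary: u)
  case 0
  then show ?case using linear_continuous_on[OF L] by (auto intro: continuous_on_compose2)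
next
  case (Suc k)
  show ?case
  proof (rule Ck_on_SucI[OF open_UNIV, where w' = "\<lambda>x e. frechet_derivative u (at (L x)) (L e)"])
    show "((\<lambda>x. u (L x)) has_derivative (\<lambda>e. frechet_derivative u (at (L x)) (L e))) (at x)" for x
      by (rule has_derivative_compose[OF bounded_linear_imp_has_derivative[OF L] Ck_on_SucD(1)[OF open_UNIV Suc.prems UNIV_I]])
    show "Ck_on k UNIV (\<lambda>x. frechet_derivative u (at (L x)) (L e))" for e
      by (rule Suc.IH[OF Ck_on_SucD(2)[OF open_UNIV Suc.prems]])
  qed
qed

lemma Ck_on_powr: "Ck_on k {0<..} (\<lambda>t::real. c * t powr a)"
proof (induction k arbitrary: c a)
  case 0
  show ?case by (auto intro!: continuous_intros)
next
  case (Suc k)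
  show ?case
  proof (rule Ck_on_SucI[where w' = "\<lambda>t e. c * a * e * t powr (a - 1)"])
    show "((\<lambda>t. c * t powr a) has_derivative (\<lambda>e. c * a * e * x powr (a - 1))) (at x)" if "x \<in> {0<..}" for x
    proof -
      have "((\<lambda>t. c * t powr a) has_real_derivative (c * (a * x powr (a - 1)))) (at x)"
        using that by (auto intro!: derivative_eq_intros)
      moreover have "(*) (c * (a * x powr (a - 1))) = (\<lambda>e. c * a * e * x powr (a - 1))" by (auto simp: fun_eq_iff)
      ultimately show ?thesis by (simp only: has_field_derivative_def)
    qed
    show "Ck_on k {0<..} (\<lambda>t. c * a * e * t powr (a - 1))" for e by (rule Suc)
  qed auto
qed

text \<open>Direction before point, so that \<open>D1 w e\<close> is again a function of the point
  and can be differentiated once more.\<close>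

definition D1 :: "('a::euclidean_space \<Rightarrow> real) \<Rightarrow> 'a \<Rightarrow> 'a \<Rightarrow> real" where
  "D1 w e x = frechet_derivative w (at x) e"

lemma has_derivative_D1: "Ck_on (Suc k) UNIV w \<Longrightarrow> (w has_derivative (\<lambda>e. D1 w e x)) (at x)"
  unfolding D1_def using Ck_on_SucD(1)[OF open_UNIV, of k w x] by simp

lemma Ck_on_D1: "Ck_on (Suc k) UNIV w \<Longrightarrow> Ck_on k UNIV (D1 w e)"
  unfolding D1_def[abs_def] by (rule Ck_on_SucD(2)[OF open_UNIV])

lemma D1_eqI: "(w has_derivative w') (at x) \<Longrightarrow> D1 w e x = w' e"
  unfolding D1_def by (simp add: frechet_derivative_at[symmetric])

section \<open>The mollifier as a kernel comparable to a weight\<close>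

lemma norm_inner_powr: "x \<noteq> 0 \<Longrightarrow> norm x powr a = (x \<bullet> x) powr (a/2)" for x :: "'a::real_inner"
  by (simp add: norm_eq_sqrt_inner powr_half_sqrt[symmetric] powr_powr)

lemma inner_powr_has_derivative:
  fixes x :: "'a::real_inner"
  assumes "x \<noteq> 0"
  shows "((\<lambda>x. (x \<bullet> x) powr a) has_derivative (\<lambda>e. 2 * a * (x \<bullet> x) powr (a - 1) * (x \<bullet> e))) (at x)"
proof -
  have p: "x \<bullet> x > 0" using assms by simp
  have "((\<lambda>t. t powr a) has_real_derivative a * (x \<bullet> x) powr (a - 1)) (at (x \<bullet> x))"
    using p by (auto intro!: derivative_eq_intros)
  then have 1: "((\<lambda>t. t powr a) has_derivative (\<lambda>h. a * (x \<bullet> x) powr (a - 1) * h)) (at (x \<bullet> x))"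
    by (simp add: has_field_derivative_def)
  have 2: "((\<lambda>x. x \<bullet> x) has_derivative (\<lambda>e. 2 * (x \<bullet> e))) (at x)"
    by (auto intro!: derivative_eq_intros simp: inner_commute)
  from has_derivative_compose[OF 2 1] show ?thesis by (simp add: mult_ac)
qed

text \<open>The properties of the mollifier that enter. \<open>\<beta> > 3\<close> makes the first
  moment finite in the plane, so functions of linear growth can be mollified. The lower bound lets
  the derivatives be bounded by \<rho> itself, and it is the source of the lower bounds on S and on
  \<open>\<phi> - h\<close>.\<close>

locale smooth_kernel =
  fixes \<rho> :: "real^2 \<Rightarrow> real" and \<beta> :: real
  assumes \<beta>: "\<beta> > 3"
    and C2: "Ck_on 2 UNIV \<rho>"
    and pos: "\<rho> x > 0"
    and even: "\<rho> (- x) = \<rho> x"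
    and mass: "(LINT x|lborel. \<rho> x) = 1"
    and lower: "\<exists>c>0. \<forall>x. c * weight \<beta> x \<le> \<rho> x"
    and bound0: "\<exists>C. \<forall>x. \<bar>\<rho> x\<bar> \<le> C * weight \<beta> x"
    and bound1: "\<exists>C. \<forall>x. \<bar>D1 \<rho> e x\<bar> \<le> C * weight \<beta> x"
    and bound2: "\<exists>C. \<forall>x. \<bar>D1 (D1 \<rho> e) e' x\<bar> \<le> C * weight \<beta> x"

text \<open>Beyond \<open>r0\<close> the kernel is an explicit power of the norm, and its
  derivatives decay even faster than \<open>norm x powr (- \<beta>)\<close>; inside, continuity and
  compactness suffice. Writing the tail through \<open>x \<bullet> x\<close> avoids differentiating
  the norm.\<close>

lemma mollifier_smooth_kernel:
  fixes g :: "real \<Rightarrow> real"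
  assumes s: "1/2 < s" "s < 1" and g: "mollifier_profile s m g"
  shows "smooth_kernel (\<lambda>q. g (norm q)) (2 * s + 2)"
proof -
  let ?\<rho> = "\<lambda>q::real^2. g (norm q)"
  define \<beta> where "\<beta> = 2 * s + 2"
  have sm: "Ck_on k UNIV ?\<rho>" for k
  proof -
    have "smooth_on UNIV ?\<rho>" using g unfolding mollifier_profile_def by blast
    then show ?thesis by (simp add: smooth_on_def)
  qed
  obtain d where d: "d > 0" "\<And>r. 0 \<le> r \<Longrightarrow> r \<le> d \<Longrightarrow> g r = 1" using g unfolding mollifier_profile_def by auto
  obtain r0 g0 where r0: "r0 > 2" "g0 > 0" and tail: "\<And>r. r \<ge> r0 \<Longrightarrow> g r = g0 * r powr (- 2 * s - 2)"
    using g unfolding mollifier_profile_def by auto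
  have gpos: "g r > 0" if "r \<ge> 0" for r
  proof -
    have "\<forall>r>0. 0 < g r" using g unfolding mollifier_profile_def by blast
    then show ?thesis using d(2)[of 0] d(1) that by (cases "r = 0") auto
  qed
  have b0: "\<beta> > 0" using s by (simp add: \<beta>_def)
  have rho_tail: "?\<rho> x = g0 * (x \<bullet> x) powr (- s - 1)" if "norm x > r0" for x
  proof -
    have "x \<noteq> 0" using that r0 by auto
    have e: "(- 2 * s - 2) / 2 = - s - 1" by simp
    show ?thesis
      unfolding tail[OF less_imp_le[OF that]] norm_inner_powr[OF \<open>x \<noteq> 0\<close>] e ..
  qed
  have open_out: "open {x :: real^2. norm x > r0}"
    by (intro open_Collect_less continuous_intros)
  have D1_tail: "D1 ?\<rho> e x = g0 * (2 * (- s - 1) * (x \<bullet> x) powr (- s - 2) * (x \<bullet> e))" if "norm x > r0" for x e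
  proof (rule D1_eqI)
    have x0: "x \<noteq> 0" using that r0 by auto
    have "((\<lambda>x. g0 * (x \<bullet> x) powr (- s - 1)) has_derivative (\<lambda>e. g0 * (2 * (- s - 1) * (x \<bullet> x) powr (- s - 1 - 1) * (x \<bullet> e)))) (at x)"
      by (intro has_derivative_mult_right inner_powr_has_derivative x0)
    then have "((\<lambda>x. g0 * (x \<bullet> x) powr (- s - 1)) has_derivative (\<lambda>e. g0 * (2 * (- s - 1) * (x \<bullet> x) powr (- s - 2) * (x \<bullet> e)))) (at x)"
      by (simp add: algebra_simps)
    then show "(?\<rho> has_derivative (\<lambda>e. g0 * (2 * (- s - 1) * (x \<bullet> x) powr (- s - 2) * (x \<bullet> e)))) (at x)"
      by (rule has_derivative_transform_within_open[OF _ open_out]) (use that rho_tail in auto)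
  qed
  have D2_tail: "D1 (D1 ?\<rho> e) e' x = 2 * (- s - 1) * g0 * ((2 * (- s - 2) * (x \<bullet> x) powr (- s - 3) * (x \<bullet> e')) * (x \<bullet> e) + (x \<bullet> x) powr (- s - 2) * (e' \<bullet> e))"
    if "norm x > r0" for x e e'
  proof (rule D1_eqI[where w' = "\<lambda>e'. 2 * (- s - 1) * g0 * ((2 * (- s - 2) * (x \<bullet> x) powr (- s - 3) * (x \<bullet> e')) * (x \<bullet> e) + (x \<bullet> x) powr (- s - 2) * (e' \<bullet> e))"])
    have x0: "x \<noteq> 0" using that r0 by auto
    have "((\<lambda>x. (x \<bullet> x) powr (- s - 2)) has_derivative (\<lambda>e'. 2 * (- s - 2) * (x \<bullet> x) powr (- s - 3) * (x \<bullet> e'))) (at x)"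
      using inner_powr_has_derivative[OF x0, of "- s - 2"] by (simp add: algebra_simps)
    moreover have "((\<lambda>x. x \<bullet> e) has_derivative (\<lambda>e'. e' \<bullet> e)) (at x)"
      by (auto intro!: derivative_eq_intros)
    ultimately have "((\<lambda>x. (x \<bullet> x) powr (- s - 2) * (x \<bullet> e)) has_derivative (\<lambda>e'. (x \<bullet> x) powr (- s - 2) * (e' \<bullet> e) + (2 * (- s - 2) * (x \<bullet> x) powr (- s - 3) * (x \<bullet> e')) * (x \<bullet> e))) (at x)"
      by (rule has_derivative_mult)
    from has_derivative_mult_right[OF this, of "2 * (- s - 1) * g0"]
    have "((\<lambda>x. 2 * (- s - 1) * g0 * ((x \<bullet> x) powr (- s - 2) * (x \<bullet> e))) has_derivative (\<lambda>e'. 2 * (- s - 1) * g0 * ((2 * (- s - 2) * (x \<bullet> x) powr (- s - 3) * (x \<bullet> e')) * (x \<bullet> e) + (x \<bullet> x) powr (- s - 2) * (e' \<bullet> e)))) (at x)"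
      by (simp only: add.commute)
    then show "(D1 ?\<rho> e has_derivative (\<lambda>e'. 2 * (- s - 1) * g0 * ((2 * (- s - 2) * (x \<bullet> x) powr (- s - 3) * (x \<bullet> e')) * (x \<bullet> e) + (x \<bullet> x) powr (- s - 2) * (e' \<bullet> e)))) (at x)"
      by (rule has_derivative_transform_within_open[OF _ open_out]) (use that D1_tail in \<open>auto simp: mult_ac\<close>)
  qed
  \<comment> \<open>Here \<open>norm x > 1\<close>, so surplus negative powers may be
    dropped.\<close>
  have le: "(x \<bullet> x) powr (- s - 2) * norm x \<le> norm x powr (- \<beta>)" "(x \<bullet> x) powr (- s - 2) \<le> norm x powr (- \<beta>)"
    "(x \<bullet> x) powr (- s - 3) * norm x * norm x \<le> norm x powr (- \<beta>)" if "norm x > r0" for x :: "real^2"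
  proof -
    have x0: "x \<noteq> 0" and x1: "norm x \<ge> 1" using that r0 by auto
    have e: "(x \<bullet> x) powr a = norm x powr (2 * a)" for a using norm_inner_powr[OF x0, of "2 * a"] by simp
    have "(x \<bullet> x) powr (- s - 2) * norm x = norm x powr (2 * (- s - 2) + 1)"
      unfolding e using x0 by (simp only: powr_add) simp
    then show "(x \<bullet> x) powr (- s - 2) * norm x \<le> norm x powr (- \<beta>)"
      using x1 by (auto simp: \<beta>_def intro!: powr_mono)
    show "(x \<bullet> x) powr (- s - 2) \<le> norm x powr (- \<beta>)"
      unfolding e using x1 by (auto simp: \<beta>_def intro!: powr_mono)
    have "(x \<bullet> x) powr (- s - 3) * norm x * norm x = norm x powr (2 * (- s - 3) + 1 + 1)"
      unfolding e using x0 by (simp only: powr_add) simp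
    then show "(x \<bullet> x) powr (- s - 3) * norm x * norm x \<le> norm x powr (- \<beta>)"
      using x1 by (auto simp: \<beta>_def intro!: powr_mono)
  qed
  have c0: "continuous_on UNIV ?\<rho>" by (rule Ck_on_imp_continuous_on[OF sm[of 0]])
  have c1: "continuous_on UNIV (D1 ?\<rho> e)" for e by (rule Ck_on_imp_continuous_on[OF Ck_on_D1[OF sm[of "Suc 0"]]])
  have c2: "continuous_on UNIV (D1 (D1 ?\<rho> e) e')" for e e'
    by (rule Ck_on_imp_continuous_on[OF Ck_on_D1[OF Ck_on_D1[OF sm[of "Suc (Suc 0)"]]]])
  have r1: "r0 \<ge> 1" using r0 by simp
  show ?thesis
    unfolding \<beta>_def[symmetric]
  proof
    show "\<beta> > 3" using s by (simp add: \<beta>_def)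
    show "Ck_on 2 UNIV ?\<rho>" by (rule sm)
    show "?\<rho> x > 0" for x by (simp add: gpos)
    show "?\<rho> (- x) = ?\<rho> x" for x by simp
    have rho_out: "?\<rho> x = g0 * norm x powr (- \<beta>)" if "norm x > r0" for x
      using tail[of "norm x"] that by (simp add: \<beta>_def)
    obtain C where "\<And>x. \<bar>?\<rho> x\<bar> \<le> C * weight \<beta> x"
      by (rule bounded_by_weight[OF c0 r1, of \<beta> g0]) (use b0 rho_out r0 in auto)
    then show "\<exists>C. \<forall>x. \<bar>?\<rho> x\<bar> \<le> C * weight \<beta> x" by blast
    show "\<exists>C. \<forall>x. \<bar>D1 ?\<rho> e x\<bar> \<le> C * weight \<beta> x" for e
    proof -
      have "\<bar>D1 ?\<rho> e x\<bar> \<le> (g0 * (2 * (s + 1)) * norm e) * norm x powr (- \<beta>)" if "norm x > r0" for x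
      proof -
        have "\<bar>D1 ?\<rho> e x\<bar> = g0 * (2 * (s + 1)) * (x \<bullet> x) powr (- s - 2) * \<bar>x \<bullet> e\<bar>"
        proof -
          have "\<bar>2 * (- s - 1)\<bar> = 2 * (s + 1)" using s by simp
          then show ?thesis unfolding D1_tail[OF that] abs_mult[of g0] abs_mult[of "2 * (-s - 1) * _"] abs_mult[of "2 * (-s - 1)"]
            using r0 by simp
        qed
        also have "\<dots> \<le> g0 * (2 * (s + 1)) * (x \<bullet> x) powr (- s - 2) * (norm x * norm e)"
          using s r0 by (intro mult_left_mono Cauchy_Schwarz_ineq2) auto
        also have "\<dots> = g0 * (2 * (s + 1)) * norm e * ((x \<bullet> x) powr (- s - 2) * norm x)" by simp
        also have "\<dots> \<le> g0 * (2 * (s + 1)) * norm e * norm x powr (- \<beta>)"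
          using le(1)[OF that] s r0 by (intro mult_left_mono) auto
        finally show ?thesis .
      qed
      then obtain C where "\<And>x. \<bar>D1 ?\<rho> e x\<bar> \<le> C * weight \<beta> x"
        using bounded_by_weight[OF c1 r1 less_imp_le[OF b0]] by blast
      then show ?thesis by blast
    qed
    show "\<exists>C. \<forall>x. \<bar>D1 (D1 ?\<rho> e) e' x\<bar> \<le> C * weight \<beta> x" for e e'
    proof -
      have "\<bar>D1 (D1 ?\<rho> e) e' x\<bar> \<le> (2 * (s + 1) * g0 * (2 * (s + 2) + 1) * norm e * norm e') * norm x powr (- \<beta>)" if "norm x > r0" for x
      proof -
        define A B where "A = (x \<bullet> x) powr (- s - 3)" and "B = (x \<bullet> x) powr (- s - 2)"
        have AB: "A \<ge> 0" "B \<ge> 0" by (auto simp: A_def B_def)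
        have 1: "\<bar>2 * (- s - 2) * A * (x \<bullet> e') * (x \<bullet> e)\<bar> \<le> 2 * (s + 2) * (norm e * norm e') * norm x powr (- \<beta>)"
        proof -
          have "\<bar>2 * (- s - 2) * A * (x \<bullet> e') * (x \<bullet> e)\<bar> = 2 * (s + 2) * A * (\<bar>x \<bullet> e'\<bar> * \<bar>x \<bullet> e\<bar>)"
          proof -
            have "\<bar>2 * (- s - 2)\<bar> = 2 * (s + 2)" using s by simp
            then show ?thesis using AB by (simp add: abs_mult)
          qed
          also have "\<dots> \<le> 2 * (s + 2) * A * ((norm x * norm e') * (norm x * norm e))"
            using s AB by (intro mult_left_mono mult_mono Cauchy_Schwarz_ineq2) auto
          also have "\<dots> = 2 * (s + 2) * (norm e * norm e') * (A * norm x * norm x)" by simp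
          also have "\<dots> \<le> 2 * (s + 2) * (norm e * norm e') * norm x powr (- \<beta>)"
            using le(3)[OF that] s by (intro mult_left_mono) (auto simp: A_def)
          finally show ?thesis .
        qed
        have 2: "\<bar>B * (e' \<bullet> e)\<bar> \<le> norm e * norm e' * norm x powr (- \<beta>)"
        proof -
          have "\<bar>B * (e' \<bullet> e)\<bar> \<le> B * (norm e' * norm e)"
            using AB by (simp add: abs_mult mult_left_mono Cauchy_Schwarz_ineq2)
          also have "\<dots> = norm e * norm e' * B" by simp
          also have "\<dots> \<le> norm e * norm e' * norm x powr (- \<beta>)"
            using le(2)[OF that] by (intro mult_left_mono) (auto simp: B_def)
          finally show ?thesis .
        qed
        have "\<bar>2 * (- s - 2) * A * (x \<bullet> e') * (x \<bullet> e) + B * (e' \<bullet> e)\<bar> \<le> (2 * (s + 2) + 1) * (norm e * norm e') * norm x powr (- \<beta>)"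
          using 1 2 by (simp add: distrib_right) 
        then have "2 * (s + 1) * g0 * \<bar>2 * (- s - 2) * A * (x \<bullet> e') * (x \<bullet> e) + B * (e' \<bullet> e)\<bar> \<le> 2 * (s + 1) * g0 * ((2 * (s + 2) + 1) * (norm e * norm e') * norm x powr (- \<beta>))"
          using s r0 by (intro mult_left_mono) auto
        moreover have "\<bar>D1 (D1 ?\<rho> e) e' x\<bar> = 2 * (s + 1) * g0 * \<bar>2 * (- s - 2) * A * (x \<bullet> e') * (x \<bullet> e) + B * (e' \<bullet> e)\<bar>"
        proof -
          have "\<bar>2 * (- s - 1) * g0\<bar> = 2 * (s + 1) * g0" using s r0 by (simp add: abs_mult)
          then show ?thesis unfolding D2_tail[OF that] A_def[symmetric] B_def[symmetric] by (simp only: abs_mult)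
        qed
        ultimately show ?thesis by (simp only: mult.assoc)
      qed
      then obtain C where "\<And>x. \<bar>D1 (D1 ?\<rho> e) e' x\<bar> \<le> C * weight \<beta> x"
        using bounded_by_weight[OF c2 r1 less_imp_le[OF b0]] by blast
      then show ?thesis by blast
    qed
    show "\<exists>c>0. \<forall>x. c * weight \<beta> x \<le> ?\<rho> x"
    proof -
      \<comment> \<open>The quotient of weight and kernel is continuous and at most
        \<open>1 / g0\<close> in the tail, hence bounded.\<close>
      have cq: "continuous_on UNIV (\<lambda>x. weight \<beta> x / ?\<rho> x)"
        using gpos by (intro continuous_on_divide continuous_weight c0) (auto simp: less_imp_neq[symmetric])
      have "\<bar>weight \<beta> x / ?\<rho> x\<bar> \<le> (1 / g0) * norm x powr (- 0)" if "norm x > r0" for x :: "real^2"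
      proof -
        have nx: "norm x > 0" using that r0 by linarith
        have "weight \<beta> x \<le> norm x powr (- \<beta>)" unfolding weight_def using b0 nx by (intro powr_mono2') auto
        then have "weight \<beta> x / ?\<rho> x \<le> norm x powr (- \<beta>) / ?\<rho> x" using gpos[of "norm x"] by (intro divide_right_mono) auto
        also have "\<dots> = 1 / g0" unfolding rho_out[OF that] using nx by simp
        finally show ?thesis using gpos[of "norm x"] weight_pos[of \<beta> x] nx by simp
      qed
      then obtain C where C: "\<And>x::real^2. \<bar>weight \<beta> x / ?\<rho> x\<bar> \<le> C * weight 0 x"
        using bounded_by_weight[OF cq r1 order_refl] by blast
      have "weight \<beta> x \<le> C * ?\<rho> x" for x :: "real^2"
      proof -
        have "1 + norm x > 0" using norm_ge_zero[of x] by linarith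
        then have "weight \<beta> x / ?\<rho> x \<le> C" using C[of x] gpos[of "norm x"] weight_pos[of \<beta> x]
          by (simp add: weight_def[of 0])
        then show ?thesis using gpos[of "norm x"] by (simp add: divide_le_eq)
      qed
      moreover from this[of 0] have "C > 0" using weight_pos[of \<beta> "0::real^2"] gpos[of 0]
        by (metis less_le_trans norm_zero order_refl zero_less_mult_pos2)
      ultimately show ?thesis by (intro exI[of _ "1/C"]) (auto simp: divide_simps mult.commute)
    qed
    show "(LINT x|lborel. ?\<rho> x) = 1"
    proof -
      \<comment> \<open>\<open>g\<close> is unconstrained on negative numbers; \<open>G r\<close>
        equals \<open>g \<bar>r\<bar>\<close>, a continuous even extension and hence
        measurable.\<close>
      define G where "G = (\<lambda>r. ?\<rho> (r *\<^sub>R axis 1 1))"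
      have Gc: "continuous_on UNIV G" unfolding G_def by (intro continuous_on_compose2[OF c0] continuous_intros) auto
      have Gm [measurable]: "G \<in> borel_measurable borel" by (rule borel_measurable_continuous_onI[OF Gc])
      have Gg: "G r = g r" if "r \<ge> 0" for r using that by (simp add: G_def)
      have L: "2 * pi * (LINT r:{0..}|lborel. r * g r) = 1" using g unfolding mollifier_profile_def by blast
      have eq: "(LINT r:{0..}|lborel. r * g r) = (LINT r|lborel. indicator {0..} r * (r * G r))"
        unfolding set_lebesgue_integral_def by (intro Bochner_Integration.integral_cong) (auto simp: indicator_def Gg)
      \<comment> \<open>A non-integrable function would have integral 0, contradicting the
        normalisation.\<close>
      have int: "integrable lborel (\<lambda>r. indicator {0..} r * (r * G r))"
        using L not_integrable_integral_eq[of lborel "\<lambda>r. indicator {0..} r * (r * G r)"] unfolding eq by fastforce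
      have nn: "0 \<le> indicator {0..} r * (r * G r)" for r using gpos[of r] Gg[of r] by (auto simp: indicator_def)
      have "(\<integral>\<^sup>+x. ennreal (?\<rho> x) \<partial>lborel) = (\<integral>\<^sup>+x. ennreal (G (norm (x::real^2))) \<partial>lborel)"
        by (intro nn_integral_cong) (simp add: Gg)
      also have "\<dots> = (\<integral>\<^sup>+r. ennreal (real DIM(real^2) * unit_ball_vol (real DIM(real^2)) * r ^ (DIM(real^2) - 1)) * indicator {0..} r * ennreal (G r) \<partial>lborel)"
        by (rule nn_integral_radial) measurable
      also have "\<dots> = (\<integral>\<^sup>+r. ennreal (2 * pi * (indicator {0..} r * (r * G r))) \<partial>lborel)"
      proof (intro nn_integral_cong)
        fix r :: real
        show "ennreal (real DIM(real^2) * unit_ball_vol (real DIM(real^2)) * r ^ (DIM(real^2) - 1)) * indicator {0..} r * ennreal (G r)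
          = ennreal (2 * pi * (indicator {0..} r * (r * G r)))"
          using gpos[of r] Gg[of r] by (auto simp: indicator_def ennreal_mult[symmetric] unit_ball_vol_2 mult_ac)
      qed
      also have "\<dots> = ennreal (LINT r|lborel. 2 * pi * (indicator {0..} r * (r * G r)))"
        using int nn by (intro nn_integral_eq_integral) auto
      also have "(LINT r|lborel. 2 * pi * (indicator {0..} r * (r * G r))) = 1"
        using L unfolding eq by simp
      finally have "(\<integral>\<^sup>+x. ennreal (?\<rho> x) \<partial>lborel) = 1" by simp
      then show ?thesis
        using gpos borel_measurable_continuous_onI[OF c0]
        by (subst integral_eq_nn_integral) (simp_all add: less_imp_le)
    qed
  qed
qed

section \<open>The mollified pyramid\<close>

lemma AE_inner_neq:
  fixes a :: "'a::euclidean_space"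
  assumes "a \<noteq> 0"
  shows "AE y in lborel. a \<bullet> y \<noteq> b"
proof (rule AE_I')
  have "negligible {y. a \<bullet> y = b}" using assms by (simp add: negligible_hyperplane)
  moreover have "{y. a \<bullet> y = b} \<in> sets borel" by (simp add: closed_hyperplane)
  ultimately show "{y. a \<bullet> y = b} \<in> null_sets lborel"
    by (simp add: negligible_iff_null_sets null_sets_completion_iff2 null_sets_def)
qed auto

text \<open>The pyramid as a maximum of linear functions whose gradients are distinct and of equal
  length. Equal length makes \<open>m\<^sup>2 - (norm (G q))\<^sup>2\<close> a variance, see
  \<open>sigma_eq\<close>, and makes moving along \<open>v i\<close> favour facet i, see
  \<open>inner_v\<close>.\<close>

locale pyramid_kernel = smooth_kernel \<rho> \<beta> for \<rho> :: "real^2 \<Rightarrow> real" and \<beta> :: real +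
  fixes I :: "nat set" and v :: "nat \<Rightarrow> real^2" and m :: real
  assumes finI: "finite I" and inj: "inj_on v I" and norm_v: "\<And>i. i \<in> I \<Longrightarrow> norm (v i) = m"
    and two: "\<exists>i\<in>I. \<exists>j\<in>I. i \<noteq> j"
begin

definition h :: "real^2 \<Rightarrow> real" where "h q = Max ((\<lambda>i. v i \<bullet> q) ` I)"
text \<open>
  Ties between facets go to the least index, so that the weights \<open>w i\<close> add up to one everywhere
  and \<open>P i\<close> is a \<open>C\<^sup>2\<close> partition of unity, with \<open>G\<close> the gradient of \<open>\<phi>\<close>.
\<close>

definition sel :: "real^2 \<Rightarrow> nat" where "sel y = (LEAST i. i \<in> I \<and> v i \<bullet> y = h y)"
definition w :: "nat \<Rightarrow> real^2 \<Rightarrow> real" where "w i y = of_bool (sel y = i)"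
definition P :: "nat \<Rightarrow> real^2 \<Rightarrow> real" where "P i = convolve \<rho> (w i)"
definition G :: "real^2 \<Rightarrow> real^2" where "G q = (\<Sum>i\<in>I. P i q *\<^sub>R v i)"
definition \<phi> :: "real^2 \<Rightarrow> real" where "\<phi> = convolve \<rho> h"

section \<open>Facets and the partition of unity\<close>

lemma I_ne: "I \<noteq> {}" using two by auto

lemma h_ge: "i \<in> I \<Longrightarrow> v i \<bullet> y \<le> h y"
  unfolding h_def by (rule Max_ge) (auto simp: finI)

lemma sel: "sel y \<in> I" "v (sel y) \<bullet> y = h y"
proof -
  have "h y \<in> (\<lambda>i. v i \<bullet> y) ` I" unfolding h_def by (rule Max_in) (auto simp: finI I_ne)
  then have "\<exists>i. i \<in> I \<and> v i \<bullet> y = h y" by auto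
  from LeastI_ex[OF this] show "sel y \<in> I" "v (sel y) \<bullet> y = h y" unfolding sel_def by auto
qed

lemma sel_max: "i \<in> I \<Longrightarrow> v i \<bullet> y \<le> v (sel y) \<bullet> y"
  using h_ge sel(2) by metis

lemma sel_eqI:
  assumes "j \<in> I" "\<And>i. i \<in> I \<Longrightarrow> i \<noteq> j \<Longrightarrow> v i \<bullet> y < v j \<bullet> y"
  shows "sel y = j"
  using assms sel(1)[of y] sel_max[OF assms(1), of y] by force

text \<open>Turns the least maximising index into finitely many linear inequalities, from which
  measurability of the sectors follows.\<close>

lemma sel_iff: "sel y = i \<longleftrightarrow> i \<in> I \<and> (\<forall>j\<in>I. v j \<bullet> y \<le> v i \<bullet> y) \<and> (\<forall>j\<in>I. j < i \<longrightarrow> v j \<bullet> y < v i \<bullet> y)"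
proof
  assume i: "sel y = i"
  have "v j \<bullet> y < v i \<bullet> y" if "j \<in> I" "j < i" for j
  proof -
    have "v j \<bullet> y \<noteq> h y" using that i not_less_Least[of j "\<lambda>i. i \<in> I \<and> v i \<bullet> y = h y"] unfolding sel_def by auto
    then show ?thesis using h_ge[OF that(1), of y] sel(2)[of y] i by simp
  qed
  then show "i \<in> I \<and> (\<forall>j\<in>I. v j \<bullet> y \<le> v i \<bullet> y) \<and> (\<forall>j\<in>I. j < i \<longrightarrow> v j \<bullet> y < v i \<bullet> y)"
    using i sel(1)[of y] sel_max by auto
next
  assume r: "i \<in> I \<and> (\<forall>j\<in>I. v j \<bullet> y \<le> v i \<bullet> y) \<and> (\<forall>j\<in>I. j < i \<longrightarrow> v j \<bullet> y < v i \<bullet> y)"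
  have "v i \<bullet> y = h y" using r sel[of y] h_ge[of i y] by (metis order_antisym)
  moreover have "\<not> sel y < i" using r sel[of y] calculation by (metis less_irrefl)
  moreover have "sel y \<le> i" unfolding sel_def by (rule Least_le) (use r calculation in auto)
  ultimately show "sel y = i" by simp
qed

lemma sel_sets: "{y. sel y = i} \<in> sets borel"
proof (cases "i \<in> I")
  case True
  have "{y. sel y = i} = (\<Inter>j\<in>I. {y. v j \<bullet> y \<le> v i \<bullet> y}) \<inter> (\<Inter>j\<in>I. {y. j < i \<longrightarrow> v j \<bullet> y < v i \<bullet> y})"
    using True by (auto simp: sel_iff)
  also have "\<dots> \<in> sets borel"
    using finI I_ne by (intro sets.Int sets.finite_INT) auto
  finally show ?thesis .
next
  case False
  then have "{y. sel y = i} = {}" by (auto simp: sel_iff)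
  then show ?thesis by (metis sets.empty_sets)
qed

lemma w_measurable [measurable]: "w i \<in> borel_measurable borel"
proof -
  have "w i = indicator {y. sel y = i}" by (auto simp: w_def indicator_def fun_eq_iff)
  then show ?thesis using sel_sets[of i] by simp
qed

lemma w_bound: "\<bar>w i y\<bar> \<le> 1" "0 \<le> w i y" "w i y \<le> 1"
  by (simp_all add: w_def)

lemma sum_w: "(\<Sum>i\<in>I. w i y) = 1"
  using sel(1)[of y] finI by (simp add: w_def of_bool_def sum.delta)

lemma \<rho>_cont: "continuous_on UNIV \<rho>" by (rule Ck_on_imp_continuous_on[OF C2])

lemma \<rho>_measurable [measurable]: "\<rho> \<in> borel_measurable borel"
  by (rule borel_measurable_continuous_onI[OF \<rho>_cont])

lemma \<beta>_dim: "\<beta> > real DIM(real^2)" using \<beta> by simp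

lemma \<rho>_int: "integrable lborel \<rho>"
  using mass not_integrable_integral_eq by fastforce

lemma P_integrable: "integrable lborel (\<lambda>y. \<rho> (q - y) * w i y)"
proof -
  obtain C where "\<And>x. \<bar>\<rho> x\<bar> \<le> C * weight \<beta> x" using bound0 by blast
  then show ?thesis by (intro integrable_convolve[OF \<beta>_dim]) (auto simp: w_bound)
qed

lemma P_nonneg: "P i q \<ge> 0"
  unfolding P_def convolve_def by (intro integral_nonneg_AE AE_I2 mult_nonneg_nonneg less_imp_le[OF pos] w_bound)

lemma sum_P: "(\<Sum>i\<in>I. P i q) = 1"
proof -
  have "(\<Sum>i\<in>I. P i q) = (LINT y|lborel. (\<Sum>i\<in>I. \<rho> (q - y) * w i y))"
    unfolding P_def convolve_def using P_integrable by (simp add: Bochner_Integration.integral_sum)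
  also have "\<dots> = (LINT y|lborel. \<rho> (q - y))"
    by (simp add: sum_distrib_left[symmetric] sum_w)
  also have "\<dots> = 1" by (simp add: integral_reflect mass)
  finally show ?thesis .
qed

lemma P_le_1: "i \<in> I \<Longrightarrow> P i q \<le> 1"
  using sum_P[of q] member_le_sum[of i I "\<lambda>i. P i q"] finI P_nonneg by auto

lemma kernel_le:
  assumes "\<exists>C. \<forall>x. \<bar>\<kappa> x\<bar> \<le> C * weight \<beta> x"
  obtains K where "K \<ge> 0" "\<And>x. \<bar>\<kappa> x\<bar> \<le> K * \<rho> x"
proof -
  obtain C where C: "\<And>x. \<bar>\<kappa> x\<bar> \<le> C * weight \<beta> x" using assms by blast
  obtain c where c: "c > 0" "\<And>x. c * weight \<beta> x \<le> \<rho> x" using lower by blast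
  have C0: "C \<ge> 0" using C[of 0] weight_pos[of \<beta> "0::real^2"] by (metis abs_ge_zero order_trans zero_le_mult_iff not_less)
  show thesis
  proof (rule that)
    show "C / c \<ge> 0" using C0 c by simp
    have "C * weight \<beta> x = C / c * (c * weight \<beta> x)" for x using c by simp
    also have "\<dots> x \<le> C / c * \<rho> x" for x using C0 c by (intro mult_left_mono) auto
    finally show "\<bar>\<kappa> x\<bar> \<le> C / c * \<rho> x" for x using C[of x] order_trans by blast
  qed
qed

text \<open>Domination by \<rho> survives convolution because \<open>w i\<close> is nonnegative. In
  this way the smallness of \<open>P i\<close> on foreign facets passes to its derivatives without a
  separate estimate.\<close>

lemma convolve_le_P:
  assumes K: "\<And>x. \<bar>\<kappa> x\<bar> \<le> K * \<rho> x" and [measurable]: "\<kappa> \<in> borel_measurable borel"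
  shows "\<bar>convolve \<kappa> (w i) q\<bar> \<le> K * P i q"
proof -
  have b: "\<bar>\<kappa> (q - y) * w i y\<bar> \<le> K * (\<rho> (q - y) * w i y)" for y
    using K[of "q - y"] w_bound(2)[of i y] by (simp add: abs_mult mult_right_mono mult.assoc[symmetric])
  have int: "integrable lborel (\<lambda>y. K * (\<rho> (q - y) * w i y))" using P_integrable by simp
  have "integrable lborel (\<lambda>y. \<kappa> (q - y) * w i y)"
    by (rule Bochner_Integration.integrable_bound[OF int]) (auto intro!: AE_I2 order_trans[OF b])
  then have "\<bar>convolve \<kappa> (w i) q\<bar> \<le> (LINT y|lborel. K * (\<rho> (q - y) * w i y))"
    unfolding convolve_def by (rule integral_abs_bound_integral[OF _ int b])
  then show ?thesis by (simp add: P_def convolve_def)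
qed

lemma Ck1: "Ck_on (Suc (Suc 0)) UNIV \<rho>" using C2 by (simp only: numeral_2_eq_2)

lemma D1_cont: "continuous_on UNIV (D1 \<rho> e)" "continuous_on UNIV (D1 (D1 \<rho> e) e')"
  using Ck_on_imp_continuous_on[OF Ck_on_D1[OF Ck1]] Ck_on_imp_continuous_on[OF Ck_on_D1[OF Ck_on_D1[OF Ck1]]] by auto

lemma P_has_derivative: "(P i has_derivative (\<lambda>e. convolve (D1 \<rho> e) (w i) q)) (at q)"
proof -
  obtain C where C: "\<And>x. \<bar>\<rho> x\<bar> \<le> C * weight \<beta> x" using bound0 by blast
  show ?thesis
    unfolding P_def
    by (rule convolve_has_derivative[OF \<beta>_dim w_measurable w_bound(1) C has_derivative_D1[OF Ck1]])
       (auto intro: D1_cont bound1)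
qed

lemma D1P_has_derivative: "(convolve (D1 \<rho> e) (w i) has_derivative (\<lambda>e'. convolve (D1 (D1 \<rho> e) e') (w i) q)) (at q)"
proof -
  obtain C where C: "\<And>x. \<bar>D1 \<rho> e x\<bar> \<le> C * weight \<beta> x" using bound1 by blast
  show ?thesis
    by (rule convolve_has_derivative[OF \<beta>_dim w_measurable w_bound(1) C has_derivative_D1[OF Ck_on_D1[OF Ck1]]])
       (auto intro: D1_cont bound2)
qed

lemma P_Ck2: "Ck_on 2 UNIV (P i)"
  unfolding numeral_2_eq_2
proof (rule Ck_on_SucI[OF open_UNIV P_has_derivative], rule Ck_on_SucI[OF open_UNIV D1P_has_derivative])
  fix e e'
  obtain C where C: "\<And>x. \<bar>D1 (D1 \<rho> e) e' x\<bar> \<le> C * weight \<beta> x" using bound2 by blast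
  show "Ck_on 0 UNIV (convolve (D1 (D1 \<rho> e) e') (w i))"
    using continuous_on_convolve[OF \<beta>_dim w_measurable w_bound(1) C D1_cont(2)] by simp
qed

lemma linear_bound:
  fixes f :: "real^2 \<Rightarrow> real"
  assumes lin: "linear f" and b: "\<And>b. b \<in> Basis \<Longrightarrow> \<bar>f b\<bar> \<le> K"
  shows "\<bar>f e\<bar> \<le> 2 * K * norm e"
proof -
  have "f e = (\<Sum>b\<in>Basis. (e \<bullet> b) * f b)"
    using linear_sum[OF lin, of "\<lambda>b. (e \<bullet> b) *\<^sub>R b" Basis] by (simp add: euclidean_representation linear_cmul[OF lin])
  then have "\<bar>f e\<bar> \<le> (\<Sum>b\<in>Basis. \<bar>e \<bullet> b\<bar> * \<bar>f b\<bar>)"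
    by (simp add: abs_mult[symmetric])
  also have "\<dots> \<le> (\<Sum>b\<in>(Basis::(real^2) set). norm e * K)"
    by (intro sum_mono mult_mono b) (auto simp: Basis_le_norm)
  finally show ?thesis by (simp add: mult_ac)
qed

lemma P_derivative_bounds:
  obtains K where "K \<ge> 0" "\<And>i e q. \<bar>D1 (P i) e q\<bar> \<le> K * norm e * P i q"
    "\<And>i b e q. b \<in> Basis \<Longrightarrow> \<bar>D1 (D1 (P i) b) e q\<bar> \<le> K * norm e * P i q"
proof -
  have "\<exists>K. \<forall>e. K e \<ge> 0 \<and> (\<forall>x. \<bar>D1 \<rho> e x\<bar> \<le> K e * \<rho> x)"
  proof (rule choice, rule allI)
    fix e obtain K where "K \<ge> 0" "\<And>x. \<bar>D1 \<rho> e x\<bar> \<le> K * \<rho> x" by (rule kernel_le[OF bound1[of e]]) blast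
    then show "\<exists>K. K \<ge> 0 \<and> (\<forall>x. \<bar>D1 \<rho> e x\<bar> \<le> K * \<rho> x)" by blast
  qed
  then obtain K1 where K1: "\<And>e. K1 e \<ge> 0" "\<And>e x. \<bar>D1 \<rho> e x\<bar> \<le> K1 e * \<rho> x" by blast
  have "\<exists>K. \<forall>p. K p \<ge> 0 \<and> (\<forall>x. \<bar>D1 (D1 \<rho> (fst p)) (snd p) x\<bar> \<le> K p * \<rho> x)"
  proof (rule choice, rule allI)
    fix p obtain K where "K \<ge> 0" "\<And>x. \<bar>D1 (D1 \<rho> (fst p)) (snd p) x\<bar> \<le> K * \<rho> x" by (rule kernel_le[OF bound2[of "fst p" "snd p"]]) blast
    then show "\<exists>K. K \<ge> 0 \<and> (\<forall>x. \<bar>D1 (D1 \<rho> (fst p)) (snd p) x\<bar> \<le> K * \<rho> x)" by blast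
  qed
  then obtain K2 where K2: "\<And>p. K2 p \<ge> 0" "\<And>p x. \<bar>D1 (D1 \<rho> (fst p)) (snd p) x\<bar> \<le> K2 p * \<rho> x" by blast
  \<comment> \<open>A sum over all basis directions dominates each of the constants;
    \<open>linear_bound\<close> then supplies the remaining directions.\<close>
  define K where "K = (\<Sum>b\<in>Basis. K1 b) + (\<Sum>b\<in>Basis. \<Sum>b'\<in>Basis. K2 (b, b'))"
  have s1: "K1 b \<le> K" if "b \<in> Basis" for b
  proof -
    have "K1 b \<le> (\<Sum>b\<in>Basis. K1 b)" using K1(1) that by (intro member_le_sum) auto
    moreover have "(\<Sum>b\<in>(Basis::(real^2) set). \<Sum>b'\<in>(Basis::(real^2) set). K2 (b, b')) \<ge> 0" by (intro sum_nonneg K2(1))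
    ultimately show ?thesis by (simp add: K_def)
  qed
  have s2: "K2 (b, b') \<le> K" if "b \<in> Basis" "b' \<in> Basis" for b b'
  proof -
    have "K2 (b, b') \<le> (\<Sum>b'\<in>Basis. K2 (b, b'))" using K2(1) that(2) by (intro member_le_sum) auto
    also have "\<dots> \<le> (\<Sum>b\<in>Basis. \<Sum>b'\<in>Basis. K2 (b, b'))"
      using that(1) K2(1) by (intro member_le_sum[of b Basis "\<lambda>b. \<Sum>b'\<in>Basis. K2 (b, b')"] sum_nonneg) auto
    moreover have "(\<Sum>b\<in>(Basis::(real^2) set). K1 b) \<ge> 0" by (intro sum_nonneg K1(1))
    ultimately show ?thesis by (simp add: K_def)
  qed
  have K0: "K \<ge> 0" unfolding K_def by (intro add_nonneg_nonneg sum_nonneg K1 K2)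
  have D1P: "D1 (P i) e = convolve (D1 \<rho> e) (w i)" for i e
    by (rule ext) (rule D1_eqI[OF P_has_derivative])
  have D2P: "D1 (D1 (P i) e) e' = convolve (D1 (D1 \<rho> e) e') (w i)" for i e e'
    unfolding D1P by (rule ext) (rule D1_eqI[OF D1P_has_derivative])
  have m: "D1 \<rho> e \<in> borel_measurable borel" "D1 (D1 \<rho> e) e' \<in> borel_measurable borel" for e e'
    by (rule borel_measurable_continuous_onI[OF D1_cont(1)], rule borel_measurable_continuous_onI[OF D1_cont(2)])
  show thesis
  proof (rule that[of "2 * K"])
    fix i e q
    have "\<bar>convolve (D1 \<rho> e) (w i) q\<bar> \<le> 2 * (K * P i q) * norm e"
    proof (rule linear_bound[of "\<lambda>e. convolve (D1 \<rho> e) (w i) q"])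
      show "linear (\<lambda>e. convolve (D1 \<rho> e) (w i) q)" using P_has_derivative has_derivative_linear by blast
      fix b :: "real^2" assume b: "b \<in> Basis"
      have "\<bar>convolve (D1 \<rho> b) (w i) q\<bar> \<le> K1 b * P i q" by (rule convolve_le_P[OF K1(2) m(1)])
      also have "\<dots> \<le> K * P i q" by (rule mult_right_mono[OF s1[OF b] P_nonneg])
      finally show "\<bar>convolve (D1 \<rho> b) (w i) q\<bar> \<le> K * P i q" .
    qed
    then show "\<bar>D1 (P i) e q\<bar> \<le> 2 * K * norm e * P i q" unfolding D1P by (simp add: mult_ac)
  next
    fix i b e q assume b: "b \<in> (Basis :: (real^2) set)"
    have "\<bar>convolve (D1 (D1 \<rho> b) e) (w i) q\<bar> \<le> 2 * (K * P i q) * norm e"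
    proof (rule linear_bound[of "\<lambda>e. convolve (D1 (D1 \<rho> b) e) (w i) q"])
      show "linear (\<lambda>e. convolve (D1 (D1 \<rho> b) e) (w i) q)" using D1P_has_derivative has_derivative_linear by blast
      fix b' :: "real^2" assume b': "b' \<in> Basis"
      have "\<bar>convolve (D1 (D1 \<rho> b) b') (w i) q\<bar> \<le> K2 (b, b') * P i q"
        using K2(2)[of "(b, b')"] by (intro convolve_le_P m(2)) auto
      also have "\<dots> \<le> K * P i q" by (rule mult_right_mono[OF s2[OF b b'] P_nonneg])
      finally show "\<bar>convolve (D1 (D1 \<rho> b) b') (w i) q\<bar> \<le> K * P i q" .
    qed
    then show "\<bar>D1 (D1 (P i) b) e q\<bar> \<le> 2 * K * norm e * P i q" unfolding D2P by (simp add: mult_ac)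
  qed (use K0 in simp)
qed

section \<open>The mollified pyramid and its gradient\<close>

lemma m_pos: "m > 0"
proof -
  obtain i j where ij: "i \<in> I" "j \<in> I" "i \<noteq> j" using two by blast
  have "m \<ge> 0" using norm_v[OF ij(1)] norm_ge_zero by metis
  moreover have "m \<noteq> 0" using norm_v[OF ij(1)] norm_v[OF ij(2)] inj ij by (auto simp: inj_on_def)
  ultimately show ?thesis by simp
qed

lemma h_Lipschitz: "\<bar>h x - h y\<bar> \<le> m * norm (x - y)"
proof -
  have *: "h x - h y \<le> m * norm (x - y)" for x y
  proof -
    have "h x - h y \<le> v (sel x) \<bullet> x - v (sel x) \<bullet> y" using sel[of x] h_ge[of "sel x" y] by simp
    also have "\<dots> = v (sel x) \<bullet> (x - y)" by (simp add: inner_diff_right)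
    also have "\<dots> \<le> norm (v (sel x)) * norm (x - y)" by (rule norm_cauchy_schwarz)
    finally show ?thesis using norm_v[OF sel(1)] by simp
  qed
  show ?thesis using *[of x y] *[of y x] by (simp add: norm_minus_commute abs_le_iff)
qed

lemma h_cont: "continuous_on UNIV h"
proof -
  have "m-lipschitz_on UNIV h"
    using h_Lipschitz m_pos by (intro lipschitz_onI) (auto simp: dist_norm)
  then show ?thesis by (rule lipschitz_on_continuous_on)
qed

lemma h_measurable [measurable]: "h \<in> borel_measurable borel"
  by (rule borel_measurable_continuous_onI[OF h_cont])

lemma h_0: "h 0 = 0" using sel(2)[of 0] by simp

lemma \<rho>_first_moment: "integrable lborel (\<lambda>y. \<rho> y * norm y)"
proof -
  obtain C where C: "\<And>x. \<bar>\<rho> x\<bar> \<le> C * weight \<beta> x" using bound0 by blast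
  show ?thesis
  proof (rule Bochner_Integration.integrable_bound)
  show "integrable lborel (\<lambda>y::real^2. C * weight (\<beta> - 1) y)"
    using integrable_weight[where 'a = "real^2", of "\<beta> - 1"] \<beta> by simp
  show "AE y in lborel. norm (\<rho> y * norm y) \<le> norm (C * weight (\<beta> - 1) y)"
  proof (rule AE_I2)
    fix y :: "real^2"
    have p: "1 + norm y > 0" using norm_ge_zero[of y] by linarith
    have "weight \<beta> y * (1 + norm y) = weight (\<beta> - 1) y"
      using p powr_add[of "1 + norm y" "-\<beta>" 1] by (simp add: weight_def)
    moreover have "weight \<beta> y * norm y \<le> weight \<beta> y * (1 + norm y)"
      using weight_pos[of \<beta> y] by (intro mult_left_mono) auto
    ultimately have le: "weight \<beta> y * norm y \<le> weight (\<beta> - 1) y" by simp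
    have C0: "C \<ge> 0" using C[of 0] weight_pos[of \<beta> "0::real^2"] by (metis abs_ge_zero order_trans zero_le_mult_iff not_less)
    have "norm (\<rho> y * norm y) \<le> C * weight \<beta> y * norm y" using C[of y] by (simp add: abs_mult mult_right_mono)
    also have "\<dots> \<le> C * weight (\<beta> - 1) y" using le C0 by (simp add: mult.assoc mult_left_mono)
    finally show "norm (\<rho> y * norm y) \<le> norm (C * weight (\<beta> - 1) y)" by simp
  qed
  qed simp
qed

lemma h_kernel_integrable: "integrable lborel (\<lambda>y. \<rho> y * h (q - y))"
proof (rule Bochner_Integration.integrable_bound)
  show "integrable lborel (\<lambda>y. m * norm q * \<rho> y + m * (\<rho> y * norm y))"
    using \<rho>_int \<rho>_first_moment by simp
  show "AE y in lborel. norm (\<rho> y * h (q - y)) \<le> norm (m * norm q * \<rho> y + m * (\<rho> y * norm y))"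
  proof (rule AE_I2)
    fix y
    have "\<bar>h (q - y)\<bar> \<le> m * norm (q - y)" using h_Lipschitz[of "q - y" 0] h_0 by simp
    also have "\<dots> \<le> m * (norm q + norm y)" using m_pos norm_triangle_ineq4[of q y] by simp
    finally have "\<rho> y * \<bar>h (q - y)\<bar> \<le> \<rho> y * (m * (norm q + norm y))" using pos[of y] by simp
    then show "norm (\<rho> y * h (q - y)) \<le> norm (m * norm q * \<rho> y + m * (\<rho> y * norm y))"
      using pos[of y] by (simp add: abs_mult algebra_simps)
  qed
qed simp

lemma convolve_\<rho>: 
  assumes [measurable]: "u \<in> borel_measurable borel"
  shows "convolve \<rho> u q = (LINT y|lborel. \<rho> y * u (q - y))"
  unfolding convolve_def using integral_reflect[of "\<lambda>y. \<rho> y * u (q - y)" q] by simp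

lemma h_has_derivative:
  assumes "\<And>i j. i \<in> I \<Longrightarrow> j \<in> I \<Longrightarrow> i \<noteq> j \<Longrightarrow> v i \<bullet> x \<noteq> v j \<bullet> x"
  shows "(h has_derivative (\<lambda>e. v (sel x) \<bullet> e)) (at x)"
proof (rule has_derivative_transform_within_open)
  let ?j = "sel x"
  let ?U = "\<Inter>i\<in>I - {?j}. {y. v i \<bullet> y < v ?j \<bullet> y}"
  show "open ?U" using finI by (intro open_INT) (auto intro!: open_Collect_less continuous_intros)
  show "x \<in> ?U" using sel_max[of _ x] assms sel(1)[of x] by (force simp: less_le)
  show "((\<lambda>y. v ?j \<bullet> y) has_derivative (\<lambda>e. v ?j \<bullet> e)) (at x)" by (auto intro!: derivative_eq_intros)
  show "v ?j \<bullet> y = h y" if "y \<in> ?U" for y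
    using sel_eqI[OF sel(1), of x y] that sel(2)[of y] by auto
qed

text \<open>Here the translation is moved onto h, so that differentiating produces the gradient of
  the facet at \<open>q - y\<close>; averaging it with \<rho> gives the weights \<open>P i\<close>.
  The points where two facets tie lie on finitely many lines and are negligible.\<close>

lemma \<phi>_has_derivative: "(\<phi> has_derivative (\<lambda>e. G q \<bullet> e)) (at q)"
proof -
  have vw: "v (sel z) \<bullet> e = (\<Sum>i\<in>I. w i z * (v i \<bullet> e))" for z e
    using sel(1)[of z] finI by (simp add: w_def of_bool_def sum.delta if_distrib[of "\<lambda>x. x * _"] cong: if_cong)
  have d: "((\<lambda>q. LINT y|lborel. \<rho> y * h (q - y)) has_derivative (\<lambda>e. LINT y|lborel. \<rho> y * (v (sel (q - y)) \<bullet> e))) (at q)"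
  proof (rule has_derivative_integral_Lipschitz[where B = "\<lambda>y. m * \<rho> y"])
    show "integrable lborel (\<lambda>y. \<rho> y * h (q - y))" for q by (rule h_kernel_integrable)
    show "linear (\<lambda>e. \<rho> y * (v (sel (q - y)) \<bullet> e))" for y
      by (rule linearI) (simp_all add: inner_add_right distrib_left)
    show "(\<lambda>y. \<rho> y * (v (sel (q - y)) \<bullet> e)) \<in> borel_measurable borel" for e
      unfolding vw by measurable
    have "AE y in lborel. (v i - v j) \<bullet> y \<noteq> (v i - v j) \<bullet> q" if "i \<in> I" "j \<in> I" "i \<noteq> j" for i j
      using inj that by (intro AE_inner_neq) (auto simp: inj_on_def)
    then have "AE y in lborel. \<forall>i\<in>I. \<forall>j\<in>I. i \<noteq> j \<longrightarrow> (v i - v j) \<bullet> y \<noteq> (v i - v j) \<bullet> q"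
      using finI by (intro AE_finite_allI) auto
    then show "AE y in lborel. ((\<lambda>q. \<rho> y * h (q - y)) has_derivative (\<lambda>e. \<rho> y * (v (sel (q - y)) \<bullet> e))) (at q)"
    proof eventually_elim
      case (elim y)
      have "(h has_derivative (\<lambda>e. v (sel (q - y)) \<bullet> e)) (at (q - y))"
      proof (rule h_has_derivative, rule notI)
        fix i j assume ij: "i \<in> I" "j \<in> I" "i \<noteq> j" and eq: "v i \<bullet> (q - y) = v j \<bullet> (q - y)"
        have "(v i - v j) \<bullet> y = (v i - v j) \<bullet> q"
          using eq unfolding inner_diff_left inner_diff_right by linarith
        with elim ij show False by blast
      qed
      moreover have "((\<lambda>q. q - y) has_derivative (\<lambda>e. e)) (at q)" by (auto intro!: derivative_eq_intros)
      ultimately have "((\<lambda>q. h (q - y)) has_derivative (\<lambda>e. v (sel (q - y)) \<bullet> e)) (at q)"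
        by (rule has_derivative_compose[rotated])
      then show ?case by (rule has_derivative_mult_right)
    qed
    show "integrable lborel (\<lambda>y. m * \<rho> y)" using \<rho>_int by simp
    fix q' y
    have "\<bar>\<rho> y * h (q' - y) - \<rho> y * h (q - y)\<bar> = \<rho> y * \<bar>h (q' - y) - h (q - y)\<bar>"
      using pos[of y] by (simp add: right_diff_distrib[symmetric] abs_mult)
    also have "\<dots> \<le> \<rho> y * (m * norm (q' - q))"
      using h_Lipschitz[of "q' - y" "q - y"] pos[of y] by simp
    finally show "\<bar>\<rho> y * h (q' - y) - \<rho> y * h (q - y)\<bar> \<le> m * \<rho> y * norm (q' - q)" by (simp add: mult_ac)
  qed
  have "(LINT y|lborel. \<rho> y * (v (sel (q - y)) \<bullet> e)) = G q \<bullet> e" for e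
  proof -
    have i: "integrable lborel (\<lambda>y. \<rho> y * w i (q - y))" for i
      using P_integrable[of q i] integrable_reflect[of "\<lambda>y. \<rho> y * w i (q - y)" q] by simp
    have "(LINT y|lborel. \<rho> y * (v (sel (q - y)) \<bullet> e)) = (LINT y|lborel. (\<Sum>i\<in>I. (v i \<bullet> e) * (\<rho> y * w i (q - y))))"
      unfolding vw by (simp add: sum_distrib_left mult_ac)
    also have "\<dots> = (\<Sum>i\<in>I. (v i \<bullet> e) * P i q)"
      using i by (simp add: P_def convolve_\<rho>)
    finally show ?thesis by (simp add: G_def inner_sum_left mult_ac)
  qed
  moreover have "\<phi> = (\<lambda>q. LINT y|lborel. \<rho> y * h (q - y))"
    by (rule ext) (simp add: \<phi>_def convolve_\<rho>)
  ultimately show ?thesis using d by simp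
qed

text \<open>The slope defect: it would be zero if the gradient were that of a single facet. It is
  comparable to S, see \<open>S_lower\<close> and \<open>S_upper\<close>.\<close>

definition \<sigma> :: "real^2 \<Rightarrow> real" where "\<sigma> q = m\<^sup>2 - (norm (G q))\<^sup>2"

definition gap :: real where "gap = Min ((\<lambda>(i, j). norm (v i - v j)) ` {(i, j). i \<in> I \<and> j \<in> I \<and> i \<noteq> j})"

text \<open>The least lead of the maximal facet over the others. Since differences of facet
  gradients have lengths between \<open>gap\<close> and \<open>2 * m\<close>, it is comparable to
  the distance from q to the boundary of its sector.\<close>

definition depth :: "real^2 \<Rightarrow> real" where
  "depth q = Min ((\<lambda>i. (v (sel q) - v i) \<bullet> q) ` (I - {sel q}))"

text \<open>
  The order of the mass of a planar kernel decaying like \<open>|x| powr (- \<beta>)\<close> outside a ball of radius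
  \<open>depth q\<close>; all quantities measuring the deviation of \<open>\<phi>\<close> from a linear function at \<open>q\<close> are
  compared to it.
\<close>

definition decay :: "real^2 \<Rightarrow> real" where "decay q = (1 + depth q) powr (2 - \<beta>)"

section \<open>Lower bounds of order \<open>decay\<close>\<close>

lemma gap: "gap > 0" "i \<in> I \<Longrightarrow> j \<in> I \<Longrightarrow> i \<noteq> j \<Longrightarrow> gap \<le> norm (v i - v j)"
proof -
  let ?A = "{(i, j). i \<in> I \<and> j \<in> I \<and> i \<noteq> j}"
  have fin: "finite ?A" by (rule finite_subset[of _ "I \<times> I"]) (auto simp: finI)
  have ne: "?A \<noteq> {}" using two by auto
  show "gap > 0" unfolding gap_def using fin ne inj by (subst Min_gr_iff) (auto simp: inj_on_def)
  show "i \<in> I \<Longrightarrow> j \<in> I \<Longrightarrow> i \<noteq> j \<Longrightarrow> gap \<le> norm (v i - v j)"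
    unfolding gap_def by (rule Min_le) (use fin in auto)
qed

lemma other_ne: "I - {sel q} \<noteq> {}"
proof -
  obtain i j where "i \<in> I" "j \<in> I" "i \<noteq> j" using two by blast
  then show ?thesis by (cases "i = sel q") auto
qed

lemma depth: "depth q \<ge> 0" "i \<in> I \<Longrightarrow> i \<noteq> sel q \<Longrightarrow> depth q \<le> (v (sel q) - v i) \<bullet> q"
    "\<exists>i\<in>I - {sel q}. depth q = (v (sel q) - v i) \<bullet> q"
proof -
  have fin: "finite ((\<lambda>i. (v (sel q) - v i) \<bullet> q) ` (I - {sel q}))" using finI by simp
  have ne: "(\<lambda>i. (v (sel q) - v i) \<bullet> q) ` (I - {sel q}) \<noteq> {}" using other_ne by simp
  show "depth q \<ge> 0" unfolding depth_def using fin ne sel_max[of _ q] by (subst Min_ge_iff) (auto simp: inner_diff_left)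
  show "i \<in> I \<Longrightarrow> i \<noteq> sel q \<Longrightarrow> depth q \<le> (v (sel q) - v i) \<bullet> q"
    unfolding depth_def by (rule Min_le[OF fin]) auto
  show "\<exists>i\<in>I - {sel q}. depth q = (v (sel q) - v i) \<bullet> q"
    using Min_in[OF fin ne] unfolding depth_def by auto
qed

lemma norm_diff_le: "i \<in> I \<Longrightarrow> j \<in> I \<Longrightarrow> norm (v i - v j) \<le> 2 * m"
  using norm_triangle_ineq4[of "v i" "v j"] norm_v by simp

lemma decay_pos: "decay q > 0" "decay q \<le> 1"
proof -
  have p: "1 + depth q \<ge> 1" using depth(1)[of q] by simp
  then show "decay q > 0" by (simp add: decay_def)
  have "(1 + depth q) powr (2 - \<beta>) \<le> (1 + depth q) powr 0" using p \<beta> by (intro powr_mono) auto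
  then show "decay q \<le> 1" using p by (simp add: decay_def)
qed

text \<open>A ball on which u is at least 1 contributes its area times a lower bound of the weight
  on it. A fixed ball will give a constant, a ball of size comparable to the depth will give
  \<open>decay\<close>.\<close>

lemma ball_mass:
  obtains c where "c > 0" "\<And>q z R u. \<lbrakk>R > 0; u \<in> borel_measurable borel; integrable lborel (\<lambda>y. \<rho> (q - y) * u y); \<And>y. u y \<ge> 0; \<And>y. y \<in> ball z R \<Longrightarrow> u y \<ge> 1\<rbrakk>
     \<Longrightarrow> c * (1 + norm (q - z) + R) powr (- \<beta>) * R\<^sup>2 \<le> convolve \<rho> u q"
proof -
  obtain c where c: "c > 0" "\<And>x. c * weight \<beta> x \<le> \<rho> x" using lower by blast
  show thesis
  proof (rule that[of "c * pi"])
    show "c * pi > 0" using c by simp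
    fix q z :: "real^2" and R :: real and u :: "real^2 \<Rightarrow> real"
    assume R: "R > 0" and um: "u \<in> borel_measurable borel" and int: "integrable lborel (\<lambda>y. \<rho> (q - y) * u y)"
      and u0: "\<And>y. u y \<ge> 0" and u1: "\<And>y. y \<in> ball z R \<Longrightarrow> u y \<ge> 1"
    let ?W = "(1 + norm (q - z) + R) powr (- \<beta>)"
    have fm: "emeasure lborel (ball z R) = ennreal (pi * R\<^sup>2)"
      using R by (simp add: emeasure_ball unit_ball_vol_2)
    have "c * pi * ?W * R\<^sup>2 = (LINT y|lborel. c * ?W * indicator (ball z R) y)"
      using fm R by (simp add: measure_def)
    also have "\<dots> \<le> (LINT y|lborel. \<rho> (q - y) * u y)"
    proof (rule integral_mono)
      show "integrable lborel (\<lambda>y. c * ?W * indicator (ball z R) y)"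
        using fm by (intro integrable_mult_right integrable_real_indicator) auto
      fix y
      show "c * ?W * indicator (ball z R) y \<le> \<rho> (q - y) * u y"
      proof (cases "y \<in> ball z R")
        case True
        have "norm (q - y) \<le> norm (q - z) + norm (z - y)" using norm_triangle_ineq[of "q - z" "z - y"] by simp
        then have "1 + norm (q - y) \<le> 1 + norm (q - z) + R" using True by (simp add: dist_norm)
        then have "?W \<le> weight \<beta> (q - y)"
        proof -
          have "0 < 1 + norm (q - y)" using norm_ge_zero[of "q - y"] by linarith
          then show ?thesis unfolding weight_def using \<beta> \<open>1 + norm (q - y) \<le> _\<close> by (intro powr_mono2') linarith+
        qed
        then have "c * ?W \<le> c * weight \<beta> (q - y)" using c(1) by (simp add: mult_left_mono)
        then have "c * ?W \<le> \<rho> (q - y)" using c(2)[of "q - y"] by linarith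
        also have "\<dots> \<le> \<rho> (q - y) * u y" using mult_left_mono[OF u1[OF True] less_imp_le[OF pos[of "q - y"]]] by simp
        finally show ?thesis using True by simp
      next
        case False
        then show ?thesis using mult_nonneg_nonneg[OF less_imp_le[OF pos[of "q - y"]] u0[of y]] by simp
      qed
    qed (use int in auto)
    finally show "c * pi * ?W * R\<^sup>2 \<le> convolve \<rho> u q" by (simp add: convolve_def)
  qed
qed

text \<open>By equality of the lengths. A step along \<open>v i\<close> thus increases the lead of
  facet i over every other facet.\<close>

lemma inner_v: "i \<in> I \<Longrightarrow> j \<in> I \<Longrightarrow> (v i - v j) \<bullet> v i = (norm (v i - v j))\<^sup>2 / 2"
proof -
  assume "i \<in> I" "j \<in> I"
  then have "v i \<bullet> v i = m\<^sup>2" "v j \<bullet> v j = m\<^sup>2" using norm_v by (auto simp: dot_square_norm)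
  then show ?thesis by (simp add: power2_norm_eq_inner inner_diff_left inner_diff_right inner_commute)
qed

text \<open>The ball of radius \<open>gap / 2\<close> around \<open>q + v (sel q)\<close> lies in
  the sector of q. With d the difference of two facet gradients, the step adds
  \<open>(norm d)\<^sup>2 / 2\<close> to the lead, and the radius costs less than that, as
  \<open>gap \<le> norm d\<close>.\<close>

lemma P_sel_lower: obtains p where "p > 0" "\<And>q. p \<le> P (sel q) q"
proof -
  obtain c where c: "c > 0" "\<And>q z R u. \<lbrakk>R > 0; u \<in> borel_measurable borel; integrable lborel (\<lambda>y. \<rho> (q - y) * u y); \<And>y. u y \<ge> 0; \<And>y. y \<in> ball z R \<Longrightarrow> u y \<ge> 1\<rbrakk>
     \<Longrightarrow> c * (1 + norm (q - z) + R) powr (- \<beta>) * R\<^sup>2 \<le> convolve \<rho> u q" by (rule ball_mass) blast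
  let ?R = "gap / 2"
  show thesis
  proof (rule that)
    show "c * (1 + m + ?R) powr (- \<beta>) * ?R\<^sup>2 > 0" using c(1) gap m_pos by simp
    fix q
    let ?j = "sel q"
    have "c * (1 + norm (q - (q + v ?j)) + ?R) powr (- \<beta>) * ?R\<^sup>2 \<le> convolve \<rho> (w ?j) q"
    proof (rule c(2))
      fix y assume "y \<in> ball (q + v ?j) ?R"
      then have y: "norm (y - q - v ?j) < ?R" by (simp add: dist_norm norm_minus_commute algebra_simps)
      have "sel y = ?j"
      proof (rule sel_eqI[OF sel(1)])
        fix i assume i: "i \<in> I" "i \<noteq> ?j"
        let ?d = "v ?j - v i"
        have g: "gap \<le> norm ?d" "norm ?d > 0" using gap(2)[OF sel(1) i(1)] i gap(1) by fastforce+
        have "?d \<bullet> y = ?d \<bullet> q + ?d \<bullet> v ?j + ?d \<bullet> (y - q - v ?j)" by (simp add: inner_diff_right)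
        moreover have "?d \<bullet> q \<ge> 0" using sel_max[OF i(1), of q] by (simp add: inner_diff_left)
        moreover have "?d \<bullet> v ?j = norm ?d * (norm ?d / 2)" using inner_v[OF sel(1) i(1)] by (simp add: power2_eq_square)
        moreover have "\<bar>?d \<bullet> (y - q - v ?j)\<bar> < norm ?d * (norm ?d / 2)"
        proof -
          have "\<bar>?d \<bullet> (y - q - v ?j)\<bar> \<le> norm ?d * norm (y - q - v ?j)" by (rule Cauchy_Schwarz_ineq2)
          also have "\<dots> < norm ?d * (norm ?d / 2)" using y g by (intro mult_strict_left_mono) auto
          finally show ?thesis .
        qed
        ultimately have "?d \<bullet> y > 0" by linarith
        then show "v i \<bullet> y < v ?j \<bullet> y" by (simp add: inner_diff_left)
      qed
      then show "w ?j y \<ge> 1" by (simp add: w_def)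
    qed (use gap P_integrable w_bound in auto)
    then show "c * (1 + m + ?R) powr (- \<beta>) * ?R\<^sup>2 \<le> P ?j q" using norm_v[OF sel(1)] by (simp add: P_def)
  qed
qed

text \<open>Moving from q towards the facet that attains the depth, by a distance proportional to
  \<open>R = 1 + depth q\<close>, reaches a ball of radius R on which that facet leads by at least
  1. Its area and distance give \<open>R\<^sup>2 * R powr (- \<beta>) = decay q\<close> up to
  constants.\<close>

lemma far_ball:
  obtains c where "c > 0" "\<And>q u. \<lbrakk>u \<in> borel_measurable borel; integrable lborel (\<lambda>y. \<rho> (q - y) * u y); \<And>y. u y \<ge> 0;
      \<And>y i. i \<in> I \<Longrightarrow> v (sel q) \<bullet> y + 1 \<le> v i \<bullet> y \<Longrightarrow> u y \<ge> 1\<rbrakk> \<Longrightarrow> c * decay q \<le> convolve \<rho> u q"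
proof -
  obtain c where c: "c > 0" "\<And>q z R u. \<lbrakk>R > 0; u \<in> borel_measurable borel; integrable lborel (\<lambda>y. \<rho> (q - y) * u y); \<And>y. u y \<ge> 0; \<And>y. y \<in> ball z R \<Longrightarrow> u y \<ge> 1\<rbrakk>
     \<Longrightarrow> c * (1 + norm (q - z) + R) powr (- \<beta>) * R\<^sup>2 \<le> convolve \<rho> u q" by (rule ball_mass) blast
  \<comment> \<open>Then \<open>K * gap\<^sup>2 = 2 + 2 * m\<close>: on the ball the displacement
    gains at least \<open>(2 + 2 * m) * R\<close>, the radius costs at most \<open>2 * m * R\<close>
    and the initial deficit is \<open>depth q\<close>, which leaves at least 1.\<close>
  define K where "K = (2 + 2 * m) / gap\<^sup>2"
  have K: "K > 0" using m_pos gap by (simp add: K_def)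
  define B where "B = 2 + K * (2 * m)"
  have B: "B > 0" using K m_pos by (simp add: B_def add_pos_pos)
  show thesis
  proof (rule that)
    show "c * B powr (- \<beta>) > 0" using c B by simp
    fix q u assume um: "u \<in> borel_measurable borel" and int: "integrable lborel (\<lambda>y. \<rho> (q - y) * u y)" and u0: "\<And>y. u y \<ge> 0"
      and u1: "\<And>y i. i \<in> I \<Longrightarrow> v (sel q) \<bullet> y + 1 \<le> v i \<bullet> y \<Longrightarrow> u y \<ge> 1"
    define R where "R = 1 + depth q"
    have R: "R \<ge> 1" using depth(1)[of q] by (simp add: R_def)
    obtain i where i: "i \<in> I" "i \<noteq> sel q" "depth q = (v (sel q) - v i) \<bullet> q" using depth(3)[of q] by blast
    let ?e = "v i - v (sel q)"
    have ne: "norm ?e \<le> 2 * m" "norm ?e \<ge> gap" using norm_diff_le[OF i(1) sel(1)] gap(2)[OF i(1) sel(1) i(2)] by auto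
    let ?z = "q + (K * R) *\<^sub>R ?e"
    have "c * (1 + norm (q - ?z) + R) powr (- \<beta>) * R\<^sup>2 \<le> convolve \<rho> u q"
    proof (rule c(2)[OF _ um int u0])
      fix y assume "y \<in> ball ?z R"
      then have y: "norm (y - ?z) < R" by (simp add: dist_norm norm_minus_commute)
      have "?e \<bullet> y = ?e \<bullet> q + (K * R) * (norm ?e)\<^sup>2 + ?e \<bullet> (y - ?z)"
        by (simp add: inner_diff_right inner_add_right power2_norm_eq_inner)
      moreover have "?e \<bullet> q = - depth q" using i(3) by (simp add: inner_diff_left)
      moreover have "(K * R) * (norm ?e)\<^sup>2 \<ge> (K * R) * gap\<^sup>2"
        using ne gap(1) K R by (intro mult_left_mono power_mono) auto
      moreover have "(K * R) * gap\<^sup>2 = (2 + 2 * m) * R" using gap(1) by (simp add: K_def)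
      moreover have "\<bar>?e \<bullet> (y - ?z)\<bar> \<le> 2 * m * R"
      proof -
        have "\<bar>?e \<bullet> (y - ?z)\<bar> \<le> norm ?e * norm (y - ?z)" by (rule Cauchy_Schwarz_ineq2)
        also have "\<dots> \<le> 2 * m * R" using ne y m_pos by (intro mult_mono) auto
        finally show ?thesis .
      qed
      ultimately have "?e \<bullet> y \<ge> 1" using R by (simp add: R_def algebra_simps)
      then show "u y \<ge> 1" by (intro u1[OF i(1)]) (simp add: inner_diff_left)
    qed (use R in simp)
    moreover have "c * B powr (- \<beta>) * decay q \<le> c * (1 + norm (q - ?z) + R) powr (- \<beta>) * R\<^sup>2"
    proof -
      have "norm (q - ?z) = K * R * norm ?e" using K R by simp
      also have "\<dots> \<le> K * R * (2 * m)" using ne K R by (intro mult_left_mono) auto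
      finally have "1 + norm (q - ?z) + R \<le> B * R" using R by (simp add: B_def algebra_simps)
      then have "(B * R) powr (- \<beta>) \<le> (1 + norm (q - ?z) + R) powr (- \<beta>)"
        using \<beta> R by (intro powr_mono2') (auto intro: add_nonneg_pos)
      moreover have "(B * R) powr (- \<beta>) * R\<^sup>2 = B powr (- \<beta>) * decay q"
      proof -
        have "R powr (- \<beta>) * R\<^sup>2 = R powr (- \<beta> + 2)" using R by (subst powr_add) simp
        then show ?thesis using B R by (simp add: powr_mult decay_def R_def add.commute)
      qed
      ultimately have "B powr (- \<beta>) * decay q \<le> (1 + norm (q - ?z) + R) powr (- \<beta>) * R\<^sup>2"
        by (metis mult_right_mono zero_le_power2)
      then show ?thesis using c(1) by (simp add: mult.assoc)
    qed
    ultimately show "c * B powr (- \<beta>) * decay q \<le> convolve \<rho> u q" by linarith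
  qed
qed

text \<open>With weights \<open>P i q\<close> of sum 1, the variance of the vectors
  \<open>v i\<close> is half the mean of their squared mutual distances; their mean square is
  \<open>m\<^sup>2\<close> because all lengths agree.\<close>

lemma sigma_eq: "\<sigma> q = (\<Sum>i\<in>I. \<Sum>l\<in>I. P i q * P l q * ((norm (v i - v l))\<^sup>2 / 2))"
proof -
  have ip: "v i \<bullet> v l = m\<^sup>2 - (norm (v i - v l))\<^sup>2 / 2" if "i \<in> I" "l \<in> I" for i l
  proof -
    have "v i \<bullet> v i = m\<^sup>2" "v l \<bullet> v l = m\<^sup>2" using norm_v that by (auto simp: dot_square_norm)
    then show ?thesis by (simp add: power2_norm_eq_inner inner_diff_left inner_diff_right inner_commute field_simps)
  qed
  have "(norm (G q))\<^sup>2 = (\<Sum>i\<in>I. \<Sum>l\<in>I. P i q * P l q * (v i \<bullet> v l))"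
    unfolding power2_norm_eq_inner G_def inner_sum_left inner_sum_right
    by (intro sum.cong refl) (simp add: mult_ac inner_commute)
  also have "\<dots> = (\<Sum>i\<in>I. \<Sum>l\<in>I. P i q * P l q * m\<^sup>2 - P i q * P l q * ((norm (v i - v l))\<^sup>2 / 2))"
    by (intro sum.cong refl) (simp add: ip right_diff_distrib)
  also have "\<dots> = (\<Sum>i\<in>I. \<Sum>l\<in>I. P i q * P l q * m\<^sup>2) - (\<Sum>i\<in>I. \<Sum>l\<in>I. P i q * P l q * ((norm (v i - v l))\<^sup>2 / 2))"
    by (simp add: sum_subtractf)
  also have "(\<Sum>i\<in>I. \<Sum>l\<in>I. P i q * P l q * m\<^sup>2) = m\<^sup>2"
    by (simp add: sum_distrib_left[symmetric] sum_distrib_right[symmetric] sum_P)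
  finally show ?thesis by (simp add: \<sigma>_def)
qed

text \<open>Only pairs containing \<open>sel q\<close> are kept: its weight is bounded below, and
  the weights of all other facets together are at least of order \<open>decay q\<close> by
  \<open>far_ball\<close>.\<close>

lemma sigma_lower: obtains c where "c > 0" "\<And>q. c * decay q \<le> \<sigma> q"
proof -
  obtain p where p: "p > 0" "\<And>q. p \<le> P (sel q) q" by (rule P_sel_lower) blast
  obtain c where c: "c > 0" "\<And>q u. \<lbrakk>u \<in> borel_measurable borel; integrable lborel (\<lambda>y. \<rho> (q - y) * u y); \<And>y. u y \<ge> 0;
      \<And>y i. i \<in> I \<Longrightarrow> v (sel q) \<bullet> y + 1 \<le> v i \<bullet> y \<Longrightarrow> u y \<ge> 1\<rbrakk> \<Longrightarrow> c * decay q \<le> convolve \<rho> u q" by (rule far_ball) blast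
  show thesis
  proof (rule that)
    show "p * (gap\<^sup>2 / 2) * c > 0" using p c gap by simp
    fix q
    let ?j = "sel q"
    let ?u = "\<lambda>y. \<Sum>i\<in>I - {?j}. w i y"
    have sum_int: "integrable lborel (\<lambda>y. \<rho> (q - y) * ?u y)" using P_integrable by (simp add: sum_distrib_left)
    have "c * decay q \<le> convolve \<rho> ?u q"
    proof (rule c(2)[OF _ sum_int])
      show "?u \<in> borel_measurable borel" by measurable
      show "?u y \<ge> 0" for y by (intro sum_nonneg w_bound)
      fix y i assume "i \<in> I" "v ?j \<bullet> y + 1 \<le> v i \<bullet> y"
      then have "sel y \<noteq> ?j" using sel_max[of i y] by auto
      then have "w (sel y) y \<le> ?u y" using finI sel(1)[of y] by (intro member_le_sum) (auto simp: w_bound)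
      then show "?u y \<ge> 1" by (simp add: w_def)
    qed
    also have "convolve \<rho> ?u q = (\<Sum>i\<in>I - {?j}. P i q)"
      unfolding P_def convolve_def using P_integrable by (simp add: sum_distrib_left Bochner_Integration.integral_sum)
    finally have 1: "c * decay q \<le> (\<Sum>i\<in>I - {?j}. P i q)" .
    have "p * (gap\<^sup>2 / 2) * c * decay q = p * (gap\<^sup>2 / 2) * (c * decay q)" by simp
    also have "\<dots> \<le> P ?j q * (gap\<^sup>2 / 2) * (\<Sum>i\<in>I - {?j}. P i q)"
      using 1 p(2)[of q] p(1) c(1) decay_pos(1)[of q] by (intro mult_mono) (auto intro!: mult_nonneg_nonneg sum_nonneg P_nonneg)
    also have "\<dots> = (\<Sum>l\<in>I - {?j}. P ?j q * P l q * (gap\<^sup>2 / 2))" by (simp add: sum_distrib_left mult_ac)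
    also have "\<dots> \<le> (\<Sum>l\<in>I - {?j}. P ?j q * P l q * ((norm (v ?j - v l))\<^sup>2 / 2))"
    proof (intro sum_mono mult_left_mono divide_right_mono power_mono)
      fix l assume "l \<in> I - {?j}"
      then show "gap \<le> norm (v ?j - v l)" using gap(2)[OF sel(1)] by auto
    qed (use P_nonneg gap in \<open>auto intro!: mult_nonneg_nonneg\<close>)
    also have "\<dots> \<le> (\<Sum>l\<in>I. P ?j q * P l q * ((norm (v ?j - v l))\<^sup>2 / 2))"
      using finI P_nonneg by (intro sum_mono2) (auto intro!: mult_nonneg_nonneg)
    also have "\<dots> \<le> (\<Sum>i\<in>I. \<Sum>l\<in>I. P i q * P l q * ((norm (v i - v l))\<^sup>2 / 2))"
      using finI sel(1) P_nonneg
      by (intro member_le_sum[of ?j I "\<lambda>i. \<Sum>l\<in>I. P i q * P l q * ((norm (v i - v l))\<^sup>2 / 2)"] sum_nonneg) (auto intro!: mult_nonneg_nonneg)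
    finally show "p * (gap\<^sup>2 / 2) * c * decay q \<le> \<sigma> q" by (simp add: sigma_eq)
  qed
qed

text \<open>An even kernel of mass 1 reproduces linear functions, so the excess over
  \<open>v (sel q) \<bullet> q\<close> is the mollification of
  \<open>h y - v (sel q) \<bullet> y\<close>, which is nonnegative and at least 1 on the far
  ball.\<close>

lemma h_excess_lower: obtains c where "c > 0" "\<And>q. c * decay q \<le> \<phi> q - h q"
proof -
  obtain c where c: "c > 0" "\<And>q u. \<lbrakk>u \<in> borel_measurable borel; integrable lborel (\<lambda>y. \<rho> (q - y) * u y); \<And>y. u y \<ge> 0;
      \<And>y i. i \<in> I \<Longrightarrow> v (sel q) \<bullet> y + 1 \<le> v i \<bullet> y \<Longrightarrow> u y \<ge> 1\<rbrakk> \<Longrightarrow> c * decay q \<le> convolve \<rho> u q" by (rule far_ball) blast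
  show thesis
  proof (rule that[OF c(1)])
    fix q
    let ?j = "sel q"
    let ?u = "\<lambda>y. h y - v ?j \<bullet> y"
    have hi: "integrable lborel (\<lambda>y. \<rho> (q - y) * h y)"
      using h_kernel_integrable[of q] integrable_reflect[of "\<lambda>y. \<rho> (q - y) * h y" q] by simp
    have li0: "integrable lborel (\<lambda>y. \<rho> y * (a \<bullet> y))" for a
    proof (rule Bochner_Integration.integrable_bound)
      show "integrable lborel (\<lambda>y. norm a * (\<rho> y * norm y))" using \<rho>_first_moment by simp
      show "AE y in lborel. norm (\<rho> y * (a \<bullet> y)) \<le> norm (norm a * (\<rho> y * norm y))"
      proof (rule AE_I2)
        fix y
        have "\<rho> y * \<bar>a \<bullet> y\<bar> \<le> \<rho> y * (norm a * norm y)" using pos[of y] Cauchy_Schwarz_ineq2[of a y] by simp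
        then show "norm (\<rho> y * (a \<bullet> y)) \<le> norm (norm a * (\<rho> y * norm y))"
          using pos[of y] by (simp add: abs_mult mult_ac)
      qed
    qed simp
    have l0: "(LINT y|lborel. \<rho> y * (a \<bullet> y)) = 0" for a
      by (rule integral_odd) (simp_all add: even)
    have li: "integrable lborel (\<lambda>y. \<rho> (q - y) * (v ?j \<bullet> y))"
    proof -
      have "integrable lborel (\<lambda>y. (v ?j \<bullet> q) * \<rho> y - \<rho> y * (v ?j \<bullet> y))" using \<rho>_int li0 by simp
      then have "integrable lborel (\<lambda>y. \<rho> y * (v ?j \<bullet> (q - y)))" by (simp add: inner_diff_right right_diff_distrib mult.commute)
      then show ?thesis using integrable_reflect[of "\<lambda>y. \<rho> (q - y) * (v ?j \<bullet> y)" q] by simp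
    qed
    have lin: "convolve \<rho> (\<lambda>y. v ?j \<bullet> y) q = v ?j \<bullet> q"
    proof -
      have "convolve \<rho> (\<lambda>y. v ?j \<bullet> y) q = (LINT y|lborel. (v ?j \<bullet> q) * \<rho> y - \<rho> y * (v ?j \<bullet> y))"
        by (subst convolve_\<rho>) (auto simp: inner_diff_right right_diff_distrib mult.commute)
      also have "\<dots> = v ?j \<bullet> q" using \<rho>_int li0 l0 mass by simp
      finally show ?thesis .
    qed
    have "c * decay q \<le> convolve \<rho> ?u q"
    proof (rule c(2))
      show "?u \<in> borel_measurable borel" by measurable
      show "integrable lborel (\<lambda>y. \<rho> (q - y) * ?u y)" using hi li by (simp add: right_diff_distrib)
      show "?u y \<ge> 0" for y using h_ge[OF sel(1), of q y] by simp
      show "?u y \<ge> 1" if "i \<in> I" "v ?j \<bullet> y + 1 \<le> v i \<bullet> y" for y i using that h_ge[OF that(1), of y] by simp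
    qed
    also have "convolve \<rho> ?u q = \<phi> q - v ?j \<bullet> q"
      unfolding \<phi>_def lin[symmetric] using hi li by (simp add: convolve_def right_diff_distrib)
    finally show "c * decay q \<le> \<phi> q - h q" using sel(2)[of q] by simp
  qed
qed

text \<open>
  In the ball of radius \<open>kap * (1 + depth q)\<close> around \<open>q\<close> the other facets stay far away.
\<close>

definition kap :: real where "kap = 1 / (8 * (m + 1))"

section \<open>Upper bounds of order \<open>decay\<close>\<close>

lemma kap: "0 < kap" "kap \<le> 1" "6 * m * kap < 1"
  using m_pos by (auto simp: kap_def field_simps)

text \<open>Within the radius \<open>kap * (1 + depth q)\<close> every point stays at a distance of
  order \<open>depth q\<close> from the sector of another facet i, so \<open>P i\<close> is at most
  the tail mass of \<rho>. At depth at most 1 the trivial bound \<open>P i \<le> 1\<close> is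
  already of order \<open>decay\<close>.\<close>

lemma P_decay: obtains C where "C \<ge> 0" "\<And>q i (\<eta>::real^2). i \<in> I \<Longrightarrow> i \<noteq> sel q \<Longrightarrow> norm \<eta> \<le> kap * (1 + depth q) \<Longrightarrow> P i (q + \<eta>) \<le> C * decay q"
proof -
  obtain C where C: "\<And>x. \<bar>\<rho> x\<bar> \<le> C * weight \<beta> x" using bound0 by blast
  have C0: "C \<ge> 0" using C[of 0] weight_pos[of \<beta> "0::real^2"] by (metis abs_ge_zero order_trans zero_le_mult_iff not_less)
  \<comment> \<open>The tail mass outside the radius \<open>kap * depth q / 2\<close>; the last
    factor replaces \<open>depth q\<close> by \<open>1 + depth q\<close>, at most its double where
    this is used.\<close>
  define T where "T = C * (2 * pi / (\<beta> - 2)) * (kap/2) powr (2 - \<beta>) * 2 powr (\<beta> - 2)"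
  have T0: "T \<ge> 0" using C0 \<beta> by (simp add: T_def)
  show thesis
  proof (rule that[of "2 powr (\<beta> - 2) + T"])
    show "2 powr (\<beta> - 2) + T \<ge> 0" using T0 by simp
    fix q i and \<eta> :: "real^2" assume i: "i \<in> I" "i \<noteq> sel q" and \<eta>: "norm \<eta> \<le> kap * (1 + depth q)"
    let ?d = "depth q"
    have Tp: "0 \<le> T * decay q" using T0 decay_pos(1)[of q] by simp
    show "P i (q + \<eta>) \<le> (2 powr (\<beta> - 2) + T) * decay q"
    proof (cases "?d \<le> 1")
      case True
      have "2 powr (2 - \<beta>) \<le> decay q" unfolding decay_def using True depth(1)[of q] \<beta> by (intro powr_mono2') auto
      then have "2 powr (\<beta> - 2) * 2 powr (2 - \<beta>) \<le> 2 powr (\<beta> - 2) * decay q" by (intro mult_left_mono) auto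
      then have "1 \<le> 2 powr (\<beta> - 2) * decay q" by (simp add: powr_add[symmetric])
      then show ?thesis using P_le_1[OF i(1), of "q + \<eta>"] Tp by (simp add: distrib_right)
    next
      case False
      let ?R = "kap * ?d / 2"
      have R: "?R > 0" using False kap by simp
      \<comment> \<open>A closer point y would satisfy
        \<open>norm (y - q) \<le> 3 * kap * depth q\<close>. This changes the lead over facet i by
        at most \<open>6 * m * kap * depth q\<close>, less than \<open>depth q\<close>, so y could
        not belong to facet i.\<close>
      have far: "norm (q + \<eta> - y) > ?R" if y: "sel y = i" for y
      proof (rule ccontr)
        assume "\<not> norm (q + \<eta> - y) > ?R"
        then have a: "norm (q + \<eta> - y) \<le> kap * ?d" using R by simp
        have b: "norm \<eta> \<le> kap * (2 * ?d)" using \<eta> mult_left_mono[of "1 + ?d" "2 * ?d" kap] False kap by linarith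
        have "norm (y - q) \<le> norm \<eta> + norm (q + \<eta> - y)"
          using norm_triangle_ineq4[of \<eta> "q + \<eta> - y"] by (simp add: algebra_simps)
        then have n: "norm (y - q) \<le> 3 * kap * ?d" using a b by simp
        let ?e = "v (sel q) - v i"
        have "\<bar>?e \<bullet> (y - q)\<bar> \<le> norm ?e * norm (y - q)" by (rule Cauchy_Schwarz_ineq2)
        also have "\<dots> \<le> 2 * m * (3 * kap * ?d)" using n norm_diff_le[OF sel(1) i(1)] m_pos by (intro mult_mono) auto
        also have "\<dots> = 6 * m * kap * ?d" by simp
        also have "\<dots> < 1 * ?d" using kap(3) False by (intro mult_strict_right_mono) auto
        finally have "?e \<bullet> (y - q) > - ?d" by linarith
        moreover have "?e \<bullet> q \<ge> ?d" using depth(2)[OF i] .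
        ultimately have "?e \<bullet> y > 0" by (simp add: inner_diff_right)
        then have "v i \<bullet> y < v (sel q) \<bullet> y" by (simp add: inner_diff_left)
        then show False using sel_max[OF sel(1), of q y] y by simp
      qed
      have fint: "integrable lborel (\<lambda>x::real^2. C * (indicator {x. norm x > ?R} x * norm x powr (- \<beta>)))"
        using integrable_norm_powr_far[where 'a = "real^2", of \<beta> ?R] \<beta> R by simp
      have "P i (q + \<eta>) = (LINT x|lborel. \<rho> x * w i (q + \<eta> - x))" unfolding P_def by (rule convolve_\<rho>) measurable
      also have "\<dots> \<le> (LINT x|lborel. C * (indicator {x. norm x > ?R} x * norm (x::real^2) powr (- \<beta>)))"
      proof (rule integral_mono[OF _ fint])
        show "integrable lborel (\<lambda>x. \<rho> x * w i (q + \<eta> - x))"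
          using P_integrable[of "q + \<eta>" i] integrable_reflect[of "\<lambda>y. \<rho> y * w i (q + \<eta> - y)" "q + \<eta>"] by simp
        fix x
        show "\<rho> x * w i (q + \<eta> - x) \<le> C * (indicator {x. norm x > ?R} x * norm x powr (- \<beta>))"
        proof (cases "sel (q + \<eta> - x) = i")
          case True
          then have nx: "norm x > ?R" using far[of "q + \<eta> - x"] by simp
          have "\<rho> x \<le> C * weight \<beta> x" using C[of x] by simp
          also have "\<dots> \<le> C * norm x powr (- \<beta>)"
            unfolding weight_def using C0 \<beta> nx R by (intro mult_left_mono powr_mono2') auto
          finally show ?thesis using True nx by (simp add: w_def)
        next
          case False
          then show ?thesis using C0 by (simp add: w_def)
        qed
      qed
      also have "\<dots> = C * (2 * pi / (\<beta> - 2)) * ?R powr (2 - \<beta>)"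
        using integral_norm_powr_far[where 'a = "real^2", of \<beta> ?R] \<beta> R by (simp add: unit_ball_vol_2)
      also have "?R powr (2 - \<beta>) = (kap/2) powr (2 - \<beta>) * ?d powr (2 - \<beta>)"
        using kap False by (simp add: powr_mult[symmetric])
      also have "C * (2 * pi / (\<beta> - 2)) * ((kap/2) powr (2 - \<beta>) * ?d powr (2 - \<beta>)) \<le> T * decay q"
      proof -
        have "(2 * ?d) powr (2 - \<beta>) \<le> decay q" unfolding decay_def using False \<beta> by (intro powr_mono2') auto
        then have "2 powr (\<beta> - 2) * (2 * ?d) powr (2 - \<beta>) \<le> 2 powr (\<beta> - 2) * decay q" by (intro mult_left_mono) auto
        moreover have "2 powr (\<beta> - 2) * (2 * ?d) powr (2 - \<beta>) = ?d powr (2 - \<beta>)"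
          using False by (simp add: powr_mult mult.assoc[symmetric] powr_add[symmetric])
        ultimately have "?d powr (2 - \<beta>) \<le> 2 powr (\<beta> - 2) * decay q" by simp
        then have "C * (2 * pi / (\<beta> - 2)) * (kap/2) powr (2 - \<beta>) * ?d powr (2 - \<beta>) \<le> C * (2 * pi / (\<beta> - 2)) * (kap/2) powr (2 - \<beta>) * (2 powr (\<beta> - 2) * decay q)"
          using C0 \<beta> by (intro mult_left_mono) auto
        then show ?thesis by (simp add: T_def mult.assoc)
      qed
      finally show ?thesis
        using mult_nonneg_nonneg[OF powr_ge_zero[of 2 "\<beta> - 2"] less_imp_le[OF decay_pos(1)[of q]]] by (simp add: distrib_right)
    qed
  qed
qed

definition G' :: "real^2 \<Rightarrow> real^2 \<Rightarrow> real^2" where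
  "G' q \<eta> = (\<Sum>i\<in>I. D1 (P i) \<eta> q *\<^sub>R v i)"

lemma P_Ck: "Ck_on (Suc (Suc 0)) UNIV (P i)" using P_Ck2 by (simp only: numeral_2_eq_2)

lemma P_D1: "(P i has_derivative (\<lambda>e. D1 (P i) e x)) (at x)" by (rule has_derivative_D1[OF P_Ck])

lemma P_D2: "(D1 (P i) e has_derivative (\<lambda>e'. D1 (D1 (P i) e) e' x)) (at x)" by (rule has_derivative_D1[OF Ck_on_D1[OF P_Ck]])

lemma D1_linear: "linear (\<lambda>e. D1 (P i) e x)" using P_D1 has_derivative_linear by blast

lemma sum_D1P: "(\<Sum>i\<in>I. D1 (P i) \<eta> q) = 0"
proof -
  have "((\<lambda>q. \<Sum>i\<in>I. P i q) has_derivative (\<lambda>e. \<Sum>i\<in>I. D1 (P i) e q)) (at q)"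
    by (intro has_derivative_sum P_D1)
  then have "((\<lambda>q. 1) has_derivative (\<lambda>e. \<Sum>i\<in>I. D1 (P i) e q)) (at q)" by (simp add: sum_P)
  then have "(\<lambda>e. \<Sum>i\<in>I. D1 (P i) e q) = (\<lambda>e. 0)"
    using has_derivative_unique[OF _ has_derivative_const] by blast
  then show ?thesis by (rule fun_cong)
qed

text \<open>Since the coefficients sum to 0, \<open>v (sel q)\<close> may be subtracted from every
  vector. The coefficient of the leading facet, over which X gives no control, disappears.\<close>

lemma comb_bound:
  assumes a: "(\<Sum>i\<in>I. a i) = 0" and X: "\<And>i. i \<in> I \<Longrightarrow> i \<noteq> sel q \<Longrightarrow> \<bar>a i\<bar> \<le> X"
  shows "norm (\<Sum>i\<in>I. a i *\<^sub>R v i) \<le> real (card I) * (2 * m) * X"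
proof -
  let ?j = "sel q"
  have X0: "X \<ge> 0"
  proof -
    obtain i where "i \<in> I" "i \<noteq> ?j" using other_ne[of q] by blast
    then show ?thesis using X abs_ge_zero order_trans by blast
  qed
  have "(\<Sum>i\<in>I. a i *\<^sub>R (v i - v ?j)) = (\<Sum>i\<in>I. a i *\<^sub>R v i) - (\<Sum>i\<in>I. a i) *\<^sub>R v ?j"
    by (simp add: scaleR_right_diff_distrib sum_subtractf scaleR_sum_left)
  then have "(\<Sum>i\<in>I. a i *\<^sub>R v i) = (\<Sum>i\<in>I. a i *\<^sub>R (v i - v ?j))" using a by simp
  also have "norm \<dots> \<le> (\<Sum>i\<in>I. X * (2 * m))"
  proof (rule sum_norm_le)
    fix i assume i: "i \<in> I"
    show "norm (a i *\<^sub>R (v i - v ?j)) \<le> X * (2 * m)"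
    proof (cases "i = ?j")
      case True
      then show ?thesis using X0 m_pos by simp
    next
      case False
      then show ?thesis using X[OF i] norm_diff_le[OF i sel(1), of q] X0 by (simp add: mult_mono)
    qed
  qed
  finally show ?thesis by (simp add: mult_ac)
qed

text \<open>The bounds on G apply \<open>comb_bound\<close> to increments or derivatives of the
  \<open>P i\<close>, which are of order \<open>decay q\<close> for every facet but the leading one.
  The increment of G and the remainder of \<phi> are each estimated to two consecutive orders in
  \<open>norm \<eta>\<close>, so that one can later interpolate.\<close>

lemma local_bounds:
  obtains C where "C > 0"
    "\<And>q \<eta>. norm \<eta> \<le> kap * (1 + depth q) \<Longrightarrow> norm (G (q + \<eta>) - G q) \<le> C * decay q"
    "\<And>q \<eta>. norm \<eta> \<le> kap * (1 + depth q) \<Longrightarrow> norm (G (q + \<eta>) - G q) \<le> C * decay q * norm \<eta>"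
    "\<And>q \<eta>. norm \<eta> \<le> kap * (1 + depth q) \<Longrightarrow> norm (G (q + \<eta>) - G q - G' q \<eta>) \<le> C * decay q * (norm \<eta>)\<^sup>2"
    "\<And>q \<eta>. norm (G' q \<eta>) \<le> C * decay q * norm \<eta>"
    "\<And>q \<eta>. norm \<eta> \<le> kap * (1 + depth q) \<Longrightarrow> \<bar>\<phi> (q + \<eta>) - \<phi> q - G q \<bullet> \<eta>\<bar> \<le> C * decay q * norm \<eta>"
    "\<And>q \<eta>. norm \<eta> \<le> kap * (1 + depth q) \<Longrightarrow> \<bar>\<phi> (q + \<eta>) - \<phi> q - G q \<bullet> \<eta>\<bar> \<le> C * decay q * (norm \<eta>)\<^sup>2"
    "\<And>q. \<sigma> q \<le> C * decay q"
proof -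
  obtain C where C: "C \<ge> 0" "\<And>q i (\<eta>::real^2). i \<in> I \<Longrightarrow> i \<noteq> sel q \<Longrightarrow> norm \<eta> \<le> kap * (1 + depth q) \<Longrightarrow> P i (q + \<eta>) \<le> C * decay q"
    by (rule P_decay) blast
  obtain K where K: "K \<ge> 0" "\<And>i e q. \<bar>D1 (P i) e q\<bar> \<le> K * norm e * P i q"
    "\<And>i b e q. b \<in> Basis \<Longrightarrow> \<bar>D1 (D1 (P i) b) e q\<bar> \<le> K * norm e * P i q" by (rule P_derivative_bounds) blast
  define N where "N = real (card I) * (2 * m)"
  have N: "N > 0" using finI I_ne m_pos by (simp add: N_def card_gt_0_iff)
  define B where "B = N * (C + 2 * K * C + 1)"
  have Bge: "B \<ge> N * C" "B \<ge> N * (K * C)" "B \<ge> N * (2 * K * C)" "B > 0"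
    unfolding B_def using N C(1) K(1) by (auto intro!: mult_left_mono mult_pos_pos add_nonneg_pos)
  have Px: "P i x \<le> C * decay q" if "i \<in> I" "i \<noteq> sel q" "norm (x - q) \<le> kap * (1 + depth q)" for i q x
    using C(2)[OF that] by simp
  have r0: "kap * (1 + depth q) \<ge> 0" for q using kap depth(1)[of q] by simp
  have dd: "C * decay q \<ge> 0" for q using C(1) decay_pos(1)[of q] by simp
  have 0: "\<bar>P i (q + \<eta>) - P i q\<bar> \<le> C * decay q" if "i \<in> I" "i \<noteq> sel q" "norm \<eta> \<le> kap * (1 + depth q)" for i q \<eta>
  proof -
    have "P i (q + \<eta>) \<le> C * decay q" "P i q \<le> C * decay q"
      using C(2)[OF that] C(2)[OF that(1,2), of 0] r0 by auto
    then show ?thesis using P_nonneg[of i q] P_nonneg[of i "q + \<eta>"] by linarith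
  qed
  have 1: "\<bar>P i x - P i q\<bar> \<le> K * (C * decay q) * norm (x - q)" if i: "i \<in> I" "i \<noteq> sel q" and x: "norm (x - q) \<le> kap * (1 + depth q)" for i q x
  proof -
    have "norm (P i x - P i q) \<le> K * (C * decay q) * norm (x - q)"
    proof (rule differentiable_bound[where S = "cball q (norm (x - q))" and f' = "\<lambda>x e. D1 (P i) e x"])
      show "(P i has_derivative (\<lambda>e. D1 (P i) e y)) (at y within cball q (norm (x - q)))" for y
        by (rule has_derivative_at_withinI[OF P_D1])
      fix y assume "y \<in> cball q (norm (x - q))"
      then have y: "norm (y - q) \<le> kap * (1 + depth q)" using x by (simp add: dist_norm norm_minus_commute)
      show "onorm (\<lambda>e. D1 (P i) e y) \<le> K * (C * decay q)"
      proof (rule onorm_le)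
        fix e :: "real^2"
        have "K * norm e * P i y \<le> K * norm e * (C * decay q)"
          using Px[OF i y] K(1) by (intro mult_left_mono) auto
        then show "norm (D1 (P i) e y) \<le> K * (C * decay q) * norm e" using K(2)[of i e y] by (simp add: mult_ac)
      qed
    qed (auto simp: dist_norm norm_minus_commute)
    then show ?thesis by simp
  qed
  \<comment> \<open>The mean value theorem for \<open>P i\<close> minus its linear part at q; the
    derivative of this is a difference of first derivatives, bounded by the mean value theorem once
    more.\<close>
  have 2: "\<bar>P i (q + \<eta>) - P i q - D1 (P i) \<eta> q\<bar> \<le> 2 * K * (C * decay q) * (norm \<eta>)\<^sup>2"
    if i: "i \<in> I" "i \<noteq> sel q" and \<eta>: "norm \<eta> \<le> kap * (1 + depth q)" for i q \<eta>
  proof -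
    define X where "X = K * (C * decay q)"
    have X0: "X \<ge> 0" using K(1) dd[of q] by (simp add: X_def)
    have "norm ((P i (q + \<eta>) - D1 (P i) (q + \<eta>) q) - (P i q - D1 (P i) q q)) \<le> 2 * X * norm \<eta> * norm (q + \<eta> - q)"
    proof (rule differentiable_bound[where S = "cball q (norm \<eta>)" and f' = "\<lambda>x e. D1 (P i) e x - D1 (P i) e q" and f = "\<lambda>x. P i x - D1 (P i) x q"])
      show "((\<lambda>x. P i x - D1 (P i) x q) has_derivative (\<lambda>e. D1 (P i) e y - D1 (P i) e q)) (at y within cball q (norm \<eta>))" for y
      proof -
        have "bounded_linear (\<lambda>x. D1 (P i) x q)" using D1_linear by (simp add: linear_conv_bounded_linear)
        then show ?thesis
          by (intro has_derivative_diff has_derivative_at_withinI[OF P_D1] bounded_linear_imp_has_derivative)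
      qed
      fix y assume "y \<in> cball q (norm \<eta>)"
      then have yq: "norm (y - q) \<le> norm \<eta>" by (simp add: dist_norm norm_minus_commute)
      then have y: "norm (y - q) \<le> kap * (1 + depth q)" using \<eta> by linarith
      have b: "\<bar>D1 (P i) b y - D1 (P i) b q\<bar> \<le> X * norm \<eta>" if b: "b \<in> Basis" for b
      proof -
        have "norm (D1 (P i) b y - D1 (P i) b q) \<le> X * norm (y - q)"
        proof (rule differentiable_bound[where S = "cball q (norm \<eta>)" and f' = "\<lambda>x e. D1 (D1 (P i) b) e x"])
          show "(D1 (P i) b has_derivative (\<lambda>e. D1 (D1 (P i) b) e z)) (at z within cball q (norm \<eta>))" for z
            by (rule has_derivative_at_withinI[OF P_D2])
          fix z assume "z \<in> cball q (norm \<eta>)"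
          then have z: "norm (z - q) \<le> kap * (1 + depth q)" using \<eta> by (simp add: dist_norm norm_minus_commute)
          show "onorm (\<lambda>e. D1 (D1 (P i) b) e z) \<le> X"
          proof (rule onorm_le)
            fix e :: "real^2"
            have "K * norm e * P i z \<le> K * norm e * (C * decay q)"
              using Px[OF i z] K(1) by (intro mult_left_mono) auto
            then show "norm (D1 (D1 (P i) b) e z) \<le> X * norm e" using K(3)[OF b, of i e z] by (simp add: mult_ac X_def)
          qed
        qed (use yq in \<open>auto simp: dist_norm norm_minus_commute\<close>)
        also have "\<dots> \<le> X * norm \<eta>" using yq X0 by (rule mult_left_mono)
        finally show ?thesis by simp
      qed
      show "onorm (\<lambda>e. D1 (P i) e y - D1 (P i) e q) \<le> 2 * X * norm \<eta>"
      proof (rule onorm_le)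
        fix e :: "real^2"
        have "\<bar>D1 (P i) e y - D1 (P i) e q\<bar> \<le> 2 * (X * norm \<eta>) * norm e"
          by (rule linear_bound[OF linear_compose_sub[OF D1_linear D1_linear] b])
        then show "norm (D1 (P i) e y - D1 (P i) e q) \<le> 2 * X * norm \<eta> * norm e" by simp
      qed
    qed (auto simp: dist_norm)
    moreover have "(P i (q + \<eta>) - D1 (P i) (q + \<eta>) q) - (P i q - D1 (P i) q q) = P i (q + \<eta>) - P i q - D1 (P i) \<eta> q"
      using linear_add[OF D1_linear[of i q], of q \<eta>] by simp
    ultimately show ?thesis by (simp add: X_def power2_eq_square mult_ac)
  qed
  have GD: "G (q + \<eta>) - G q = (\<Sum>i\<in>I. (P i (q + \<eta>) - P i q) *\<^sub>R v i)" for q \<eta>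
    by (simp add: G_def scaleR_left_diff_distrib sum_subtractf)
  have S0: "(\<Sum>i\<in>I. P i (q + \<eta>) - P i q) = 0" for q \<eta> by (simp add: sum_subtractf sum_P)
  have b1: "norm (G (q + \<eta>) - G q) \<le> B * decay q" if "norm \<eta> \<le> kap * (1 + depth q)" for q \<eta>
  proof -
    have "norm (G (q + \<eta>) - G q) \<le> N * (C * decay q)"
      unfolding GD N_def using comb_bound[OF S0 0] that by blast
    also have "\<dots> \<le> B * decay q" using mult_right_mono[OF Bge(1) less_imp_le[OF decay_pos(1)[of q]]] by (simp add: mult_ac)
    finally show ?thesis .
  qed
  have b2: "norm (G (q + \<eta>) - G q) \<le> B * decay q * norm \<eta>" if \<eta>: "norm \<eta> \<le> kap * (1 + depth q)" for q \<eta>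
  proof -
    have "norm (G (q + \<eta>) - G q) \<le> N * (K * (C * decay q) * norm \<eta>)"
      unfolding GD N_def by (rule comb_bound[OF S0]) (use 1[of _ q "q + \<eta>"] \<eta> in simp)
    also have "\<dots> = N * (K * C) * (decay q * norm \<eta>)" by simp
    also have "\<dots> \<le> B * (decay q * norm \<eta>)" using Bge(2) decay_pos(1)[of q] by (intro mult_right_mono) auto
    finally show ?thesis by (simp add: mult.assoc)
  qed
  have b3: "norm (G (q + \<eta>) - G q - G' q \<eta>) \<le> B * decay q * (norm \<eta>)\<^sup>2" if \<eta>: "norm \<eta> \<le> kap * (1 + depth q)" for q \<eta>
  proof -
    have eq: "G (q + \<eta>) - G q - G' q \<eta> = (\<Sum>i\<in>I. (P i (q + \<eta>) - P i q - D1 (P i) \<eta> q) *\<^sub>R v i)"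
      unfolding GD G'_def by (simp add: scaleR_left_diff_distrib sum_subtractf)
    have z: "(\<Sum>i\<in>I. P i (q + \<eta>) - P i q - D1 (P i) \<eta> q) = 0" by (simp add: sum_subtractf sum_P sum_D1P)
    have "norm (G (q + \<eta>) - G q - G' q \<eta>) \<le> N * (2 * K * (C * decay q) * (norm \<eta>)\<^sup>2)"
      unfolding eq N_def by (rule comb_bound[OF z]) (use 2 \<eta> in blast)
    also have "\<dots> = N * (2 * K * C) * (decay q * (norm \<eta>)\<^sup>2)" by simp
    also have "\<dots> \<le> B * (decay q * (norm \<eta>)\<^sup>2)" using Bge(3) decay_pos(1)[of q] by (intro mult_right_mono) auto
    finally show ?thesis by (simp add: mult.assoc)
  qed
  have b4: "norm (G' q \<eta>) \<le> B * decay q * norm \<eta>" for q \<eta>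
  proof -
    have "norm (G' q \<eta>) \<le> N * (K * norm \<eta> * (C * decay q))"
      unfolding G'_def N_def
    proof (rule comb_bound[OF sum_D1P])
      fix i assume i: "i \<in> I" "i \<noteq> sel q"
      have "P i q \<le> C * decay q" using Px[OF i, of q] r0 by simp
      then have "K * norm \<eta> * P i q \<le> K * norm \<eta> * (C * decay q)" using K(1) by (intro mult_left_mono) auto
      then show "\<bar>D1 (P i) \<eta> q\<bar> \<le> K * norm \<eta> * (C * decay q)" using K(2)[of i \<eta> q] by linarith
    qed
    also have "\<dots> = N * (K * C) * (decay q * norm \<eta>)" by simp
    also have "\<dots> \<le> B * (decay q * norm \<eta>)" using Bge(2) decay_pos(1)[of q] by (intro mult_right_mono) auto
    finally show ?thesis by (simp add: mult.assoc)
  qed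
  \<comment> \<open>\<phi> minus its linear part at q has gradient \<open>G x - G q\<close>, so a
    bound X for this on the ball gives \<open>X * norm \<eta>\<close>; both orders for \<phi>
    follow.\<close>
  have b5: "\<bar>\<phi> (q + \<eta>) - \<phi> q - G q \<bullet> \<eta>\<bar> \<le> X * norm \<eta>"
    if X: "\<And>\<zeta>. norm \<zeta> \<le> norm \<eta> \<Longrightarrow> norm (G (q + \<zeta>) - G q) \<le> X" for q \<eta> X
  proof -
    have "norm ((\<phi> (q + \<eta>) - G q \<bullet> (q + \<eta>)) - (\<phi> q - G q \<bullet> q)) \<le> X * norm (q + \<eta> - q)"
    proof (rule differentiable_bound[where S = "cball q (norm \<eta>)" and f' = "\<lambda>x e. G x \<bullet> e - G q \<bullet> e" and f = "\<lambda>x. \<phi> x - G q \<bullet> x"])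
      show "((\<lambda>x. \<phi> x - G q \<bullet> x) has_derivative (\<lambda>e. G y \<bullet> e - G q \<bullet> e)) (at y within cball q (norm \<eta>))" for y
        by (intro has_derivative_diff has_derivative_at_withinI[OF \<phi>_has_derivative] has_derivative_at_withinI[OF bounded_linear_imp_has_derivative] bounded_linear_inner_right)
      fix y assume "y \<in> cball q (norm \<eta>)"
      then have "norm (y - q) \<le> norm \<eta>" by (simp add: dist_norm norm_minus_commute)
      then have Xy: "norm (G y - G q) \<le> X" using X[of "y - q"] by simp
      show "onorm (\<lambda>e. G y \<bullet> e - G q \<bullet> e) \<le> X"
      proof (rule onorm_le)
        fix e :: "real^2"
        have "\<bar>(G y - G q) \<bullet> e\<bar> \<le> norm (G y - G q) * norm e" by (rule Cauchy_Schwarz_ineq2)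
        also have "\<dots> \<le> X * norm e" using Xy by (rule mult_right_mono) simp
        finally show "norm (G y \<bullet> e - G q \<bullet> e) \<le> X * norm e" by (simp add: inner_diff_left)
      qed
    qed (auto simp: dist_norm)
    then show ?thesis by (simp add: inner_add_right)
  qed
  show thesis
  \<comment> \<open>The second summand accommodates the bound for \<sigma>, which factors as
    \<open>(m - norm (G q)) * (m + norm (G q))\<close>.\<close>
  proof (rule that[of "B + 4 * m * B"])
    have le: "B * decay q * x \<le> (B + 4 * m * B) * decay q * x" "B * decay q \<le> (B + 4 * m * B) * decay q" if "x \<ge> 0" for q x
      using Bge(4) m_pos decay_pos(1)[of q] that by (auto intro!: mult_right_mono)
    show "B + 4 * m * B > 0" using Bge(4) m_pos by (simp add: add_pos_pos)
    fix q
    show "norm (G' q \<eta>) \<le> (B + 4 * m * B) * decay q * norm \<eta>" for \<eta>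
      using b4[of q \<eta>] le(1)[of "norm \<eta>" q] by simp
    show "\<sigma> q \<le> (B + 4 * m * B) * decay q"
    proof -
      let ?j = "sel q"
      have "G q - v ?j = (\<Sum>i\<in>I. (P i q - of_bool (i = ?j)) *\<^sub>R v i)"
        using sel(1)[of q] finI by (simp add: G_def scaleR_left_diff_distrib sum_subtractf of_bool_def if_distrib[of "\<lambda>x. x *\<^sub>R _"] sum.delta cong: if_cong)
      moreover have "norm (\<Sum>i\<in>I. (P i q - of_bool (i = ?j)) *\<^sub>R v i) \<le> N * (C * decay q)"
        unfolding N_def
      proof (rule comb_bound[where q = q])
        show "(\<Sum>i\<in>I. P i q - of_bool (i = ?j)) = 0" using sel(1)[of q] finI by (simp add: sum_subtractf sum_P of_bool_def sum.delta)
        fix i assume i: "i \<in> I" "i \<noteq> ?j"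
        show "\<bar>P i q - of_bool (i = ?j)\<bar> \<le> C * decay q" using Px[OF i, of q] r0 i P_nonneg[of i q] by simp
      qed
      moreover have "N * (C * decay q) \<le> B * decay q" using mult_right_mono[OF Bge(1) less_imp_le[OF decay_pos(1)[of q]]] by (simp add: mult_ac)
      ultimately have d: "norm (G q - v ?j) \<le> B * decay q" by simp
      have Gm: "norm (G q) \<le> m"
      proof -
        have "norm (G q) \<le> (\<Sum>i\<in>I. P i q * m)" unfolding G_def
          by (rule sum_norm_le) (use norm_v P_nonneg in simp)
        then show ?thesis by (simp add: sum_distrib_right[symmetric] sum_P)
      qed
      have "\<sigma> q = (m - norm (G q)) * (m + norm (G q))" by (simp add: \<sigma>_def power2_eq_square algebra_simps)
      also have "\<dots> \<le> (B * decay q) * (2 * m)"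
      proof (rule mult_mono)
        have "m \<le> norm (G q) + norm (G q - v ?j)"
          using norm_triangle_ineq4[of "G q" "G q - v ?j"] norm_v[OF sel(1)] by simp
        then show "m - norm (G q) \<le> B * decay q" using d by linarith
      qed (use Gm Bge(4) decay_pos(1)[of q] m_pos in \<open>auto intro!: add_nonneg_nonneg\<close>)
      also have "\<dots> \<le> (B + 4 * m * B) * decay q"
        using Bge(4) m_pos decay_pos(1)[of q] by (simp add: distrib_right mult_ac)
      finally show ?thesis .
    qed
    fix \<eta> :: "real^2" assume \<eta>: "norm \<eta> \<le> kap * (1 + depth q)"
    show "norm (G (q + \<eta>) - G q) \<le> (B + 4 * m * B) * decay q" using b1[OF \<eta>] le(2)[of 0 q] by simp
    show "norm (G (q + \<eta>) - G q) \<le> (B + 4 * m * B) * decay q * norm \<eta>" using b2[OF \<eta>] le(1)[of "norm \<eta>" q] by simp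
    show "norm (G (q + \<eta>) - G q - G' q \<eta>) \<le> (B + 4 * m * B) * decay q * (norm \<eta>)\<^sup>2" using b3[OF \<eta>] le(1)[of "(norm \<eta>)\<^sup>2" q] by simp
    have "\<bar>\<phi> (q + \<eta>) - \<phi> q - G q \<bullet> \<eta>\<bar> \<le> B * decay q * norm \<eta>"
      by (rule b5) (use b1 \<eta> order_trans in blast)
    then show "\<bar>\<phi> (q + \<eta>) - \<phi> q - G q \<bullet> \<eta>\<bar> \<le> (B + 4 * m * B) * decay q * norm \<eta>" using le(1)[of "norm \<eta>" q] by simp
    have "\<bar>\<phi> (q + \<eta>) - \<phi> q - G q \<bullet> \<eta>\<bar> \<le> (B * decay q * norm \<eta>) * norm \<eta>"
    proof (rule b5)
      fix \<zeta> :: "real^2" assume z: "norm \<zeta> \<le> norm \<eta>"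
      then have "norm (G (q + \<zeta>) - G q) \<le> B * decay q * norm \<zeta>" using b2 \<eta> by simp
      also have "\<dots> \<le> B * decay q * norm \<eta>" using z Bge(4) decay_pos(1)[of q] by (intro mult_left_mono) auto
      finally show "norm (G (q + \<zeta>) - G q) \<le> B * decay q * norm \<eta>" .
    qed
    then show "\<bar>\<phi> (q + \<eta>) - \<phi> q - G q \<bullet> \<eta>\<bar> \<le> (B + 4 * m * B) * decay q * (norm \<eta>)\<^sup>2" using le(1)[of "(norm \<eta>)\<^sup>2" q] by (simp add: power2_eq_square mult.assoc)
  qed
qed

end

section \<open>The one-dimensional profile\<close>

lemma Ck_on_real_deriv:
  fixes F :: "real \<Rightarrow> real"
  assumes "Ck_on (Suc k) UNIV F"
  shows "(F has_real_derivative deriv F t) (at t)" and "Ck_on k UNIV (deriv F)"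
proof -
  have d: "(F has_derivative (\<lambda>e. D1 F e t)) (at t)" for t by (rule has_derivative_D1[OF assms])
  have l: "D1 F e t = D1 F 1 t * e" for e t
    using linear_cmul[OF has_derivative_linear[OF d[of t]], of e 1] by simp
  have "(\<lambda>e. D1 F e t) = (*) (D1 F 1 t)" for t by (rule ext, rule l)
  then have r: "(F has_real_derivative D1 F 1 t) (at t)" for t
    using d[of t] unfolding has_field_derivative_def by (simp only:)
  then have e: "deriv F = D1 F 1" by (auto simp: DERIV_imp_deriv fun_eq_iff)
  show "(F has_real_derivative deriv F t) (at t)" unfolding e by (rule r)
  show "Ck_on k UNIV (deriv F)" unfolding e by (rule Ck_on_D1[OF assms])
qed

text \<open>Continuity covers the bounded region about which the asymptotic relation says nothing;
  with \<open>1 + \<bar>t\<bar>\<close> in place of \<open>\<bar>t\<bar>\<close> the bound holds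
  everywhere.\<close>

lemma bigo_powr_all:
  fixes u :: "real \<Rightarrow> real"
  assumes u: "u \<in> O[at_infinity](\<lambda>t. \<bar>t\<bar> powr (- a))" and cont: "continuous_on UNIV u" and a: "a \<ge> 0"
  obtains C where "C \<ge> 0" "\<And>t. \<bar>u t\<bar> \<le> C * (1 + \<bar>t\<bar>) powr (- a)"
proof -
  obtain c where "eventually (\<lambda>t. norm (u t) \<le> c * norm (\<bar>t\<bar> powr (- a))) at_infinity"
    using landau_o.bigE[OF u] by blast
  then obtain b where b: "\<And>t. b \<le> norm t \<Longrightarrow> norm (u t) \<le> c * norm (\<bar>t\<bar> powr (- a))"
    unfolding eventually_at_infinity by blast
  obtain C' where "\<And>t. \<bar>u t\<bar> \<le> C' * weight a t" "C' \<ge> 0"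
    by (rule bounded_by_weight[OF cont max.cobounded2[of 1 b] a, of c]) (use b in auto)
  then show thesis using that by (simp add: weight_def)
qed

locale front =
  fixes s k :: real and f \<Phi> :: "real \<Rightarrow> real"
  assumes s: "1/2 < s" "s < 1" and bistable: "bistable f" and profile: "profile s f k \<Phi>" and k: "k > 0"
    and O0: "(\<lambda>\<mu>. 1 - \<bar>\<Phi> \<mu>\<bar>) \<in> O[at_infinity](\<lambda>\<mu>. \<bar>\<mu>\<bar> powr (- 2 * s))"
    and O1: "(\<lambda>\<mu>. - deriv \<Phi> \<mu>) \<in> O[at_infinity](\<lambda>\<mu>. \<bar>\<mu>\<bar> powr (- 1 - 2 * s))"
begin

section \<open>Monotonicity and decay of the profile\<close>

lemma \<Phi>_Ck: "Ck_on (Suc (Suc 0)) UNIV \<Phi>"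
  using profile by (simp add: profile_def Cs2_def numeral_2_eq_2 del: Ck_on.simps)

lemma f_Ck: "Ck_on (Suc (Suc 0)) UNIV f"
  using bistable by (simp add: bistable_def numeral_2_eq_2 del: Ck_on.simps)

lemma \<Phi>_deriv: "(\<Phi> has_real_derivative deriv \<Phi> t) (at t)" by (rule Ck_on_real_deriv(1)[OF \<Phi>_Ck])

lemma \<Phi>'_cont: "continuous_on UNIV (deriv \<Phi>)" by (rule Ck_on_imp_continuous_on[OF Ck_on_real_deriv(2)[OF \<Phi>_Ck]])

lemma \<Phi>'_deriv: "(deriv \<Phi> has_real_derivative deriv (deriv \<Phi>) t) (at t)"
  by (rule Ck_on_real_deriv(1)[OF Ck_on_real_deriv(2)[OF \<Phi>_Ck]])

lemma \<Phi>''_cont: "continuous_on UNIV (deriv (deriv \<Phi>))"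
  using Ck_on_real_deriv(2)[OF Ck_on_real_deriv(2)[OF \<Phi>_Ck]] by simp

lemma \<Phi>_cont: "continuous_on UNIV \<Phi>" by (rule Ck_on_imp_continuous_on[OF \<Phi>_Ck])

lemma \<Phi>'_neg: "deriv \<Phi> t < 0" using profile by (simp add: profile_def)

lemma \<Phi>_less: "x < y \<Longrightarrow> \<Phi> y < \<Phi> x"
  using DERIV_neg_imp_decreasing[of x y \<Phi>] \<Phi>_deriv \<Phi>'_neg by blast

lemma \<Phi>_lim: "(\<Phi> \<longlongrightarrow> -1) at_top" "(\<Phi> \<longlongrightarrow> 1) at_bot" using profile by (auto simp: profile_def)

text \<open>The limits give weak inequalities only; applying them at \<open>t + 1\<close> and
  \<open>t - 1\<close> makes them strict by monotonicity.\<close>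

lemma \<Phi>_bound: "-1 < \<Phi> t" "\<Phi> t < 1"
proof -
  have "eventually (\<lambda>x. \<Phi> x \<le> \<Phi> (t + 1)) at_top"
    using eventually_gt_at_top[of "t + 1"] by eventually_elim (simp add: \<Phi>_less less_imp_le)
  then have "-1 \<le> \<Phi> (t + 1)" by (rule tendsto_upperbound[OF \<Phi>_lim(1)]) simp
  then show "-1 < \<Phi> t" using \<Phi>_less[of t "t + 1"] by simp
  have "eventually (\<lambda>x. \<Phi> x \<ge> \<Phi> (t - 1)) at_bot"
    using eventually_le_at_bot[of "t - 1"] by eventually_elim (metis \<Phi>_less less_imp_le order_le_less order_refl)
  then have "\<Phi> (t - 1) \<le> 1" by (rule tendsto_lowerbound[OF \<Phi>_lim(2)]) simp
  then show "\<Phi> t < 1" using \<Phi>_less[of "t - 1" t] by simp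
qed

lemma \<Phi>_abs: "\<bar>\<Phi> t\<bar> \<le> 1" using \<Phi>_bound[of t] by simp

text \<open>The constant may depend on m: its purpose is the convergence of the principal value, and
  the uniform bounds are obtained by other means.\<close>

lemma \<Phi>_taylor: "\<exists>d C. \<forall>\<tau>. \<bar>\<tau>\<bar> \<le> 1 \<longrightarrow> \<bar>\<Phi> (m + \<tau>) - \<Phi> m - d * \<tau>\<bar> \<le> C * \<tau>\<^sup>2"
proof -
  have "compact (deriv (deriv \<Phi>) ` {m-1..m+1})"
    by (intro compact_continuous_image continuous_on_subset[OF \<Phi>''_cont]) auto
  then have "bounded (deriv (deriv \<Phi>) ` {m-1..m+1})" by (rule compact_imp_bounded)
  then obtain K where "\<forall>x\<in>deriv (deriv \<Phi>) ` {m-1..m+1}. norm x \<le> K" unfolding bounded_iff by blast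
  then have K: "\<bar>deriv (deriv \<Phi>) x\<bar> \<le> K" if "x \<in> {m-1..m+1}" for x using that by simp
  have K0: "K \<ge> 0" using K[of m] by simp
  have "\<bar>\<Phi> (m + \<tau>) - \<Phi> m - deriv \<Phi> m * \<tau>\<bar> \<le> K * \<tau>\<^sup>2" if \<tau>: "\<bar>\<tau>\<bar> \<le> 1" for \<tau>
  proof -
    have D: "\<bar>deriv \<Phi> y - deriv \<Phi> m\<bar> \<le> K * \<bar>y - m\<bar>" if "y \<in> {m-1..m+1}" for y
      using field_differentiable_bound[of "{m-1..m+1}" "deriv \<Phi>" "deriv (deriv \<Phi>)" K y m] that K
      by (auto intro: DERIV_subset[OF \<Phi>'_deriv])
    have "norm ((\<Phi> (m + \<tau>) - deriv \<Phi> m * (m + \<tau>)) - (\<Phi> m - deriv \<Phi> m * m)) \<le> K * \<bar>\<tau>\<bar> * norm ((m + \<tau>) - m)"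
    proof (rule field_differentiable_bound[of "cball m \<bar>\<tau>\<bar>" _ "\<lambda>y. deriv \<Phi> y - deriv \<Phi> m"])
      show "((\<lambda>y. \<Phi> y - deriv \<Phi> m * y) has_field_derivative deriv \<Phi> z - deriv \<Phi> m) (at z within cball m \<bar>\<tau>\<bar>)" for z
        by (auto intro!: derivative_eq_intros DERIV_subset[OF \<Phi>_deriv])
      fix z assume "z \<in> cball m \<bar>\<tau>\<bar>"
      then have z: "\<bar>z - m\<bar> \<le> \<bar>\<tau>\<bar>" by (simp add: dist_real_def abs_minus_commute)
      then have "z \<in> {m-1..m+1}" using \<tau> by (auto simp: abs_le_iff)
      from D[OF this] show "norm (deriv \<Phi> z - deriv \<Phi> m) \<le> K * \<bar>\<tau>\<bar>"
        using mult_left_mono[OF z K0] by simp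
    qed (auto simp: dist_real_def)
    moreover have "(\<Phi> (m + \<tau>) - deriv \<Phi> m * (m + \<tau>)) - (\<Phi> m - deriv \<Phi> m * m) = \<Phi> (m + \<tau>) - \<Phi> m - deriv \<Phi> m * \<tau>"
      by (simp add: algebra_simps)
    moreover have "K * \<bar>\<tau>\<bar> * norm ((m + \<tau>) - m) = K * \<tau>\<^sup>2" by (simp add: power2_eq_square)
    ultimately show ?thesis by (simp only: real_norm_def)
  qed
  then show ?thesis by blast
qed

lemma \<Phi>'_decay: obtains C where "C > 0" "\<And>t. \<bar>deriv \<Phi> t\<bar> \<le> C * (1 + \<bar>t\<bar>) powr (- (1 + 2 * s))" "\<And>t. \<bar>deriv \<Phi> t\<bar> \<le> C / (1 + \<bar>t\<bar>)" "\<And>t. \<bar>deriv \<Phi> t\<bar> \<le> C"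
proof -
  have "(\<lambda>t. - deriv \<Phi> t) \<in> O[at_infinity](\<lambda>t. \<bar>t\<bar> powr (- (1 + 2 * s)))" using O1 by simp
  then obtain C where C: "C \<ge> 0" "\<And>t. \<bar>- deriv \<Phi> t\<bar> \<le> C * (1 + \<bar>t\<bar>) powr (- (1 + 2 * s))"
    by (rule bigo_powr_all) (use s in \<open>auto intro!: continuous_on_minus \<Phi>'_cont\<close>)
  have le: "(1 + \<bar>t\<bar>) powr (- (1 + 2 * s)) \<le> 1 / (1 + \<bar>t\<bar>)" for t
  proof -
    have "(1 + \<bar>t\<bar>) powr (- (1 + 2 * s)) \<le> (1 + \<bar>t\<bar>) powr (- 1)" using s by (intro powr_mono) auto
    then show ?thesis by (simp add: powr_minus_divide)
  qed
  have le1: "1 / (1 + \<bar>t\<bar>) \<le> 1" for t :: real by (simp add: divide_le_eq)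
  show thesis
  proof (rule that[of "C + 1"])
    show "C + 1 > 0" using C(1) by simp
    fix t
    have "C * (1 + \<bar>t\<bar>) powr (- (1 + 2 * s)) \<le> (C + 1) * (1 + \<bar>t\<bar>) powr (- (1 + 2 * s))" by (intro mult_right_mono) auto
    then show a: "\<bar>deriv \<Phi> t\<bar> \<le> (C + 1) * (1 + \<bar>t\<bar>) powr (- (1 + 2 * s))" using C(2)[of t] by simp
    have "(C + 1) * (1 + \<bar>t\<bar>) powr (- (1 + 2 * s)) \<le> (C + 1) * (1 / (1 + \<bar>t\<bar>))" using le[of t] C(1) by (intro mult_left_mono) auto
    then show b: "\<bar>deriv \<Phi> t\<bar> \<le> (C + 1) / (1 + \<bar>t\<bar>)" using a by simp
    have "(C + 1) * (1 / (1 + \<bar>t\<bar>)) \<le> (C + 1) * 1" using le1[of t] C(1) by (intro mult_left_mono) auto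
    then show "\<bar>deriv \<Phi> t\<bar> \<le> C + 1" using b by simp
  qed
qed

lemma \<Phi>_MVT: "\<bar>\<Phi> x - \<Phi> y\<bar> \<le> B * \<bar>x - y\<bar>" if "\<And>z. min x y \<le> z \<Longrightarrow> z \<le> max x y \<Longrightarrow> \<bar>deriv \<Phi> z\<bar> \<le> B"
  using field_differentiable_bound[of "{min x y..max x y}" \<Phi> "deriv \<Phi>" B x y] that
  by (auto intro: DERIV_subset[OF \<Phi>_deriv])

text \<open>If \<tau> is short compared with \<open>1 + \<bar>m\<bar>\<close>, the derivative along
  the whole segment is of order \<open>1 / (1 + \<bar>m\<bar>)\<close>. If it is long, the
  right-hand side is at least 2, the oscillation of \<Phi>.\<close>

lemma \<Phi>_increment: obtains K where "K > 0" "\<And>m \<tau>. \<bar>\<Phi> m - \<Phi> (m + \<tau>)\<bar> \<le> K / (1 + \<bar>m\<bar>) * \<bar>\<tau>\<bar>"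
proof -
  obtain C where C: "C > 0" "\<And>t. \<bar>deriv \<Phi> t\<bar> \<le> C / (1 + \<bar>t\<bar>)" "\<And>t. \<bar>deriv \<Phi> t\<bar> \<le> C" by (rule \<Phi>'_decay) blast
  show thesis
  proof (rule that[of "2 * C + 6"])
    show "2 * C + 6 > 0" using C(1) by simp
    fix m \<tau>
    show "\<bar>\<Phi> m - \<Phi> (m + \<tau>)\<bar> \<le> (2 * C + 6) / (1 + \<bar>m\<bar>) * \<bar>\<tau>\<bar>"
    proof (cases "2 * \<bar>\<tau>\<bar> \<le> 1 + \<bar>m\<bar>")
      case True
      have "\<bar>\<Phi> m - \<Phi> (m + \<tau>)\<bar> \<le> (2 * C / (1 + \<bar>m\<bar>)) * \<bar>m - (m + \<tau>)\<bar>"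
      proof (rule \<Phi>_MVT)
        fix z assume "min m (m + \<tau>) \<le> z" "z \<le> max m (m + \<tau>)"
        then have "1 + \<bar>m\<bar> \<le> 2 * (1 + \<bar>z\<bar>)" using True by (auto simp: abs_if split: if_splits)
        then have "C / (1 + \<bar>z\<bar>) \<le> 2 * C / (1 + \<bar>m\<bar>)"
        proof -
          have "2 * C / (2 * (1 + \<bar>z\<bar>)) \<le> 2 * C / (1 + \<bar>m\<bar>)"
            using C(1) \<open>1 + \<bar>m\<bar> \<le> _\<close> by (intro divide_left_mono mult_pos_pos) auto
          moreover have "2 * C / (2 * (1 + \<bar>z\<bar>)) = C / (1 + \<bar>z\<bar>)" by (rule mult_divide_mult_cancel_left) simp
          ultimately show ?thesis by (simp only:)
        qed
        then show "\<bar>deriv \<Phi> z\<bar> \<le> 2 * C / (1 + \<bar>m\<bar>)" using C(2)[of z] by linarith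
      qed
      also have "\<dots> \<le> (2 * C + 6) / (1 + \<bar>m\<bar>) * \<bar>\<tau>\<bar>"
        by (simp, intro mult_right_mono divide_right_mono) auto
      finally show ?thesis .
    next
      case False
      have "\<bar>\<Phi> m - \<Phi> (m + \<tau>)\<bar> \<le> 2" using \<Phi>_abs[of m] \<Phi>_abs[of "m + \<tau>"] by linarith
      moreover have "2 * (1 + \<bar>m\<bar>) \<le> (2 * C + 6) * \<bar>\<tau>\<bar>"
      proof -
        have "0 \<le> 2 * C * \<bar>\<tau>\<bar>" using C(1) by simp
        then show ?thesis using False abs_ge_zero[of m] unfolding distrib_right distrib_left by linarith
      qed
      moreover have "0 < 1 + \<bar>m\<bar>" using abs_ge_zero[of m] by linarith
      ultimately have "2 \<le> (2 * C + 6) / (1 + \<bar>m\<bar>) * \<bar>\<tau>\<bar>" by (simp add: pos_le_divide_eq)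
      with \<open>\<bar>\<Phi> m - \<Phi> (m + \<tau>)\<bar> \<le> 2\<close> show ?thesis by linarith
    qed
  qed
qed

section \<open>The reaction term\<close>

lemma f_deriv: "(f has_real_derivative deriv f t) (at t)" by (rule Ck_on_real_deriv(1)[OF f_Ck])

lemma f'_cont: "continuous_on UNIV (deriv f)" by (rule Ck_on_imp_continuous_on[OF Ck_on_real_deriv(2)[OF f_Ck]])

lemma f_bound: obtains M where "M > 0" "\<And>t. \<bar>t\<bar> \<le> R \<Longrightarrow> \<bar>deriv f t\<bar> \<le> M"
    "\<And>t u. \<bar>t\<bar> \<le> R \<Longrightarrow> \<bar>u\<bar> \<le> R \<Longrightarrow> \<bar>f t - f u\<bar> \<le> M * \<bar>t - u\<bar>"
proof -
  have "compact (deriv f ` {-R..R})"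
    by (intro compact_continuous_image continuous_on_subset[OF f'_cont]) auto
  then have "bounded (deriv f ` {-R..R})" by (rule compact_imp_bounded)
  then obtain M where "\<forall>x\<in>deriv f ` {-R..R}. norm x \<le> M" unfolding bounded_iff by blast
  then have M: "\<bar>deriv f t\<bar> \<le> \<bar>M\<bar> + 1" if "\<bar>t\<bar> \<le> R" for t
  proof -
    have "t \<in> {-R..R}" using that by auto
    then have "norm (deriv f t) \<le> M" using \<open>\<forall>x\<in>deriv f ` {-R..R}. norm x \<le> M\<close> by blast
    then show ?thesis by simp
  qed
  show thesis
  proof (rule that[of "\<bar>M\<bar> + 1"])
    show "\<bar>f t - f u\<bar> \<le> (\<bar>M\<bar> + 1) * \<bar>t - u\<bar>" if "\<bar>t\<bar> \<le> R" "\<bar>u\<bar> \<le> R" for t u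
    proof -
      have "norm (f t - f u) \<le> (\<bar>M\<bar> + 1) * norm (t - u)"
      proof (rule field_differentiable_bound[of "{-R..R}" f "deriv f"])
        show "(f has_field_derivative deriv f z) (at z within {-R..R})" for z by (rule DERIV_subset[OF f_deriv]) simp
        show "norm (deriv f z) \<le> \<bar>M\<bar> + 1" if "z \<in> {-R..R}" for z using M[of z] that by (simp add: abs_le_iff)
      qed (use that in \<open>auto simp: abs_le_iff\<close>)
      then show ?thesis by simp
    qed
  qed (use M in auto)
qed

text \<open>Read off from the profile equation instead of the integral: the derivative of \<Phi>
  decays, and \<open>f (\<Phi> m)\<close> is controlled by the distance of \<open>\<Phi> m\<close>
  to the nearer of the zeros 1 and -1.\<close>

lemma \<Phi>_frac_laplacian_decay: obtains K where "K > 0" "\<And>m. \<bar>frac_laplacian s \<Phi> m\<bar> \<le> K * (1 + \<bar>m\<bar>) powr (- 2 * s)"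
proof -
  have f01: "f 1 = 0" "f (-1) = 0" using bistable by (auto simp: bistable_def)
  obtain M where M: "M > 0" "\<And>t u. \<bar>t\<bar> \<le> 1 \<Longrightarrow> \<bar>u\<bar> \<le> 1 \<Longrightarrow> \<bar>f t - f u\<bar> \<le> M * \<bar>t - u\<bar>" by (rule f_bound[of 1]) blast
  have "(\<lambda>\<mu>. 1 - \<bar>\<Phi> \<mu>\<bar>) \<in> O[at_infinity](\<lambda>\<mu>. \<bar>\<mu>\<bar> powr (- (2 * s)))" using O0 by simp
  then obtain C0 where C0: "C0 \<ge> 0" "\<And>t. \<bar>1 - \<bar>\<Phi> t\<bar>\<bar> \<le> C0 * (1 + \<bar>t\<bar>) powr (- (2 * s))"
    by (rule bigo_powr_all) (use s in \<open>auto intro!: continuous_intros \<Phi>_cont\<close>)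
  obtain C where C: "C > 0" "\<And>t. \<bar>deriv \<Phi> t\<bar> \<le> C * (1 + \<bar>t\<bar>) powr (- (1 + 2 * s))" by (rule \<Phi>'_decay) blast
  show thesis
  proof (rule that[of "k * C + M * C0"])
    show "k * C + M * C0 > 0" using k C(1) M(1) C0(1) by (intro add_pos_nonneg mult_pos_pos mult_nonneg_nonneg) auto
    fix m
    let ?w = "(1 + \<bar>m\<bar>) powr (- 2 * s)"
    have eq: "frac_laplacian s \<Phi> m = k * deriv \<Phi> m + f (\<Phi> m)"
    proof -
      have "frac_laplacian s \<Phi> m - k * deriv \<Phi> m - f (\<Phi> m) = 0" using profile by (simp add: profile_def)
      then show ?thesis by simp
    qed
    have "\<bar>f (\<Phi> m)\<bar> \<le> M * (1 - \<bar>\<Phi> m\<bar>)"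
      using M(2)[of "\<Phi> m" 1] M(2)[of "\<Phi> m" "-1"] f01 \<Phi>_abs[of m] by (cases "\<Phi> m \<ge> 0") (auto simp: add.commute)
    also have "\<dots> \<le> M * (C0 * ?w)" using C0(2)[of m] \<Phi>_abs[of m] M(1) by (intro mult_left_mono) auto
    finally have a: "\<bar>f (\<Phi> m)\<bar> \<le> M * C0 * ?w" by simp
    have "(1 + \<bar>m\<bar>) powr (- (1 + 2 * s)) \<le> ?w" by (intro powr_mono) auto
    then have "C * (1 + \<bar>m\<bar>) powr (- (1 + 2 * s)) \<le> C * ?w" using C(1) by (intro mult_left_mono) auto
    then have "\<bar>deriv \<Phi> m\<bar> \<le> C * ?w" using C(2)[of m] by linarith
    then have "\<bar>k * deriv \<Phi> m\<bar> \<le> k * (C * ?w)" using k by (simp add: abs_mult)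
    then show "\<bar>frac_laplacian s \<Phi> m\<bar> \<le> (k * C + M * C0) * ?w"
      unfolding eq using a by (simp add: distrib_right mult.assoc)
  qed
qed

lemma reaction_gain:
  assumes Smax: "Smax > 0"
  obtains \<epsilon> b where "0 < \<epsilon>" "\<epsilon> < 1" "b > 0"
    "\<And>t S. 0 < S \<Longrightarrow> S \<le> Smax \<Longrightarrow> b * S \<le> - S * deriv \<Phi> t - (f (\<Phi> t + \<epsilon> * S) - f (\<Phi> t))"
proof -
  have f': "deriv f 1 < 0" "deriv f (-1) < 0" using bistable by (auto simp: bistable_def)
  define a where "a = min (- deriv f 1) (- deriv f (-1)) / 2"
  have a: "a > 0" using f' by (simp add: a_def)
  have cont1: "isCont (deriv f) 1" "isCont (deriv f) (-1)" using f'_cont by (auto simp: continuous_on_eq_continuous_at)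
  obtain d1 where d1: "d1 > 0" "\<And>t. \<bar>t - 1\<bar> < d1 \<Longrightarrow> deriv f t < - a"
  proof -
    have "deriv f 1 < - a" using f' by (auto simp: a_def)
    then have "eventually (\<lambda>t. deriv f t < - a) (nhds 1)"
      using cont1(1) order_tendstoD(2)[of "deriv f" "deriv f 1" "nhds 1" "-a"] by (simp add: continuous_at tendsto_nhds_iff)
    then show thesis using that unfolding eventually_nhds_metric by (auto simp: dist_real_def)
  qed
  obtain d2 where d2: "d2 > 0" "\<And>t. \<bar>t + 1\<bar> < d2 \<Longrightarrow> deriv f t < - a"
  proof -
    have "deriv f (-1) < - a" using f' by (auto simp: a_def)
    then have "eventually (\<lambda>t. deriv f t < - a) (nhds (-1))"
      using cont1(2) order_tendstoD(2)[of "deriv f" "deriv f (-1)" "nhds (-1)" "-a"] by (simp add: continuous_at tendsto_nhds_iff)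
    then show thesis using that unfolding eventually_nhds_metric by (auto simp: dist_real_def)
  qed
  \<comment> \<open>Half, because \<Phi> is within d of its limit and the shift adds at most d
    more.\<close>
  define d where "d = min 1 (min d1 d2) / 2"
  have d: "d > 0" "d \<le> 1/2" "2 * d \<le> d1" "2 * d \<le> d2" using d1 d2 by (auto simp: d_def)
  obtain t1 where t1: "\<And>t. t \<ge> t1 \<Longrightarrow> \<Phi> t < -1 + d"
    using order_tendstoD(2)[OF \<Phi>_lim(1), of "-1 + d"] d by (auto simp: eventually_at_top_linorder)
  obtain t2 where t2: "\<And>t. t \<le> t2 \<Longrightarrow> \<Phi> t > 1 - d"
    using order_tendstoD(1)[OF \<Phi>_lim(2), of "1 - d"] d by (auto simp: eventually_at_bot_linorder)
  obtain b0 where b0: "b0 > 0" "\<And>t. t2 \<le> t \<Longrightarrow> t \<le> t1 \<Longrightarrow> deriv \<Phi> t \<le> - b0"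
  proof (cases "t2 \<le> t1")
    case True
    obtain x where "x \<in> {t2..t1}" "\<forall>y\<in>{t2..t1}. deriv \<Phi> y \<le> deriv \<Phi> x"
      using continuous_attains_sup[of "{t2..t1}" "deriv \<Phi>"] True continuous_on_subset[OF \<Phi>'_cont] by auto
    then show thesis using that[of "- deriv \<Phi> x"] \<Phi>'_neg[of x] by auto
  next
    case False
    then show thesis using that[of 1] by auto
  qed
  obtain M where M: "M > 0" "\<And>t u. \<bar>t\<bar> \<le> 2 \<Longrightarrow> \<bar>u\<bar> \<le> 2 \<Longrightarrow> \<bar>f t - f u\<bar> \<le> M * \<bar>t - u\<bar>" by (rule f_bound[of 2]) blast
  \<comment> \<open>\<open>d / Smax\<close> keeps the shift \<open>\<epsilon> * S\<close> below d;
    \<open>b0 / (2 * M)\<close> lets the reaction consume at most half of the gain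
    \<open>b0 * S\<close> between the ends of the profile.\<close>
  define \<epsilon> where "\<epsilon> = min (1/2) (min (d / Smax) (b0 / (2 * M)))"
  have \<epsilon>: "0 < \<epsilon>" "\<epsilon> < 1" "\<epsilon> \<le> d / Smax" "\<epsilon> \<le> b0 / (2 * M)"
    using d b0 M Smax by (auto simp: \<epsilon>_def)
  show thesis
  proof (rule that[OF \<epsilon>(1,2), of "min (a * \<epsilon>) (b0 / 2)"])
    show "min (a * \<epsilon>) (b0 / 2) > 0" using a \<epsilon> b0 by simp
    fix t S assume S: "0 < S" "S \<le> Smax"
    have eS: "0 < \<epsilon> * S" "\<epsilon> * S \<le> d"
    proof -
      show "0 < \<epsilon> * S" using \<epsilon> S by simp
      have "\<epsilon> * S \<le> d / Smax * Smax" using \<epsilon> S d Smax by (intro mult_mono) auto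
      then show "\<epsilon> * S \<le> d" using Smax by simp
    qed
    have near: "min (a * \<epsilon>) (b0 / 2) * S \<le> - S * deriv \<Phi> t - (f (\<Phi> t + \<epsilon> * S) - f (\<Phi> t))"
      if fa: "\<And>x. \<Phi> t \<le> x \<Longrightarrow> x \<le> \<Phi> t + \<epsilon> * S \<Longrightarrow> deriv f x < - a"
    proof -
      obtain z where z: "\<Phi> t < z" "z < \<Phi> t + \<epsilon> * S" "f (\<Phi> t + \<epsilon> * S) - f (\<Phi> t) = (\<Phi> t + \<epsilon> * S - \<Phi> t) * deriv f z"
        using MVT2[of "\<Phi> t" "\<Phi> t + \<epsilon> * S" f "deriv f"] eS(1) f_deriv by auto
      have "(\<epsilon> * S) * deriv f z \<le> (\<epsilon> * S) * (- a)" using fa[of z] z eS(1) by (intro mult_left_mono) auto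
      then have "f (\<Phi> t + \<epsilon> * S) - f (\<Phi> t) \<le> - (a * \<epsilon> * S)" using z(3) by (simp add: mult_ac)
      moreover have "0 \<le> - S * deriv \<Phi> t" using S \<Phi>'_neg[of t] by (simp add: mult_nonneg_nonpos)
      moreover have "min (a * \<epsilon>) (b0 / 2) * S \<le> a * \<epsilon> * S" using S by (intro mult_right_mono) auto
      ultimately show ?thesis by linarith
    qed
    consider "t \<ge> t1" | "t \<le> t2" | "t2 \<le> t" "t \<le> t1" by linarith
    then show "min (a * \<epsilon>) (b0 / 2) * S \<le> - S * deriv \<Phi> t - (f (\<Phi> t + \<epsilon> * S) - f (\<Phi> t))"
    proof cases
      case 1
      show ?thesis
      proof (rule near, rule d2(2))
        fix x assume "\<Phi> t \<le> x" "x \<le> \<Phi> t + \<epsilon> * S"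
        then show "\<bar>x + 1\<bar> < d2" using t1[OF 1] eS d \<Phi>_bound(1)[of t] by (simp add: abs_less_iff)
      qed
    next
      case 2
      show ?thesis
      proof (rule near, rule d1(2))
        fix x assume "\<Phi> t \<le> x" "x \<le> \<Phi> t + \<epsilon> * S"
        then show "\<bar>x - 1\<bar> < d1" using t2[OF 2] eS d \<Phi>_bound(2)[of t] by (simp add: abs_less_iff)
      qed
    next
      case 3
      have "\<bar>f (\<Phi> t + \<epsilon> * S) - f (\<Phi> t)\<bar> \<le> M * \<bar>\<Phi> t + \<epsilon> * S - \<Phi> t\<bar>"
        using M(2)[of "\<Phi> t + \<epsilon> * S" "\<Phi> t"] eS d \<Phi>_bound[of t] by (simp add: abs_le_iff)
      also have "\<dots> = (M * \<epsilon>) * S" using eS by simp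
      also have "\<dots> \<le> (b0 / 2) * S"
      proof -
        have "M * \<epsilon> \<le> M * (b0 / (2 * M))" using \<epsilon>(4) M(1) by (intro mult_left_mono) auto
        then show ?thesis using M(1) S by (intro mult_right_mono) auto
      qed
      finally have "f (\<Phi> t + \<epsilon> * S) - f (\<Phi> t) \<le> (b0 / 2) * S" by linarith
      moreover have "b0 * S \<le> - S * deriv \<Phi> t" using mult_left_mono[OF b0(2)[OF 3] less_imp_le[OF S(1)]] by (simp add: mult_ac)
      moreover have "min (a * \<epsilon>) (b0 / 2) * S \<le> b0 / 2 * S" using S by (intro mult_right_mono) auto
      ultimately show ?thesis by linarith
    qed
  qed
qed

end

section \<open>The super-solution\<close>

text \<open>In the variables \<open>a = 1 / sqrt x\<close> and \<open>b = 1 / sqrt y\<close> the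
  increment is \<open>x - y\<close> times a rational function of a and b, and everything follows
  from both lying in the interval from 0 to 1; \<open>- a ^ 3 / 2\<close> is the derivative of the
  inverse root.\<close>

lemma inverse_sqrt_taylor:
  fixes x y :: real
  assumes "x \<ge> 1" "y \<ge> 1"
  shows "\<bar>1 / sqrt y - 1 / sqrt x\<bar> \<le> \<bar>y - x\<bar>"
    and "\<bar>1 / sqrt y - 1 / sqrt x + (1 / sqrt x) ^ 3 * (y - x) / 2\<bar> \<le> (y - x)\<^sup>2"
proof -
  define a b where "a = 1 / sqrt x" and "b = 1 / sqrt y"
  have a: "0 < a" "a \<le> 1" and b: "0 < b" "b \<le> 1" using assms by (auto simp: a_def b_def)
  have xa: "x = 1 / a\<^sup>2" and yb: "y = 1 / b\<^sup>2" using assms by (auto simp: a_def b_def power_divide)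
  have ab: "b - a = (x - y) * (a\<^sup>2 * b\<^sup>2 / (a + b))"
  proof -
    have "(x - y) * (a\<^sup>2 * b\<^sup>2) = b\<^sup>2 - a\<^sup>2" unfolding xa yb using a b by (simp add: field_simps)
    also have "\<dots> = (b - a) * (a + b)" by (simp add: power2_eq_square algebra_simps)
    finally have "(x - y) * (a\<^sup>2 * b\<^sup>2) / (a + b) = b - a" using a b by simp
    then show ?thesis by simp
  qed
  have r: "0 \<le> a\<^sup>2 * b\<^sup>2 / (a + b)" "a\<^sup>2 * b\<^sup>2 / (a + b) \<le> 1"
  proof -
    have "a\<^sup>2 * b\<^sup>2 \<le> a * 1"
      using a b by (intro mult_mono) (auto simp: power2_eq_square mult_le_one mult_left_le)
    then have "a\<^sup>2 * b\<^sup>2 \<le> a + b" using b by simp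
    then show "a\<^sup>2 * b\<^sup>2 / (a + b) \<le> 1" using a b by (simp add: divide_le_eq)
    show "0 \<le> a\<^sup>2 * b\<^sup>2 / (a + b)" using a b by simp
  qed
  have 1: "\<bar>b - a\<bar> \<le> \<bar>y - x\<bar>"
  proof -
    have "\<bar>b - a\<bar> = \<bar>x - y\<bar> * (a\<^sup>2 * b\<^sup>2 / (a + b))" by (simp only: ab abs_mult abs_of_nonneg[OF r(1)])
    also have "\<dots> \<le> \<bar>x - y\<bar> * 1" using r by (intro mult_left_mono) auto
    finally show ?thesis by (simp add: abs_minus_commute)
  qed
  then show "\<bar>1 / sqrt y - 1 / sqrt x\<bar> \<le> \<bar>y - x\<bar>" by (simp add: a_def b_def)
  have "b - a + a ^ 3 * (y - x) / 2 = (x - y) * (a\<^sup>2 * ((b - a) * ((2 * b + a) / (2 * (a + b)))))"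
  proof -
    have "a\<^sup>2 * b\<^sup>2 / (a + b) - a ^ 3 / 2 = a\<^sup>2 * ((b - a) * ((2 * b + a) / (2 * (a + b))))"
      using a b by (simp add: field_simps power2_eq_square power3_eq_cube)
    moreover have "b - a + a ^ 3 * (y - x) / 2 = (x - y) * (a\<^sup>2 * b\<^sup>2 / (a + b) - a ^ 3 / 2)"
      unfolding right_diff_distrib ab[symmetric] by (simp add: field_simps)
    ultimately show ?thesis by simp
  qed
  moreover have "0 \<le> (2 * b + a) / (2 * (a + b))" using a b by (intro divide_nonneg_pos) auto
  ultimately have "\<bar>b - a + a ^ 3 * (y - x) / 2\<bar> = \<bar>x - y\<bar> * (a\<^sup>2 * (\<bar>b - a\<bar> * ((2 * b + a) / (2 * (a + b)))))"
    by (simp only: abs_mult abs_of_nonneg zero_le_power2)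
  also have "\<dots> \<le> \<bar>x - y\<bar> * (1 * (\<bar>y - x\<bar> * 1))"
  proof (intro mult_left_mono mult_mono 1)
    show "a\<^sup>2 \<le> 1" using a by (simp add: power_le_one)
    show "(2 * b + a) / (2 * (a + b)) \<le> 1" using a b by (simp add: divide_le_eq)
  qed (use a b in auto)
  also have "\<dots> = (y - x)\<^sup>2" by (simp add: power2_eq_square abs_minus_commute[of x y])
  finally show "\<bar>1 / sqrt y - 1 / sqrt x + (1 / sqrt x) ^ 3 * (y - x) / 2\<bar> \<le> (y - x)\<^sup>2" by (simp add: a_def b_def)
qed

text \<open>Interpolation between a bounded and a linear estimate, resting on
  \<open>min 1 x \<le> x powr \<theta>\<close>.\<close>

lemma min_le_powr:
  fixes X x :: real
  assumes th: "0 \<le> \<theta>" "\<theta> \<le> 1" and x: "0 \<le> x" and X: "0 \<le> X" and le: "u \<le> X" "u \<le> X * x"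
  shows "u \<le> X * x powr \<theta>"
proof (cases "x = 0")
  case True
  then show ?thesis using le by simp
next
  case False
  show ?thesis
  proof (cases "x \<le> 1")
    case True
    then have "x powr 1 \<le> x powr \<theta>" using th False x by (intro powr_mono') auto
    then show ?thesis using le(2) mult_left_mono[OF _ X, of x "x powr \<theta>"] False x by simp
  next
    case False
    then have "1 \<le> x powr \<theta>" using th ge_one_powr_ge_zero by simp
    then show ?thesis using le(1) mult_left_mono[OF _ X, of 1 "x powr \<theta>"] by simp
  qed
qed

lemma linear_xy: "linear xy"
  by (rule linearI) (simp_all add: xy_def vec_eq_iff forall_2)

lemma xy_add: "xy (x + y) = xy x + xy y" by (rule linear_add[OF linear_xy])

lemma norm_xy_le: "norm (xy \<xi>) \<le> norm \<xi>"
  unfolding norm_eq_sqrt_inner by (intro real_sqrt_le_mono) (simp add: inner_vec_def sum_2 sum_3 xy_def)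

text \<open>With \<open>\<beta> = 2 * s + 2\<close>,
  \<open>decay q = (1 + depth q) powr (- 2 * s)\<close> has the order of the mass of the
  three-dimensional kernel outside a ball of radius proportional to \<open>1 + depth q\<close>. The
  value of m makes \<open>sqrt (1 + m\<^sup>2) = c / k\<close>, so S would vanish exactly for
  \<open>norm (G q) = m\<close>.\<close>

locale traveling_front = front s k f \<Phi> + pyramid_kernel \<rho> "2 * s + 2" I v m
  for s k :: real and f \<Phi> :: "real \<Rightarrow> real" and \<rho> :: "real^2 \<Rightarrow> real" and I :: "nat set" and v :: "nat \<Rightarrow> real^2" and m :: real +
  fixes c :: real
  assumes c: "c > k" and m: "m = sqrt (c\<^sup>2 - k\<^sup>2) / k"
begin

definition Dn :: "real^2 \<Rightarrow> real" where "Dn q = 1 / sqrt (1 + (norm (G q))\<^sup>2)"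
definition S :: "real^2 \<Rightarrow> real" where "S q = c * Dn q - k"
text \<open>Derivative of \<open>Dn\<close> at q in the direction \<eta>, from differentiating the
  inverse square root; \<open>gD\<close> is the corresponding gradient.\<close>

definition dD :: "real^2 \<Rightarrow> real^2 \<Rightarrow> real" where "dD q \<eta> = - (Dn q ^ 3 * (G q \<bullet> G' q \<eta>))"
definition gD :: "real^2 \<Rightarrow> real^2" where "gD q = (\<Sum>b\<in>Basis. dD q b *\<^sub>R b)"
definition \<mu> :: "real \<Rightarrow> real^3 \<Rightarrow> real" where
  "\<mu> \<alpha> p = (p$3 - \<phi> (\<alpha> *\<^sub>R xy p) / \<alpha>) * Dn (\<alpha> *\<^sub>R xy p)"
definition V :: "real \<Rightarrow> real \<Rightarrow> real^3 \<Rightarrow> real" where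
  "V \<epsilon> \<alpha> p = \<Phi> (\<mu> \<alpha> p) + \<epsilon> * S (\<alpha> *\<^sub>R xy p)"

section \<open>Size of S and of the increments of \<open>Dn\<close>\<close>

lemma c_pos: "c > 0" using c k by simp

lemma m2: "1 + m\<^sup>2 = (c / k)\<^sup>2"
proof -
  have "c\<^sup>2 - k\<^sup>2 \<ge> 0" using c k by (simp add: power_mono)
  then have "m\<^sup>2 = (c\<^sup>2 - k\<^sup>2) / k\<^sup>2" unfolding m by (simp add: power_divide)
  then show ?thesis using k by (simp add: field_simps)
qed

lemma sqrt_m2: "sqrt (1 + m\<^sup>2) = c / k" using m2 c_pos k by simp

lemma G_less: "norm (G q) < m"
proof -
  obtain c0 where "c0 > 0" "c0 * decay q \<le> \<sigma> q" by (rule sigma_lower) blast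
  then have "\<sigma> q > 0" using decay_pos(1)[of q] by (meson less_le_trans mult_pos_pos)
  then show ?thesis using m_pos power2_less_imp_less[of "norm (G q)" m] by (simp add: \<sigma>_def)
qed

lemma G_le: "norm (G q) \<le> m" using G_less[of q] by simp

lemma Dn_pos: "Dn q > 0" by (simp add: Dn_def add_pos_nonneg)

lemma Dn_le_1: "Dn q \<le> 1"
proof -
  have "1 \<le> sqrt (1 + (norm (G q))\<^sup>2)" by simp
  then show ?thesis unfolding Dn_def by (subst divide_le_eq_1_pos) linarith+
qed

lemma Dn_lower: "Dn q > k / c"
proof -
  have "sqrt (1 + (norm (G q))\<^sup>2) < c / k"
    unfolding sqrt_m2[symmetric] using G_less[of q] by (simp add: power_strict_mono)
  moreover have "sqrt (1 + (norm (G q))\<^sup>2) > 0" by (simp add: add_pos_nonneg)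
  ultimately have "1 / (c / k) < Dn q" unfolding Dn_def by (intro divide_strict_left_mono) (use c_pos k in auto)
  then show ?thesis by simp
qed

lemma S_pos: "S q > 0" using Dn_lower[of q] c_pos by (simp add: S_def divide_less_eq mult.commute)

lemma S_le: "S q \<le> c - k" using Dn_le_1[of q] c_pos by (simp add: S_def mult_left_le)

text \<open>With \<open>A = sqrt (1 + (norm (G q))\<^sup>2)\<close> and \<open>B = c / k\<close> one
  has \<open>S q = k * (B - A) / A\<close> and \<open>\<sigma> q = (B - A) * (B + A)\<close>; as
  \<open>1 \<le> A\<close> and \<open>A < B\<close>, the two are comparable.\<close>

lemma S_lower: obtains c0 where "c0 > 0" "\<And>q. c0 * decay q \<le> S q"
proof -
  obtain c0 where c0: "c0 > 0" "\<And>q. c0 * decay q \<le> \<sigma> q" by (rule sigma_lower) blast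
  define B where "B = c / k"
  have B: "B > 1" using c k by (simp add: B_def)
  show thesis
  proof (rule that[of "k / (2 * B\<^sup>2) * c0"])
    show "k / (2 * B\<^sup>2) * c0 > 0" using k B c0(1) by simp
    fix q
    define A where "A = sqrt (1 + (norm (G q))\<^sup>2)"
    have A: "1 \<le> A" "A < B" unfolding A_def B_def sqrt_m2[symmetric] using G_less[of q] by (auto simp: power_strict_mono)
    have sig: "\<sigma> q = (B - A) * (B + A)"
    proof -
      have "A\<^sup>2 = 1 + (norm (G q))\<^sup>2" unfolding A_def by (simp add: add_nonneg_nonneg)
      moreover have "B\<^sup>2 = 1 + m\<^sup>2" using m2 by (simp add: B_def)
      moreover have "(B - A) * (B + A) = B\<^sup>2 - A\<^sup>2" by (simp add: power2_eq_square algebra_simps)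
      ultimately show ?thesis by (simp add: \<sigma>_def)
    qed
    have "S q = k * (B - A) / A"
      using A k by (simp add: S_def Dn_def A_def[symmetric] B_def field_simps)
    moreover have "k * (B - A) / A \<ge> k * (B - A) / B"
      using A k by (intro divide_left_mono mult_nonneg_nonneg mult_pos_pos) auto
    moreover have "k / (2 * B\<^sup>2) * \<sigma> q \<le> k * (B - A) / B"
    proof -
      have "k / (2 * B\<^sup>2) * \<sigma> q = k * (B - A) / B * ((B + A) / (2 * B))"
        unfolding sig using A by (simp add: power2_eq_square)
      also have "\<dots> \<le> k * (B - A) / B * 1"
        using A k by (intro mult_left_mono divide_nonneg_pos mult_nonneg_nonneg) (auto simp: divide_le_eq)
      finally show ?thesis by simp
    qed
    moreover have "k / (2 * B\<^sup>2) * c0 * decay q \<le> k / (2 * B\<^sup>2) * \<sigma> q"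
      unfolding mult.assoc using c0(2)[of q] k B by (intro mult_left_mono) auto
    ultimately show "k / (2 * B\<^sup>2) * c0 * decay q \<le> S q" by linarith
  qed
qed

lemma S_upper: obtains c0 where "c0 > 0" "\<And>q. S q \<le> c0 * decay q"
proof -
  obtain C where C: "C > 0" "\<And>q. \<sigma> q \<le> C * decay q" by (rule local_bounds) blast
  show thesis
  proof (rule that[of "k * C"])
    show "k * C > 0" using k C(1) by simp
    fix q
    define A B where "A = sqrt (1 + (norm (G q))\<^sup>2)" and "B = c / k"
    have A: "1 \<le> A" "A < B" unfolding A_def B_def sqrt_m2[symmetric] using G_less[of q] by (auto simp: power_strict_mono)
    have sig: "\<sigma> q = (B - A) * (B + A)"
    proof -
      have "A\<^sup>2 = 1 + (norm (G q))\<^sup>2" unfolding A_def by (simp add: add_nonneg_nonneg)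
      moreover have "B\<^sup>2 = 1 + m\<^sup>2" using m2 by (simp add: B_def)
      moreover have "(B - A) * (B + A) = B\<^sup>2 - A\<^sup>2" by (simp add: power2_eq_square algebra_simps)
      ultimately show ?thesis by (simp add: \<sigma>_def)
    qed
    have "S q = k * (B - A) / A"
      using A k by (simp add: S_def Dn_def A_def[symmetric] B_def field_simps)
    also have "\<dots> \<le> k * (B - A) / 1" using A k by (intro divide_left_mono mult_nonneg_nonneg) auto
    also have "\<dots> \<le> k * \<sigma> q"
    proof -
      have "(B - A) * 1 \<le> (B - A) * (B + A)" using A by (intro mult_left_mono) auto
      then show ?thesis unfolding sig using k by (simp add: mult_left_mono)
    qed
    also have "\<dots> \<le> k * (C * decay q)" using C(2)[of q] k by (intro mult_left_mono) auto
    finally show "S q \<le> k * C * decay q" by simp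
  qed
qed

lemma G'_linear: "linear (G' q)"
  unfolding G'_def
  by (rule linearI) (simp_all add: linear_add[OF D1_linear] linear_cmul[OF D1_linear] scaleR_left_distrib sum.distrib scaleR_sum_right)

lemma dD_linear: "linear (dD q)"
  unfolding dD_def
  by (rule linearI) (simp_all add: linear_add[OF G'_linear] linear_cmul[OF G'_linear] inner_add_right algebra_simps)

lemma gD: "gD q \<bullet> \<eta> = dD q \<eta>"
proof -
  have "dD q \<eta> = dD q (\<Sum>b\<in>Basis. (\<eta> \<bullet> b) *\<^sub>R b)" by (simp add: euclidean_representation)
  also have "\<dots> = (\<Sum>b\<in>Basis. (\<eta> \<bullet> b) * dD q b)" by (simp add: linear_sum[OF dD_linear] linear_cmul[OF dD_linear])
  finally have "dD q \<eta> = (\<Sum>b\<in>Basis. (\<eta> \<bullet> b) * dD q b)" .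
  moreover have "gD q \<bullet> \<eta> = (\<Sum>b\<in>Basis. (\<eta> \<bullet> b) * dD q b)"
    unfolding gD_def inner_sum_left by (intro sum.cong refl) (simp add: inner_commute mult.commute)
  ultimately show ?thesis by simp
qed

text \<open>Transports \<open>local_bounds\<close> from G to \<open>Dn\<close> through
  \<open>inverse_sqrt_taylor\<close>, using that the norm of G is at most m. Products of two small
  factors are reduced to one by \<open>decay q \<le> 1\<close>.\<close>

lemma Dn_bounds:
  obtains C where "C > 0"
    "\<And>q \<eta>. norm \<eta> \<le> kap * (1 + depth q) \<Longrightarrow> \<bar>Dn (q + \<eta>) - Dn q\<bar> \<le> C * decay q"
    "\<And>q \<eta>. norm \<eta> \<le> kap * (1 + depth q) \<Longrightarrow> \<bar>Dn (q + \<eta>) - Dn q\<bar> \<le> C * decay q * norm \<eta>"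
    "\<And>q \<eta>. norm \<eta> \<le> kap * (1 + depth q) \<Longrightarrow> \<bar>Dn (q + \<eta>) - Dn q - dD q \<eta>\<bar> \<le> C * decay q * (norm \<eta>)\<^sup>2"
    "\<And>q. norm (gD q) \<le> C * decay q"
proof -
  obtain C where C: "C > 0"
    "\<And>q \<eta>. norm \<eta> \<le> kap * (1 + depth q) \<Longrightarrow> norm (G (q + \<eta>) - G q) \<le> C * decay q"
    "\<And>q \<eta>. norm \<eta> \<le> kap * (1 + depth q) \<Longrightarrow> norm (G (q + \<eta>) - G q) \<le> C * decay q * norm \<eta>"
    "\<And>q \<eta>. norm \<eta> \<le> kap * (1 + depth q) \<Longrightarrow> norm (G (q + \<eta>) - G q - G' q \<eta>) \<le> C * decay q * (norm \<eta>)\<^sup>2"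
    "\<And>q \<eta>. norm (G' q \<eta>) \<le> C * decay q * norm \<eta>"
    by (rule local_bounds) blast
  define B where "B = 2 * m * C + (4 * m\<^sup>2 + 1) * C\<^sup>2 + m * C"
  have B: "B > 0" "2 * m * C \<le> B" "(4 * m\<^sup>2 + 1) * C\<^sup>2 + m * C \<le> B" "m * C \<le> B"
    unfolding B_def using m_pos C(1) by (auto intro!: add_pos_nonneg)
  have sq: "(norm (g + \<Delta>))\<^sup>2 - (norm g)\<^sup>2 = 2 * (g \<bullet> \<Delta>) + (norm \<Delta>)\<^sup>2" for g \<Delta> :: "real^2"
    by (simp add: power2_norm_eq_inner inner_add_left inner_add_right inner_commute)
  have dx: "\<bar>(norm (G (q + \<eta>)))\<^sup>2 - (norm (G q))\<^sup>2\<bar> \<le> 2 * m * norm (G (q + \<eta>) - G q)" for q \<eta>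
  proof -
    have "\<bar>(norm (G (q + \<eta>)))\<^sup>2 - (norm (G q))\<^sup>2\<bar> = \<bar>norm (G (q + \<eta>)) - norm (G q)\<bar> * (norm (G (q + \<eta>)) + norm (G q))"
    proof -
      have "(norm (G (q + \<eta>)))\<^sup>2 - (norm (G q))\<^sup>2 = (norm (G (q + \<eta>)) - norm (G q)) * (norm (G (q + \<eta>)) + norm (G q))"
        by (simp add: power2_eq_square algebra_simps)
      then show ?thesis by (simp add: abs_mult)
    qed
    also have "\<dots> \<le> norm (G (q + \<eta>) - G q) * (m + m)"
      by (intro mult_mono add_mono G_le norm_triangle_ineq3) auto
    finally show ?thesis by (simp add: mult_ac)
  qed
  have lip: "\<bar>Dn (q + \<eta>) - Dn q\<bar> \<le> 2 * m * norm (G (q + \<eta>) - G q)" for q \<eta>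
    using inverse_sqrt_taylor(1)[of "1 + (norm (G q))\<^sup>2" "1 + (norm (G (q + \<eta>)))\<^sup>2"] dx[of q \<eta>]
    by (simp add: Dn_def)
  show thesis
  proof (rule that[OF B(1)])
    fix q and \<eta> :: "real^2" assume \<eta>: "norm \<eta> \<le> kap * (1 + depth q)"
    have "\<bar>Dn (q + \<eta>) - Dn q\<bar> \<le> 2 * m * (C * decay q)"
      by (rule order_trans[OF lip mult_left_mono[OF C(2)[OF \<eta>]]]) (use m_pos in simp)
    also have "\<dots> \<le> B * decay q" using mult_right_mono[OF B(2) less_imp_le[OF decay_pos(1)[of q]]] by (simp add: mult_ac)
    finally show "\<bar>Dn (q + \<eta>) - Dn q\<bar> \<le> B * decay q" .
    have "\<bar>Dn (q + \<eta>) - Dn q\<bar> \<le> 2 * m * (C * decay q * norm \<eta>)"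
      by (rule order_trans[OF lip mult_left_mono[OF C(3)[OF \<eta>]]]) (use m_pos in simp)
    also have "\<dots> = 2 * m * C * (decay q * norm \<eta>)" by simp
    also have "\<dots> \<le> B * (decay q * norm \<eta>)" using B(2) decay_pos(1)[of q] by (intro mult_right_mono) auto
    finally show "\<bar>Dn (q + \<eta>) - Dn q\<bar> \<le> B * decay q * norm \<eta>" by (simp add: mult.assoc)
    define x y \<Delta> where "x = 1 + (norm (G q))\<^sup>2" and "y = 1 + (norm (G (q + \<eta>)))\<^sup>2" and "\<Delta> = G (q + \<eta>) - G q"
    have D0: "0 \<le> Dn q ^ 3" "Dn q ^ 3 \<le> 1" using Dn_pos[of q] Dn_le_1[of q] by (auto simp: power_le_one)
    have xy2: "y - x = 2 * (G q \<bullet> \<Delta>) + (norm \<Delta>)\<^sup>2" using sq[of "G q" \<Delta>] by (simp add: x_def y_def \<Delta>_def)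
    have yx: "\<bar>y - x\<bar> \<le> 2 * m * norm \<Delta>" using dx[of q \<eta>] by (simp add: x_def y_def \<Delta>_def)
    have t: "\<bar>Dn (q + \<eta>) - Dn q + Dn q ^ 3 * (y - x) / 2\<bar> \<le> (y - x)\<^sup>2"
      using inverse_sqrt_taylor(2)[of x y] by (simp add: Dn_def x_def y_def)
    have yx2: "(y - x)\<^sup>2 \<le> 4 * m\<^sup>2 * (norm \<Delta>)\<^sup>2"
      using power_mono[OF yx, of 2] by (simp add: power_mult_distrib)
    \<comment> \<open>The remainder has three sources: the curvature of the inverse root, the
      quadratic part of the increment of the squared norm of G, and the nonlinear part of the
      increment of G.\<close>
    have "Dn (q + \<eta>) - Dn q - dD q \<eta> = (Dn (q + \<eta>) - Dn q + Dn q ^ 3 * (y - x) / 2) - Dn q ^ 3 * ((norm \<Delta>)\<^sup>2 / 2) - Dn q ^ 3 * (G q \<bullet> (\<Delta> - G' q \<eta>))"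
      unfolding dD_def xy2 by (simp add: inner_diff_right algebra_simps)
    moreover have "\<bar>Dn q ^ 3 * ((norm \<Delta>)\<^sup>2 / 2)\<bar> \<le> (norm \<Delta>)\<^sup>2"
    proof -
      have "0 \<le> Dn q ^ 3 * ((norm \<Delta>)\<^sup>2 / 2)" using D0 by simp
      moreover have "Dn q ^ 3 * ((norm \<Delta>)\<^sup>2 / 2) \<le> 1 * ((norm \<Delta>)\<^sup>2 / 2)" using D0(2) by (rule mult_right_mono) simp
      ultimately show ?thesis using zero_le_power2[of "norm \<Delta>"] by linarith
    qed
    moreover have "\<bar>Dn q ^ 3 * (G q \<bullet> (\<Delta> - G' q \<eta>))\<bar> \<le> m * norm (\<Delta> - G' q \<eta>)"
    proof -
      have "\<bar>G q \<bullet> (\<Delta> - G' q \<eta>)\<bar> \<le> norm (G q) * norm (\<Delta> - G' q \<eta>)" by (rule Cauchy_Schwarz_ineq2)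
      also have "\<dots> \<le> m * norm (\<Delta> - G' q \<eta>)" by (intro mult_right_mono G_le) auto
      finally have "Dn q ^ 3 * \<bar>G q \<bullet> (\<Delta> - G' q \<eta>)\<bar> \<le> 1 * (m * norm (\<Delta> - G' q \<eta>))" using D0 by (intro mult_mono) auto
      then show ?thesis using D0 by (simp add: abs_mult)
    qed
    ultimately have "\<bar>Dn (q + \<eta>) - Dn q - dD q \<eta>\<bar> \<le> (4 * m\<^sup>2 + 1) * (norm \<Delta>)\<^sup>2 + m * norm (\<Delta> - G' q \<eta>)"
      using t yx2 unfolding distrib_right by linarith
    also have "\<dots> \<le> (4 * m\<^sup>2 + 1) * (C\<^sup>2 * (decay q * (norm \<eta>)\<^sup>2)) + m * (C * decay q * (norm \<eta>)\<^sup>2)"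
    proof (intro add_mono mult_left_mono)
      have "(norm \<Delta>)\<^sup>2 \<le> (C * decay q * norm \<eta>)\<^sup>2" using C(3)[OF \<eta>] unfolding \<Delta>_def by (intro power_mono) auto
      also have "\<dots> = C\<^sup>2 * (decay q)\<^sup>2 * (norm \<eta>)\<^sup>2" by (simp add: power_mult_distrib)
      also have "\<dots> \<le> C\<^sup>2 * decay q * (norm \<eta>)\<^sup>2"
        using decay_pos[of q] by (intro mult_right_mono mult_left_mono) (auto simp: power2_eq_square mult_left_le)
      finally show "(norm \<Delta>)\<^sup>2 \<le> C\<^sup>2 * (decay q * (norm \<eta>)\<^sup>2)" by (simp add: mult.assoc)
      show "norm (\<Delta> - G' q \<eta>) \<le> C * decay q * (norm \<eta>)\<^sup>2" using C(4)[OF \<eta>] by (simp add: \<Delta>_def)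
    qed (use m_pos in auto)
    also have "\<dots> = ((4 * m\<^sup>2 + 1) * C\<^sup>2 + m * C) * (decay q * (norm \<eta>)\<^sup>2)" by (simp add: algebra_simps)
    also have "\<dots> \<le> B * (decay q * (norm \<eta>)\<^sup>2)" using B(3) decay_pos(1)[of q] by (intro mult_right_mono) auto
    finally show "\<bar>Dn (q + \<eta>) - Dn q - dD q \<eta>\<bar> \<le> B * decay q * (norm \<eta>)\<^sup>2" by (simp add: mult.assoc)
  next
    fix q
    have D0: "0 \<le> Dn q ^ 3" "Dn q ^ 3 \<le> 1" using Dn_pos[of q] Dn_le_1[of q] by (auto simp: power_le_one)
    \<comment> \<open>Testing \<open>dD q\<close> on its own gradient reduces the norm of
      \<open>gD q\<close> to the bound on \<open>G'\<close>.\<close>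
    have "norm (gD q) * norm (gD q) = dD q (gD q)" using gD[of q "gD q"] by (simp add: power2_norm_eq_inner[symmetric] power2_eq_square)
    also have "\<dots> \<le> Dn q ^ 3 * \<bar>G q \<bullet> G' q (gD q)\<bar>" unfolding dD_def using D0 abs_ge_minus_self[of "Dn q ^ 3 * (G q \<bullet> G' q (gD q))"] by (simp add: abs_mult)
    also have "\<dots> \<le> 1 * (m * (C * decay q * norm (gD q)))"
    proof (intro mult_mono D0)
      have "\<bar>G q \<bullet> G' q (gD q)\<bar> \<le> norm (G q) * norm (G' q (gD q))" by (rule Cauchy_Schwarz_ineq2)
      also have "\<dots> \<le> m * (C * decay q * norm (gD q))" using m_pos by (intro mult_mono G_le C(5)) auto
      finally show "\<bar>G q \<bullet> G' q (gD q)\<bar> \<le> m * (C * decay q * norm (gD q))" .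
    qed auto
    also have "\<dots> = (m * C * decay q) * norm (gD q)" by simp
    finally have "norm (gD q) \<le> m * C * decay q"
      by (cases "norm (gD q) = 0") (use m_pos C(1) decay_pos(1)[of q] in \<open>auto simp: mult_le_cancel_right\<close>)
    also have "\<dots> \<le> B * decay q" using B(4) decay_pos(1)[of q] by (intro mult_right_mono) auto
    finally show "norm (gD q) \<le> B * decay q" .
  qed
qed

end

text \<open>The adjoint of \<open>xy\<close>, see \<open>inner_lift\<close>: it carries horizontal
  gradients to three dimensions.\<close>

definition lift :: "real^2 \<Rightarrow> real^3" where "lift a = vector [a$1, a$2, 0]"

lemma inner_lift: "lift a \<bullet> \<xi> = a \<bullet> xy \<xi>"
  by (simp add: lift_def inner_vec_def sum_2 sum_3 xy_def)

lemma xy_lift: "xy (lift a) = a"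
  by (simp add: lift_def xy_def vec_eq_iff forall_2)

lemma norm_lift: "norm (lift a) = norm a"
  by (simp add: norm_eq_sqrt_inner inner_lift xy_lift)

context front
begin

text \<open>Points within \<open>\<bar>m\<bar> / 2\<close> of m have modulus at least
  \<open>\<bar>m\<bar> / 2\<close>, so the decay rate of the derivative at m holds between them up
  to the factor 2.\<close>

lemma \<Phi>_near:
  assumes K: "\<And>t. \<bar>deriv \<Phi> t\<bar> \<le> K / (1 + \<bar>t\<bar>)" and K0: "K > 0"
    and p: "\<bar>p - m\<bar> \<le> \<bar>m\<bar> / 2" "\<bar>p' - m\<bar> \<le> \<bar>m\<bar> / 2"
  shows "\<bar>\<Phi> p - \<Phi> p'\<bar> \<le> 2 * K / (1 + \<bar>m\<bar>) * \<bar>p - p'\<bar>"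
proof (rule \<Phi>_MVT)
  fix z assume "min p p' \<le> z" "z \<le> max p p'"
  moreover have "m - \<bar>m\<bar> / 2 \<le> p" "m - \<bar>m\<bar> / 2 \<le> p'" "p \<le> m + \<bar>m\<bar> / 2" "p' \<le> m + \<bar>m\<bar> / 2"
    using p unfolding abs_le_iff by linarith+
  then have "m - \<bar>m\<bar> / 2 \<le> min p p'" "max p p' \<le> m + \<bar>m\<bar> / 2" by simp_all
  ultimately have zm: "\<bar>z - m\<bar> \<le> \<bar>m\<bar> / 2" unfolding abs_le_iff by linarith
  have aux: "1 + M \<le> 2 * (1 + Z)" if "W \<le> M / 2" "M - Z \<le> W" for W M Z :: real
    unfolding distrib_left using that by linarith
  have z: "1 + \<bar>m\<bar> \<le> 2 * (1 + \<bar>z\<bar>)"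
    by (rule aux[OF zm]) (use abs_triangle_ineq2[of m z] in \<open>simp add: abs_minus_commute\<close>)
  have "2 * K / (2 * (1 + \<bar>z\<bar>)) \<le> 2 * K / (1 + \<bar>m\<bar>)"
    using K0 z by (intro divide_left_mono mult_pos_pos) auto
  then have "K / (1 + \<bar>z\<bar>) \<le> 2 * K / (1 + \<bar>m\<bar>)" by (simp only: mult_divide_mult_cancel_left_if) simp
  with K[of z] show "\<bar>deriv \<Phi> z\<bar> \<le> 2 * K / (1 + \<bar>m\<bar>)" by (rule order_trans)
qed

text \<open>A multiplicative error in the argument is harmless uniformly in t: the displacement
  grows like \<open>\<bar>t\<bar>\<close>, while the derivative between t and \<open>r * t\<close>
  is of order \<open>1 / (1 + l * \<bar>t\<bar>)\<close>.\<close>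

lemma \<Phi>_scale:
  assumes K: "\<And>t. \<bar>deriv \<Phi> t\<bar> \<le> K / (1 + \<bar>t\<bar>)" and K0: "K > 0"
    and l: "0 < l" "l \<le> 1" "l \<le> r"
  shows "\<bar>\<Phi> (r * t) - \<Phi> t\<bar> \<le> K / l * \<bar>r - 1\<bar>"
proof -
  have p: "1 + l * \<bar>t\<bar> > 0" using mult_nonneg_nonneg[of l "\<bar>t\<bar>"] l by linarith
  have "\<bar>\<Phi> (r * t) - \<Phi> t\<bar> \<le> K / (1 + l * \<bar>t\<bar>) * \<bar>r * t - t\<bar>"
  proof (rule \<Phi>_MVT)
    fix z assume z: "min (r * t) t \<le> z" "z \<le> max (r * t) t"
    have "l * \<bar>t\<bar> \<le> \<bar>z\<bar>"
    proof (cases "t \<ge> 0")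
      case True
      have "l * t \<le> r * t" "l * t \<le> t" using True l by (auto intro: mult_right_mono mult_left_le_one_le)
      then have "l * t \<le> z" using z(1) by linarith
      then show ?thesis using True by simp
    next
      case False
      then have "r * t \<le> l * t" "t \<le> l * t" using l by (auto intro: mult_right_mono_neg simp: mult_le_cancel_right2)
      then have "z \<le> l * t" using z(2) by linarith
      then show ?thesis using False by simp
    qed
    then have "K / (1 + \<bar>z\<bar>) \<le> K / (1 + l * \<bar>t\<bar>)" using K0 p by (intro divide_left_mono mult_pos_pos) auto
    then show "\<bar>deriv \<Phi> z\<bar> \<le> K / (1 + l * \<bar>t\<bar>)" using K[of z] by linarith
  qed
  also have "\<bar>r * t - t\<bar> = \<bar>r - 1\<bar> * \<bar>t\<bar>" by (simp add: abs_mult[symmetric] algebra_simps)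
  also have "K / (1 + l * \<bar>t\<bar>) * (\<bar>r - 1\<bar> * \<bar>t\<bar>) = K / l * \<bar>r - 1\<bar> * (l * \<bar>t\<bar> / (1 + l * \<bar>t\<bar>))"
    using l by simp
  also have "\<dots> \<le> K / l * \<bar>r - 1\<bar> * 1"
    using p l K0 by (intro mult_left_mono) (auto simp: divide_le_eq)
  finally show ?thesis by simp
qed

end

context traveling_front
begin

text \<open>The upward unit normal of the rescaled graph, equal to the gradient of \<mu> at points
  of the graph.\<close>

definition nrm :: "real^2 \<Rightarrow> real^3" where "nrm q = Dn q *\<^sub>R (axis 3 1 - lift (G q))"

lemma Dn_sq: "(Dn q)\<^sup>2 * (1 + (norm (G q))\<^sup>2) = 1"
proof -
  have "1 + (norm (G q))\<^sup>2 > 0" by (simp add: add_pos_nonneg)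
  then show ?thesis by (simp add: Dn_def power_divide)
qed

lemma nrm_inner: "nrm q \<bullet> \<xi> = Dn q * (\<xi>$3 - G q \<bullet> xy \<xi>)"
  by (simp add: nrm_def inner_diff_left inner_lift inner_axis')

lemma norm_nrm: "norm (nrm q) = 1"
proof -
  let ?a = "axis 3 1 - lift (G q)"
  have "?a \<bullet> ?a = 1 + (norm (G q))\<^sup>2"
    unfolding power2_norm_eq_inner by (simp add: inner_vec_def sum_3 sum_2 lift_def axis_def)
  then have "(norm (nrm q))\<^sup>2 = 1"
    using Dn_sq[of q] by (simp add: nrm_def power_mult_distrib power2_norm_eq_inner[of ?a])
  then show ?thesis by (simp add: power2_eq_1_iff norm_ge_zero)
     (metis norm_ge_zero not_one_le_zero neg_0_le_iff_le)
qed

section \<open>Regularity and boundedness of V\<close>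

lemma \<phi>_Ck2: "Ck_on 2 UNIV \<phi>"
  unfolding numeral_2_eq_2
proof (rule Ck_on_SucI[OF open_UNIV \<phi>_has_derivative])
  fix e
  have "Ck_on (Suc 0) UNIV (\<lambda>x. \<Sum>i\<in>I. (v i \<bullet> e) * P i x)"
    by (intro Ck_on_sum Ck_on_cmult open_UNIV Ck_on_Suc[OF P_Ck])
  moreover have "(\<lambda>x. G x \<bullet> e) = (\<lambda>x. \<Sum>i\<in>I. (v i \<bullet> e) * P i x)"
    by (simp add: G_def inner_sum_left mult.commute)
  ultimately show "Ck_on (Suc 0) UNIV (\<lambda>x. G x \<bullet> e)" by (simp only:)
qed

lemma Dn_Ck2: "Ck_on 2 UNIV Dn"
proof -
  have eq: "Dn = (\<lambda>q. 1 * (1 + (\<Sum>i\<in>I. \<Sum>l\<in>I. (v i \<bullet> v l) * (P i q * P l q))) powr (- 1/2))"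
  proof
    fix q
    have "(norm (G q))\<^sup>2 = (\<Sum>i\<in>I. \<Sum>l\<in>I. (v i \<bullet> v l) * (P i q * P l q))"
      unfolding power2_norm_eq_inner G_def inner_sum_left inner_sum_right
      by (intro sum.cong refl) (simp add: mult_ac inner_commute)
    moreover have "1 + (norm (G q))\<^sup>2 > 0" by (simp add: add_pos_nonneg)
    ultimately show "Dn q = 1 * (1 + (\<Sum>i\<in>I. \<Sum>l\<in>I. (v i \<bullet> v l) * (P i q * P l q))) powr (- 1/2)"
      unfolding Dn_def by (simp add: powr_minus_divide powr_half_sqrt)
  qed
  have pos: "1 + (\<Sum>i\<in>I. \<Sum>l\<in>I. (v i \<bullet> v l) * (P i q * P l q)) \<in> {0<..}" for q
  proof -
    have "(norm (G q))\<^sup>2 = (\<Sum>i\<in>I. \<Sum>l\<in>I. (v i \<bullet> v l) * (P i q * P l q))"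
      unfolding power2_norm_eq_inner G_def inner_sum_left inner_sum_right
      by (intro sum.cong refl) (simp add: mult_ac inner_commute)
    then show ?thesis using zero_le_power2[of "norm (G q)"] by simp
  qed
  show ?thesis unfolding eq
    by (rule Ck_on_compose_real[OF open_UNIV open_greaterThan Ck_on_powr _ pos])
       (intro Ck_on_add Ck_on_const Ck_on_sum Ck_on_cmult Ck_on_mult P_Ck2 open_UNIV)
qed

lemma xy_scaled_bounded_linear: "bounded_linear (\<lambda>p. \<alpha> *\<^sub>R xy p)"
proof -
  have "linear (\<lambda>p. \<alpha> *\<^sub>R xy p)"
    by (rule linearI) (simp_all add: linear_add[OF linear_xy] linear_cmul[OF linear_xy] scaleR_right_distrib)
  then show ?thesis by (simp add: linear_conv_bounded_linear)
qed

lemma \<mu>_Ck2: "Ck_on 2 UNIV (\<mu> \<alpha>)"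
proof -
  have "Ck_on 2 UNIV (\<lambda>p::real^3. (p$3 + (- 1 / \<alpha>) * \<phi> (\<alpha> *\<^sub>R xy p)) * Dn (\<alpha> *\<^sub>R xy p))"
    by (intro Ck_on_mult Ck_on_add Ck_on_cmult open_UNIV Ck_on_bounded_linear bounded_linear_vec_nth
        Ck_on_compose_linear[OF xy_scaled_bounded_linear \<phi>_Ck2] Ck_on_compose_linear[OF xy_scaled_bounded_linear Dn_Ck2])
  moreover have "\<mu> \<alpha> = (\<lambda>p::real^3. (p$3 + (- 1 / \<alpha>) * \<phi> (\<alpha> *\<^sub>R xy p)) * Dn (\<alpha> *\<^sub>R xy p))"
    by (auto simp: \<mu>_def fun_eq_iff)
  ultimately show ?thesis by (simp only:)
qed

lemma V_Ck2: "Ck_on 2 UNIV (V \<epsilon> \<alpha>)"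
proof -
  have "Ck_on 2 UNIV \<Phi>" using \<Phi>_Ck by (simp only: numeral_2_eq_2)
  then have "Ck_on 2 UNIV (\<lambda>p. \<Phi> (\<mu> \<alpha> p) + \<epsilon> * (c * Dn (\<alpha> *\<^sub>R xy p) + (- k)))"
    by (intro Ck_on_add Ck_on_cmult open_UNIV Ck_on_const Ck_on_compose_linear[OF xy_scaled_bounded_linear Dn_Ck2]
        Ck_on_compose_real[OF open_UNIV open_UNIV _ \<mu>_Ck2]) auto
  moreover have "V \<epsilon> \<alpha> = (\<lambda>p. \<Phi> (\<mu> \<alpha> p) + \<epsilon> * (c * Dn (\<alpha> *\<^sub>R xy p) + (- k)))"
    by (auto simp: V_def S_def fun_eq_iff)
  ultimately show ?thesis by (simp only:)
qed

lemma V_measurable: "V \<epsilon> \<alpha> \<in> borel_measurable borel"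
  by (rule borel_measurable_continuous_onI[OF Ck_on_imp_continuous_on[OF V_Ck2]])

lemma V_bound:
  assumes "0 \<le> \<epsilon>"
  shows "\<bar>V \<epsilon> \<alpha> p\<bar> \<le> 1 + \<epsilon> * (c - k)"
proof -
  have "0 \<le> \<epsilon> * S (\<alpha> *\<^sub>R xy p)" using assms S_pos[of "\<alpha> *\<^sub>R xy p"] by simp
  moreover have "\<epsilon> * S (\<alpha> *\<^sub>R xy p) \<le> \<epsilon> * (c - k)" using S_le assms by (rule mult_left_mono)
  ultimately show ?thesis unfolding V_def using \<Phi>_abs[of "\<mu> \<alpha> p"] by linarith
qed

text \<open>The local bounds on \<phi> and \<open>Dn\<close> reach up to the distance
  \<open>r / \<alpha>\<close> with \<open>r = kap * (1 + depth q)\<close>; beyond it only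
  boundedness is used. All three error terms of \<open>frac_laplacian_close\<close> then contain a
  positive power of \<alpha> and one factor \<open>decay\<close>.\<close>

lemma frac_laplacian_V:
  obtains C \<alpha>0 where "C > 0" "0 < \<alpha>0" "\<alpha>0 \<le> 1"
    "\<And>\<epsilon> \<alpha> x. \<lbrakk>0 < \<epsilon>; \<epsilon> < 1; 0 < \<alpha>; \<alpha> \<le> \<alpha>0\<rbrakk> \<Longrightarrow>
       \<bar>frac_laplacian s (V \<epsilon> \<alpha>) x - frac_laplacian s \<Phi> (\<mu> \<alpha> x)\<bar> \<le> C * \<alpha> powr (s - 1/2) * decay (\<alpha> *\<^sub>R xy x)"
proof -
  obtain B1 where B1: "B1 > 0"
    "\<And>q \<eta>. norm \<eta> \<le> kap * (1 + depth q) \<Longrightarrow> \<bar>\<phi> (q + \<eta>) - \<phi> q - G q \<bullet> \<eta>\<bar> \<le> B1 * decay q * norm \<eta>"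
    "\<And>q \<eta>. norm \<eta> \<le> kap * (1 + depth q) \<Longrightarrow> \<bar>\<phi> (q + \<eta>) - \<phi> q - G q \<bullet> \<eta>\<bar> \<le> B1 * decay q * (norm \<eta>)\<^sup>2"
    by (rule local_bounds) blast
  obtain B2 where B2: "B2 > 0"
    "\<And>q \<eta>. norm \<eta> \<le> kap * (1 + depth q) \<Longrightarrow> \<bar>Dn (q + \<eta>) - Dn q\<bar> \<le> B2 * decay q"
    "\<And>q \<eta>. norm \<eta> \<le> kap * (1 + depth q) \<Longrightarrow> \<bar>Dn (q + \<eta>) - Dn q\<bar> \<le> B2 * decay q * norm \<eta>"
    "\<And>q \<eta>. norm \<eta> \<le> kap * (1 + depth q) \<Longrightarrow> \<bar>Dn (q + \<eta>) - Dn q - dD q \<eta>\<bar> \<le> B2 * decay q * (norm \<eta>)\<^sup>2"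
    "\<And>q. norm (gD q) \<le> B2 * decay q"
    by (rule Dn_bounds) blast
  define B where "B = B1 + B2"
  have B: "B > 0" "B1 \<le> B" "B2 \<le> B" using B1(1) B2(1) by (auto simp: B_def)
  have up: "u \<le> b * decay q * x \<Longrightarrow> 0 \<le> x \<Longrightarrow> b \<le> B \<Longrightarrow> u \<le> B * decay q * x" for u b q x
  proof -
    assume u: "u \<le> b * decay q * x" "0 \<le> x" "b \<le> B"
    have "b * (decay q * x) \<le> B * (decay q * x)" using u decay_pos(1)[of q] by (intro mult_right_mono) auto
    then show "u \<le> B * decay q * x" using u(1) by (simp only: mult.assoc)
  qed
  have up1: "u \<le> b * decay q \<Longrightarrow> b \<le> B \<Longrightarrow> u \<le> B * decay q" for u b q
    using mult_right_mono[of b B "decay q"] decay_pos(1)[of q] by linarith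
  obtain K where K: "K > 0" "\<And>t. \<bar>deriv \<Phi> t\<bar> \<le> K / (1 + \<bar>t\<bar>)" "\<And>t. \<bar>deriv \<Phi> t\<bar> \<le> K" by (rule \<Phi>'_decay) blast
  obtain K1 where K1: "K1 > 0" "\<And>m \<tau>. \<bar>\<Phi> m - \<Phi> (m + \<tau>)\<bar> \<le> K1 / (1 + \<bar>m\<bar>) * \<bar>\<tau>\<bar>" by (rule \<Phi>_increment) blast
  obtain K2 where K2: "K2 > 0" "\<And>m. \<bar>frac_laplacian s \<Phi> m\<bar> \<le> K2 * (1 + \<bar>m\<bar>) powr (- 2 * s)" by (rule \<Phi>_frac_laplacian_decay) blast
  define l where "l = k / c"
  have l: "0 < l" "l \<le> 1" using k c by (auto simp: l_def)
  \<comment> \<open>far from \<open>x\<close>, pairs of bounds of consecutive orders in \<open>\<alpha> * norm \<xi>\<close> are interpolated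
    to the growth exponent \<open>1 + \<theta> < 2 * s\<close>, which is integrable against the kernel and keeps a factor \<open>\<alpha> powr \<theta>\<close>\<close>
  define \<theta> where "\<theta> = s - 1/2"
  define p where "p = 1 + \<theta>"
  have th: "0 \<le> \<theta>" "\<theta> \<le> 1" using s by (auto simp: \<theta>_def)
  have p: "p < 2 * s" using s by (simp add: p_def \<theta>_def)
  have \<Phi>m: "\<Phi> \<in> borel_measurable borel" by (rule borel_measurable_continuous_onI[OF \<Phi>_cont])
  have P0: "B / l \<ge> 0" using B l by simp
  obtain CC where CC: "CC > 0"
    "\<And>V x A b n m M D R P. \<lbrakk>V \<in> borel_measurable borel; norm n = 1; l \<le> norm A; \<bar>norm A - 1\<bar> \<le> P * (1 + \<bar>m\<bar>); P \<le> B / l; R > 0; D \<ge> 0; M \<ge> 0;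
      \<And>\<xi>. norm \<xi> \<le> 1 \<Longrightarrow> \<bar>V (x + \<xi>) - V x - (\<Phi> (m + A \<bullet> \<xi>) - \<Phi> m) - b \<bullet> \<xi>\<bar> \<le> M * (norm \<xi>)\<^sup>2;
      \<And>\<xi>. norm \<xi> > 1 \<Longrightarrow> \<bar>V (x + \<xi>) - V x - (\<Phi> (m + n \<bullet> \<xi>) - \<Phi> m)\<bar> \<le> M * norm \<xi> powr p + (if norm \<xi> > R then D else 0)\<rbrakk>
     \<Longrightarrow> \<bar>frac_laplacian s V (x::real^3) - frac_laplacian s \<Phi> m\<bar> \<le> CC * (M + D * R powr (- 2 * s) + P)"
    using frac_laplacian_close[OF s \<Phi>m \<Phi>_abs \<Phi>_taylor K1(2) K2(2) l P0 p] by blast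
  \<comment> \<open>Per unit of \<open>\<alpha> * \<bar>u0\<bar>\<close>, L bounds the increments of
    the profile arguments over the unit ball when \<open>\<alpha> * \<bar>u0\<bar> > 1\<close>. The
    condition \<open>\<alpha> \<le> l / (2 * L)\<close> keeps them below
    \<open>\<bar>m0\<bar> / 2\<close>, as \<open>\<Phi>_near\<close> demands.\<close>
  define L where "L = (1 + m + B) + B * (m + 3)"
  have L: "L > 0" unfolding L_def using B m_pos by (intro add_pos_pos mult_pos_pos) auto
  define \<alpha>0 where "\<alpha>0 = min (min 1 kap) (l / (2 * L))"
  define Mn where "Mn = 2 * K / l * B * (m + 3) + c * B"
  define Mf where "Mf = (K + K / l / l + c) * B"
  have Mn: "Mn > 0" unfolding Mn_def using K B l m_pos c_pos by (intro add_pos_pos mult_pos_pos divide_pos_pos) auto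
  have Mf: "Mf > 0" unfolding Mf_def using K B l c_pos by (intro mult_pos_pos add_pos_pos divide_pos_pos) auto
  define C where "C = CC * ((Mn + Mf) + (4 + c) * kap powr (- 2 * s) + B / l)"
  show thesis
  proof (rule that[of C \<alpha>0])
    show "C > 0" unfolding C_def using CC(1) Mn Mf B l c_pos kap
      by (intro mult_pos_pos add_pos_pos divide_pos_pos) auto
    show "0 < \<alpha>0" "\<alpha>0 \<le> 1" using kap l L by (auto simp: \<alpha>0_def)
    fix \<epsilon> \<alpha> :: real and x :: "real^3" assume \<epsilon>: "0 < \<epsilon>" "\<epsilon> < 1" and \<alpha>: "0 < \<alpha>" "\<alpha> \<le> \<alpha>0"
    have \<alpha>1: "\<alpha> \<le> 1" "\<alpha> \<le> kap" "\<alpha> \<le> l / (2 * L)" using \<alpha> by (auto simp: \<alpha>0_def)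
    have \<alpha>th: "\<alpha> \<le> \<alpha> powr \<theta>" "\<alpha> powr (2 * s) \<le> \<alpha> powr \<theta>" "\<alpha> powr \<theta> > 0"
      using powr_mono'[of \<theta> 1 \<alpha>] powr_mono'[of \<theta> "2 * s" \<alpha>] \<alpha> \<alpha>1 th s by (auto simp: \<theta>_def)
    define q where "q = \<alpha> *\<^sub>R xy x"
    define dq where "dq = decay q"
    define u0 where "u0 = x$3 - \<phi> q / \<alpha>"
    define m0 where "m0 = \<mu> \<alpha> x"
    define r where "r = kap * (1 + depth q)"
    \<comment> \<open>The gradient of \<mu> at x. Its second part grows with the height
      \<open>u0\<close> over the graph and is the reason why the slope is not 1. Correspondingly b
      is the gradient of the term \<open>\<epsilon> * S\<close>.\<close>
    define A where "A = nrm q + (\<alpha> * u0) *\<^sub>R lift (gD q)"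
    define b where "b = (\<epsilon> * c * \<alpha>) *\<^sub>R lift (gD q)"
    have dq: "0 < dq" "dq \<le> 1" using decay_pos[of q] by (auto simp: dq_def)
    have rk: "kap \<le> r" using kap(1) depth(1)[of q] mult_left_mono[of 1 "1 + depth q" kap] by (simp add: r_def)
    have r0: "r > 0" using rk kap by simp
    have m0: "m0 = u0 * Dn q" by (simp add: m0_def \<mu>_def u0_def q_def)
    have D0: "l < Dn q" "0 < Dn q" "Dn q \<le> 1" using Dn_lower[of q] Dn_pos[of q] Dn_le_1[of q] by (auto simp: l_def)
    have m0u: "l * \<bar>u0\<bar> \<le> \<bar>m0\<bar>"
      unfolding m0 abs_mult using D0 mult_right_mono[of l "Dn q" "\<bar>u0\<bar>"] by (simp add: mult.commute)
    define Eta where "Eta = (\<lambda>\<xi>::real^3. \<alpha> *\<^sub>R xy \<xi>)"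
    define E where "E = (\<lambda>\<xi>. \<phi> (q + Eta \<xi>) - \<phi> q - G q \<bullet> Eta \<xi>)"
    define t3 where "t3 = (\<lambda>\<xi>::real^3. \<xi>$3 - G q \<bullet> xy \<xi>)"
    define D where "D = (\<lambda>\<xi>. Dn (q + Eta \<xi>))"
    have shift: "\<alpha> *\<^sub>R xy (x + \<xi>) = q + Eta \<xi>" for \<xi> by (simp add: xy_add q_def Eta_def scaleR_right_distrib)
    have Eta_le: "norm (Eta \<xi>) \<le> \<alpha> * norm \<xi>" for \<xi>
      using \<alpha> mult_left_mono[OF norm_xy_le[of \<xi>], of \<alpha>] by (simp add: Eta_def)
    have mu: "\<mu> \<alpha> (x + \<xi>) = (u0 + t3 \<xi> - E \<xi> / \<alpha>) * D \<xi>" for \<xi>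
    proof -
      have "E \<xi> / \<alpha> = \<phi> (q + Eta \<xi>) / \<alpha> - \<phi> q / \<alpha> - G q \<bullet> xy \<xi>"
        using \<alpha> by (simp add: E_def Eta_def diff_divide_distrib)
      then show ?thesis by (simp add: \<mu>_def shift D_def u0_def t3_def)
    qed
    have n_inner: "nrm q \<bullet> \<xi> = Dn q * t3 \<xi>" for \<xi> by (simp add: nrm_inner t3_def)
    have A_inner: "A \<bullet> \<xi> = Dn q * t3 \<xi> + u0 * dD q (Eta \<xi>)" for \<xi>
      by (simp add: A_def inner_add_left n_inner inner_lift gD[symmetric] Eta_def mult_ac)
    have b_inner: "b \<bullet> \<xi> = \<epsilon> * (c * dD q (Eta \<xi>))" for \<xi>
      by (simp add: b_def inner_lift gD[symmetric] Eta_def mult_ac)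
    have t3_le: "\<bar>t3 \<xi>\<bar> \<le> (1 + m) * norm \<xi>" for \<xi>
    proof -
      have "\<bar>G q \<bullet> xy \<xi>\<bar> \<le> norm (G q) * norm (xy \<xi>)" by (rule Cauchy_Schwarz_ineq2)
      also have "\<dots> \<le> m * norm \<xi>" using m_pos by (intro mult_mono G_le norm_xy_le) auto
      finally have "\<bar>G q \<bullet> xy \<xi>\<bar> \<le> m * norm \<xi>" .
      moreover have "\<bar>\<xi>$3\<bar> \<le> norm \<xi>" by (rule component_le_norm_cart)
      ultimately show ?thesis unfolding t3_def distrib_right by linarith
    qed
    have D1: "l \<le> D \<xi>" "0 < D \<xi>" "D \<xi> \<le> 1" for \<xi>
      unfolding D_def using Dn_lower[of "q + Eta \<xi>"] Dn_pos[of "q + Eta \<xi>"] Dn_le_1[of "q + Eta \<xi>"] by (auto simp: l_def)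
    have Ddiff: "\<bar>D \<xi> - Dn q\<bar> \<le> B * dq * norm (Eta \<xi>)" "\<bar>D \<xi> - Dn q\<bar> \<le> B * dq"
      "\<bar>D \<xi> - Dn q - dD q (Eta \<xi>)\<bar> \<le> B * dq * (norm (Eta \<xi>))\<^sup>2"
      "\<bar>E \<xi>\<bar> \<le> B * dq * norm (Eta \<xi>)" "\<bar>E \<xi>\<bar> \<le> B * dq * (norm (Eta \<xi>))\<^sup>2" if "norm (Eta \<xi>) \<le> r" for \<xi>
      unfolding D_def E_def dq_def
      by (rule up[OF B2(3)[OF that[unfolded r_def]] _ B(3)], simp,
          rule up1[OF B2(2)[OF that[unfolded r_def]] B(3)],
          rule up[OF B2(4)[OF that[unfolded r_def]] _ B(3)], simp,
          rule up[OF B1(2)[OF that[unfolded r_def]] _ B(2)], simp,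
          rule up[OF B1(3)[OF that[unfolded r_def]] _ B(2)], simp)
    have lA: "l \<le> norm A"
    proof -
      have "\<bar>A $ 3\<bar> \<le> norm A" by (rule component_le_norm_cart)
      moreover have "A $ 3 = Dn q" by (simp add: A_def nrm_def lift_def axis_def)
      ultimately show ?thesis using D0 by simp
    qed
    \<comment> \<open>The relative deviation of the slope:
      \<open>\<alpha> * \<bar>u0\<bar> * norm (gD q)\<close> is bounded through
      \<open>\<bar>u0\<bar> \<le> \<bar>m0\<bar> / l\<close>, leaving the admissible factor
      \<open>1 + \<bar>m0\<bar>\<close>.\<close>
    define PP where "PP = \<alpha> * B * dq / l"
    have A1: "\<bar>norm A - 1\<bar> \<le> PP * (1 + \<bar>m0\<bar>)"
    proof -
      have "\<bar>norm A - norm (nrm q)\<bar> \<le> norm (A - nrm q)" by (rule norm_triangle_ineq3)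
      also have "\<dots> = \<alpha> * \<bar>u0\<bar> * norm (gD q)" using \<alpha> by (simp add: A_def norm_lift abs_mult)
      also have "\<dots> \<le> \<alpha> * (\<bar>m0\<bar> / l) * (B * dq)"
      proof (intro mult_mono)
        show "\<bar>u0\<bar> \<le> \<bar>m0\<bar> / l" using m0u l by (simp add: pos_le_divide_eq mult.commute)
        show "norm (gD q) \<le> B * dq" unfolding dq_def by (rule up1[OF B2(5) B(3)])
      qed (use \<alpha> l in auto)
      also have "\<dots> = PP * \<bar>m0\<bar>" by (simp add: PP_def)
      also have "\<dots> \<le> PP * (1 + \<bar>m0\<bar>)" unfolding PP_def using \<alpha> B dq l by (intro mult_left_mono) auto
      finally show ?thesis by (simp add: norm_nrm)
    qed
    have PP: "PP \<le> B / l" "PP \<le> B / l * (\<alpha> powr \<theta> * dq)"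
    proof -
      have "\<alpha> * dq \<le> 1 * 1" using \<alpha> \<alpha>1 dq by (intro mult_mono) auto
      then have "B / l * (\<alpha> * dq) \<le> B / l * 1" using P0 by (intro mult_left_mono) auto
      then show "PP \<le> B / l" by (simp add: PP_def mult_ac)
      have "B / l * (\<alpha> * dq) \<le> B / l * (\<alpha> powr \<theta> * dq)" using P0 \<alpha>th dq by (intro mult_left_mono mult_right_mono) auto
      then show "PP \<le> B / l * (\<alpha> powr \<theta> * dq)" by (simp add: PP_def mult_ac)
    qed
    define M where "M = (Mn + Mf) * (\<alpha> powr \<theta> * dq)"
    have near: "\<bar>V \<epsilon> \<alpha> (x + \<xi>) - V \<epsilon> \<alpha> x - (\<Phi> (m0 + A \<bullet> \<xi>) - \<Phi> m0) - b \<bullet> \<xi>\<bar> \<le> M * (norm \<xi>)\<^sup>2"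
      if \<xi>: "norm \<xi> \<le> 1" for \<xi>
    proof -
      let ?n = "norm \<xi>"
      have "\<alpha> * ?n \<le> kap * 1" using \<alpha> \<alpha>1 \<xi> kap by (intro mult_mono) auto
      then have \<eta>: "norm (Eta \<xi>) \<le> r" using Eta_le[of \<xi>] rk by simp
      have e2: "(norm (Eta \<xi>))\<^sup>2 \<le> \<alpha>\<^sup>2 * ?n\<^sup>2" using power_mono[OF Eta_le, of \<xi> 2] by (simp add: power_mult_distrib)
      define d2 where "d2 = D \<xi> - Dn q - dD q (Eta \<xi>)"
      have Bd: "0 \<le> B * dq" using B dq by simp
      have d2: "\<bar>d2\<bar> \<le> B * dq * (\<alpha>\<^sup>2 * ?n\<^sup>2)" unfolding d2_def by (rule order_trans[OF Ddiff(3)[OF \<eta>] mult_left_mono[OF e2 Bd]])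
      have Eb: "\<bar>E \<xi>\<bar> \<le> B * dq * (\<alpha>\<^sup>2 * ?n\<^sup>2)" by (rule order_trans[OF Ddiff(5)[OF \<eta>] mult_left_mono[OF e2 Bd]])
      have Dd: "\<bar>D \<xi> - Dn q\<bar> \<le> B * dq * (\<alpha> * ?n)" by (rule order_trans[OF Ddiff(1)[OF \<eta>] mult_left_mono[OF Eta_le Bd]])
      \<comment> \<open>The basic second-order error; of the two factors \<alpha> in the squared
        displacement one is spent on the division of \<phi> by \<alpha>.\<close>
      define F where "F = B * dq * (\<alpha> * ?n\<^sup>2)"
      have F0: "F \<ge> 0" using Bd \<alpha> by (simp add: F_def)
      have diff: "\<mu> \<alpha> (x + \<xi>) - (m0 + A \<bullet> \<xi>) = d2 * u0 + (D \<xi> - Dn q) * t3 \<xi> - D \<xi> * (E \<xi> / \<alpha>)"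
        unfolding mu m0 A_inner d2_def by (simp add: algebra_simps)
      have x1: "\<bar>d2 * u0\<bar> \<le> F * (\<alpha> * \<bar>u0\<bar>)"
      proof -
        have "\<bar>d2 * u0\<bar> \<le> B * dq * (\<alpha>\<^sup>2 * ?n\<^sup>2) * \<bar>u0\<bar>" unfolding abs_mult using d2 by (rule mult_right_mono) simp
        also have "\<dots> = F * (\<alpha> * \<bar>u0\<bar>)" by (simp add: F_def power2_eq_square mult_ac)
        finally show ?thesis .
      qed
      have x2: "\<bar>(D \<xi> - Dn q) * t3 \<xi>\<bar> \<le> F * (1 + m)"
      proof -
        have "\<bar>(D \<xi> - Dn q) * t3 \<xi>\<bar> \<le> (B * dq * (\<alpha> * ?n)) * ((1 + m) * ?n)"
          unfolding abs_mult using Bd \<alpha> by (intro mult_mono Dd t3_le) auto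
        also have "\<dots> = F * (1 + m)" by (simp add: F_def power2_eq_square mult_ac)
        finally show ?thesis .
      qed
      have x3: "\<bar>D \<xi> * (E \<xi> / \<alpha>)\<bar> \<le> F"
      proof -
        have "\<bar>E \<xi> / \<alpha>\<bar> \<le> B * dq * (\<alpha>\<^sup>2 * ?n\<^sup>2) / \<alpha>"
          unfolding abs_divide using Eb \<alpha> by (simp add: divide_right_mono)
        also have "\<dots> = F" using \<alpha> by (simp add: F_def power2_eq_square)
        finally have "\<bar>D \<xi>\<bar> * \<bar>E \<xi> / \<alpha>\<bar> \<le> 1 * F" using D1[of \<xi>] by (intro mult_mono) auto
        then show ?thesis by (simp only: abs_mult mult_1)
      qed
      have dle: "\<bar>\<mu> \<alpha> (x + \<xi>) - (m0 + A \<bullet> \<xi>)\<bar> \<le> F * (\<alpha> * \<bar>u0\<bar> + (m + 2))"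
        unfolding diff distrib_left using x1 x2 x3 unfolding distrib_left by linarith
      \<comment> \<open>For bounded \<open>\<alpha> * \<bar>u0\<bar>\<close> the Lipschitz bound of
        \<Phi> suffices. Otherwise the error in the argument grows with \<open>u0\<close>, but so
        does \<open>m0\<close>, and the decay of the derivative of \<Phi> near \<open>m0\<close>
        cancels the growth.\<close>
      have main: "\<bar>\<Phi> (\<mu> \<alpha> (x + \<xi>)) - \<Phi> (m0 + A \<bullet> \<xi>)\<bar> \<le> 2 * K / l * (m + 3) * F"
      proof (cases "\<alpha> * \<bar>u0\<bar> \<le> 1")
        case True
        have "\<bar>\<Phi> (\<mu> \<alpha> (x + \<xi>)) - \<Phi> (m0 + A \<bullet> \<xi>)\<bar> \<le> K * \<bar>\<mu> \<alpha> (x + \<xi>) - (m0 + A \<bullet> \<xi>)\<bar>"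
          by (rule \<Phi>_MVT) (rule K(3))
        also have "\<dots> \<le> K * (F * (m + 3))"
        proof (intro mult_left_mono order_trans[OF dle])
          show "\<alpha> * \<bar>u0\<bar> + (m + 2) \<le> m + 3" using True by simp
        qed (use K F0 in auto)
        also have "\<dots> = K * (m + 3) * F" by simp
        also have "\<dots> \<le> 2 * K / l * (m + 3) * F"
        proof (intro mult_right_mono F0)
          have "K * l \<le> K * 1" using l K by (intro mult_left_mono) auto
          then show "K \<le> 2 * K / l" using l K by (simp add: pos_le_divide_eq)
        qed (use m_pos in simp)
        finally show ?thesis .
      next
        case False
        define U where "U = \<alpha> * \<bar>u0\<bar>"
        have U: "U > 1" using False by (simp add: U_def)
        have n2: "?n\<^sup>2 \<le> 1" using \<xi> by (simp add: power_le_one)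
        have FB: "F \<le> B * \<alpha>"
        proof -
          have "dq * (\<alpha> * ?n\<^sup>2) \<le> 1 * (\<alpha> * 1)" using dq n2 \<alpha> by (intro mult_mono) auto
          then have "B * (dq * (\<alpha> * ?n\<^sup>2)) \<le> B * \<alpha>" using B by (intro mult_left_mono) auto
          then show ?thesis by (simp add: F_def mult.assoc)
        qed
        have d': "\<bar>\<mu> \<alpha> (x + \<xi>) - (m0 + A \<bullet> \<xi>)\<bar> \<le> F * (U * (m + 3))"
        proof (rule order_trans[OF dle mult_left_mono[OF _ F0]])
          have "(m + 2) * 1 \<le> (m + 2) * U" using U m_pos by (intro mult_left_mono) auto
          then show "\<alpha> * \<bar>u0\<bar> + (m + 2) \<le> U * (m + 3)" unfolding U_def[symmetric] by (simp add: algebra_simps)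
        qed
        have d'': "\<bar>\<mu> \<alpha> (x + \<xi>) - (m0 + A \<bullet> \<xi>)\<bar> \<le> U * (B * (m + 3))"
        proof -
          have "F * (U * (m + 3)) \<le> B * (U * (m + 3))"
          proof (intro mult_right_mono order_trans[OF FB])
            show "B * \<alpha> \<le> B" using B \<alpha>1 by (simp add: mult_left_le)
          qed (use U m_pos in simp)
          then show ?thesis using d' by (simp add: mult_ac)
        qed
        have Ax: "\<bar>A \<bullet> \<xi>\<bar> \<le> U * (1 + m + B)"
        proof -
          have "\<bar>Dn q * t3 \<xi>\<bar> \<le> 1 * (1 + m)"
          proof -
            have "\<bar>t3 \<xi>\<bar> \<le> (1 + m) * 1" by (rule order_trans[OF t3_le]) (use \<xi> m_pos in \<open>intro mult_left_mono, auto\<close>)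
            then show ?thesis unfolding abs_mult using D0 m_pos by (intro mult_mono) auto
          qed
          also have "\<dots> \<le> U * (1 + m)" using U m_pos by (intro mult_right_mono) auto
          finally have a1: "\<bar>Dn q * t3 \<xi>\<bar> \<le> U * (1 + m)" .
          have "\<bar>u0 * dD q (Eta \<xi>)\<bar> \<le> \<bar>u0\<bar> * (B * \<alpha>)"
          proof -
            have "\<bar>dD q (Eta \<xi>)\<bar> \<le> norm (gD q) * norm (Eta \<xi>)" unfolding gD[symmetric] by (rule Cauchy_Schwarz_ineq2)
            also have "\<dots> \<le> B * (\<alpha> * 1)"
            proof (intro mult_mono)
              have "norm (gD q) \<le> B2 * decay q" by (rule B2(5))
              also have "\<dots> \<le> B * 1" using B B2(1) decay_pos[of q] by (intro mult_mono) auto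
              finally show "norm (gD q) \<le> B" by simp
              show "norm (Eta \<xi>) \<le> \<alpha> * 1" by (rule order_trans[OF Eta_le]) (use \<xi> \<alpha> in \<open>intro mult_left_mono, auto\<close>)
            qed (use B in auto)
            finally show ?thesis unfolding abs_mult by (intro mult_left_mono) auto
          qed
          also have "\<dots> = U * B" by (simp add: U_def)
          finally have a2: "\<bar>u0 * dD q (Eta \<xi>)\<bar> \<le> U * B" .
          show ?thesis unfolding A_inner distrib_left using a1 a2 unfolding distrib_left by linarith
        qed
        have half: "U * L \<le> \<bar>m0\<bar> / 2"
        proof -
          have "\<alpha> * L \<le> l / (2 * L) * L" using \<alpha>1(3) L by (intro mult_right_mono) auto
          then have "\<alpha> * L \<le> l / 2" using L by simp
          then have "\<bar>u0\<bar> * (\<alpha> * L) \<le> \<bar>u0\<bar> * (l / 2)" by (intro mult_left_mono) auto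
          then show ?thesis using m0u by (simp add: U_def mult_ac)
        qed
        have UL: "U * L = U * (1 + m + B) + U * (B * (m + 3))" unfolding L_def by (rule distrib_left)
        have pos2: "0 \<le> U * (B * (m + 3))" using U B m_pos by simp
        have "\<bar>\<Phi> (\<mu> \<alpha> (x + \<xi>)) - \<Phi> (m0 + A \<bullet> \<xi>)\<bar> \<le> 2 * K / (1 + \<bar>m0\<bar>) * \<bar>\<mu> \<alpha> (x + \<xi>) - (m0 + A \<bullet> \<xi>)\<bar>"
        proof (rule \<Phi>_near[OF K(2) K(1)])
          show "\<bar>\<mu> \<alpha> (x + \<xi>) - m0\<bar> \<le> \<bar>m0\<bar> / 2" using d'' Ax half UL by linarith
          show "\<bar>m0 + A \<bullet> \<xi> - m0\<bar> \<le> \<bar>m0\<bar> / 2" using Ax half UL pos2 by linarith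
        qed
        also have "\<dots> \<le> 2 * K / (1 + \<bar>m0\<bar>) * (F * (U * (m + 3)))" using K d' by (intro mult_left_mono) auto
        also have "\<dots> = 2 * K * (m + 3) * F * (U / (1 + \<bar>m0\<bar>))" by simp
        also have "\<dots> \<le> 2 * K * (m + 3) * F * (1 / l)"
        proof (intro mult_left_mono)
          have "U * l \<le> \<bar>u0\<bar> * l" unfolding U_def using \<alpha>1 \<alpha> l by (intro mult_right_mono) (auto simp: mult_left_le_one_le)
          then have "U * l \<le> 1 + \<bar>m0\<bar>" using m0u by (simp add: mult.commute)
          moreover have "1 + \<bar>m0\<bar> > 0" using abs_ge_zero[of m0] by linarith
          ultimately show "U / (1 + \<bar>m0\<bar>) \<le> 1 / l" using l by (simp add: divide_le_eq pos_le_divide_eq mult.commute)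
        qed (use K m_pos F0 in auto)
        also have "\<dots> = 2 * K / l * (m + 3) * F" by simp
        finally show ?thesis .
      qed
      have Sd: "\<bar>\<epsilon> * (c * d2)\<bar> \<le> c * F"
      proof -
        have "\<bar>d2\<bar> \<le> F"
        proof (rule order_trans[OF d2])
          have "\<alpha>\<^sup>2 * ?n\<^sup>2 \<le> \<alpha> * ?n\<^sup>2" using \<alpha> \<alpha>1 by (intro mult_right_mono) (auto simp: power2_eq_square mult_left_le)
          then show "B * dq * (\<alpha>\<^sup>2 * ?n\<^sup>2) \<le> F" unfolding F_def using Bd by (intro mult_left_mono) auto
        qed
        then have "\<bar>\<epsilon>\<bar> * (\<bar>c\<bar> * \<bar>d2\<bar>) \<le> 1 * (c * F)" using \<epsilon> c_pos by (intro mult_mono) auto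
        then show ?thesis by (simp add: abs_mult)
      qed
      have eq: "V \<epsilon> \<alpha> (x + \<xi>) - V \<epsilon> \<alpha> x - (\<Phi> (m0 + A \<bullet> \<xi>) - \<Phi> m0) - b \<bullet> \<xi>
         = (\<Phi> (\<mu> \<alpha> (x + \<xi>)) - \<Phi> (m0 + A \<bullet> \<xi>)) + \<epsilon> * (c * d2)"
        unfolding V_def shift b_inner S_def d2_def D_def m0_def q_def[symmetric] by (simp add: algebra_simps)
      have "\<bar>(\<Phi> (\<mu> \<alpha> (x + \<xi>)) - \<Phi> (m0 + A \<bullet> \<xi>)) + \<epsilon> * (c * d2)\<bar> \<le> 2 * K / l * (m + 3) * F + c * F"
        using main Sd by linarith
      also have "\<dots> = Mn * (\<alpha> * dq * ?n\<^sup>2)" by (simp add: Mn_def F_def algebra_simps)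
      also have "\<dots> \<le> (Mn + Mf) * (\<alpha> powr \<theta> * dq * ?n\<^sup>2)"
        using Mn Mf \<alpha> \<alpha>th dq by (intro mult_mono mult_right_mono) auto
      finally show ?thesis unfolding eq M_def by (simp add: mult.assoc)
    qed
    have far: "\<bar>V \<epsilon> \<alpha> (x + \<xi>) - V \<epsilon> \<alpha> x - (\<Phi> (m0 + nrm q \<bullet> \<xi>) - \<Phi> m0)\<bar> \<le> M * norm \<xi> powr p + (if norm \<xi> > r / \<alpha> then 4 + c else 0)"
      if \<xi>: "norm \<xi> > 1" for \<xi>
    proof -
      let ?n = "norm \<xi>"
      have M0: "M * ?n powr p \<ge> 0" unfolding M_def using Mn Mf dq by (intro mult_nonneg_nonneg) auto
      have eq: "V \<epsilon> \<alpha> (x + \<xi>) - V \<epsilon> \<alpha> x - (\<Phi> (m0 + nrm q \<bullet> \<xi>) - \<Phi> m0)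
         = (\<Phi> (\<mu> \<alpha> (x + \<xi>)) - \<Phi> (m0 + nrm q \<bullet> \<xi>)) + \<epsilon> * (c * (D \<xi> - Dn q))"
        unfolding V_def shift S_def D_def m0_def q_def[symmetric] by (simp add: algebra_simps)
      show ?thesis
      proof (cases "?n > r / \<alpha>")
        case True
        have "\<bar>D \<xi> - Dn q\<bar> \<le> 1" using D1[of \<xi>] D0 by linarith
        then have "\<bar>\<epsilon>\<bar> * (\<bar>c\<bar> * \<bar>D \<xi> - Dn q\<bar>) \<le> 1 * (c * 1)" using \<epsilon> c_pos by (intro mult_mono) auto
        then have "\<bar>\<epsilon> * (c * (D \<xi> - Dn q))\<bar> \<le> c" by (simp add: abs_mult)
        then show ?thesis unfolding eq using True M0 \<Phi>_abs[of "\<mu> \<alpha> (x + \<xi>)"] \<Phi>_abs[of "m0 + nrm q \<bullet> \<xi>"] by simp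
      next
        case False
        then have "\<alpha> * ?n \<le> r" using \<alpha> by (simp add: pos_le_divide_eq mult.commute not_less)
        then have \<eta>: "norm (Eta \<xi>) \<le> r" using Eta_le[of \<xi>] by simp
        define X where "X = \<alpha> powr \<theta> * ?n powr p"
        have X0: "X \<ge> 0" by (simp add: X_def)
        have Bd: "0 \<le> B * dq" using B dq by simp
        have e_th: "norm (Eta \<xi>) powr \<theta> \<le> \<alpha> powr \<theta> * ?n powr \<theta>"
          using powr_mono2[OF th(1) _ Eta_le[of \<xi>]] \<alpha> by (simp add: powr_mult)
        have np: "?n powr p = ?n * ?n powr \<theta>" using \<xi> unfolding p_def by (subst powr_add) simp
        have nth: "?n powr \<theta> \<le> ?n powr p" using \<xi> by (simp add: p_def)
        have Dd: "\<bar>D \<xi> - Dn q\<bar> \<le> B * dq * X"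
        proof -
          have "\<bar>D \<xi> - Dn q\<bar> \<le> B * dq * norm (Eta \<xi>) powr \<theta>"
            by (rule min_le_powr[OF th _ Bd Ddiff(2)[OF \<eta>] Ddiff(1)[OF \<eta>]]) simp
          also have "\<dots> \<le> B * dq * X"
          proof (rule mult_left_mono[OF _ Bd])
            have "\<alpha> powr \<theta> * ?n powr \<theta> \<le> X" unfolding X_def using nth by (intro mult_left_mono) auto
            then show "norm (Eta \<xi>) powr \<theta> \<le> X" using e_th by linarith
          qed
          finally show ?thesis .
        qed
        have Eb: "\<bar>E \<xi> / \<alpha>\<bar> \<le> B * dq * X"
        proof -
          \<comment> \<open>Interpolation between the first and second order bounds for the
            remainder of \<phi>; the factor \<open>norm (Eta \<xi>)\<close> kept outside supplies
            the \<alpha> that is lost by dividing.\<close>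
          have "\<bar>E \<xi>\<bar> \<le> (B * dq * norm (Eta \<xi>)) * norm (Eta \<xi>) powr \<theta>"
          proof (rule min_le_powr[OF th])
            show "\<bar>E \<xi>\<bar> \<le> B * dq * norm (Eta \<xi>) * norm (Eta \<xi>)" using Ddiff(5)[OF \<eta>] by (simp add: power2_eq_square mult.assoc)
          qed (use Ddiff(4)[OF \<eta>] Bd in auto)
          also have "\<dots> \<le> (B * dq * (\<alpha> * ?n)) * (\<alpha> powr \<theta> * ?n powr \<theta>)"
            using Bd \<alpha> by (intro mult_mono e_th mult_left_mono Eta_le) auto
          also have "\<dots> = \<alpha> * (B * dq * X)" by (simp add: X_def np mult_ac)
          finally have "\<bar>E \<xi>\<bar> / \<alpha> \<le> B * dq * X" using \<alpha> by (simp add: pos_divide_le_eq mult.commute)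
          then show ?thesis using \<alpha> by (simp add: abs_divide)
        qed
        define t where "t = m0 + nrm q \<bullet> \<xi>"
        have t: "t = Dn q * (u0 + t3 \<xi>)" by (simp add: t_def m0 n_inner algebra_simps)
        \<comment> \<open>The two errors differ in nature: the change of \<open>Dn\<close> rescales
          the argument t, which \<open>\<Phi>_scale\<close> handles uniformly, while the deviation
          of \<phi> from linearity shifts it.\<close>
        have mu': "\<mu> \<alpha> (x + \<xi>) = (D \<xi> / Dn q) * t - D \<xi> * (E \<xi> / \<alpha>)"
          unfolding mu t using D0 by (simp add: algebra_simps)
        have s1: "\<bar>\<Phi> (\<mu> \<alpha> (x + \<xi>)) - \<Phi> ((D \<xi> / Dn q) * t)\<bar> \<le> K * (B * dq * X)"
        proof -
          have "\<bar>\<Phi> (\<mu> \<alpha> (x + \<xi>)) - \<Phi> ((D \<xi> / Dn q) * t)\<bar> \<le> K * \<bar>\<mu> \<alpha> (x + \<xi>) - (D \<xi> / Dn q) * t\<bar>"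
            by (rule \<Phi>_MVT) (rule K(3))
          also have "\<bar>\<mu> \<alpha> (x + \<xi>) - (D \<xi> / Dn q) * t\<bar> = \<bar>D \<xi>\<bar> * \<bar>E \<xi> / \<alpha>\<bar>" unfolding mu' by (simp add: abs_mult)
          also have "K * (\<bar>D \<xi>\<bar> * \<bar>E \<xi> / \<alpha>\<bar>) \<le> K * (1 * (B * dq * X))"
            using K D1[of \<xi>] Eb by (intro mult_left_mono mult_mono) auto
          finally show ?thesis by simp
        qed
        have s2: "\<bar>\<Phi> ((D \<xi> / Dn q) * t) - \<Phi> t\<bar> \<le> K / l / l * (B * dq * X)"
        proof -
          have lD: "l \<le> D \<xi> / Dn q" using D0 D1[of \<xi>] l by (simp add: pos_le_divide_eq) (meson mult_left_le order_trans less_imp_le)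
          have "\<bar>\<Phi> ((D \<xi> / Dn q) * t) - \<Phi> t\<bar> \<le> K / l * \<bar>D \<xi> / Dn q - 1\<bar>"
            by (rule \<Phi>_scale[OF K(2) K(1) l lD])
          also have "\<bar>D \<xi> / Dn q - 1\<bar> = \<bar>D \<xi> - Dn q\<bar> / Dn q"
          proof -
            have "D \<xi> / Dn q - 1 = (D \<xi> - Dn q) / Dn q" using D0 by (simp add: diff_divide_distrib)
            then show ?thesis using D0 by (simp add: abs_divide)
          qed
          also have "K / l * (\<bar>D \<xi> - Dn q\<bar> / Dn q) \<le> K / l * (B * dq * X / l)"
            using K l D0 Dd by (intro mult_left_mono frac_le) auto
          finally show ?thesis by simp
        qed
        have s3: "\<bar>\<epsilon> * (c * (D \<xi> - Dn q))\<bar> \<le> c * (B * dq * X)"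
        proof -
          have "\<bar>\<epsilon>\<bar> * (\<bar>c\<bar> * \<bar>D \<xi> - Dn q\<bar>) \<le> 1 * (c * (B * dq * X))" using \<epsilon> c_pos Dd by (intro mult_mono) auto
          then show ?thesis by (simp add: abs_mult)
        qed
        have "\<bar>(\<Phi> (\<mu> \<alpha> (x + \<xi>)) - \<Phi> (m0 + nrm q \<bullet> \<xi>)) + \<epsilon> * (c * (D \<xi> - Dn q))\<bar> \<le> K * (B * dq * X) + K / l / l * (B * dq * X) + c * (B * dq * X)"
          using s1 s2 s3 unfolding t_def by linarith
        also have "\<dots> = Mf * (dq * X)" by (simp add: Mf_def algebra_simps)
        also have "\<dots> \<le> (Mn + Mf) * (dq * X)" using Mn dq X0 by (intro mult_right_mono) auto
        also have "\<dots> = M * ?n powr p" by (simp add: M_def X_def)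
        finally show ?thesis unfolding eq using False by simp
      qed
    qed
    have R0: "r / \<alpha> > 0" using r0 \<alpha> by simp
    have Mge: "M \<ge> 0" unfolding M_def using Mn Mf dq by (intro mult_nonneg_nonneg) auto
    have c4: "4 + c \<ge> 0" using c_pos by simp
    have "\<bar>frac_laplacian s (V \<epsilon> \<alpha>) x - frac_laplacian s \<Phi> m0\<bar> \<le> CC * (M + (4 + c) * (r / \<alpha>) powr (- 2 * s) + PP)"
      by (rule CC(2)[OF V_measurable norm_nrm lA A1 PP(1) R0 c4 Mge near far])
    also have "\<dots> \<le> CC * (M + (4 + c) * (kap powr (- 2 * s) * (\<alpha> powr \<theta> * dq)) + B / l * (\<alpha> powr \<theta> * dq))"
    proof (intro mult_left_mono add_mono PP(2) order_refl)
      \<comment> \<open>The nonlocal tail: outside the radius \<open>r / \<alpha>\<close> the kernel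
        has mass of order \<open>\<alpha> powr (2 * s) * decay q\<close>. This is where the tail
        exponent of the mollifier has to match the order of the operator.\<close>
      have "(r / \<alpha>) powr (- 2 * s) = kap powr (- 2 * s) * (\<alpha> powr (2 * s) * dq)"
      proof -
        have d1: "1 + depth q > 0" using depth(1)[of q] by simp
        have "(r / \<alpha>) powr (- 2 * s) = (kap * (1 + depth q) * (1 / \<alpha>)) powr (- 2 * s)" by (simp add: r_def)
        also have "\<dots> = kap powr (- 2 * s) * (1 + depth q) powr (- 2 * s) * (1 / \<alpha>) powr (- 2 * s)"
          using kap d1 \<alpha> by (simp only: powr_mult)
        also have "(1 / \<alpha>) powr (- 2 * s) = \<alpha> powr (2 * s)" using \<alpha> by (simp add: powr_divide powr_minus_divide)
        also have "(1 + depth q) powr (- 2 * s) = dq" by (simp add: dq_def decay_def)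
        finally show ?thesis by (simp add: mult_ac)
      qed
      also have "\<dots> \<le> kap powr (- 2 * s) * (\<alpha> powr \<theta> * dq)" using \<alpha>th dq by (intro mult_left_mono mult_right_mono) auto
      finally show "(r / \<alpha>) powr (- 2 * s) \<le> kap powr (- 2 * s) * (\<alpha> powr \<theta> * dq)" .
    qed (use CC(1) c_pos in auto)
    also have "\<dots> = C * (\<alpha> powr \<theta> * dq)" unfolding C_def M_def by (simp add: algebra_simps)
    finally show "\<bar>frac_laplacian s (V \<epsilon> \<alpha>) x - frac_laplacian s \<Phi> (\<mu> \<alpha> x)\<bar> \<le> C * \<alpha> powr (s - 1/2) * decay (\<alpha> *\<^sub>R xy x)"
      by (simp add: m0_def dq_def q_def \<theta>_def mult.assoc)
  qed
qed

end

section \<open>Comparison with v and choice of the parameters\<close>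

lemma grad_eqI:
  assumes "(w has_derivative (\<lambda>e. D \<bullet> e)) (at x)"
  shows "grad w x = D"
  unfolding grad_def
proof (rule the_equality)
  show "GDERIV w x :> D" using assms by (simp add: gderiv_def inner_commute)
  fix D' assume "GDERIV w x :> D'"
  then have "(w has_derivative (\<lambda>e. D' \<bullet> e)) (at x)" by (simp add: gderiv_def inner_commute)
  then have "(\<lambda>e. D' \<bullet> e) = (\<lambda>e. D \<bullet> e)" using assms by (rule has_derivative_unique)
  then show "D' = D" by (metis vector_eq_rdot inner_commute)
qed

context traveling_front
begin

lemma h_scale:
  assumes "\<alpha> > 0"
  shows "h (\<alpha> *\<^sub>R q) = \<alpha> * h q"
proof -
  have "h (\<alpha> *\<^sub>R q) = Max ((\<lambda>t. \<alpha> * t) ` (\<lambda>i. v i \<bullet> q) ` I)" by (simp add: h_def image_image)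
  also have "\<dots> = \<alpha> * h q" unfolding h_def
    using assms finI I_ne by (intro mono_Max_commute[symmetric]) (auto simp: mono_def)
  finally show ?thesis .
qed

text \<open>The z-derivative of \<mu> is \<open>Dn\<close>, and \<open>c * Dn = S + k\<close>. The
  k-part cancels against the profile equation and leaves \<open>- S\<close> times the derivative of
  \<Phi>.\<close>

lemma travel_op_V:
  "travel_op s c f (V \<epsilon> \<alpha>) p = frac_laplacian s (V \<epsilon> \<alpha>) p - frac_laplacian s \<Phi> (\<mu> \<alpha> p)
     + (- S (\<alpha> *\<^sub>R xy p) * deriv \<Phi> (\<mu> \<alpha> p) - (f (V \<epsilon> \<alpha> p) - f (\<Phi> (\<mu> \<alpha> p))))"
proof -
  let ?q = "\<alpha> *\<^sub>R xy p"
  have xy: "xy (p + t *\<^sub>R axis 3 1) = xy p" for t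
    by (simp add: xy_def vec_eq_iff forall_2 axis_def)
  have "\<mu> \<alpha> (p + t *\<^sub>R axis 3 1) = \<mu> \<alpha> p + t * Dn ?q" for t
    by (simp add: \<mu>_def xy algebra_simps)
  then have "(\<lambda>t. V \<epsilon> \<alpha> (p + t *\<^sub>R axis 3 1)) = (\<lambda>t. \<Phi> (\<mu> \<alpha> p + t * Dn ?q) + \<epsilon> * S ?q)"
    by (simp add: V_def xy)
  moreover have "deriv (\<lambda>t. \<Phi> (\<mu> \<alpha> p + t * Dn ?q) + \<epsilon> * S ?q) 0 = deriv \<Phi> (\<mu> \<alpha> p) * Dn ?q"
  proof -
    have "((\<lambda>t. \<mu> \<alpha> p + t * Dn ?q) has_real_derivative Dn ?q) (at 0)"
      by (auto intro!: derivative_eq_intros)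
    from DERIV_add[OF DERIV_chain2[OF \<Phi>_deriv this] DERIV_const[of "\<epsilon> * S ?q"]]
    show ?thesis by (intro DERIV_imp_deriv) simp
  qed
  ultimately have "deriv (\<lambda>t. V \<epsilon> \<alpha> (p + t *\<^sub>R axis 3 1)) 0 = deriv \<Phi> (\<mu> \<alpha> p) * Dn ?q" by simp
  moreover have "frac_laplacian s \<Phi> (\<mu> \<alpha> p) = k * deriv \<Phi> (\<mu> \<alpha> p) + f (\<Phi> (\<mu> \<alpha> p))"
    using profile unfolding profile_def by (simp add: algebra_simps)
  ultimately show ?thesis unfolding travel_op_def by (simp add: S_def algebra_simps)
qed

text \<open>With u the height over the mollified graph and e the height of that graph over the
  pyramid, \<mu> exceeds the argument of v only if \<open>u * S q > k * e\<close>. Since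
  \<open>S q \<le> cU * decay q\<close> and \<open>e \<ge> c1 * decay q / \<alpha>\<close>, this
  forces u to be at least of order \<open>1 / \<alpha>\<close>; there the profile is so flat that
  the loss is at most a multiple of \<open>\<alpha> * S q\<close> and is outweighed by
  \<open>\<epsilon> * S q\<close>.\<close>

lemma V_above_pyramid:
  obtains A where "A > 0" "\<And>\<epsilon> \<alpha> p. \<lbrakk>0 < \<epsilon>; 0 < \<alpha>; A * \<alpha> < \<epsilon>\<rbrakk> \<Longrightarrow> \<Phi> (k / c * (p$3 - h (xy p))) < V \<epsilon> \<alpha> p"
proof -
  obtain C where C: "C > 0" "\<And>t. \<bar>deriv \<Phi> t\<bar> \<le> C * (1 + \<bar>t\<bar>) powr (- (1 + 2 * s))" by (rule \<Phi>'_decay) blast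
  obtain c1 where c1: "c1 > 0" "\<And>q. c1 * decay q \<le> \<phi> q - h q" by (rule h_excess_lower) blast
  obtain cU where cU: "cU > 0" "\<And>q. S q \<le> cU * decay q" by (rule S_upper) blast
  \<comment> \<open>The rate \<open>1 + 2 * s\<close> exceeds 2; stated with the power 2, the bound
    leads to a loss linear in \<alpha>.\<close>
  have C2: "\<bar>deriv \<Phi> t\<bar> \<le> C / x\<^sup>2" if "0 < x" "x \<le> t" for t x
  proof -
    have "(1 + \<bar>t\<bar>) powr (- (1 + 2 * s)) \<le> (1 + \<bar>t\<bar>) powr (- 2)" using s by (intro powr_mono) auto
    also have "\<dots> \<le> x powr (- 2)" using that by (intro powr_mono2') auto
    also have "\<dots> = 1 / x\<^sup>2" using that by (simp add: powr_minus_divide powr_numeral)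
    finally have "C * (1 + \<bar>t\<bar>) powr (- (1 + 2 * s)) \<le> C * (1 / x\<^sup>2)" using C(1) by (intro mult_left_mono) auto
    then show ?thesis using C(2)[of t] by simp
  qed
  define A where "A = C * c * cU / (k ^ 3 * c1)"
  show thesis
  proof (rule that[of A])
    show "A > 0" using C(1) c_pos cU(1) k c1(1) by (simp add: A_def)
    fix \<epsilon> \<alpha> :: real and p :: "real^3"
    assume \<epsilon>: "0 < \<epsilon>" and \<alpha>: "0 < \<alpha>" and A: "A * \<alpha> < \<epsilon>"
    define q where "q = \<alpha> *\<^sub>R xy p"
    define u where "u = p$3 - \<phi> q / \<alpha>"
    define e where "e = (\<phi> q - h q) / \<alpha>"
    define Z where "Z = k / c * (p$3 - h (xy p))"
    define M where "M = \<mu> \<alpha> p"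
    have e: "c1 * decay q / \<alpha> \<le> e" unfolding e_def using \<alpha> by (intro divide_right_mono c1(2)) auto
    have e0: "e > 0" using e c1(1) decay_pos(1)[of q] \<alpha> by (intro less_le_trans[OF _ e]) simp
    have hq: "h q / \<alpha> = h (xy p)" using h_scale[OF \<alpha>, of "xy p"] \<alpha> by (simp add: q_def)
    have Z: "Z = k / c * (u + e)" using hq by (simp add: Z_def u_def e_def diff_divide_distrib)
    have Dq: "Dn q = k / c + S q / c" using c_pos by (simp add: S_def field_simps)
    have M: "M = k / c * u + u * (S q / c)"
      unfolding M_def \<mu>_def q_def[symmetric] u_def[symmetric] Dq by (simp add: algebra_simps)
    have V: "V \<epsilon> \<alpha> p = \<Phi> M + \<epsilon> * S q" by (simp add: V_def M_def q_def)
    have S: "S q > 0" by (rule S_pos)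
    have ES: "\<epsilon> * S q > 0" using \<epsilon> S by simp
    show "\<Phi> (k / c * (p$3 - h (xy p))) < V \<epsilon> \<alpha> p"
    proof (cases "M \<le> Z")
      case True
      then have "\<Phi> Z \<le> \<Phi> M" using \<Phi>_less[of M Z] by (cases "M = Z") auto
      then show ?thesis unfolding Z_def[symmetric] V using ES by linarith
    next
      case False
      then have "k / c * u + k / c * e < k / c * u + u * (S q / c)" unfolding M Z by (simp add: distrib_left)
      then have "k * e / c < u * S q / c" by simp
      then have uS: "k * e < u * S q" using c_pos by (simp add: divide_less_cancel)
      have u: "u > 0"
      proof (rule ccontr)
        assume "\<not> u > 0"
        then have "u * S q \<le> 0" using S by (simp add: mult_nonpos_nonneg)
        moreover have "k * e > 0" using k e0 by simp
        ultimately show False using uS by linarith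
      qed
      define x where "x = k / c * u"
      have x: "x > 0" using k c_pos u by (simp add: x_def)
      have "k * (c1 * decay q / \<alpha>) \<le> k * e" using e k by (intro mult_left_mono) auto
      moreover have "u * S q \<le> u * (cU * decay q)" using cU(2)[of q] u by (intro mult_left_mono) auto
      ultimately have "k * (c1 * decay q / \<alpha>) \<le> u * (cU * decay q)" using uS by linarith
      then have "(k * c1 / \<alpha>) * decay q \<le> (u * cU) * decay q" by (simp add: mult_ac)
      then have "k * c1 / \<alpha> \<le> u * cU" using decay_pos(1)[of q] by (simp only: mult_le_cancel_right_pos)
      then have ul: "k * c1 \<le> u * cU * \<alpha>" using \<alpha> by (simp add: divide_le_eq)
      have Zx: "x \<le> Z" using k c_pos e0 by (simp add: Z x_def distrib_left)
      have "\<bar>\<Phi> M - \<Phi> Z\<bar> \<le> C / x\<^sup>2 * \<bar>M - Z\<bar>"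
        by (rule \<Phi>_MVT) (use Zx False in \<open>auto intro!: C2[OF x]\<close>)
      also have "\<dots> \<le> C / x\<^sup>2 * (u * (S q / c))"
      proof (rule mult_left_mono)
        show "\<bar>M - Z\<bar> \<le> u * (S q / c)" using False Zx M x_def by linarith
      qed (use C(1) in simp)
      also have "\<dots> = (C / (k * x)) * S q"
        using k c_pos u by (simp add: x_def power2_eq_square)
      finally have d: "\<Phi> Z - \<Phi> M \<le> (C / (k * x)) * S q" by linarith
      have "C / (k * x) \<le> A * \<alpha>"
      proof -
        have "C * c * (k * c1) \<le> C * c * (u * cU * \<alpha>)" using ul C(1) c_pos by (intro mult_left_mono) auto
        then have "C * (c * c1) * k * k ^ 2 \<le> C * c * cU * \<alpha> * u * k ^ 2" using k by (intro mult_right_mono) (auto simp: mult_ac)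
        then show ?thesis unfolding A_def x_def using k c_pos u c1(1)
          by (simp add: divide_simps) (simp add: algebra_simps power2_eq_square power3_eq_cube)
      qed
      then have "C / (k * x) < \<epsilon>" using A by linarith
      then have "(C / (k * x)) * S q < \<epsilon> * S q" using S by (rule mult_strict_right_mono)
      then show ?thesis unfolding Z_def[symmetric] V using d by linarith
    qed
  qed
qed

lemma V_Cs2:
  assumes "0 \<le> \<epsilon>"
  shows "V \<epsilon> \<alpha> \<in> Cs2 s"
proof -
  have "integrable lborel (\<lambda>x::real^3. \<bar>V \<epsilon> \<alpha> x\<bar> / (1 + norm x) powr (real DIM(real^3) + 2 * s))"
  proof (rule Bochner_Integration.integrable_bound)
    show "integrable lborel (\<lambda>x::real^3. (1 + \<epsilon> * (c - k)) * weight (real DIM(real^3) + 2 * s) x)"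
      using s by (intro integrable_mult_right integrable_weight) auto
    show "(\<lambda>x::real^3. \<bar>V \<epsilon> \<alpha> x\<bar> / (1 + norm x) powr (real DIM(real^3) + 2 * s)) \<in> borel_measurable lborel"
      using V_measurable[of \<epsilon> \<alpha>] by measurable
    show "AE x::real^3 in lborel. norm (\<bar>V \<epsilon> \<alpha> x\<bar> / (1 + norm x) powr (real DIM(real^3) + 2 * s))
            \<le> norm ((1 + \<epsilon> * (c - k)) * weight (real DIM(real^3) + 2 * s) x)"
    proof (intro AE_I2)
      fix x :: "real^3"
      have "\<bar>V \<epsilon> \<alpha> x\<bar> * weight (real DIM(real^3) + 2 * s) x \<le> (1 + \<epsilon> * (c - k)) * weight (real DIM(real^3) + 2 * s) x"
        by (intro mult_right_mono V_bound[OF assms] less_imp_le weight_pos)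
      then show "norm (\<bar>V \<epsilon> \<alpha> x\<bar> / (1 + norm x) powr (real DIM(real^3) + 2 * s))
            \<le> norm ((1 + \<epsilon> * (c - k)) * weight (real DIM(real^3) + 2 * s) x)"
        using assms c by (simp add: weight_def powr_minus[of _ "real DIM(real^3) + 2 * s"] divide_inverse abs_mult del: minus_add_distrib minus_diff_eq DIM_cart)
    qed
  qed
  then show ?thesis using V_Ck2 by (simp add: Cs2_def del: Ck_on.simps)
qed

lemma V_supersolution:
  "\<exists>\<epsilon>\<in>{0<..<1}. \<exists>\<alpha>\<in>{0<..<1}. super_solution s c f (V \<epsilon> \<alpha>) \<and> V \<epsilon> \<alpha> \<in> Cs2 s \<and>
     (\<forall>p. travel_op s c f (V \<epsilon> \<alpha>) p > 0) \<and> (\<forall>p. \<Phi> (k / c * (p$3 - h (xy p))) < V \<epsilon> \<alpha> p)"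
proof -
  obtain A where A: "A > 0" "\<And>\<epsilon> \<alpha> p. \<lbrakk>0 < \<epsilon>; 0 < \<alpha>; A * \<alpha> < \<epsilon>\<rbrakk> \<Longrightarrow> \<Phi> (k / c * (p$3 - h (xy p))) < V \<epsilon> \<alpha> p"
    by (rule V_above_pyramid) blast
  obtain C \<alpha>0 where C: "C > 0" "0 < \<alpha>0" "\<alpha>0 \<le> 1"
    "\<And>\<epsilon> \<alpha> x. \<lbrakk>0 < \<epsilon>; \<epsilon> < 1; 0 < \<alpha>; \<alpha> \<le> \<alpha>0\<rbrakk> \<Longrightarrow>
       \<bar>frac_laplacian s (V \<epsilon> \<alpha>) x - frac_laplacian s \<Phi> (\<mu> \<alpha> x)\<bar> \<le> C * \<alpha> powr (s - 1/2) * decay (\<alpha> *\<^sub>R xy x)"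
    by (rule frac_laplacian_V) blast
  obtain c0 where c0: "c0 > 0" "\<And>q. c0 * decay q \<le> S q" by (rule S_lower) blast
  obtain \<epsilon> b where \<epsilon>: "0 < \<epsilon>" "\<epsilon> < 1" "b > 0"
    "\<And>t S. 0 < S \<Longrightarrow> S \<le> c - k \<Longrightarrow> b * S \<le> - S * deriv \<Phi> t - (f (\<Phi> t + \<epsilon> * S) - f (\<Phi> t))"
    by (rule reaction_gain[of "c - k"]) (use c in auto)
  \<comment> \<open>The solution of \<open>C * \<theta> powr (s - 1/2) = b * c0 / 2\<close>, where
    the error consumes half of the reaction gain.\<close>
  define \<theta> where "\<theta> = (b * c0 / (2 * C)) powr (1 / (s - 1/2))"
  \<comment> \<open>The three entries serve, in order, the validity of the error estimate together
    with \<open>\<alpha> < 1\<close>, its absorption, and \<open>v < V\<close>.\<close>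
  define \<alpha> where "\<alpha> = Min {\<alpha>0 / 2, \<theta>, \<epsilon> / (2 * A)}"
  have \<theta>: "\<theta> > 0" using \<epsilon>(3) c0(1) C(1) by (simp add: \<theta>_def)
  have \<alpha>: "0 < \<alpha>" "\<alpha> \<le> \<alpha>0 / 2" "\<alpha> \<le> \<theta>" "\<alpha> \<le> \<epsilon> / (2 * A)"
    using C(2) \<theta> \<epsilon>(1) A(1) by (auto simp: \<alpha>_def)
  have A\<alpha>: "A * \<alpha> < \<epsilon>"
  proof -
    have "A * \<alpha> \<le> A * (\<epsilon> / (2 * A))" using \<alpha>(4) A(1) by (intro mult_left_mono) auto
    then show ?thesis using A(1) \<epsilon>(1) by simp
  qed
  have "\<alpha> powr (s - 1/2) \<le> \<theta> powr (s - 1/2)" using \<alpha> s by (intro powr_mono2) auto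
  also have "\<dots> = b * c0 / (2 * C)" using s \<epsilon>(3) c0(1) C(1) by (simp add: \<theta>_def powr_powr)
  finally have "C * \<alpha> powr (s - 1/2) \<le> C * (b * c0 / (2 * C))" using C(1) by (intro mult_left_mono) auto
  also have "\<dots> = b * c0 / 2" using C(1) by simp
  finally have small: "C * \<alpha> powr (s - 1/2) \<le> b * c0 / 2" .
  have L: "travel_op s c f (V \<epsilon> \<alpha>) p > 0" for p
  proof -
    let ?q = "\<alpha> *\<^sub>R xy p"
    have 1: "b * S ?q \<le> - S ?q * deriv \<Phi> (\<mu> \<alpha> p) - (f (V \<epsilon> \<alpha> p) - f (\<Phi> (\<mu> \<alpha> p)))"
      unfolding V_def by (rule \<epsilon>(4)[OF S_pos S_le])
    have 2: "\<bar>frac_laplacian s (V \<epsilon> \<alpha>) p - frac_laplacian s \<Phi> (\<mu> \<alpha> p)\<bar> \<le> C * \<alpha> powr (s - 1/2) * decay ?q"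
      by (rule C(4)) (use \<epsilon> \<alpha> C in auto)
    have 3: "C * \<alpha> powr (s - 1/2) * decay ?q \<le> b * c0 / 2 * decay ?q"
      using small decay_pos(1)[of ?q] by (intro mult_right_mono) auto
    have 4: "b * (c0 * decay ?q) \<le> b * S ?q" using c0(2)[of ?q] \<epsilon>(3) by (intro mult_left_mono) auto
    have 5: "0 < b * c0 / 2 * decay ?q" using \<epsilon>(3) c0(1) decay_pos(1)[of ?q] by simp
    have 6: "b * (c0 * decay ?q) = b * c0 / 2 * decay ?q + b * c0 / 2 * decay ?q" by simp
    from 2 have "- (C * \<alpha> powr (s - 1/2) * decay ?q) \<le> frac_laplacian s (V \<epsilon> \<alpha>) p - frac_laplacian s \<Phi> (\<mu> \<alpha> p)"
      by (simp only: abs_le_iff) linarith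
    with 1 3 4 5 6 show ?thesis unfolding travel_op_V by linarith
  qed
  have Cs2: "V \<epsilon> \<alpha> \<in> Cs2 s" using \<epsilon>(1) by (intro V_Cs2) simp
  have bd: "bounded (range (V \<epsilon> \<alpha>))"
    unfolding bounded_iff using V_bound[of \<epsilon> \<alpha>] \<epsilon>(1) by auto
  have "super_solution s c f (V \<epsilon> \<alpha>)"
    unfolding super_solution_def
  \<comment> \<open>V is itself of class C^2, so the family of which it is the minimum has one
    member.\<close>
  proof (intro conjI exI[of _ "{V \<epsilon> \<alpha>}"])
    show "continuous_on UNIV (V \<epsilon> \<alpha>)" by (rule Ck_on_imp_continuous_on[OF V_Ck2])
  qed (use bd L V_Ck2[of \<epsilon> \<alpha>] in \<open>auto intro: less_imp_le simp del: Ck_on.simps\<close>)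
  moreover have "\<alpha> < 1" using \<alpha> C by linarith
  ultimately show ?thesis using \<epsilon>(1,2) \<alpha>(1) L Cs2 A(2)[OF \<epsilon>(1) \<alpha>(1) A\<alpha>]
    by (intro bexI[of _ \<epsilon>] bexI[of _ \<alpha>] conjI allI) simp_all
qed

end

theorem proposition5p2:
  fixes s c k :: real
    and f \<Phi> :: "real \<Rightarrow> real"
    and N :: nat and a b :: "nat \<Rightarrow> real"
    and g :: "real \<Rightarrow> real"
    and h \<phi> :: "real^2 \<Rightarrow> real"
  assumes "1/2 < s" and "s < 1"
    and "bistable f"
    and "profile s f k \<Phi>" and "k > 0"
    and "(\<lambda>\<mu>. 1 - \<bar>\<Phi> \<mu>\<bar>) \<in> O[at_infinity](\<lambda>\<mu>. \<bar>\<mu>\<bar> powr (- 2 * s))"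
    and "(\<lambda>\<mu>. - deriv \<Phi> \<mu>) \<in> O[at_infinity](\<lambda>\<mu>. \<bar>\<mu>\<bar> powr (- 1 - 2 * s))"
    and "c > k"
    and "pyramid_data (m_star c k) N a b"
    and "h = pyramid N a b"
    and "mollifier_profile s (m_star c k) g"
    and "\<phi> = mollified g h"
  shows "\<exists>\<epsilon>\<in>{0<..<1}. \<exists>\<alpha>\<in>{0<..<1}.
           super_solution s c f (V_fun c k \<Phi> \<phi> \<epsilon> \<alpha>) \<and>
           V_fun c k \<Phi> \<phi> \<epsilon> \<alpha> \<in> Cs2 s \<and>
           (\<forall>p. travel_op s c f (V_fun c k \<Phi> \<phi> \<epsilon> \<alpha>) p > 0) \<and>
           (\<forall>p. v_fun c k \<Phi> h p < V_fun c k \<Phi> \<phi> \<epsilon> \<alpha> p)"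
proof -
  \<comment> \<open>The slopes \<open>(a j, b j)\<close> become facet gradients of the common length
    \<open>m_star c k\<close>.\<close>
  define w where "w j = (vector [a j, b j] :: real^2)" for j
  let ?\<rho> = "\<lambda>q::real^2. g (norm q)"
  note P = assms(9)[unfolded pyramid_data_def]
  have kern: "smooth_kernel ?\<rho> (2 * s + 2)"
    by (rule mollifier_smooth_kernel[OF assms(1,2,11)])
  have ck: "c\<^sup>2 - k\<^sup>2 \<ge> 0" using assms(5,8) by (simp add: power2_le_iff_abs_le)
  have inj: "inj_on w {1..N}"
  proof (rule inj_onI)
    fix i j assume ij: "i \<in> {1..N}" "j \<in> {1..N}" "w i = w j"
    then have "w i $ 1 = w j $ 1" "w i $ 2 = w j $ 2" by simp_all
    then have "(a i, b i) = (a j, b j)" by (simp add: w_def)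
    then show "i = j" using P ij(1,2) by (auto dest: inj_onD)
  qed
  have nm: "norm (w j) = m_star c k" if "j \<in> {1..N}" for j
  proof -
    have "(a j)\<^sup>2 + (b j)\<^sup>2 = (m_star c k)\<^sup>2" using P that by blast
    moreover have "m_star c k \<ge> 0" using ck assms(5) by (simp add: m_star_def)
    ultimately show ?thesis by (simp add: norm_vec_def L2_set_def sum_2 w_def)
  qed
  have pk: "pyramid_kernel ?\<rho> (2 * s + 2) {1..N} w (m_star c k)"
  proof (intro pyramid_kernel.intro kern pyramid_kernel_axioms.intro inj nm)
    show "\<exists>i\<in>{1..N}. \<exists>j\<in>{1..N}. i \<noteq> j" using P by (intro bexI[of _ 1] bexI[of _ 2]) auto
  qed auto
  interpret T: traveling_front s k f \<Phi> ?\<rho> "{1..N}" w "m_star c k" c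
    by (intro traveling_front.intro front.intro pk traveling_front_axioms.intro assms) (simp add: m_star_def)
  have h_eq: "h = T.h"
    unfolding assms(10) by (rule ext) (simp add: pyramid_def T.h_def w_def inner_vec_def sum_2 del: One_nat_def)
  have \<phi>_eq: "\<phi> = T.\<phi>" unfolding assms(12) mollified_def T.\<phi>_def h_eq ..
  have gr: "grad \<phi> q = T.G q" for q unfolding \<phi>_eq by (rule grad_eqI[OF T.\<phi>_has_derivative])
  have S_eq: "S_fun c k \<phi> = T.S" by (rule ext) (simp add: S_fun_def T.S_def T.Dn_def gr del: One_nat_def)
  have V_eq: "V_fun c k \<Phi> \<phi> \<epsilon> \<alpha> = T.V \<epsilon> \<alpha>" for \<epsilon> \<alpha>
    by (rule ext) (simp add: V_fun_def T.V_def T.\<mu>_def T.Dn_def gr S_eq \<phi>_eq[symmetric] del: One_nat_def)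
  show ?thesis using T.V_supersolution unfolding V_eq v_fun_def h_eq .
qed

end
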